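(* Let $\Omega\subseteq\mathbb{C}^n$ be a bounded domain and let $u$ be a bounded plurisubharmonic function on $\Omega$ (not necessarily continuous). Suppose that $(dd^c u)^n\leq f$ as measures on $\Omega$ for some non-negative function $f\in L^2(\Omega)$. Then $$\sup_{\Omega}u^{-}\leq \sup_{\partial\Omega}(u_{*})^{-}+C\,\mathrm{diam}(\Omega)\,\big\Vert f\cdot\chi_{\{\Gamma_{u_*}=\widetilde{u_*}\}}\big\Vert_{L^2(\Omega)}^{1/n},$$ where $C$ is a numerical constant depending only on the dimension $n$.
   Context: $(dd^c u)^n$ denotes the Bedford–Taylor complex Monge–Ampère measure of a locally bounded plurisubharmonic function, normalized so that for $u\in C^2$ one has $(dd^cu)^n=4^n n!\det\big(\partial^2 u/\partial z_j\partial\bar z_k\big)\,d\lambda^{2n}$, $\lambda^{2n}$ being Lebesgue measure on $\mathbb{C}^n\cong\mathbb{R}^{2n}$. For a function $g$, $g^-:=\max\{-g,0\}$. The lower semicontinuous regularization is $u_*(w):=\liminf_{\Omega\ni z\to w,\,z\neq w}u(z)$ for $w\in\overline{\Omega}$; this is a lower semicontinuous function on $\overline\Omega$. Contact set: fix a ball $B_d$ of radius $d$ with $\overline\Omega\subset B_d$ and let $B_{2d}$ be the concentric ball of radius $2d$. Put $s:=\sup_{\partial\Omega}(u_* )^-$ and $w:=u_*+s$ on $\overline\Omega$. Let $\widetilde{u_*}$ denote the function on $B_{2d}$ equal to $\min\{w,0\}$ on $\Omega$ and to $0$ on $B_{2d}\setminus\Omega$, and let $\Gamma_{u_*}(x):=\sup\{l(x):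 l \text{ affine on } \mathbb{R}^{2n},\ l\leq \widetilde{u_*}\text{ on }B_{2d}\}$ for $x\in B_{2d}$ (the convex envelope). The contact set is $\{\Gamma_{u_*}=\widetilde{u_*}\}$.
   Formalization: The ball B_d is required to satisfy d ≤ 2 diam(Ω), since for u=|z|²−1 on the unit disc the estimate fails as d→∞; the Bedford–Taylor measure is specified as the weak limit along all decreasing C² psh sequences. *)

theory Defs
  imports "HOL-Analysis.Analysis"
begin

definition usc_on :: "'a::topological_space set \<Rightarrow> ('a \<Rightarrow> real) \<Rightarrow> bool" where
  "usc_on S u \<longleftrightarrow> (\<forall>x\<in>S. \<forall>c. u x < c \<longrightarrow> eventually (\<lambda>y. u y < c) (at x within S))"

definition psh_on :: "(complex^'n) set \<Rightarrow> (complex^'n \<Rightarrow> real) \<Rightarrow> bool" where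
  "psh_on S u \<longleftrightarrow> usc_on S u \<and>
     (\<forall>z\<in>S. \<forall>v r. 0 < r \<and> (\<forall>\<zeta>. cmod \<zeta> \<le> r \<longrightarrow> z + \<zeta> *s v \<in> S) \<longrightarrow>
        u z \<le> (1 / (2 * pi)) * (LBINT \<theta>=0..2*pi. u (z + (complex_of_real r * cis \<theta>) *s v)))"

definition hess :: "('a::real_normed_vector \<Rightarrow> real) \<Rightarrow> 'a \<Rightarrow> 'a \<Rightarrow> 'a \<Rightarrow> real" where
  "hess u x a b = frechet_derivative (\<lambda>y. frechet_derivative u (at y) a) (at x) b"

definition C2_on :: "'a::real_normed_vector set \<Rightarrow> ('a \<Rightarrow> real) \<Rightarrow> bool" where
  "C2_on S u \<longleftrightarrow> open S \<and> (\<forall>x\<in>S. u differentiable (at x) \<and>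
       (\<forall>a. (\<lambda>y. frechet_derivative u (at y) a) differentiable (at x))) \<and>
     (\<forall>a b. continuous_on S (\<lambda>x. hess u x a b))"

text \<open>Complex Hessian entries \<open>\<partial>^2 u / \<partial>z_j \<partial>\<bar>z_k\<close>.\<close>
definition cHess :: "(complex^'n \<Rightarrow> real) \<Rightarrow> complex^'n \<Rightarrow> complex^'n^'n" where
  "cHess u x = (\<chi> j k.
     (1/4) * (complex_of_real (hess u x (axis j 1) (axis k 1) + hess u x (axis j \<i>) (axis k \<i>))
             + \<i> * complex_of_real (hess u x (axis j 1) (axis k \<i>) - hess u x (axis j \<i>) (axis k 1))))"

text \<open>Density of \<open>(dd^c u)^n\<close> w.r.t. Lebesgue measure for \<open>C^2\<close> functions.\<close>
definition MA_density :: "(complex^'n \<Rightarrow> real) \<Rightarrow> complex^'n \<Rightarrow> real" where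
  "MA_density u x = 4 ^ CARD('n) * fact CARD('n) * Re (det (cHess u x))"

text \<open>Bedford--Taylor Monge--Ampere measure of a bounded psh function \<open>u\<close> on \<open>\<Omega>\<close>
  (extended by zero outside \<open>\<Omega>\<close>): the locally finite Borel measure which is the weak
  limit of \<open>(dd^c v_j)^n\<close> for every decreasing sequence of \<open>C^2\<close> psh functions
  \<open>v_j \<searrow> u\<close> on a neighbourhood of a relatively compact open subset.\<close>
definition MA_measure :: "(complex^'n) set \<Rightarrow> (complex^'n \<Rightarrow> real) \<Rightarrow> (complex^'n) measure \<Rightarrow> bool" where
  "MA_measure \<Omega> u \<mu> \<longleftrightarrow> sets \<mu> = sets borel \<and> emeasure \<mu> (- \<Omega>) = 0 \<and>
     (\<forall>K. compact K \<and> K \<subseteq> \<Omega> \<longrightarrow> emeasure \<mu> K < \<infinity>) \<and>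
     (\<forall>U V v \<phi>. open U \<and> open V \<and> compact (closure U) \<and> closure U \<subseteq> V \<and> V \<subseteq> \<Omega> \<and>
        (\<forall>j. C2_on V (v j) \<and> psh_on V (v j)) \<and>
        (\<forall>x\<in>V. \<forall>j. v (Suc j) x \<le> v j x) \<and> (\<forall>x\<in>V. (\<lambda>j. v j x) \<longlonglongrightarrow> u x) \<and>
        continuous_on UNIV \<phi> \<and> (\<exists>K. compact K \<and> K \<subseteq> U \<and> (\<forall>x. x \<notin> K \<longrightarrow> \<phi> x = 0))
        \<longrightarrow> (\<lambda>j. \<integral>x. \<phi> x * MA_density (v j) x \<partial>lborel) \<longlonglongrightarrow> (\<integral>x. \<phi> x \<partial>\<mu>))"

definition lsc_reg :: "(complex^'n) set \<Rightarrow> (complex^'n \<Rightarrow> real) \<Rightarrow> complex^'n \<Rightarrow> real" where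
  "lsc_reg \<Omega> u w = real_of_ereal (Liminf (at w within \<Omega>) (\<lambda>z. ereal (u z)))"

definition negpart :: "real \<Rightarrow> real" where
  "negpart t = max (- t) 0"

definition u_tilde :: "(complex^'n) set \<Rightarrow> (complex^'n \<Rightarrow> real) \<Rightarrow> complex^'n \<Rightarrow> real" where
  "u_tilde \<Omega> u x = (if x \<in> \<Omega> then
      min (lsc_reg \<Omega> u x + (SUP y\<in>frontier \<Omega>. negpart (lsc_reg \<Omega> u y))) 0 else 0)"

definition conv_env :: "(complex^'n) set \<Rightarrow> (complex^'n \<Rightarrow> real) \<Rightarrow> complex^'n \<Rightarrow> real" where
  "conv_env B g x = (SUP l\<in>{l. (\<exists>p c. l = (\<lambda>y. inner p y + c)) \<and> (\<forall>y\<in>B. l y \<le> g y)}. l x)"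

definition contact_set :: "(complex^'n) set \<Rightarrow> (complex^'n \<Rightarrow> real) \<Rightarrow> complex^'n \<Rightarrow> real \<Rightarrow> (complex^'n) set" where
  "contact_set \<Omega> u c d = {x \<in> ball c (2*d).
      conv_env (ball c (2*d)) (u_tilde \<Omega> u) x = u_tilde \<Omega> u x}"

end

theory Submission
 imports Defs "HOL-Complex_Analysis.Great_Picard"
begin

text \<open>Smooth convex functions \<open>\<psi> \<le> 0\<close> on a large ball with \<open>(dd^c \<psi>)^n \<ge> g\<close> are used as barriers. Their upper
envelope is not too negative: comparing it with quadratic polynomials bounds the volume of its sections from below
and the volume of the set of slopes that almost touch at a point from above, and counting pairs (slope, point)
in two ways gives \<open>(- env)^{2n} \<le> C R^{2n} \<integral> g^2\<close>.

Let \<open>g\<close> approximate \<open>f + \<epsilon>\<close> on a neighbourhood of the contact set and \<open>\<epsilon>\<close> elsewhere. If \<open>u_tilde - \<psi>\<close> had a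
negative minimum, then, \<open>\<psi>\<close> being convex, every minimum point would be a contact point, so near it
\<open>(dd^c \<psi>)^n > f \<ge> (dd^c u)^n\<close>. This contradicts the comparison inequality
\<open>\<integral> (w - v) ((dd^c w)^n - (dd^c v)^n) \<le> 0\<close> for \<open>w = max v (\<psi> + const)\<close>, which is applied to a regularised maximum and to
smooth \<open>v\<close> decreasing to \<open>u\<close>; the defining property of the Monge-Ampere measure then passes to the limit.\<close>

section \<open>Volume distortion of complex linear maps\<close>

text \<open>The exponent 2 reflects the complex structure. For a quadratic formed from the squares
  of the real linear forms given by the rows of a matrix W, the Monge-Ampere density is a multiple
  of |det W|^2, and real volumes in dimension 2n are distorted by the same factor. Hence a section
  of height h has volume at least of order h^n / g, the slopes almost touching at a point fill at
  most order h^n g, and g^2 remains once h^n cancels.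

  Two lacks of regularity shape the rest. f is only square integrable, so the barriers belong to
  continuous g_k converging in L^1; contact is tested with their uniform limit, the differential
  inequality with the smooth approximants. And u is only semicontinuous, so v_j need not converge
  uniformly, while weak convergence needs a test function that does not move with the index: it is
  frozen at an index i, and the error is an energy made small by monotonicity.

  Barriers live on the ball of radius 3d: a convex function that is non-positive there and bounded
  below at one point of the d-ball is Lipschitz on the 2d-ball that defines the contact set.\<close>

text \<open>Uniqueness of Haar measure by Fubini: the double integral of 1_A(x) 1_B(x + y) is
  evaluated in both orders, shifting y by invariance of \<open>\<nu>\<close> and x by invariance of
  \<open>\<mu>\<close>. Reflection invariance of \<open>\<nu>\<close> turns the measure of x - A
  into that of A.\<close>

lemma translation_invariant_measure_proportional:
 fixes \<mu> \<nu> :: "'a::euclidean_space measure"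
 assumes sm: "sets \<mu> = sets borel" and sn: "sets \<nu> = sets borel"
  and fm: "sigma_finite_measure \<mu>" and fn: "sigma_finite_measure \<nu>"
  and tm: "!!x. distr \<mu> borel (%y. x + y) = \<mu>"
  and tn: "!!x. distr \<nu> borel (%y. x + y) = \<nu>"
  and nm: "distr \<nu> borel uminus = \<nu>"
  and A: "A \<in> sets borel" and B: "B \<in> sets borel"
 shows "emeasure \<mu> A * emeasure \<nu> B = emeasure \<mu> B * emeasure \<nu> A"
proof -
 interpret m: sigma_finite_measure \<mu> by (rule fm)
 interpret n: sigma_finite_measure \<nu> by (rule fn)
 interpret pair_sigma_finite \<mu> \<nu> by (simp add: pair_sigma_finite_def fm fn)
 have spm: "space \<mu> = UNIV" and spn: "space \<nu> = UNIV"
  using sm sn sets_eq_imp_space_eq by (metis space_borel)+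
 note mc = measurable_cong_sets[OF sm refl] measurable_cong_sets[OF sn refl]
  sets_pair_measure_cong[OF sm sn]
 have pm: "borel_measurable (\<mu> \<Otimes>\<^sub>M \<nu>) = borel_measurable (borel \<Otimes>\<^sub>M borel)"
  by (intro measurable_cong_sets sets_pair_measure_cong sm sn refl)
 have "emeasure \<mu> A * emeasure \<nu> B = (\<integral>\<^sup>+x. indicator A x * emeasure \<nu> B \<partial>\<mu>)"
  using A sm by (simp add: nn_integral_multc mc)
 also have "... = (\<integral>\<^sup>+x. (\<integral>\<^sup>+y. indicator A x * indicator B (x + y) \<partial>\<nu>) \<partial>\<mu>)"
 proof (rule nn_integral_cong)
  fix x
  have "(\<integral>\<^sup>+y. indicator B y \<partial>\<nu>) = (\<integral>\<^sup>+y. indicator B (x + y) \<partial>\<nu>)"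
   by (subst tn[of x, symmetric], subst nn_integral_distr) (use B in \<open>auto simp: mc\<close>)
  thus "indicator A x * emeasure \<nu> B = (\<integral>\<^sup>+y. indicator A x * indicator B (x + y) \<partial>\<nu>)"
   using B sn by (subst nn_integral_cmult) (auto simp: mc)
 qed
 also have "... = (\<integral>\<^sup>+y. (\<integral>\<^sup>+x. indicator A x * indicator B (x + y) \<partial>\<mu>) \<partial>\<nu>)"
  by (rule Fubini'[symmetric]) (use A B in \<open>simp add: pm case_prod_beta\<close>)
 also have "... = (\<integral>\<^sup>+y. (\<integral>\<^sup>+x. indicator A (x - y) * indicator B x \<partial>\<mu>) \<partial>\<nu>)"
 proof (rule nn_integral_cong)
  fix y
  show "(\<integral>\<^sup>+x. indicator A x * indicator B (x + y) \<partial>\<mu>) = (\<integral>\<^sup>+x. indicator A (x - y) * indicator B x \<partial>\<mu> :: ennreal)"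
   by (subst (2) tm[of y, symmetric], subst nn_integral_distr) (use A B in \<open>auto simp: mc ac_simps\<close>)
 qed
 also have "... = (\<integral>\<^sup>+x. (\<integral>\<^sup>+y. indicator A (x - y) * indicator B x \<partial>\<nu>) \<partial>\<mu>)"
  by (rule Fubini') (use A B in \<open>simp add: pm case_prod_beta\<close>)
 also have "... = (\<integral>\<^sup>+x. emeasure \<nu> A * indicator B x \<partial>\<mu>)"
 proof (rule nn_integral_cong)
  fix x
  have "(\<integral>\<^sup>+y. indicator A y \<partial>\<nu>) = (\<integral>\<^sup>+y. indicator A (x + y) \<partial>\<nu>)"
   by (subst tn[of x, symmetric], subst nn_integral_distr) (use A in \<open>auto simp: mc\<close>)
  also have "... = (\<integral>\<^sup>+y. indicator A (x - y) \<partial>\<nu>)"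
   by (subst nm[symmetric], subst nn_integral_distr) (use A in \<open>auto simp: mc\<close>)
  finally show "(\<integral>\<^sup>+y. indicator A (x - y) * indicator B x \<partial>\<nu>) = emeasure \<nu> A * indicator B x"
   using A sn by (subst nn_integral_multc) (auto simp: mc)
 qed
 also have "... = emeasure \<nu> A * emeasure \<mu> B"
  using B sm by (simp add: nn_integral_cmult mc)
 finally show ?thesis by (simp add: ac_simps)
qed

text \<open>For a bijective linear map this is the absolute value of the real determinant.
  Normalising by the unit ball makes the factor of an isometry obvious and leaves real determinants
  out of the argument.\<close>

definition vol_factor :: "('a::euclidean_space => 'a) => real" where
 "vol_factor L = measure lborel (L ` ball 0 1) / measure lborel (ball (0::'a) 1)"


lemma linear_bij_inv:
 fixes L :: "'a::euclidean_space => 'a"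
 assumes L: "linear L" "bij L"
 shows "linear (inv L)" "inv L \<in> borel_measurable borel"
proof -
 show 1: "linear (inv L)" using L by (simp add: inj_linear_imp_inv_linear bij_is_inj)
 thus "inv L \<in> borel_measurable borel"
  by (intro borel_measurable_continuous_onI linear_continuous_on) (simp add: linear_conv_bounded_linear)
qed

lemma linear_bij_image_eq_vimage:
 fixes L :: "'a::euclidean_space => 'a"
 assumes L: "linear L" "bij L"
 shows "L ` A = inv L -` A" "A \<in> sets borel ==> L ` A \<in> sets borel"
proof -
 show 1: "L ` A = inv L -` A" using L bij_vimage_eq_inv_image[of "inv L" A]
  by (simp add: inv_inv_eq bij_imp_bij_inv)
 show "L ` A \<in> sets borel" if "A \<in> sets borel"
  unfolding 1 using linear_bij_inv(2)[OF L] that by (metis measurable_sets_borel)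
qed

text \<open>Pulling Lebesgue measure back along \<open>L\<close> yields a sigma-finite
  translation-invariant measure, so proportionality applies and the unit ball fixes the factor. The
  second conclusion does not involve \<open>A\<close>; later uses instantiate it with
  \<open>{}\<close>.\<close>

lemma emeasure_linear_bij_image:
 fixes L :: "'a::euclidean_space => 'a"
 assumes L: "linear L" "bij L" and A: "A \<in> sets borel"
 shows "emeasure lborel (L ` A) = ennreal (vol_factor L) * emeasure lborel A" and "vol_factor L > 0"
proof -
 define \<mu> where "\<mu> = distr lborel borel (inv L)"
 note inv = linear_bij_inv[OF L]
 have em: "emeasure \<mu> A = emeasure lborel (L ` A)" if "A \<in> sets borel" for A
  unfolding \<mu>_def using that inv(2) by (subst emeasure_distr) (auto simp: linear_bij_image_eq_vimage[OF L])
 have bl: "bounded (L ` ball 0 r)" for r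
  using L by (intro bounded_linear_image) (auto simp: linear_conv_bounded_linear)
 have fin: "emeasure \<mu> (ball 0 r) < \<infinity>" for r
  using emeasure_bounded_finite[OF bl] by (simp add: em)
 have sf: "sigma_finite_measure \<mu>"
  unfolding sigma_finite_measure_def
  by (intro exI[of _ "range (%n. ball 0 (real n))"])
    (use fin in \<open>auto simp: \<mu>_def less_top[symmetric] reals_Archimedean2\<close>)
 have tm: "distr \<mu> borel ((+) x) = \<mu>" for x
 proof -
  have eq: "(+) x \<circ> inv L = inv L \<circ> (+) (L x)"
   using inv(1) L by (auto simp: fun_eq_iff linear_add bij_is_inj)
  have "distr \<mu> borel ((+) x) = distr lborel borel ((+) x \<circ> inv L)"
   unfolding \<mu>_def using inv(2) by (subst distr_distr) auto
  also have "... = distr (distr lborel borel ((+) (L x))) borel (inv L)"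
   unfolding eq using inv(2) by (subst distr_distr) auto
  finally show ?thesis by (simp add: lborel_distr_plus \<mu>_def)
 qed
 have nm: "distr lborel borel uminus = (lborel :: 'a measure)"
  by (subst lborel_affine[of "-1" 0]) (auto simp: density_1)
 have b: "emeasure lborel (ball (0::'a) 1) = ennreal (measure lborel (ball (0::'a) 1))"
  by (intro emeasure_eq_ennreal_measure) (use emeasure_bounded_finite[of "ball (0::'a) 1"] in auto)
 have bp: "measure lborel (ball (0::'a) 1) > 0"
  using content_ball_pos[of 1 "0::'a"] by simp
 have bL: "emeasure lborel (L ` ball 0 1) = ennreal (measure lborel (L ` ball 0 1))"
  by (intro emeasure_eq_ennreal_measure) (use emeasure_bounded_finite[OF bl] in \<open>auto simp: less_top[symmetric]\<close>)
 have *: "emeasure lborel (L ` A) = ennreal (vol_factor L) * emeasure lborel A"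
  if "A \<in> sets borel" for A
 proof -
  have "emeasure \<mu> A * emeasure lborel (ball (0::'a) 1) = emeasure \<mu> (ball 0 1) * emeasure lborel A"
  proof (intro translation_invariant_measure_proportional sf sigma_finite_lborel tm lborel_distr_plus nm that)
  qed (auto simp: \<mu>_def)
  hence "emeasure lborel (L ` A) * ennreal (measure lborel (ball (0::'a) 1))
   = ennreal (measure lborel (L ` ball 0 1)) * emeasure lborel A"
   using that by (simp add: em b bL)
  hence "emeasure lborel (L ` A) = ennreal (measure lborel (L ` ball 0 1)) * emeasure lborel A / ennreal (measure lborel (ball (0::'a) 1))"
   using bp by (metis ennreal_mult_divide_eq ennreal_eq_0_iff ennreal_neq_top not_less)
  thus ?thesis
   unfolding vol_factor_def using bp
   by (simp add: divide_ennreal[symmetric] ennreal_times_divide mult.commute)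
 qed
 show "emeasure lborel (L ` A) = ennreal (vol_factor L) * emeasure lborel A" using * A by simp
 \<comment> \<open>A zero factor would make the whole space null, as \<open>L\<close> is
   onto.\<close>
 have "emeasure lborel (L ` UNIV) = ennreal (vol_factor L) * emeasure lborel (UNIV :: 'a set)"
  using *[of UNIV] by simp
 hence "vol_factor L \<noteq> 0" using L by (auto simp: bij_is_surj)
 thus "vol_factor L > 0" by (simp add: vol_factor_def less_le)
qed

lemma vol_factor_compose:
 fixes L K :: "'a::euclidean_space => 'a"
 assumes L: "linear L" "bij L" and K: "linear K" "bij K"
 shows "vol_factor (L \<circ> K) = vol_factor L * vol_factor K"
proof -
 have KB: "K ` ball 0 1 \<in> sets borel" by (rule linear_bij_image_eq_vimage[OF K]) simp
 have "emeasure lborel ((L \<circ> K) ` ball 0 1) = ennreal (vol_factor L) * (ennreal (vol_factor K) * emeasure lborel (ball (0::'a) 1))"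
  using emeasure_linear_bij_image(1)[OF L KB] emeasure_linear_bij_image(1)[OF K, of "ball 0 1"] by (simp add: image_comp)
 hence "measure lborel ((L \<circ> K) ` ball 0 1) = vol_factor L * (vol_factor K * measure lborel (ball (0::'a) 1))"
  using emeasure_linear_bij_image(2)[OF L, of "{}"] emeasure_linear_bij_image(2)[OF K, of "{}"]
  by (simp add: measure_def enn2real_mult)
 moreover have "measure lborel (ball (0::'a) 1) > 0"
  using content_ball_pos[of 1 "0::'a"] by simp
 ultimately show ?thesis unfolding vol_factor_def[of "L \<circ> K"] by simp
qed

lemma vol_factor_isometry:
 fixes L :: "'a::euclidean_space => 'a"
 assumes "bij L" "!!x. norm (L x) = norm x"
 shows "vol_factor L = 1"
proof -
 have "L ` ball 0 1 = ball 0 1"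
 proof
  show "ball 0 1 \<subseteq> L ` ball 0 1"
  proof
   fix y assume "y \<in> ball (0::'a) 1"
   thus "y \<in> L ` ball 0 1"
    using assms(2)[of "inv L y"] bij_inv_eq_iff[OF assms(1)] assms(1)
    by (intro image_eqI[of _ _ "inv L y"]) (auto simp: bij_is_surj surj_f_inv_f)
  qed
 qed (use assms(2) in auto)
 thus ?thesis
  unfolding vol_factor_def using content_ball_pos[of 1 "0::'a"] by simp
qed

definition coord_scale :: "'n => complex => complex^'n => complex^'n" where
 "coord_scale k a x = (\<chi> i. if i = k then a * x $ i else x $ i)"

definition coord_shear :: "'n => complex^'n => complex^'n => complex^'n" where
 "coord_shear k b x = (\<chi> i. if i = k then x $ i else x $ i + b $ i * x $ k)"

lemma coord_scale_linear_bij: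
 assumes "a \<noteq> 0"
 shows "linear (coord_scale k a)" "bij (coord_scale k a)"
proof -
 show "linear (coord_scale k a)"
  by (rule linearI) (auto simp: coord_scale_def vec_eq_iff algebra_simps)
 show "bij (coord_scale k a)"
  by (rule o_bij[of "coord_scale k (1/a)"]) (use assms in \<open>auto simp: coord_scale_def vec_eq_iff fun_eq_iff\<close>)
qed

lemma coord_shear_linear_bij: "linear (coord_shear k b)" "bij (coord_shear k b)"
proof -
 show "linear (coord_shear k b)"
  by (rule linearI) (auto simp: coord_shear_def vec_eq_iff algebra_simps)
 show "bij (coord_shear k b)"
  by (rule o_bij[of "coord_shear k (-b)"]) (auto simp: coord_shear_def vec_eq_iff fun_eq_iff)
qed

text \<open>A complex coordinate is two real ones: the map stretches exactly the basis vectors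
  \<open>axis k 1\<close> and \<open>axis k \<i>\<close>, each by r.\<close>

lemma vol_factor_coord_scale_real:
 fixes k :: "'n::finite"
 assumes "r > 0"
 shows "vol_factor (coord_scale k (complex_of_real r)) = r\<^sup>2"
proof -
 let ?L = "coord_scale k (complex_of_real r)"
 have L: "linear ?L" "bij ?L" using coord_scale_linear_bij[of "complex_of_real r" k] assms by auto
 define c where "c j = (if j \<in> {axis k 1, axis k \<i>} then r else 1)" for j :: "complex^'n"
 have inn: "x \<bullet> axis i 1 = Re (x $ i)" "x \<bullet> axis i \<i> = Im (x $ i)" for x :: "complex^'n" and i
  by (simp_all add: inner_axis inner_complex_def)
 have ax: "axis k 1 \<noteq> axis k \<i>" by (auto simp: axis_eq_axis complex_eq_iff)
 have kB: "(axis k 1 :: complex^'n) \<in> Basis" "(axis k \<i> :: complex^'n) \<in> Basis"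
  by (simp_all add: axis_in_Basis_iff Basis_complex_def)
 have T: "0 + (\<Sum>j\<in>Basis. (c j * (x \<bullet> j)) *\<^sub>R j) = ?L x" for x
 proof (rule euclidean_eqI)
  fix b :: "complex^'n" assume b: "b \<in> Basis"
  have "(0 + (\<Sum>j\<in>Basis. (c j * (x \<bullet> j)) *\<^sub>R j)) \<bullet> b = c b * (x \<bullet> b)"
   using b by (simp add: inner_sum_left inner_Basis if_distrib[of "%t. _ * t"] cong: if_cong)
  also have "... = ?L x \<bullet> b"
   using b by (auto simp: Basis_vec_def Basis_complex_def c_def inn coord_scale_def axis_eq_axis complex_eq_iff)
  finally show "(0 + (\<Sum>j\<in>Basis. (c j * (x \<bullet> j)) *\<^sub>R j)) \<bullet> b = ?L x \<bullet> b" .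
 qed
 have p: "(\<Prod>j\<in>Basis. \<bar>c j\<bar>) = r\<^sup>2"
 proof -
  have "(\<Prod>j\<in>Basis. \<bar>c j\<bar>) = (\<Prod>j\<in>{axis k 1, axis k \<i>}. r)"
   using kB assms by (intro prod.mono_neutral_cong_right) (auto simp: c_def)
  thus ?thesis using ax by (simp add: power2_eq_square)
 qed
 have eq: "lborel = density (distr lborel borel ?L) (%_. ennreal (r\<^sup>2))"
  using lborel_affine_euclidean[of c 0] assms unfolding T p by (simp add: c_def)
 have Lm: "?L \<in> borel_measurable borel"
  using L(1) by (intro borel_measurable_continuous_onI linear_continuous_on) (simp add: linear_conv_bounded_linear)
 have LB: "?L ` ball 0 1 \<in> sets borel" by (rule linear_bij_image_eq_vimage[OF L]) simp
 have "emeasure lborel (?L ` ball 0 1) = ennreal (r\<^sup>2) * emeasure (distr lborel borel ?L) (?L ` ball 0 1)"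
  by (subst eq, subst emeasure_density) (use LB in \<open>auto simp: nn_integral_cmult\<close>)
 also have "... = ennreal (r\<^sup>2) * emeasure lborel (ball (0::complex^'n) 1)"
  using LB Lm L by (subst emeasure_distr) (auto simp: bij_is_inj inj_vimage_image_eq)
 finally have "measure lborel (?L ` ball 0 1) = r\<^sup>2 * measure lborel (ball (0::complex^'n) 1)"
  by (simp add: measure_def enn2real_mult)
 thus ?thesis
  unfolding vol_factor_def using content_ball_pos[of 1 "0::complex^'n"] by simp
qed

text \<open>Polar form of a: the unimodular factor \<open>sgn a\<close> acts as an isometry, the
  modulus is the real case.\<close>

lemma vol_factor_coord_scale:
 fixes k :: "'n::finite"
 assumes "a \<noteq> 0"
 shows "vol_factor (coord_scale k a) = (cmod a)\<^sup>2"
proof -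
 have eq: "coord_scale k a = coord_scale k (complex_of_real (cmod a)) \<circ> coord_scale k (sgn a)"
  using assms by (auto simp: coord_scale_def fun_eq_iff vec_eq_iff sgn_eq)
 have "norm (coord_scale k (sgn a) x) = norm x" for x
  using assms by (auto simp: norm_vec_def coord_scale_def L2_set_def norm_mult norm_sgn intro!: sum.cong)
 hence "vol_factor (coord_scale k (sgn a)) = 1"
  using assms coord_scale_linear_bij[of "sgn a" k] by (intro vol_factor_isometry) (auto simp: sgn_zero_iff)
 thus ?thesis
  unfolding eq using assms coord_scale_linear_bij[of "sgn a" k] coord_scale_linear_bij[of "complex_of_real (cmod a)" k]
  by (subst vol_factor_compose) (auto simp: vol_factor_coord_scale_real sgn_zero_iff)
qed

text \<open>Doubling a shear is both squaring it and conjugating it by a scaling, so its factor equals its square.\<close>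
lemma vol_factor_coord_shear:
 fixes k :: "'n::finite"
 shows "vol_factor (coord_shear k b) = 1"
proof -
 note sh = coord_shear_linear_bij and sc = coord_scale_linear_bij[of "1/2" k] coord_scale_linear_bij[of 2 k]
 have 1: "coord_shear k b \<circ> coord_shear k b = coord_shear k (2 *\<^sub>R b)"
  by (auto simp: coord_shear_def fun_eq_iff vec_eq_iff scaleR_conv_of_real algebra_simps)
 have 2: "coord_scale k (1/2) \<circ> coord_shear k b \<circ> coord_scale k 2 = coord_shear k (2 *\<^sub>R b)"
  by (auto simp: coord_shear_def coord_scale_def fun_eq_iff vec_eq_iff scaleR_conv_of_real algebra_simps)
 have "vol_factor (coord_shear k b) * vol_factor (coord_shear k b)
   = vol_factor (coord_scale k (1/2)) * vol_factor (coord_shear k b) * vol_factor (coord_scale k 2)"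
  using vol_factor_compose[OF sh sh, of k b k b] 1 2
   vol_factor_compose[OF linear_compose[OF sh(1) sc(1)] bij_comp[OF sh(2) sc(2)] sc(3,4), of k b]
   vol_factor_compose[OF sc(1,2) sh, of k b] by simp
 hence "vol_factor (coord_shear k b) * vol_factor (coord_shear k b) = vol_factor (coord_shear k b)"
  by (simp add: vol_factor_coord_scale power2_eq_square)
 thus ?thesis using emeasure_linear_bij_image(2)[OF sh, of "{}" k b] by simp
qed

lemma vector_matrix_mult_linear: "linear (%x::complex^'n. x v* (M::complex^'n^'n))"
 by (rule linearI) (auto simp: vector_matrix_mult_def vec_eq_iff sum.distrib algebra_simps scaleR_sum_right)

lemma vector_matrix_mult_bij:
 assumes "det (M::complex^'n^'n) \<noteq> 0"
 shows "bij (%x. x v* M)"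
proof -
 obtain M' where M': "M ** M' = mat 1" "M' ** M = mat 1"
  using assms by (auto simp: invertible_det_nz[symmetric] invertible_def)
 show ?thesis
  by (rule o_bij[of "%x. x v* M'"])
    (auto simp: fun_eq_iff vector_matrix_mul_assoc M' vector_matrix_mul_rid)
qed

text \<open>Equal rows would kill the determinant, so the rows are a permutation of the axes and the
  map permutes coordinates isometrically.\<close>

lemma vol_factor_axis_rows:
 fixes M :: "complex^'n^'n"
 assumes det: "det M \<noteq> 0" and ax: "!!k. \<exists>i. M $ k = axis i 1"
 shows "vol_factor (%x. x v* M) = (cmod (det M))\<^sup>2"
proof -
 obtain p where p: "!!k. M $ k = axis (p k) 1" using ax by metis
 have inj: "inj p"
 proof (rule injI, rule ccontr)
  fix k l assume kl: "p k = p l" "k \<noteq> l"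
  hence "row k M = row l M" by (simp add: row_def p vec_eq_iff)
  thus False using det kl det_identical_rows by blast
 qed
 have perm: "p permutes UNIV" using inj by (intro bij_imp_permutes) (auto simp: bij_def finite_UNIV_inj_surj)
 have "M = (\<chi> i. mat 1 $ p i)" by (auto simp: vec_eq_iff p mat_def axis_def)
 hence "det M = of_int (sign p) * det (mat 1 :: complex^'n^'n)"
  by (metis det_permute_rows[OF perm])
 hence cd: "cmod (det M) = 1" by (simp add: sign_def)
 have comp: "(x v* M) $ j = x $ (inv p j)" for x j
 proof -
  have "(x v* M) $ j = (\<Sum>i\<in>UNIV. if i = inv p j then x $ i else 0)"
   unfolding vector_matrix_mult_def vec_lambda_beta
   by (rule sum.cong) (auto simp: p axis_def permutes_inverses[OF perm])
  thus ?thesis by simp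
 qed
 have "norm (x v* M) = norm x" for x
  unfolding norm_vec_def L2_set_def comp
  using sum.permute[OF permutes_inv[OF perm], of "%i. (norm (x $ i))\<^sup>2"] by (simp add: o_def)
 thus ?thesis using vol_factor_isometry[OF vector_matrix_mult_bij[OF det]] cd by simp
qed

text \<open>Elimination, by induction on the number of rows that are not axis vectors: one such row
  is replaced by an axis missing among the rows, which amounts to composing with a coordinate
  scaling by c_k and a shear of factor 1. The determinant gains the factor c_k and the volume the
  factor |c_k|^2, so both sides change alike.\<close>

lemma vol_factor_vector_matrix_mult:
 fixes M :: "complex^'n^'n"
 assumes "det M \<noteq> 0"
 shows "vol_factor (%x. x v* M) = (cmod (det M))\<^sup>2"
 using assms
proof (induction "card {k. \<forall>i. M $ k \<noteq> axis i 1}" arbitrary: M rule: less_induct)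
 case less
 let ?N = "%M::complex^'n^'n. {k. \<forall>i. M $ k \<noteq> axis i 1}"
 show ?case
 proof (cases "?N M = {}")
  case True
  thus ?thesis using less.prems by (intro vol_factor_axis_rows) auto
 next
  case False
  then obtain k0 where k0: "k0 \<in> ?N M" by auto
  \<comment> \<open>Pigeonhole: if every axis occurred among the rows, distinct axes would occupy
    distinct rows and exhaust them all, including \<open>k0\<close>.\<close>
  obtain i where i: "!!k. M $ k \<noteq> axis i 1"
  proof (rule ccontr)
   assume "\<not> thesis"
   with that obtain p where p: "!!i. M $ (p i) = axis i 1" by metis
   hence "inj p" by (metis axis_eq_axis injI zero_neq_one)
   hence "surj p" by (simp add: finite_UNIV_inj_surj)
   then obtain j where "p j = k0" by (metis surjD)
   with p[of j] k0 show False by auto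
  qed
  obtain M' where M': "M ** M' = mat 1" "M' ** M = mat 1"
   using less.prems by (auto simp: invertible_det_nz[symmetric] invertible_def)
  define c where "c = axis i 1 v* M'"
  have c: "c v* M = axis i 1" by (simp add: c_def vector_matrix_mul_assoc M' vector_matrix_mul_rid)
  \<comment> \<open>Some row that is not an axis must carry a nonzero coefficient: every other row
    is an axis different from \<open>axis i 1\<close> and has entry 0 in column i, whereas
    \<open>c v* M\<close> has entry 1 there.\<close>
  obtain k where k: "k \<in> ?N M" "c $ k \<noteq> 0"
  proof (rule ccontr)
   assume "\<not> thesis"
   with that have z: "c $ k = 0" if "k \<in> ?N M" for k using that by blast
   have "(c v* M) $ i = (\<Sum>k\<in>UNIV. M $ k $ i * c $ k)" by (simp add: vector_matrix_mult_def mult.commute)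
   also have "... = 0"
   proof (rule sum.neutral, rule ballI)
    fix k
    show "M $ k $ i * c $ k = 0"
    proof (cases "k \<in> ?N M")
     case False
     then obtain j where j: "M $ k = axis j 1" by auto
     with i[of k] have "j \<noteq> i" by auto
     thus ?thesis by (simp add: j axis_def)
    qed (simp add: z)
   qed
   finally show False by (simp add: c)
  qed
  define M1 where "M1 = (\<chi> m. if m = k then axis i 1 else M $ m)"
  let ?E = "coord_shear k (\<chi> m. c $ m / c $ k) \<circ> coord_scale k (c $ k)"
  have E: "(%x. x v* M1) = (%x. x v* M) \<circ> ?E"
  proof (rule ext)
   fix x
   have "(x v* M1) $ j = (\<Sum>m\<in>UNIV. (if m = k then axis i 1 $ j * x $ k else M $ m $ j * x $ m))" for j
    unfolding vector_matrix_mult_def M1_def by (auto intro!: sum.cong)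
   also have "... j = axis i 1 $ j * x $ k + (\<Sum>m\<in>UNIV - {k}. M $ m $ j * x $ m)" for j
    by (subst sum.remove[of _ k]) auto
   also have "... j = (c v* M) $ j * x $ k + (\<Sum>m\<in>UNIV - {k}. M $ m $ j * x $ m)" for j by (simp add: c)
   also have "... j = (\<Sum>m\<in>UNIV. M $ m $ j * c $ m * x $ k) + (\<Sum>m\<in>UNIV - {k}. M $ m $ j * x $ m)" for j
    by (simp add: vector_matrix_mult_def sum_distrib_left mult.commute mult.left_commute)
   also have "... j = M $ k $ j * c $ k * x $ k + (\<Sum>m\<in>UNIV - {k}. M $ m $ j * (x $ m + c $ m * x $ k))" for j
    by (subst sum.remove[of _ k]) (auto simp: sum.distrib[symmetric] algebra_simps)
   also have "... j = (\<Sum>m\<in>UNIV. M $ m $ j * ?E x $ m)" for j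
    using k(2) by (subst (2) sum.remove[of _ k]) (auto simp: coord_shear_def coord_scale_def intro!: sum.cong)
   finally show "x v* M1 = ((%x. x v* M) \<circ> ?E) x" by (simp add: vec_eq_iff vector_matrix_mult_def mult.commute)
  qed
  \<comment> \<open>Row k is scaled by c_k, then a combination of the other rows is added to turn it
    into \<open>c v* M\<close>.\<close>
  have dM1: "det M1 = c $ k * det M"
  proof -
   define A where "A = (\<chi> m. if m = k then c $ k *s M $ k else M $ m)"
   have "det A = c $ k * det (\<chi> m. if m = k then M $ k else M $ m)"
    unfolding A_def by (rule det_row_mul)
   hence dA: "det A = c $ k * det M" by (simp add: if_distrib[of "%t. M $ t", symmetric] cong: if_cong)
   define s where "s = (\<Sum>m\<in>UNIV - {k}. c $ m *s M $ m)"
   have "s \<in> vec.span {row j A |j. j \<noteq> k}"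
    unfolding s_def
    by (intro vec.span_sum vec.span_scale vec.span_base) (auto simp: A_def row_def vec_eq_iff intro!: exI)
   from det_row_span[OF this]
   have "det (\<chi> m. if m = k then row k A + s else row m A) = det A" .
   moreover have "(\<chi> m. if m = k then row k A + s else row m A) = M1"
   proof -
    have "c $ k *s M $ k + s = c v* M"
     unfolding s_def by (subst sum.remove[of UNIV k "%m. c $ m *s M $ m", symmetric])
      (auto simp: vec_eq_iff vector_matrix_mult_def mult.commute)
    thus ?thesis by (auto simp: M1_def A_def row_def vec_eq_iff c)
   qed
   ultimately show ?thesis using dA by simp
  qed
  have "?N M1 \<subset> ?N M" using k(1) by (auto simp: M1_def)
  hence "card (?N M1) < card (?N M)" by (intro psubset_card_mono) auto
  hence IH: "vol_factor (%x. x v* M1) = (cmod (det M1))\<^sup>2"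
   using less.hyps dM1 k(2) less.prems by simp
  note sc = coord_scale_linear_bij[OF k(2), of k]
  have "vol_factor (%x. x v* M1) = vol_factor (%x. x v* M) * (cmod (c $ k))\<^sup>2"
   unfolding E
   using vol_factor_compose[OF vector_matrix_mult_linear vector_matrix_mult_bij[OF less.prems]
     linear_compose[OF sc(1) coord_shear_linear_bij(1)] bij_comp[OF sc(2) coord_shear_linear_bij(2)]]
    vol_factor_compose[OF coord_shear_linear_bij sc] k(2)
   by (simp add: vol_factor_coord_scale vol_factor_coord_shear)
  thus ?thesis using IH dM1 k(2) by (simp add: norm_mult power_mult_distrib)
 qed
qed

lemma emeasure_matrix_image:
 fixes M :: "complex^'n^'n"
 assumes det: "det M \<noteq> 0" and A: "A \<in> sets borel"
 shows "emeasure lborel ((%x. M *v x) ` A) = ennreal ((cmod (det M))\<^sup>2) * emeasure lborel A"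
  and "(%x. M *v x) ` A \<in> sets borel"
proof -
 have eq: "(%x. M *v x) = (%x. x v* transpose M)" by (simp add: fun_eq_iff)
 have d: "det (transpose M) \<noteq> 0" using det by simp
 note L = vector_matrix_mult_linear vector_matrix_mult_bij[OF d]
 show "emeasure lborel ((%x. M *v x) ` A) = ennreal ((cmod (det M))\<^sup>2) * emeasure lborel A"
  unfolding eq using emeasure_linear_bij_image(1)[OF L A] vol_factor_vector_matrix_mult[OF d] by simp
 show "(%x. M *v x) ` A \<in> sets borel" unfolding eq by (rule linear_bij_image_eq_vimage(2)[OF L A])
qed

section \<open>Determinants of Hermitian matrices\<close>

text \<open>Linear in x, antilinear in y. With this index order the form of \<open>cHess\<close> is
  the Levi form, a quarter of the sum of the real second derivatives along z and
  \<open>\<i> *s z\<close> (see \<open>hform_cHess\<close>).\<close>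

definition hsesq :: "complex^'n^'n => complex^'n => complex^'n => complex" where
 "hsesq H x y = (\<Sum>j\<in>UNIV. \<Sum>k\<in>UNIV. H $ j $ k * x $ j * cnj (y $ k))"

definition hform :: "complex^'n^'n => complex^'n => real" where
 "hform H x = Re (hsesq H x x)"

definition hermitian :: "complex^'n^'n => bool" where
 "hermitian H \<longleftrightarrow> (\<forall>j k. H $ k $ j = cnj (H $ j $ k))"

definition hpsd :: "complex^'n^'n => bool" where
 "hpsd H \<longleftrightarrow> hermitian H \<and> (\<forall>z. 0 <= hform H z)"

definition hpd :: "complex^'n^'n => bool" where
 "hpd H \<longleftrightarrow> hermitian H \<and> (\<forall>z. z \<noteq> 0 \<longrightarrow> 0 < hform H z)"

lemma hsesq_linear:
 "hsesq H (x + x') y = hsesq H x y + hsesq H x' y"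
 "hsesq H x (y + y') = hsesq H x y + hsesq H x y'"
 "hsesq H (c *s x) y = c * hsesq H x y"
 "hsesq H x (c *s y) = cnj c * hsesq H x y"
 "hsesq (H + H') x y = hsesq H x y + hsesq H' x y"
 by (simp_all add: hsesq_def algebra_simps sum.distrib sum_distrib_left)

lemma hsesq_sum:
 "hsesq H (\<Sum>i\<in>A. f i) y = (\<Sum>i\<in>A. hsesq H (f i) y)"
 "hsesq H x (\<Sum>i\<in>A. f i) = (\<Sum>i\<in>A. hsesq H x (f i))"
proof -
 have z: "hsesq H 0 y = 0" "hsesq H x 0 = 0" for x y by (simp_all add: hsesq_def)
 show "hsesq H (\<Sum>i\<in>A. f i) y = (\<Sum>i\<in>A. hsesq H (f i) y)"
  by (induction A rule: infinite_finite_induct) (auto simp: z hsesq_linear)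
 show "hsesq H x (\<Sum>i\<in>A. f i) = (\<Sum>i\<in>A. hsesq H x (f i))"
  by (induction A rule: infinite_finite_induct) (auto simp: z hsesq_linear)
qed

lemma hermitian_hsesq: "hermitian H ==> hsesq H y x = cnj (hsesq H x y)"
proof -
 assume "hermitian H"
 hence "cnj (H $ j $ k) = H $ k $ j" for j k unfolding hermitian_def by metis
 thus ?thesis unfolding hsesq_def by (subst sum.swap) (simp add: mult.commute mult.left_commute)
qed

lemma hermitian_hsesq_self: "hermitian H ==> hsesq H x x = complex_of_real (hform H x)"
 using hermitian_hsesq[of H x x] by (simp add: hform_def complex_eq_iff)

lemma hform_scale: "hform H (c *s x) = (cmod c)\<^sup>2 * hform H x"
proof -
 have "hsesq H (c *s x) (c *s x) = complex_of_real ((cmod c)\<^sup>2) * hsesq H x x"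
  by (simp add: hsesq_linear complex_norm_square del: of_real_power)
 thus ?thesis by (simp add: hform_def del: of_real_power)
qed

lemma continuous_hform [continuous_intros]: "continuous_on S (hform H)"
 unfolding hform_def[abs_def] hsesq_def by (intro continuous_intros)

lemma det_conjugate_transpose: "det (\<chi> i j. cnj (A $ j $ i)) = cnj (det (A::complex^'n^'n))"
proof -
 have "det (\<chi> i j. cnj (A $ j $ i)) = det (\<chi> i j. cnj (A $ i $ j))"
  by (subst det_transpose[symmetric]) (simp add: transpose_def)
 thus ?thesis by (simp add: det_def cnj_prod)
qed

text \<open>Compactness of the unit sphere and quadratic homogeneity; the bound makes the set of
  frames in the unit ball of the form compact.\<close>

lemma hpd_lower_bound:
 fixes H :: "complex^'n^'n"
 assumes "hpd H"
 obtains e where "e > 0" "!!z. e * (norm z)\<^sup>2 <= hform H z"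
proof -
 have ne: "sphere (0::complex^'n) 1 \<noteq> {}"
  using vector_choose_size[of 1] by (auto simp: dist_norm)
 obtain z0 where z0: "z0 \<in> sphere 0 1" "!!z. z \<in> sphere 0 1 ==> hform H z0 <= hform H z"
  using continuous_attains_inf[OF compact_sphere ne continuous_hform[of _ H]] by blast
 show thesis
 proof
  have "z0 \<noteq> 0" using z0(1) by auto
  thus "hform H z0 > 0" using assms by (auto simp: hpd_def)
  fix z :: "complex^'n"
  show "hform H z0 * (norm z)\<^sup>2 <= hform H z"
  proof (cases "z = 0")
   case True thus ?thesis by (simp add: hform_def hsesq_def)
  next
   case False
   have "z = complex_of_real (norm z) *s (complex_of_real (1 / norm z) *s z)"
    using False by (simp add: vec_eq_iff)
   hence "hform H z = (norm z)\<^sup>2 * hform H (complex_of_real (1 / norm z) *s z)"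
    by (metis hform_scale norm_of_real abs_norm_cancel)
   moreover have "complex_of_real (1 / norm z) *s z = (1 / norm z) *\<^sub>R z"
    by (simp add: vec_eq_iff scaleR_conv_of_real[where 'a=complex])
   hence "complex_of_real (1 / norm z) *s z \<in> sphere 0 1"
    using False by (simp add: dist_norm)
   ultimately show ?thesis
    using mult_left_mono[OF z0(2), of "complex_of_real (1 / norm z) *s z" "(norm z)\<^sup>2"] by (simp add: mult.commute)
  qed
 qed
qed

text \<open>The orthonormal frame maximises the determinant over frames in the unit ball of the form.\<close>
lemma hpd_orthonormal_frame:
 fixes H :: "complex^'n^'n"
 assumes H: "hpd H"
 obtains S :: "complex^'n^'n" where "det S \<noteq> 0"
  "!!i l. hsesq H (S $ i) (S $ l) = (if i = l then 1 else 0)"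
proof -
 define K where "K = {S :: complex^'n^'n. \<forall>i. hform H (S $ i) <= 1}"
 obtain e where e: "e > 0" "!!z. e * (norm z)\<^sup>2 <= hform H z" using hpd_lower_bound[OF H] by blast
 have herm: "hermitian H" using H by (simp add: hpd_def)
 have "closed K"
 proof -
  have "K = (\<Inter>i. {S. hform H (S $ i) <= 1})" by (auto simp: K_def)
  moreover have "closed {S :: complex^'n^'n. hform H (S $ i) <= 1}" for i
   by (intro closed_Collect_le continuous_on_compose2[OF continuous_hform] continuous_intros) auto
  ultimately show ?thesis by auto
 qed
 moreover have "bounded K"
 proof -
  have "norm (S $ i) <= sqrt (1 / e)" if "S \<in> K" for S i
  proof -
   have "e * (norm (S $ i))\<^sup>2 <= 1" using e(2)[of "S $ i"] that by (auto simp: K_def intro: order_trans)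
   thus ?thesis using e(1) by (intro real_le_rsqrt) (simp add: field_simps)
  qed
  hence "norm S <= (\<Sum>i\<in>(UNIV::'n set). sqrt (1/e))" if "S \<in> K" for S
   using that order_trans[OF L2_set_le_sum[of UNIV "%i. norm (S $ i)"] sum_mono, of "%_. sqrt (1/e)"]
   by (simp add: norm_vec_def[of S])
  thus ?thesis unfolding bounded_iff by blast
 qed
 ultimately have cK: "compact K" by (simp add: compact_eq_bounded_closed)
 have "0 \<in> K" by (simp add: K_def hform_def hsesq_def)
 have contdet: "continuous_on K (%S. cmod (det S))"
  unfolding det_def by (intro continuous_intros)
 obtain S where S: "S \<in> K" "!!S'. S' \<in> K ==> cmod (det S') <= cmod (det S)"
  using continuous_attains_sup[OF cK _ contdet] \<open>0 \<in> K\<close> by blast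
 have scl: "det (\<chi> m. if m = i then c *s x else S $ m) = c * det (\<chi> m. if m = i then x else S $ m)" for c i x S
  by (rule det_row_mul)
 have rS: "(\<chi> m. if m = i then S $ i else S $ m) = S" for i S by (auto simp: vec_eq_iff)
 have nz: "det S \<noteq> 0"
 proof -
  \<comment> \<open>A small multiple of the standard frame lies in \<open>K\<close>, so the maximal
    determinant is not 0.\<close>
  obtain r where r: "r > 0" "!!i. r * hform H (axis i 1) <= 1"
  proof -
   define r where "r = 1 / (1 + (\<Sum>i\<in>UNIV. hform H (axis i 1)))"
   have nn: "0 <= hform H (axis i 1)" for i using e(2)[of "axis i 1"] e(1) by (smt (verit) mult_nonneg_nonneg zero_le_power2)
   have "hform H (axis i 1) <= (\<Sum>i\<in>UNIV. hform H (axis i 1))" for i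
    by (rule member_le_sum) (auto simp: nn)
   moreover have "0 <= (\<Sum>i\<in>UNIV. hform H (axis i 1))" by (simp add: nn sum_nonneg)
   ultimately show thesis
    by (intro that[of r]) (auto simp: r_def field_simps intro: order_trans[OF _ le_add_same_cancel2[THEN iffD2]])
  qed
  define S' :: "complex^'n^'n" where "S' = (\<chi> i. complex_of_real (sqrt r) *s axis i 1)"
  have "S' \<in> K" using r by (auto simp: K_def S'_def hform_scale)
  moreover have "det S' = (\<Prod>i\<in>UNIV. S' $ i $ i)"
   by (rule det_diagonal) (auto simp: S'_def axis_def)
  hence "det S' \<noteq> 0" using r by (simp add: S'_def axis_def)
  ultimately show ?thesis using S(2)[of S'] by auto
 qed
 \<comment> \<open>Replacing a row by a vector of form less than 1 without changing the determinant
   contradicts maximality, since that vector can still be stretched to form 1.\<close>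
 have improve: False if x: "hform H x < 1" "det (\<chi> m. if m = i then x else S $ m) = det S" for x i
 proof -
  have "x \<noteq> 0"
  proof
   assume "x = 0"
   hence "det (\<chi> m. if m = i then x else S $ m) = 0" by (intro det_zero_row[of i]) (auto simp: row_def vec_eq_iff)
   thus False using x nz by simp
  qed
  hence p: "hform H x > 0" using H by (simp add: hpd_def)
  define c where "c = 1 / sqrt (hform H x)"
  have c: "c > 1" using x p by (simp add: c_def)
  have "(\<chi> m. if m = i then complex_of_real c *s x else S $ m) \<in> K"
   using S(1) p by (auto simp: K_def hform_scale c_def power_divide norm_divide)
  from S(2)[OF this] have "c * cmod (det S) <= cmod (det S)"
   using c by (simp add: scl x norm_mult)
  thus False using c nz by simp
 qed
 have one: "hform H (S $ i) = 1" for i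
  using improve[of "S $ i" i] S(1) unfolding rS by (smt (verit) K_def mem_Collect_eq)
 \<comment> \<open>Subtracting the projection of row i on row l keeps the determinant and lowers the
   form of row i by |\<alpha>|^2.\<close>
 have orth: "hsesq H (S $ i) (S $ l) = 0" if "i \<noteq> l" for i l
 proof (rule ccontr)
  define \<alpha> where "\<alpha> = hsesq H (S $ i) (S $ l)"
  assume "hsesq H (S $ i) (S $ l) \<noteq> 0"
  hence a: "\<alpha> \<noteq> 0" by (simp add: \<alpha>_def)
  let ?x = "S $ i + (- \<alpha>) *s S $ l"
  have li: "hsesq H (S $ l) (S $ i) = cnj \<alpha>" using hermitian_hsesq[OF herm, of "S $ l" "S $ i"] by (simp add: \<alpha>_def)
  have "hsesq H ?x ?x = 1 - \<alpha> * cnj \<alpha>"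
   unfolding hsesq_linear \<alpha>_def[symmetric] li using hermitian_hsesq_self[OF herm] one by (simp add: algebra_simps)
  hence "hform H ?x = 1 - (cmod \<alpha>)\<^sup>2" by (simp add: hform_def complex_mult_cnj cmod_power2)
  hence "hform H ?x < 1" using a by simp
  moreover have "det (\<chi> m. if m = i then ?x else S $ m) = det S"
   using det_row_operation[OF that, of S "- \<alpha>"] by (simp add: row_def vec_lambda_eta cong: if_cong)
  ultimately show False by (rule improve)
 qed
 show thesis
  by (rule that[OF nz]) (use orth one hermitian_hsesq_self[OF herm] in auto)
qed

text \<open>The orthonormality relations say that S H times the conjugate transpose of S is the
  identity; then determinants are taken.\<close>

lemma det_hpd_frame:
 fixes H S :: "complex^'n^'n"
 assumes "!!i l. hsesq H (S $ i) (S $ l) = (if i = l then 1 else 0)"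
 shows "det H * complex_of_real ((cmod (det S))\<^sup>2) = 1"
proof -
 have "S ** H ** (\<chi> i j. cnj (S $ j $ i)) = mat 1"
 proof -
  have "(S ** H ** (\<chi> i j. cnj (S $ j $ i))) $ i $ l = hsesq H (S $ i) (S $ l)" for i l
   unfolding hsesq_def
   by (subst sum.swap) (auto simp: matrix_matrix_mult_def sum_distrib_left mult.commute intro!: sum.cong)
  thus ?thesis using assms by (simp add: vec_eq_iff mat_def)
 qed
 hence "det S * det H * cnj (det S) = 1"
  by (metis det_mul det_I det_conjugate_transpose)
 thus ?thesis by (simp only: complex_norm_square) (simp add: ac_simps)
qed

lemma nn_integral_vector_matrix_mult:
 fixes S :: "complex^'n^'n"
 assumes S: "det S \<noteq> 0" and f: "f \<in> borel_measurable borel"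
 shows "(\<integral>\<^sup>+z. f z \<partial>lborel) = ennreal ((cmod (det S))\<^sup>2) * (\<integral>\<^sup>+c. f (c v* S) \<partial>lborel)"
proof -
 let ?L = "%c. c v* S"
 note L = vector_matrix_mult_linear[of S] vector_matrix_mult_bij[OF S]
 have Lm: "?L \<in> borel_measurable borel"
  using L(1) by (intro borel_measurable_continuous_onI linear_continuous_on) (simp add: linear_conv_bounded_linear)
 have eq: "lborel = density (distr lborel borel ?L) (%_. ennreal ((cmod (det S))\<^sup>2))"
 proof (rule measure_eqI)
  fix A :: "(complex^'n) set" assume "A \<in> sets lborel"
  hence A: "A \<in> sets borel" by simp
  have v: "?L -` A \<in> sets borel" using Lm A by (metis measurable_sets_borel)
  have "?L ` (?L -` A) = A" using L(2) by (simp add: bij_is_surj surj_image_vimage_eq)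
  with emeasure_linear_bij_image(1)[OF L v] A Lm
  show "emeasure lborel A = emeasure (density (distr lborel borel ?L) (%_. ennreal ((cmod (det S))\<^sup>2))) A"
   by (simp add: emeasure_density nn_integral_cmult emeasure_distr vol_factor_vector_matrix_mult[OF S])
 qed simp
 show ?thesis
  by (subst eq) (use f Lm in \<open>simp add: nn_integral_density nn_integral_distr nn_integral_cmult\<close>)
qed

section \<open>Order and quasi-concavity of the Hermitian determinant\<close>

text \<open>A constant multiple of 1 / det H for positive definite H. The integrand is convex and
  decreasing in the form, so inequalities between forms become inequalities between determinants
  without any diagonalisation.\<close>

definition hvol :: "complex^'n^'n => ennreal" where
 "hvol H = (\<integral>\<^sup>+z. ennreal (max 0 (1 - hform H z)) \<partial>lborel)"

text \<open>In the coordinates of an orthonormal frame the form is the standard one, so the integral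
  only picks up the Jacobian |det S|^2 = 1 / det H.\<close>

lemma hpd_det_hvol:
 fixes H :: "complex^'n^'n"
 assumes H: "hpd H"
 shows "Im (det H) = 0" "Re (det H) > 0"
  "hvol H = ennreal (1 / Re (det H)) * hvol (mat 1 :: complex^'n^'n)"
proof -
 obtain S where S: "det S \<noteq> 0" "!!i l. hsesq H (S $ i) (S $ l) = (if i = l then 1 else 0)"
  using hpd_orthonormal_frame[OF H] by blast
 define d where "d = (cmod (det S))\<^sup>2"
 have d: "d > 0" using S(1) by (simp add: d_def)
 have "det H * complex_of_real d = 1" using det_hpd_frame[OF S(2)] by (simp add: d_def)
 hence dH: "det H = complex_of_real (1 / d)" using d by (simp add: field_simps)
 thus "Im (det H) = 0" "Re (det H) > 0" using d by auto
 have hf: "hform H (c v* S) = hform (mat 1) c" for c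
 proof -
  have e: "c v* S = (\<Sum>i\<in>UNIV. c $ i *s S $ i)"
   by (simp add: vec_eq_iff vector_matrix_mult_def)
  have "hsesq H (c v* S) (c v* S) = (\<Sum>i\<in>UNIV. c $ i * cnj (c $ i))"
   unfolding e by (simp add: hsesq_sum hsesq_linear S(2) if_distrib[of "%t. _ * t"] mult.commute cong: if_cong)
  moreover have "hsesq (mat 1) c c = (\<Sum>i\<in>UNIV. c $ i * cnj (c $ i))"
   unfolding hsesq_def mat_def by (simp add: if_distrib[of "%t. t * _"] cong: if_cong)
  moreover have "(\<Sum>i\<in>UNIV. cnj (c $ i) * c $ i) = (\<Sum>i\<in>UNIV. c $ i * cnj (c $ i))"
   by (simp add: mult.commute)
  ultimately show ?thesis by (simp add: hform_def)
 qed
 have "hvol H = ennreal d * hvol (mat 1 :: complex^'n^'n)"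
  unfolding hvol_def d_def
  by (subst nn_integral_vector_matrix_mult[OF S(1)])
    (auto simp: hf intro!: borel_measurable_continuous_onI continuous_intros)
 thus "hvol H = ennreal (1 / Re (det H)) * hvol (mat 1 :: complex^'n^'n)" by (simp add: dH)
qed

lemma hform_mat_1: "hform (mat 1) (z::complex^'n) = (norm z)\<^sup>2"
proof -
 have "hsesq (mat 1) z z = (\<Sum>i\<in>UNIV. z $ i * cnj (z $ i))"
  unfolding hsesq_def mat_def by (simp add: if_distrib[of "%t. t * _"] cong: if_cong)
 hence "hform (mat 1) z = (\<Sum>i\<in>UNIV. (norm (z $ i))\<^sup>2)"
  by (simp add: hform_def complex_mult_cnj cmod_power2)
 thus ?thesis by (simp add: norm_vec_def L2_set_def sum_nonneg)
qed

lemma hvol_mat_1: "0 < hvol (mat 1 :: complex^'n^'n)" "hvol (mat 1 :: complex^'n^'n) < \<infinity>"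
proof -
 have "0 < ennreal (1/2) * emeasure lborel (ball (0::complex^'n) (1/2))"
  using open_not_negligible[of "ball (0::complex^'n) (1/2)"]
  by (auto simp: ennreal_zero_less_mult_iff negligible_iff_null_sets null_sets_def pos_less_divide_eq zero_less_iff_neq_zero)
 also have "... = (\<integral>\<^sup>+z. ennreal (1/2) * indicator (ball (0::complex^'n) (1/2)) z \<partial>lborel)"
  by (rule nn_integral_cmult_indicator[symmetric]) simp
 also have "... <= hvol (mat 1 :: complex^'n^'n)"
  unfolding hvol_def hform_mat_1
 proof (intro nn_integral_mono)
  fix z :: "complex^'n"
  have "(norm z)\<^sup>2 * 2 <= 1" if "norm z < 1/2"
  proof -
   have "(norm z)\<^sup>2 <= (1/2)\<^sup>2" using that by (intro power_mono) auto
   thus ?thesis by (simp add: power2_eq_square)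
  qed
  thus "ennreal (1/2) * indicator (ball 0 (1/2)) z <= ennreal (max 0 (1 - (norm z)\<^sup>2))"
   by (cases "norm z < 1/2") (simp_all del: ennreal_half add: indicator_def ennreal_leI)
 qed
 finally show "0 < hvol (mat 1 :: complex^'n^'n)" .
 have "hvol (mat 1 :: complex^'n^'n) <= (\<integral>\<^sup>+z. indicator (cball (0::complex^'n) 1) z \<partial>lborel)"
  unfolding hvol_def hform_mat_1
 proof (intro nn_integral_mono)
  fix z :: "complex^'n"
  show "ennreal (max 0 (1 - (norm z)\<^sup>2)) <= indicator (cball 0 1) z"
  proof (cases "norm z <= 1")
   case False
   hence "(norm z)\<^sup>2 \<ge> 1" by simp
   thus ?thesis by (simp add: max_def)
  qed (auto simp: indicator_def max_def)
 qed
 also have "... < \<infinity>" using emeasure_bounded_finite[of "cball (0::complex^'n) 1"] by simp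
 finally show "hvol (mat 1 :: complex^'n^'n) < \<infinity>" .
qed

lemma hermitian_add: "hermitian P ==> hermitian Q ==> hermitian (P + Q)"
proof -
 assume P: "hermitian P" and Q: "hermitian Q"
 have "(P + Q) $ k $ j = cnj ((P + Q) $ j $ k)" for j k
  using P[unfolded hermitian_def, rule_format, of k j] Q[unfolded hermitian_def, rule_format, of k j] by simp
 thus ?thesis unfolding hermitian_def by blast
qed

lemma hermitian_scaleR: "hermitian P ==> hermitian (r *\<^sub>R P)"
proof -
 assume P: "hermitian P"
 have "(r *\<^sub>R P) $ k $ j = cnj ((r *\<^sub>R P) $ j $ k)" for j k
  using P[unfolded hermitian_def, rule_format, of k j] by simp
 thus ?thesis unfolding hermitian_def by blast
qed

lemma hermitian_mat_1: "hermitian (mat 1)"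
 unfolding hermitian_def by (simp add: mat_def)

lemma hform_add: "hform (P + Q) z = hform P z + hform Q z"
 by (simp add: hform_def hsesq_linear)

lemma hform_scaleR: "hform (r *\<^sub>R P) z = r * hform P z"
 by (simp add: hform_def hsesq_def sum_distrib_left)

lemma hpd_add: "hpsd P ==> hpd Q ==> hpd (P + Q)"
 by (auto simp: hpsd_def hpd_def hform_add intro!: hermitian_add add_nonneg_pos)

lemma hpd_scaled_id: "e > 0 ==> hpd (e *\<^sub>R mat 1 :: complex^'n^'n)"
 by (auto simp: hpd_def hform_scaleR hform_mat_1 intro!: hermitian_scaleR hermitian_mat_1)

text \<open>Lets semidefinite statements be deduced from definite ones by adding e times the
  identity.\<close>

lemma det_tendsto_perturb: "((%e. det (H + e *\<^sub>R mat 1 :: complex^'n^'n)) \<longlongrightarrow> det H) (at_right 0)"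
proof -
 have "continuous_on UNIV (%e. det (H + e *\<^sub>R mat 1 :: complex^'n^'n))"
  unfolding det_def by (intro continuous_intros)
 hence "isCont (%e. det (H + e *\<^sub>R mat 1 :: complex^'n^'n)) 0"
  by (simp add: continuous_on_eq_continuous_at)
 hence "((%e. det (H + e *\<^sub>R mat 1 :: complex^'n^'n)) \<longlongrightarrow> det (H + 0 *\<^sub>R mat 1)) (at 0)"
  unfolding isCont_def by simp
 thus ?thesis using tendsto_mono[OF at_le[of "{0<..}" UNIV]] by simp
qed

lemma hpsd_det: assumes "hpsd (H::complex^'n^'n)" shows "Im (det H) = 0" "0 <= Re (det H)"
proof -
 have pd: "hpd (H + e *\<^sub>R mat 1)" if "e > 0" for e
  using hpd_add[OF assms hpd_scaled_id[OF that]] .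
 have ev: "\<forall>\<^sub>F e in at_right (0::real). e > 0" by (simp add: eventually_at_right_less)
 have "((%e. Im (det (H + e *\<^sub>R mat 1))) \<longlongrightarrow> Im (det H)) (at_right 0)"
  by (intro tendsto_intros det_tendsto_perturb)
 moreover have "((%e. Im (det (H + e *\<^sub>R mat 1))) \<longlongrightarrow> 0) (at_right 0)"
  by (rule tendsto_eventually) (rule eventually_mono[OF ev], use pd hpd_det_hvol(1) in blast)
 ultimately show "Im (det H) = 0" by (intro tendsto_unique[of "at_right (0::real)"]) auto
 have "((%e. Re (det (H + e *\<^sub>R mat 1))) \<longlongrightarrow> Re (det H)) (at_right 0)"
  by (intro tendsto_intros det_tendsto_perturb)
 thus "0 <= Re (det H)"
  by (rule tendsto_lowerbound) (auto intro!: eventually_mono[OF ev] less_imp_le hpd_det_hvol(2) pd)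
qed

text \<open>Convexity and monotonicity of the integrand of \<open>hvol\<close> give 1 / det M \<le>
  t / det P + (1 - t) / det Q, which is at most the reciprocal of the minimum. A bound by the
  minimum is what the maximum of two subsolutions with the same right-hand side calls for.\<close>

lemma hpd_det_quasiconcave:
 fixes P Q M :: "complex^'n^'n"
 assumes P: "hpd P" and Q: "hpd Q" and M: "hpd M" and t: "0 <= t" "t <= 1"
  and ge: "!!z. t * hform P z + (1 - t) * hform Q z <= hform M z"
 shows "min (Re (det P)) (Re (det Q)) <= Re (det M)"
proof -
 let ?m = "min (Re (det P)) (Re (det Q))" and ?c = "hvol (mat 1 :: complex^'n^'n)"
 note p = hpd_det_hvol[OF P] and q = hpd_det_hvol[OF Q] and m = hpd_det_hvol[OF M]
 have meas: "(%z. ennreal (max 0 (1 - hform H z))) \<in> borel_measurable lborel" for H :: "complex^'n^'n"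
  by (auto intro!: borel_measurable_continuous_onI continuous_intros)
 have "hvol M <= (\<integral>\<^sup>+z. ennreal t * ennreal (max 0 (1 - hform P z)) + ennreal (1 - t) * ennreal (max 0 (1 - hform Q z)) \<partial>lborel)"
  unfolding hvol_def
 proof (intro nn_integral_mono)
  fix z
  have "1 - hform M z <= t * (1 - hform P z) + (1 - t) * (1 - hform Q z)" using ge[of z] by (simp add: algebra_simps)
  also have "... <= t * max 0 (1 - hform P z) + (1 - t) * max 0 (1 - hform Q z)"
   using t by (intro add_mono mult_left_mono) auto
  finally have "max 0 (1 - hform M z) <= t * max 0 (1 - hform P z) + (1 - t) * max 0 (1 - hform Q z)"
   using t by (simp add: max_def)
  thus "ennreal (max 0 (1 - hform M z)) <= ennreal t * ennreal (max 0 (1 - hform P z)) + ennreal (1 - t) * ennreal (max 0 (1 - hform Q z))"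
   using t by (simp add: ennreal_mult[symmetric] ennreal_plus[symmetric] del: ennreal_plus)
 qed
 also have "... = ennreal t * hvol P + ennreal (1 - t) * hvol Q"
  unfolding hvol_def using meas by (simp add: nn_integral_add nn_integral_cmult)
 also have "... = ennreal (t / Re (det P) + (1 - t) / Re (det Q)) * ?c"
  using t p q by (simp add: p(3) q(3) ennreal_mult[symmetric] ennreal_plus distrib_right mult.assoc[symmetric])
 also have "... <= ennreal (1 / ?m) * ?c"
 proof (intro mult_right_mono ennreal_leI)
  have "t / Re (det P) + (1 - t) / Re (det Q) <= t / ?m + (1 - t) / ?m"
   using t p q by (intro add_mono divide_left_mono) auto
  thus "t / Re (det P) + (1 - t) / Re (det Q) <= 1 / ?m" by (simp add: add_divide_distrib[symmetric])
 qed simp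
 finally have "ennreal (1 / Re (det M)) * ?c <= ennreal (1 / ?m) * ?c" by (simp add: m(3))
 hence "ennreal (1 / Re (det M)) <= ennreal (1 / ?m)"
  using hvol_mat_1[where 'n='n] ennreal_mult_le_mult_iff[of ?c] by (simp add: mult.commute[of _ ?c])
 hence "1 / Re (det M) <= 1 / ?m" using p q by (subst (asm) ennreal_le_iff) auto
 thus ?thesis using p q m by (simp add: field_simps)
qed

lemma hpsd_det_quasiconcave:
 fixes P Q M :: "complex^'n^'n"
 assumes P: "hpsd P" and Q: "hpsd Q" and M: "hermitian M" and t: "0 <= t" "t <= 1"
  and ge: "!!z. t * hform P z + (1 - t) * hform Q z <= hform M z"
 shows "min (Re (det P)) (Re (det Q)) <= Re (det M)"
proof -
 have Mp: "hpsd M"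
  unfolding hpsd_def using M ge P Q t
  by (auto simp: hpsd_def intro!: order_trans[OF _ ge] add_nonneg_nonneg mult_nonneg_nonneg)
 have ev: "\<forall>\<^sub>F e in at_right (0::real). e > 0" by (simp add: eventually_at_right_less)
 have he: "hform (H + e *\<^sub>R mat 1) z = hform H z + hform (e *\<^sub>R mat 1) z" for H :: "complex^'n^'n" and e z
  by (simp add: hform_def hsesq_linear)
 have lim: "((%e. Re (det (H + e *\<^sub>R mat 1))) \<longlongrightarrow> Re (det H)) (at_right 0)" for H :: "complex^'n^'n"
  by (intro tendsto_intros det_tendsto_perturb)
 show ?thesis
 proof (rule tendsto_le[OF _ lim[of M] tendsto_min[OF lim[of P] lim[of Q]]])
  show "\<forall>\<^sub>F e in at_right 0. min (Re (det (P + e *\<^sub>R mat 1))) (Re (det (Q + e *\<^sub>R mat 1))) <= Re (det (M + e *\<^sub>R mat 1))"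
  proof (rule eventually_mono[OF ev])
   fix e :: real assume e: "e > 0"
   have pd: "hpd (H + e *\<^sub>R mat 1)" if "hpsd H" for H :: "complex^'n^'n"
    using hpd_add[OF that hpd_scaled_id[OF e]] .
   show "min (Re (det (P + e *\<^sub>R mat 1))) (Re (det (Q + e *\<^sub>R mat 1))) <= Re (det (M + e *\<^sub>R mat 1))"
    by (rule hpd_det_quasiconcave[OF pd[OF P] pd[OF Q] pd[OF Mp] t])
      (use ge in \<open>simp add: he algebra_simps\<close>)
  qed
 qed auto
qed

lemma hpsd_det_mono:
 fixes P Q :: "complex^'n^'n"
 assumes "hpsd P" "hermitian Q" "!!z. hform P z <= hform Q z"
 shows "Re (det P) <= Re (det Q)"
 using hpsd_det_quasiconcave[OF assms(1,1,2), of 1] assms(3) by simp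

section \<open>The linearised determinant\<close>

text \<open>The derivative of det at P in direction Q, that is, n times the mixed discriminant of n
  - 1 copies of P and one copy of Q.\<close>

definition ddet :: "complex^'n^'n => complex^'n^'n => complex" where
 "ddet P Q = (\<Sum>i\<in>UNIV. det (\<chi> m. if m = i then Q $ m else P $ m))"

lemma has_field_derivative_det:
 fixes P Q :: "complex^'n^'n"
 shows "((%s::real. det (P + s *\<^sub>R Q)) has_vector_derivative ddet (P + s *\<^sub>R Q) Q) (at s within T)"
proof -
 have pr: "((%s::real. \<Prod>i\<in>UNIV. (P + s *\<^sub>R Q) $ i $ p i) has_vector_derivative
   (\<Sum>i\<in>UNIV. \<Prod>m\<in>UNIV. (if m = i then Q $ m else (P + s *\<^sub>R Q) $ m) $ p m)) (at s within T)" for p :: "'n => 'n"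
 proof -
  have "((%s::real. \<Prod>i\<in>UNIV. (P + s *\<^sub>R Q) $ i $ p i) has_derivative
   (%y. \<Sum>i\<in>UNIV. (y *\<^sub>R (Q $ i $ p i)) * (\<Prod>j\<in>UNIV - {i}. (P + s *\<^sub>R Q) $ j $ p j))) (at s within T)"
   by (rule has_derivative_prod) (auto intro!: derivative_eq_intros)
  moreover have "(%y. \<Sum>i\<in>UNIV. (y *\<^sub>R (Q $ i $ p i)) * (\<Prod>j\<in>UNIV - {i}. (P + s *\<^sub>R Q) $ j $ p j))
   = (%y. y *\<^sub>R (\<Sum>i\<in>UNIV. \<Prod>m\<in>UNIV. (if m = i then Q $ m else (P + s *\<^sub>R Q) $ m) $ p m))"
  proof (rule ext)
   fix y
   have "(\<Prod>m\<in>UNIV. (if m = i then Q $ m else (P + s *\<^sub>R Q) $ m) $ p m) = Q $ i $ p i * (\<Prod>j\<in>UNIV - {i}. (P + s *\<^sub>R Q) $ j $ p j)" for i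
    by (subst prod.remove[of _ i]) auto
   thus "(\<Sum>i\<in>UNIV. (y *\<^sub>R (Q $ i $ p i)) * (\<Prod>j\<in>UNIV - {i}. (P + s *\<^sub>R Q) $ j $ p j))
    = y *\<^sub>R (\<Sum>i\<in>UNIV. \<Prod>m\<in>UNIV. (if m = i then Q $ m else (P + s *\<^sub>R Q) $ m) $ p m)"
    by (simp add: scaleR_sum_right)
  qed
  ultimately show ?thesis by (simp add: has_vector_derivative_def)
 qed
 have "((%s::real. \<Sum>p\<in>{p. p permutes (UNIV::'n set)}. of_int (sign p) * (\<Prod>i\<in>UNIV. (P + s *\<^sub>R Q) $ i $ p i)) has_vector_derivative
  (\<Sum>p\<in>{p. p permutes (UNIV::'n set)}. of_int (sign p) * (\<Sum>i\<in>UNIV. \<Prod>m\<in>UNIV. (if m = i then Q $ m else (P + s *\<^sub>R Q) $ m) $ p m))) (at s within T)"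
  by (intro has_vector_derivative_sum has_vector_derivative_mult_right pr)
 moreover have "(\<Sum>p\<in>{p. p permutes (UNIV::'n set)}. of_int (sign p) * (\<Sum>i\<in>UNIV. \<Prod>m\<in>UNIV. (if m = i then Q $ m else (P + s *\<^sub>R Q) $ m) $ p m))
  = ddet (P + s *\<^sub>R Q) Q"
  unfolding ddet_def det_def by (subst sum.swap) (simp add: sum_distrib_left)
 ultimately show ?thesis by (simp add: det_def)
qed

text \<open>Both sides are the derivative of the same function of s. It serves the integration by
  parts that differentiates along columns instead of rows.\<close>

lemma ddet_transpose: "ddet (transpose P) (transpose Q) = ddet P (Q::complex^'n^'n)"
proof -
 have "((%s::real. det (P + s *\<^sub>R Q)) has_vector_derivative ddet P Q) (at 0)"
  using has_field_derivative_det[of P Q 0] by simp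
 moreover have "transpose P + s *\<^sub>R transpose Q = transpose (P + s *\<^sub>R Q)" for s
  by (simp add: transpose_def vec_eq_iff)
 hence "((%s::real. det (P + s *\<^sub>R Q)) has_vector_derivative ddet (transpose P) (transpose Q)) (at 0)"
  using has_field_derivative_det[of "transpose P" "transpose Q" 0] by simp
 ultimately show ?thesis by (metis vector_derivative_at)
qed

text \<open>Ellipticity: for s > 0 the determinant of P + s Q does not fall below that of P, since
  adding s Q increases the form.\<close>

lemma ddet_nonneg:
 fixes P Q :: "complex^'n^'n"
 assumes P: "hpsd P" and Q: "hpsd Q"
 shows "0 <= Re (ddet P Q)"
proof -
 have d: "((%s::real. Re (det (P + s *\<^sub>R Q))) has_real_derivative Re (ddet P Q)) (at 0)"
  using has_field_derivative_det[of P Q 0 UNIV]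
  by (auto simp: has_real_derivative_iff_has_vector_derivative has_vector_derivative_def
    dest!: has_derivative_Re)
 have "Re (det P) <= Re (det (P + s *\<^sub>R Q))" if "s > 0" for s
 proof (rule hpsd_det_mono[OF P])
  show "hermitian (P + s *\<^sub>R Q)" using P Q by (simp add: hpsd_def hermitian_add hermitian_scaleR)
  have "hform (P + s *\<^sub>R Q) z = hform P z + s * hform Q z" for z
   by (simp add: hform_add hform_scaleR)
  thus "hform P z <= hform (P + s *\<^sub>R Q) z" for z using Q that by (simp add: hpsd_def)
 qed
 thus ?thesis
  using has_real_derivative_neg_dec_right[OF d[THEN DERIV_subset[of _ _ _ UNIV]], of ]
  by (smt (verit, del_insts) DERIV_neg_dec_right d dense scaleR_zero_left add.right_neutral add.left_neutral)
qed

section \<open>Finitely often differentiable functions\<close>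

text \<open>Direction before point, so that \<open>fd f a\<close> is itself a function that can be
  differentiated again.\<close>

definition fd :: "('a::real_normed_vector => 'b::real_normed_vector) => 'a => 'a => 'b" where
 "fd f a x = frechet_derivative f (at x) a"

text \<open>Differentiability is asked for on the whole space, so that sums, products and
  compositions carry no domains; functions built piecewise on open sets enter through
  \<open>Ck_local\<close>.\<close>

fun Ck :: "nat => ('a::real_normed_vector => 'b::real_normed_vector) => bool" where
 "Ck 0 f \<longleftrightarrow> continuous_on UNIV f"
| "Ck (Suc k) f \<longleftrightarrow> (\<forall>x. f differentiable at x) \<and> (\<forall>a. Ck k (fd f a))"

lemma hess_fd: "hess u x a b = fd (fd u a) b x"
 by (simp add: hess_def fd_def[abs_def])

lemma fd_eqI: "(f has_derivative f') (at x) ==> fd f a x = f' a"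
 unfolding fd_def by (metis frechet_derivative_at)

lemma differentiable_fd: "f differentiable at x ==> (f has_derivative (%a. fd f a x)) (at x)"
 unfolding fd_def by (simp add: frechet_derivative_works)

lemma Ck_derivative: "Ck (Suc k) f ==> (f has_derivative (%a. fd f a x)) (at x)"
 by (simp add: differentiable_fd)

lemma Ck_fd: "Ck (Suc k) f ==> Ck k (fd f a)" by simp

lemma Ck_SucI:
 assumes "!!x. (f has_derivative f' x) (at x)" "!!a. Ck k (%x. f' x a)"
 shows "Ck (Suc k) f"
proof -
 have "fd f a = (%x. f' x a)" for a using fd_eqI[OF assms(1)] by auto
 thus ?thesis using assms by (auto simp: differentiable_def)
qed

lemma Ck_Suc_imp: "Ck (Suc k) f ==> Ck k f"
proof (induction k arbitrary: f)
 case 0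
 thus ?case
  by (auto intro!: continuous_at_imp_continuous_on differentiable_imp_continuous_within)
qed auto

lemma Ck_le: "k <= l ==> Ck l f ==> Ck k f"
 by (induction rule: inc_induct) (blast intro: Ck_Suc_imp)+

lemma Ck_continuous: "Ck k f ==> continuous_on S f"
 using Ck_le[of 0 k f] continuous_on_subset by auto

lemma Ck_const [simp]: "Ck k (%x. c)"
proof (induction k arbitrary: c)
 case (Suc k)
 thus ?case by (intro Ck_SucI[of _ "%_ _. 0"]) auto
qed auto

lemma Ck_add: "Ck k f ==> Ck k g ==> Ck k (%x. f x + g x)"
proof (induction k arbitrary: f g)
 case (Suc k)
 show ?case
  by (rule Ck_SucI[OF has_derivative_add[OF Ck_derivative[OF Suc.prems(1)] Ck_derivative[OF Suc.prems(2)]]])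
    (use Suc in auto)
qed (auto intro: continuous_intros)

lemma Ck_sum: "(!!i. i \<in> I ==> Ck k (f i)) ==> Ck k (%x. \<Sum>i\<in>I. f i x)"
 by (induction I rule: infinite_finite_induct) (auto intro: Ck_add)

lemma Ck_bounded_linear: "bounded_linear L ==> Ck k f ==> Ck k (%x. L (f x))"
proof (induction k arbitrary: f)
 case 0
 thus ?case by (auto intro: bounded_linear.continuous_on)
next
 case (Suc k)
 show ?case
  by (rule Ck_SucI[OF bounded_linear.has_derivative[OF Suc.prems(1) Ck_derivative[OF Suc.prems(2)]]])
    (use Suc in auto)
qed

lemma Ck_id: "Ck k (%x. x)"
proof (cases k)
 case (Suc l)
 show ?thesis unfolding Suc by (rule Ck_SucI[of _ "%_ a. a"]) simp_all
qed simp

lemma Ck_diff: "Ck k f ==> Ck k g ==> Ck k (%x. f x - g x)"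
 using Ck_add[OF _ Ck_bounded_linear[OF bounded_linear_minus[OF bounded_linear_ident]], of k f g] by simp

lemma Ck_bilinear:
 assumes "bounded_bilinear B"
 shows "Ck k f ==> Ck k g ==> Ck k (%x. B (f x) (g x))"
proof (induction k arbitrary: f g)
 case 0
 thus ?case using bounded_bilinear.continuous_on[OF assms] by auto
next
 case (Suc k)
 note B = bounded_bilinear.FDERIV[OF assms Ck_derivative[OF Suc.prems(1)] Ck_derivative[OF Suc.prems(2)]]
 show ?case
  by (rule Ck_SucI[OF B])
    (use Suc.IH Suc.prems Ck_Suc_imp[OF Suc.prems(1)] Ck_Suc_imp[OF Suc.prems(2)] in \<open>auto intro!: Ck_add\<close>)
qed

lemmas Ck_mult = Ck_bilinear[OF bounded_bilinear_mult]
lemmas Ck_inner = Ck_bilinear[OF bounded_bilinear_inner]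
lemmas Ck_of_real = Ck_bounded_linear[OF bounded_linear_of_real]

lemma Ck_prod: "(!!i. i \<in> I ==> Ck k (f i)) ==> Ck k (%x. \<Prod>i\<in>I. f i x :: 'b::{real_normed_field})"
 by (induction I rule: infinite_finite_induct) (auto intro: Ck_mult)

lemma Ck_compose_real:
 fixes f :: "'a::real_normed_vector => real" and g :: "real => real"
 shows "Ck k g ==> Ck k f ==> Ck k (%x. g (f x))"
proof (induction k arbitrary: f g)
 case 0
 thus ?case by (auto intro: continuous_on_compose2)
next
 case (Suc k)
 have "((%x. g (f x)) has_derivative (%a. fd g (fd f a x) (f x))) (at x)" for x
  using has_derivative_compose[OF Ck_derivative[OF Suc.prems(2), of x] Ck_derivative[OF Suc.prems(1), of "f x"]] .
 moreover have "fd g (fd f a x) (f x) = fd f a x * fd g 1 (f x)" for a x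
  using linear_cmul[OF has_derivative_linear[OF Ck_derivative[OF Suc.prems(1), of "f x"]], of "fd f a x" 1] by simp
 ultimately have "((%x. g (f x)) has_derivative (%a. fd f a x * fd g 1 (f x))) (at x)" for x by simp
 thus ?case
  by (rule Ck_SucI)
    (use Suc.IH Suc.prems Ck_Suc_imp[OF Suc.prems(2)] in \<open>auto intro!: Ck_mult\<close>)
qed

lemma fd_cong_open:
 assumes "open U" "x \<in> U" "!!y. y \<in> U ==> f y = g y"
 shows "fd f a x = fd g a x"
proof -
 have "(f has_derivative D) (at x) \<longleftrightarrow> (g has_derivative D) (at x)" for D
  using has_derivative_transform_within_open[OF _ assms(1,2), of f D UNIV g]
   has_derivative_transform_within_open[OF _ assms(1,2), of g D UNIV f] assms(3) by auto
 thus ?thesis unfolding fd_def frechet_derivative_def by (simp only:)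
qed

lemma hess_cong_open:
 assumes "open U" "x \<in> U" "!!y. y \<in> U ==> f y = g y"
 shows "hess f x a b = hess g x a b"
 unfolding hess_fd by (rule fd_cong_open[OF assms(1,2)]) (rule fd_cong_open[OF assms(1) _ assms(3)])

lemma Ck_local:
 assumes "!!x. \<exists>U g. open U \<and> x \<in> U \<and> Ck k g \<and> (\<forall>y\<in>U. f y = g y)"
 shows "Ck k f"
 using assms
proof (induction k arbitrary: f)
 case 0
 have "continuous (at x) f" for x
 proof -
  obtain U g where U: "open U" "x \<in> U" "Ck 0 g" "\<forall>y\<in>U. f y = g y" using 0 by blast
  hence "continuous_on U f" using continuous_on_cong[of U U f g] continuous_on_subset[of UNIV g U] by auto
  thus ?thesis using continuous_on_eq_continuous_at[OF U(1), of f] U(2) by blast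
 qed
 thus ?case by (simp add: continuous_at_imp_continuous_on)
next
 case (Suc k)
 have "f differentiable at x" for x
 proof -
  obtain U g where U: "open U" "x \<in> U" "Ck (Suc k) g" "\<forall>y\<in>U. f y = g y" using Suc.prems by blast
  hence "(f has_derivative (%a. fd g a x)) (at x)"
   using has_derivative_transform_within_open[OF Ck_derivative[OF U(3)] U(1,2)] by auto
  thus ?thesis by (auto simp: differentiable_def)
 qed
 moreover have "Ck k (fd f a)" for a
 proof (rule Suc.IH)
  fix x
  obtain U g where U: "open U" "x \<in> U" "Ck (Suc k) g" "\<forall>y\<in>U. f y = g y" using Suc.prems by blast
  hence "\<forall>y\<in>U. fd f a y = fd g a y" using fd_cong_open[OF U(1), of _ f g] by blast
  thus "\<exists>U g. open U \<and> x \<in> U \<and> Ck k g \<and> (\<forall>y\<in>U. fd f a y = g y)"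
   using U by (intro exI[of _ U] exI[of _ "fd g a"]) auto
 qed
 ultimately show ?case by simp
qed

lemma fd_add: "f differentiable at x ==> g differentiable at x ==> fd (%x. f x + g x) a x = fd f a x + fd g a x"
 by (rule fd_eqI[OF has_derivative_add[OF differentiable_fd differentiable_fd]])

lemma fd_diff: "f differentiable at x ==> g differentiable at x ==> fd (%x. f x - g x) a x = fd f a x - fd g a x"
 by (rule fd_eqI[OF has_derivative_diff[OF differentiable_fd differentiable_fd]])

lemma fd_bounded_linear: "bounded_linear L ==> f differentiable at x ==> fd (%x. L (f x)) a x = L (fd f a x)"
 by (rule fd_eqI[OF bounded_linear.has_derivative[OF _ differentiable_fd]])

lemma fd_mult:
 fixes f g :: "'a::real_normed_vector => 'b::real_normed_algebra"
 shows "f differentiable at x ==> g differentiable at x ==> fd (%x. f x * g x) a x = f x * fd g a x + fd f a x * g x"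
 by (rule fd_eqI[OF has_derivative_mult[OF differentiable_fd differentiable_fd]])

lemma fd_linear: "Ck (Suc k) f ==> linear (%a. fd f a x)"
 by (rule has_derivative_linear[OF Ck_derivative])

lemma line_derivative:
 assumes "Ck (Suc k) (f::'a::real_normed_vector => real)"
 shows "((%t. f (x + t *\<^sub>R a)) has_real_derivative fd f a (x + t *\<^sub>R a)) (at t within T)"
proof -
 have "((%t. x + t *\<^sub>R a) has_derivative (%t. t *\<^sub>R a)) (at t within T)"
  by (auto intro!: derivative_eq_intros)
 from has_derivative_compose[OF this Ck_derivative[OF assms]]
 have "((%t. f (x + t *\<^sub>R a)) has_derivative (%s. fd f (s *\<^sub>R a) (x + t *\<^sub>R a))) (at t within T)" .
 moreover have "(%s. fd f (s *\<^sub>R a) (x + t *\<^sub>R a)) = (*) (fd f a (x + t *\<^sub>R a))"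
  using linear_cmul[OF fd_linear[OF assms], of _ a "x + t *\<^sub>R a"] by (auto simp: fun_eq_iff mult.commute)
 ultimately show ?thesis unfolding has_field_derivative_def by simp
qed

text \<open>Two mean value steps express the second difference over a parallelogram of side t
  through the second derivative at a nearby point; the second difference itself is symmetric in a
  and b.\<close>

lemma fd_symmetric:
 fixes f :: "'a::real_normed_vector => real"
 assumes f: "Ck 2 f"
 shows "fd (fd f a) b x = fd (fd f b) a x"
proof -
 have f1: "Ck (Suc (Suc 0)) f" using f by (simp add: numeral_2_eq_2)
 have key: "\<exists>\<theta> \<eta>. 0 < \<theta> \<and> \<theta> < t \<and> 0 < \<eta> \<and> \<eta> < t \<and>
   f (x + t *\<^sub>R a + t *\<^sub>R b) - f (x + t *\<^sub>R a) - f (x + t *\<^sub>R b) + f x = t * t * fd (fd f a) b (x + \<theta> *\<^sub>R a + \<eta> *\<^sub>R b)"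
  if t: "t > 0" for t a b
 proof -
  define g where "g s = f (x + t *\<^sub>R b + s *\<^sub>R a) - f (x + s *\<^sub>R a)" for s
  have "\<exists>z. 0 < z \<and> z < t \<and> g t - g 0 = (t - 0) * (fd f a (x + t *\<^sub>R b + z *\<^sub>R a) - fd f a (x + z *\<^sub>R a))"
   by (rule MVT2[OF t]) (auto simp: g_def intro!: derivative_intros line_derivative[OF f1])
  then obtain z where z: "0 < z" "z < t" "g t - g 0 = t * (fd f a (x + t *\<^sub>R b + z *\<^sub>R a) - fd f a (x + z *\<^sub>R a))" by auto
  have "\<exists>w. 0 < w \<and> w < t \<and> fd f a (x + z *\<^sub>R a + t *\<^sub>R b) - fd f a (x + z *\<^sub>R a + 0 *\<^sub>R b) = (t - 0) * fd (fd f a) b (x + z *\<^sub>R a + w *\<^sub>R b)"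
   by (rule MVT2[OF t, of "%s. fd f a (x + z *\<^sub>R a + s *\<^sub>R b)"]) (auto intro!: line_derivative Ck_fd[OF f1])
  then obtain w where w: "0 < w" "w < t" "fd f a (x + z *\<^sub>R a + t *\<^sub>R b) - fd f a (x + z *\<^sub>R a) = t * fd (fd f a) b (x + z *\<^sub>R a + w *\<^sub>R b)" by auto
  have "f (x + t *\<^sub>R a + t *\<^sub>R b) - f (x + t *\<^sub>R a) - f (x + t *\<^sub>R b) + f x = g t - g 0"
   by (simp add: g_def algebra_simps)
  also have "... = t * t * fd (fd f a) b (x + z *\<^sub>R a + w *\<^sub>R b)"
   unfolding z(3) using w(3) by (simp add: algebra_simps)
  finally show ?thesis using z w by blast
 qed
 define t where "t n = 1 / real (Suc n)" for n
 have tp: "t n > 0" for n by (simp add: t_def)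
 have t0: "t \<longlonglongrightarrow> 0" using LIMSEQ_inverse_real_of_nat by (simp add: inverse_eq_divide t_def[abs_def])
 have lim: "(%n. (f (x + t n *\<^sub>R a + t n *\<^sub>R b) - f (x + t n *\<^sub>R a) - f (x + t n *\<^sub>R b) + f x) / (t n * t n)) \<longlonglongrightarrow> fd (fd f a) b x" for a b
 proof -
  obtain \<theta> \<eta> where te: "!!n. 0 < \<theta> n \<and> \<theta> n < t n \<and> 0 < \<eta> n \<and> \<eta> n < t n \<and>
   f (x + t n *\<^sub>R a + t n *\<^sub>R b) - f (x + t n *\<^sub>R a) - f (x + t n *\<^sub>R b) + f x = t n * t n * fd (fd f a) b (x + \<theta> n *\<^sub>R a + \<eta> n *\<^sub>R b)"
   using key[OF tp, of _ a b] by metis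
  have "\<theta> \<longlonglongrightarrow> 0" "\<eta> \<longlonglongrightarrow> 0"
   by (rule real_tendsto_sandwich[OF _ _ tendsto_const t0]; use te in \<open>auto intro!: always_eventually less_imp_le\<close>)+
  hence "(%n. x + \<theta> n *\<^sub>R a + \<eta> n *\<^sub>R b) \<longlonglongrightarrow> x + 0 *\<^sub>R a + 0 *\<^sub>R b"
   by (intro tendsto_intros)
  moreover have "continuous (at x) (fd (fd f a) b)"
   using f1 by (simp add: continuous_on_eq_continuous_at)
  ultimately have "(%n. fd (fd f a) b (x + \<theta> n *\<^sub>R a + \<eta> n *\<^sub>R b)) \<longlonglongrightarrow> fd (fd f a) b x"
   by (auto intro: isCont_tendsto_compose)
  moreover have "(%n. (f (x + t n *\<^sub>R a + t n *\<^sub>R b) - f (x + t n *\<^sub>R a) - f (x + t n *\<^sub>R b) + f x) / (t n * t n)) = (%n. fd (fd f a) b (x + \<theta> n *\<^sub>R a + \<eta> n *\<^sub>R b))"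
   using te tp by (simp add: fun_eq_iff less_imp_neq[OF tp, symmetric])
  ultimately show ?thesis by simp
 qed
 have "(%n. (f (x + t n *\<^sub>R a + t n *\<^sub>R b) - f (x + t n *\<^sub>R a) - f (x + t n *\<^sub>R b) + f x) / (t n * t n))
   = (%n. (f (x + t n *\<^sub>R b + t n *\<^sub>R a) - f (x + t n *\<^sub>R b) - f (x + t n *\<^sub>R a) + f x) / (t n * t n))"
  by (simp add: fun_eq_iff algebra_simps)
 with lim[of b a] have "(%n. (f (x + t n *\<^sub>R a + t n *\<^sub>R b) - f (x + t n *\<^sub>R a) - f (x + t n *\<^sub>R b) + f x) / (t n * t n)) \<longlonglongrightarrow> fd (fd f b) a x"
  by simp
 with lim[of a b] show ?thesis by (rule LIMSEQ_unique)
qed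

lemma Ck_2_C2_on: assumes "Ck 2 u" "open S" shows "C2_on S u"
proof -
 have u: "Ck (Suc (Suc 0)) u" using assms(1) by (simp add: numeral_2_eq_2)
 have "(%y. frechet_derivative u (at y) a) = fd u a" for a by (simp add: fd_def fun_eq_iff)
 thus ?thesis
  unfolding C2_on_def using u assms(2) by (auto simp: hess_fd[abs_def] intro: continuous_on_subset[of UNIV])
qed

lemma Ck_2_hess_continuous: "Ck 2 u ==> continuous_on S (%x. hess u x a b)"
 unfolding hess_fd by (auto simp: numeral_2_eq_2 intro: continuous_on_subset[of UNIV])

section \<open>Integration by parts for the complex Monge-Ampere operator\<close>

lemma compact_support_integrable:
 fixes F :: "'a::euclidean_space => 'b::{banach,second_countable_topology}"
 assumes "continuous_on UNIV F" "compact K" "!!x. x \<notin> K ==> F x = 0"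
 shows "integrable lborel F"
proof -
 have "integrable lborel (%x. indicator K x *\<^sub>R F x)"
  using assms by (intro borel_integrable_compact) (auto intro: continuous_on_subset)
 moreover have "(%x. indicator K x *\<^sub>R F x) = F" using assms(3) by (auto simp: indicator_def)
 ultimately show ?thesis by simp
qed

lemma integral_shift:
 fixes F :: "'a::euclidean_space => 'b::{banach,second_countable_topology}"
 assumes F: "F \<in> borel_measurable borel"
 shows "(LBINT x. F (a + x)) = (LBINT x. F x)"
 by (subst (2) lborel_distr_plus[of a, symmetric], subst integral_distr) (use F in auto)

lemma fd_zero_outside:
 assumes "closed K" "!!x. x \<notin> K ==> f x = 0" "x \<notin> K"
 shows "fd f a x = 0"
proof -
 have "fd f a x = fd (%_. 0) a x"
  by (rule fd_cong_open[of "- K"]) (use assms in auto)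
 also have "... = 0" by (rule fd_eqI[OF has_derivative_const])
 finally show ?thesis .
qed

text \<open>Difference quotients of F integrate to 0 by translation invariance, and dominated
  convergence carries this to the derivative.\<close>

lemma integral_fd_zero:
 fixes F :: "'a::euclidean_space => 'b::{euclidean_space}"
 assumes F: "Ck 1 F" and K: "compact K" "!!x. x \<notin> K ==> F x = 0"
 shows "(LBINT x. fd F a x) = 0"
proof -
 have F1: "Ck (Suc 0) F" using F by simp
 have cF: "continuous_on UNIV F" using F by (rule Ck_continuous)
 have cfd: "continuous_on UNIV (fd F a)" using Ck_fd[OF F1] by simp
 have iF: "integrable lborel F" using compact_support_integrable[OF cF K] .
 define t where "t n = 1 / real (Suc n)" for n
 have tp: "0 < t n" "t n <= 1" for n by (auto simp: t_def)
 have t0: "t \<longlonglongrightarrow> 0" using LIMSEQ_inverse_real_of_nat by (simp add: inverse_eq_divide t_def[abs_def])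
 \<comment> \<open>The support swept backwards along a by up to one step; it contains the supports
   of all difference quotients with step at most 1.\<close>
 define K' where "K' = (%p. fst p - snd p *\<^sub>R a) ` (K \<times> {0..1})"
 have cK': "compact K'"
  unfolding K'_def by (intro compact_continuous_image compact_Times K continuous_intros) auto
 have KK': "K \<subseteq> K'" unfolding K'_def by force
 obtain M where M: "!!x. x \<in> K ==> norm (fd F a x) <= M"
  using compact_imp_bounded[OF compact_continuous_image[OF continuous_on_subset[OF cfd] K(1)]]
  unfolding bounded_iff by auto
 define M' where "M' = max M 0"
 have fz: "fd F a x = 0" if "x \<notin> K" for x
  using fd_zero_outside[OF compact_imp_closed[OF K(1)] K(2) that] by simp
 have M': "norm (fd F a x) <= M'" for x using M[of x] fz[of x] by (cases "x \<in> K") (auto simp: M'_def)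
 have line: "((%s. F (x + s *\<^sub>R a)) has_vector_derivative fd F a (x + s *\<^sub>R a)) (at s within T)" for x s T
 proof -
  have "((%t. x + t *\<^sub>R a) has_derivative (%t. t *\<^sub>R a)) (at s within T)"
   by (auto intro!: derivative_eq_intros)
  from has_derivative_compose[OF this Ck_derivative[OF F1]]
  have "((%t. F (x + t *\<^sub>R a)) has_derivative (%u. fd F (u *\<^sub>R a) (x + s *\<^sub>R a))) (at s within T)" .
  moreover have "(%u. fd F (u *\<^sub>R a) (x + s *\<^sub>R a)) = (%u. u *\<^sub>R fd F a (x + s *\<^sub>R a))"
   using linear_cmul[OF fd_linear[OF F1], of _ a "x + s *\<^sub>R a"] by (auto simp: fun_eq_iff)
  ultimately show ?thesis unfolding has_vector_derivative_def by simp
 qed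
 define Q where "Q n x = (1 / t n) *\<^sub>R (F (x + t n *\<^sub>R a) - F x)" for n x
 have "(%n. (LBINT x. Q n x)) \<longlonglongrightarrow> (LBINT x. fd F a x)"
 proof (rule integral_dominated_convergence[where w="%x. indicator K' x *\<^sub>R M'"])
  show "fd F a \<in> borel_measurable lborel" using cfd by (simp add: borel_measurable_continuous_onI)
  have "continuous_on UNIV (Q n)" for n
   unfolding Q_def by (intro continuous_intros continuous_on_compose2[OF cF]) auto
  thus "Q n \<in> borel_measurable lborel" for n by (simp add: borel_measurable_continuous_onI)
  show "integrable lborel (%x. indicator K' x *\<^sub>R M')"
   by (intro borel_integrable_compact cK' continuous_intros)
  show "AE x in lborel. (%n. Q n x) \<longlonglongrightarrow> fd F a x"
  proof (intro always_eventually allI)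
   fix x
   have "((%s. F (x + s *\<^sub>R a)) has_vector_derivative fd F a x) (at 0)" using line[of x 0] by simp
   hence "((%y. (1 / norm (y - 0)) *\<^sub>R (F (x + y *\<^sub>R a) - (F (x + 0 *\<^sub>R a) + (y - 0) *\<^sub>R fd F a x))) \<longlongrightarrow> 0) (at 0)"
    unfolding has_vector_derivative_def has_derivative_within by simp
   moreover have "filterlim t (at 0) sequentially"
    using t0 tp(1) by (auto simp: filterlim_at less_imp_neq[symmetric])
   ultimately have "(%n. (1 / norm (t n - 0)) *\<^sub>R (F (x + t n *\<^sub>R a) - (F (x + 0 *\<^sub>R a) + (t n - 0) *\<^sub>R fd F a x))) \<longlonglongrightarrow> 0"
    by (rule filterlim_compose)
   moreover have "(1 / norm (t n - 0)) *\<^sub>R (F (x + t n *\<^sub>R a) - (F (x + 0 *\<^sub>R a) + (t n - 0) *\<^sub>R fd F a x)) = Q n x - fd F a x" for n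
    using tp(1)[of n] by (simp add: Q_def algebra_simps)
   ultimately show "(%n. Q n x) \<longlonglongrightarrow> fd F a x" by (simp add: LIM_zero_iff)
  qed
  show "AE x in lborel. norm (Q n x) <= indicator K' x *\<^sub>R M'" for n
  proof (intro always_eventually allI)
   fix x
   show "norm (Q n x) <= indicator K' x *\<^sub>R M'"
   proof (cases "x \<in> K'")
    case False
    hence "x \<notin> K" using KK' by auto
    moreover have "x + t n *\<^sub>R a \<notin> K"
    proof
     assume "x + t n *\<^sub>R a \<in> K"
     hence "(x + t n *\<^sub>R a) - t n *\<^sub>R a \<in> K'"
      unfolding K'_def using tp[of n] by (intro image_eqI[of _ _ "(x + t n *\<^sub>R a, t n)"]) auto
     thus False using False by simp
    qed
    ultimately show ?thesis using K(2) False by (simp add: Q_def)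
   next
    case True
    have on: "onorm (%u. u *\<^sub>R fd F a y) <= M'" for y
     by (rule onorm_le) (simp add: mult.commute[of M'] mult_left_mono[OF M'])
    have "norm (F (x + t n *\<^sub>R a) - F (x + 0 *\<^sub>R a)) <= M' * norm (t n - 0)"
     by (rule differentiable_bound[of "{0..t n}" "%s. F (x + s *\<^sub>R a)" "%s u. u *\<^sub>R fd F a (x + s *\<^sub>R a)"])
       (use tp[of n] line on in \<open>auto simp: has_vector_derivative_def\<close>)
    moreover have "norm (Q n x) = norm (F (x + t n *\<^sub>R a) - F x) / t n"
     using tp[of n] by (simp add: Q_def del: scaleR_diff_right)
    ultimately show ?thesis using True tp[of n] by (simp add: pos_divide_le_eq)
   qed
  qed
 qed
 moreover have "(LBINT x. Q n x) = 0" for n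
 proof -
  have "continuous_on UNIV (%x. F (x + t n *\<^sub>R a))" by (intro continuous_intros continuous_on_compose2[OF cF]) auto
  moreover have "compact ((%x. x - t n *\<^sub>R a) ` K)" by (intro compact_continuous_image K continuous_intros)
  ultimately have "integrable lborel (%x. F (x + t n *\<^sub>R a))"
   by (rule compact_support_integrable) (use K(2) in \<open>auto simp: image_iff\<close>, metis K(2) add_diff_cancel)
  moreover have "(LBINT x. F (x + t n *\<^sub>R a)) = (LBINT x. F x)"
   using integral_shift[of F "t n *\<^sub>R a"] cF by (simp add: borel_measurable_continuous_onI add.commute)
  ultimately show ?thesis using iF by (simp add: Q_def)
 qed
 ultimately show ?thesis by (simp add: LIMSEQ_const_iff)
qed

text \<open>With \<open>s = -\<i>\<close> this is \<open>\<partial>/\<partial>z_k\<close>, with \<open>s = \<i>\<close> it is \<open>\<partial>/\<partial>\<bar>z_k\<close>.\<close>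
definition wirt :: "complex => 'n => (complex^'n => complex) => complex^'n => complex" where
 "wirt s k F x = (fd F (axis k 1) x + s * fd F (axis k \<i>) x) / 2"

lemma Ck_wirt: "Ck (Suc k) F ==> Ck k (wirt s j F)"
 unfolding wirt_def[abs_def] divide_inverse
 by (intro Ck_mult Ck_add Ck_const Ck_fd)

lemma wirt_mult:
 "F differentiable at x ==> G differentiable at x ==>
  wirt s k (%x. F x * G x) x = F x * wirt s k G x + wirt s k F x * G x"
 by (simp add: wirt_def fd_mult field_simps)

lemma wirt_zero_outside:
 assumes "closed K" "!!x. x \<notin> K ==> f x = 0" "x \<notin> K"
 shows "wirt s k f x = 0"
 using fd_zero_outside[OF assms] by (simp add: wirt_def)

lemma integral_wirt_zero:
 assumes F: "Ck 1 F" and K: "compact K" "!!x. x \<notin> K ==> F x = 0"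
 shows "(LBINT x. wirt s k F x) = 0"
proof -
 have F1: "Ck (Suc 0) F" using F by simp
 have "integrable lborel (fd F a)" for a
  using Ck_fd[OF F1, of a] fd_zero_outside[OF compact_imp_closed[OF K(1)] K(2)]
  by (intro compact_support_integrable[OF _ K(1)]) auto
 thus ?thesis using integral_fd_zero[OF F K] by (simp add: wirt_def)
qed

lemma fd_symmetric_complex:
 fixes F :: "'a::real_normed_vector => complex"
 assumes F: "Ck 2 F"
 shows "fd (fd F a) b x = fd (fd F b) a x"
proof -
 have F2: "Ck (Suc (Suc 0)) F" using F by (simp add: numeral_2_eq_2)
 have *: "L (fd (fd F a) b x) = fd (fd (%x. L (F x)) a) b x" if L: "bounded_linear L" for L :: "complex => real" and a b
 proof -
  have "fd (%x. L (F x)) a = (%x. L (fd F a x))" using F2 by (auto simp: fd_bounded_linear[OF L])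
  thus ?thesis using F2 by (auto simp: fd_bounded_linear[OF L])
 qed
 have "L (fd (fd F a) b x) = L (fd (fd F b) a x)" if L: "bounded_linear L" for L :: "complex => real"
  unfolding *[OF L] by (rule fd_symmetric[OF Ck_bounded_linear[OF L F]])
 from this[OF bounded_linear_Re] this[OF bounded_linear_Im] show ?thesis by (simp add: complex_eq_iff)
qed

lemma wirt_commute:
 assumes F: "Ck 2 F"
 shows "wirt s j (wirt r k F) x = wirt r k (wirt s j F) x"
proof -
 have F2: "Ck (Suc (Suc 0)) F" using F by (simp add: numeral_2_eq_2)
 have e: "fd (wirt r k F) a x = (fd (fd F (axis k 1)) a x + r * fd (fd F (axis k \<i>)) a x) / 2" for r k a
 proof -
  have d: "fd F b differentiable at x" for b using F2 by simp
  show ?thesis unfolding wirt_def[abs_def]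
   by (rule fd_eqI) (auto intro!: derivative_eq_intros differentiable_fd[OF d] simp: )
 qed
 show ?thesis
  unfolding wirt_def[of s j] wirt_def[of r k] e unfolding wirt_def[symmetric]
  by (simp add: e fd_symmetric_complex[OF F, of "axis k _" "axis j _"] field_simps)
qed

lemma wirt_prod:
 assumes "finite I" "!!i. i \<in> I ==> G i differentiable at x"
 shows "wirt s k (%x. \<Prod>i\<in>I. G i x) x = (\<Sum>l\<in>I. wirt s k (G l) x * (\<Prod>i\<in>I - {l}. G i x))"
  and "(%x. \<Prod>i\<in>I. G i x) differentiable at x"
proof -
 have d: "((%x. \<Prod>i\<in>I. G i x) has_derivative (%y. \<Sum>i\<in>I. fd (G i) y x * (\<Prod>j\<in>I - {i}. G j x))) (at x)"
  by (rule has_derivative_prod) (rule differentiable_fd[OF assms(2)])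
 thus "(%x. \<Prod>i\<in>I. G i x) differentiable at x" by (auto simp: differentiable_def)
 show "wirt s k (%x. \<Prod>i\<in>I. G i x) x = (\<Sum>l\<in>I. wirt s k (G l) x * (\<Prod>i\<in>I - {l}. G i x))"
  unfolding wirt_def fd_eqI[OF d]
  by (simp add: sum_distrib_left sum.distrib[symmetric] sum_divide_distrib[symmetric] field_simps)
qed

lemma continuous_det:
 fixes A :: "'a::topological_space => complex^'n^'n"
 assumes "!!i j. continuous_on S (%x. A x $ i $ j)"
 shows "continuous_on S (%x. det (A x))"
 unfolding det_def by (intro continuous_intros assms)

lemma continuous_det_row:
 fixes P Q :: "'a::topological_space => complex^'n^'n"
 assumes "!!i j. continuous_on S (%x. P x $ i $ j)" "!!i j. continuous_on S (%x. Q x $ i $ j)"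
 shows "continuous_on S (%x. det (\<chi> m. if m = i then Q x $ m else P x $ m))"
proof (rule continuous_det)
 fix m j show "continuous_on S (%x. (\<chi> m. if m = i then Q x $ m else P x $ m) $ m $ j)"
  using assms by (cases "m = i") auto
qed

lemma det_zero_row_entries:
 fixes A :: "complex^'n^'n"
 assumes "!!j. A $ i $ j = 0"
 shows "det A = 0"
 by (rule det_zero_row[of i]) (use assms in \<open>simp add: row_def vec_eq_iff\<close>)

text \<open>Integrating the distinguished factor by parts produces second derivatives that are symmetric in two
 indices which the sign of the permutation makes antisymmetric.\<close>
lemma integral_det_wirt_zero:
 fixes X :: "'n => complex^'n => complex"
 assumes X: "!!m. Ck 2 (X m)" and K: "compact K" "!!x. x \<notin> K ==> X m0 x = 0"
 shows "(LBINT x. det (\<chi> m j. wirt s j (X m) x)) = 0"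
proof -
 have X2: "Ck (Suc (Suc 0)) (X m)" for m using X[of m] by (simp add: numeral_2_eq_2)
 have cl: "closed K" using K(1) by (rule compact_imp_closed)
 let ?P = "{p. p permutes (UNIV::'n set)}"
 let ?I = "UNIV - {m0}"
 define R where "R p x = (\<Prod>m\<in>?I. wirt s (p m) (X m) x)" for p x
 define T where "T p l x = wirt s (p m0) (wirt s (p l) (X l)) x * (\<Prod>m\<in>?I - {l}. wirt s (p m) (X m) x)" for p l x
 have w1: "Ck 1 (wirt s j (X m))" for j m using Ck_wirt[OF X2] by simp
 have wd: "wirt s j (X m) differentiable at x" for j m x using w1[of j m] by simp
 have R1: "Ck 1 (R p)" for p unfolding R_def by (intro Ck_prod w1)
 have X1: "Ck 1 (X m)" for m using Ck_le[of 1 2 "X m"] X by simp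
 have Rd: "R p differentiable at x" for p x using R1[of p] by simp
 have Xd: "X m differentiable at x" for m x using X1[of m] by simp
 have wc: "continuous_on UNIV (wirt s j (X m))" for j m using w1 by (rule Ck_continuous)
 have wR: "wirt s (p m0) (R p) x = (\<Sum>l\<in>?I. T p l x)" for p x
  unfolding R_def T_def by (subst wirt_prod) (use wd in auto)
 have cTT: "continuous_on UNIV (%x. T p l x)" for p l
 proof -
  have "Ck (Suc 0) (wirt s j (X m))" for j m using w1 by simp
  hence "continuous_on UNIV (wirt s i (wirt s j (X m)))" for i j m using Ck_continuous[OF Ck_wirt] by blast
  thus ?thesis unfolding T_def by (intro continuous_on_mult continuous_on_prod wc)
 qed
 have wRc: "continuous_on UNIV (wirt s (p m0) (R p))" for p
  unfolding wR by (intro continuous_intros cTT)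
 have step: "(LBINT x. wirt s (p m0) (X m0) x * R p x) = - (LBINT x. X m0 x * wirt s (p m0) (R p) x)" for p
 proof -
  have "(LBINT x. wirt s (p m0) (%x. X m0 x * R p x) x) = 0"
   by (rule integral_wirt_zero[OF _ K(1)]) (use X1 R1 K(2) in \<open>auto intro: Ck_mult simp del: Ck.simps\<close>)
  hence "(LBINT x. X m0 x * wirt s (p m0) (R p) x + wirt s (p m0) (X m0) x * R p x) = 0"
   by (simp add: wirt_mult[OF Xd Rd])
  moreover have "integrable lborel (%x. X m0 x * wirt s (p m0) (R p) x)"
   by (rule compact_support_integrable[OF _ K(1)])
     (use K(2) wRc Ck_continuous[OF X1] in \<open>auto intro!: continuous_intros\<close>)
  moreover have "integrable lborel (%x. wirt s (p m0) (X m0) x * R p x)"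
   by (rule compact_support_integrable[OF _ K(1)])
     (use wirt_zero_outside[OF cl K(2)] wc Ck_continuous[OF R1] in \<open>auto intro!: continuous_intros\<close>)
  ultimately show ?thesis by (simp add: eq_neg_iff_add_eq_0 add.commute)
 qed
 have iw: "integrable lborel (%x. wirt s (p m0) (X m0) x * R p x)" for p
  by (rule compact_support_integrable[OF _ K(1)])
    (use wirt_zero_outside[OF cl K(2)] wc Ck_continuous[OF R1] in \<open>auto intro!: continuous_intros\<close>)
 have iT: "integrable lborel (%x. X m0 x * T p l x)" for p l
  by (rule compact_support_integrable[OF _ K(1)])
    (use K(2) cTT Ck_continuous[OF X1] in \<open>auto intro!: continuous_intros\<close>)
 \<comment> \<open>Composing p with the transposition of m0 and l leaves \<open>T p l\<close>
   unchanged, because Wirtinger derivatives commute, but reverses the sign of the permutation, so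
   the sum equals its negative.\<close>
 have zero: "(\<Sum>p\<in>?P. of_int (sign p) * T p l x) = 0" if l: "l \<in> ?I" for l x
 proof -
  let ?\<tau> = "Transposition.transpose m0 l"
  have tp: "?\<tau> permutes UNIV" by (rule permutes_swap_id) auto
  have sg: "sign ?\<tau> = -1" using l by (simp add: sign_swap_id)
  have Teq: "T (p \<circ> ?\<tau>) l x = T p l x" for p
  proof -
   have "(\<Prod>m\<in>?I - {l}. wirt s (p (?\<tau> m)) (X m) x) = (\<Prod>m\<in>?I - {l}. wirt s (p m) (X m) x)"
    by (rule prod.cong) auto
   thus ?thesis unfolding T_def o_def using wirt_commute[OF X] by simp
  qed
  have "(\<Sum>p\<in>?P. of_int (sign p) * T p l x) = (\<Sum>p\<in>?P. of_int (sign (p \<circ> ?\<tau>)) * T (p \<circ> ?\<tau>) l x)"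
   by (rule sum_permutations_compose_right[OF tp])
  also have "... = (\<Sum>p\<in>?P. - (of_int (sign p) * T p l x))"
  proof (rule sum.cong)
   fix p assume "p \<in> ?P"
   hence "sign (p \<circ> ?\<tau>) = - sign p"
    using sign_compose[of p ?\<tau>] tp sg by (auto simp: permutation_permutes)
   thus "of_int (sign (p \<circ> ?\<tau>)) * T (p \<circ> ?\<tau>) l x = - (of_int (sign p) * T p l x)" by (simp add: Teq)
  qed simp
  finally show ?thesis by (simp add: sum_negf)
 qed
 have "(LBINT x. det (\<chi> m j. wirt s j (X m) x))
   = (LBINT x. (\<Sum>p\<in>?P. of_int (sign p) * (wirt s (p m0) (X m0) x * R p x)))"
  unfolding det_def R_def by (simp add: prod.remove[of UNIV m0])
 also have "... = (\<Sum>p\<in>?P. of_int (sign p) * (LBINT x. wirt s (p m0) (X m0) x * R p x))"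
  using iw by (simp add: integral_sum)
 also have "... = (\<Sum>p\<in>?P. of_int (sign p) * - (\<Sum>l\<in>?I. (LBINT x. X m0 x * T p l x)))"
  unfolding step wR sum_distrib_left using iT by (simp add: integral_sum)
 also have "... = - (\<Sum>l\<in>?I. (LBINT x. X m0 x * (\<Sum>p\<in>?P. of_int (sign p) * T p l x)))"
 proof -
  have "(LBINT x. X m0 x * (\<Sum>p\<in>?P. of_int (sign p) * T p l x)) = (\<Sum>p\<in>?P. of_int (sign p) * (LBINT x. X m0 x * T p l x))" for l
  proof -
   have "(LBINT x. X m0 x * (\<Sum>p\<in>?P. of_int (sign p) * T p l x)) = (LBINT x. (\<Sum>p\<in>?P. of_int (sign p) * (X m0 x * T p l x)))"
    by (simp add: sum_distrib_left mult.left_commute)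
   thus ?thesis using iT by (simp add: integral_sum)
  qed
  thus ?thesis by (simp add: sum_distrib_left sum_negf sum.swap[of _ ?I])
 qed
 also have "... = 0" using zero by simp
 finally show ?thesis .
qed

section \<open>Complex Hessians and the variation of the Monge-Ampere integral\<close>

text \<open>Both orders of differentiation are recorded: the integration by parts reads the rows of
  the Hessian as z-bar-derivatives and the rows of its transpose as z-derivatives.\<close>

lemma cHess_wirt:
 assumes u: "Ck 2 u"
 shows "cHess u x $ j $ k = wirt \<i> k (wirt (- \<i>) j (%x. complex_of_real (u x))) x"
  and "cHess u x $ j $ k = wirt (- \<i>) j (wirt \<i> k (%x. complex_of_real (u x))) x"
proof -
 have u2: "Ck (Suc (Suc 0)) u" using u by (simp add: numeral_2_eq_2)
 have 1: "fd (%x. complex_of_real (u x)) a = (%x. complex_of_real (fd u a x))" for a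
  using u2 by (auto simp: fd_bounded_linear[OF bounded_linear_of_real])
 have 2: "fd (wirt r k (%x. complex_of_real (u x))) a x
   = (complex_of_real (hess u x (axis k 1) a) + r * complex_of_real (hess u x (axis k \<i>) a)) / 2" for r k a
 proof -
  have d: "fd u b differentiable at x" for b using u2 by simp
  show ?thesis unfolding wirt_def[abs_def] 1 hess_fd
   by (rule fd_eqI) (auto intro!: derivative_eq_intros differentiable_fd[OF d])
 qed
 show *: "cHess u x $ j $ k = wirt \<i> k (wirt (- \<i>) j (%x. complex_of_real (u x))) x"
  unfolding wirt_def[of \<i> k] 2 by (simp add: cHess_def field_simps)
 show "cHess u x $ j $ k = wirt (- \<i>) j (wirt \<i> k (%x. complex_of_real (u x))) x"
  unfolding * by (rule wirt_commute) (rule Ck_of_real[OF u])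
qed

lemma continuous_cHess: "Ck 2 u ==> continuous_on S (%x. cHess u x $ i $ j)"
 unfolding cHess_def by (simp add: Ck_2_hess_continuous continuous_intros)

lemma cHess_hermitian: "Ck 2 u ==> hermitian (cHess u x)"
proof -
 assume u: "Ck 2 u"
 have sym: "hess u x a b = hess u x b a" for a b unfolding hess_fd by (rule fd_symmetric[OF u])
 have "cHess u x $ k $ j = cnj (cHess u x $ j $ k)" for j k
  using sym[of "axis k 1" "axis j 1"] sym[of "axis k \<i>" "axis j \<i>"] sym[of "axis k 1" "axis j \<i>"] sym[of "axis k \<i>" "axis j 1"]
  by (simp add: cHess_def complex_eq_iff)
 thus ?thesis unfolding hermitian_def by blast
qed

lemma cHess_add_scaled:
 assumes "Ck 2 u" "Ck 2 v"
 shows "cHess (%x. u x + t * v x) x = cHess u x + t *\<^sub>R cHess v x"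
proof -
 have u2: "Ck (Suc (Suc 0)) u" "Ck (Suc (Suc 0)) v" using assms by (simp_all add: numeral_2_eq_2)
 have 1: "fd (%x. u x + t * v x) a = (%x. fd u a x + t * fd v a x)" for a
  by (rule ext, rule fd_eqI) (auto intro!: derivative_eq_intros Ck_derivative[OF u2(1)] Ck_derivative[OF u2(2)])
 have "hess (%x. u x + t * v x) x a b = hess u x a b + t * hess v x a b" for a b
  unfolding hess_fd 1
  by (rule fd_eqI) (auto intro!: derivative_eq_intros Ck_derivative[OF Ck_fd[OF u2(1)]] Ck_derivative[OF Ck_fd[OF u2(2)]])
 thus ?thesis by (simp add: cHess_def vec_eq_iff scaleR_conv_of_real[where 'a=complex] algebra_simps)
qed

lemma cHess_cong_open:
 assumes "open U" "x \<in> U" "!!y. y \<in> U ==> f y = g y"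
 shows "cHess f x = cHess g x"
proof -
 have "hess f x a b = hess g x a b" for a b by (rule hess_cong_open[OF assms])
 thus ?thesis by (simp add: cHess_def)
qed

lemma cHess_zero_outside:
 assumes "closed K" "!!x. x \<notin> K ==> f x = 0" "x \<notin> K"
 shows "cHess f x = 0"
proof -
 have z: "fd (%_. 0::real) a = (%_. 0)" for a :: "complex^'n" by (rule ext, rule fd_eqI) simp
 have "cHess f x = cHess (%_. 0) x"
  by (rule cHess_cong_open[of "- K"]) (use assms in auto)
 also have "... = 0" by (simp add: cHess_def hess_fd z vec_eq_iff)
 finally show ?thesis .
qed

text \<open>The matrix with entries d h / d z_i times d w / d z-bar_k: the gradient term left by one
  integration by parts.\<close>

definition grad_tensor :: "(complex^'n => real) => (complex^'n => real) => complex^'n => complex^'n^'n" where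
 "grad_tensor h w x = (\<chi> i k. wirt (- \<i>) i (%x. complex_of_real (h x)) x * wirt \<i> k (%x. complex_of_real (w x)) x)"

lemma continuous_ddet:
 assumes "!!i j. continuous_on S (%x. P x $ i $ j)" "!!i j. continuous_on S (%x. Q x $ i $ j)"
 shows "continuous_on S (%x. ddet (P x) (Q x))"
 unfolding ddet_def
 by (intro continuous_on_sum continuous_det_row assms)

text \<open>The integrals of w dd^c h and of h dd^c w against the power of dd^c v equal the same
  gradient integral; together they move dd^c from h to w. Each is the vanishing of the integral of a
  determinant of derivatives, one row of which comes from the product of one function with a first
  derivative of the other.\<close>

lemma integral_ddet_by_parts:
 fixes v h w :: "complex^'n => real"
 assumes v: "Ck 3 v" and h: "Ck 3 h" and c: "Ck 3 w" and K: "compact K" "!!x. x \<notin> K ==> h x = 0"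
 shows "(LBINT x. w x * ddet (cHess v x) (cHess h x)) = - (LBINT x. ddet (cHess v x) (grad_tensor h w x))"
  and "(LBINT x. h x * ddet (cHess v x) (cHess w x)) = - (LBINT x. ddet (cHess v x) (grad_tensor h w x))"
proof -
 have C2: "Ck 2 v" "Ck 2 h" "Ck 2 w" using v h c by (auto intro: Ck_le[of 2 3])
 define V H C where "V = (%x. complex_of_real (v x))" and "H = (%x. complex_of_real (h x))" and "C = (%x. complex_of_real (w x))"
 have c3: "Ck (Suc 2) V" "Ck (Suc 2) H" "Ck (Suc 2) C"
  unfolding V_def H_def C_def using Ck_of_real[OF v] Ck_of_real[OF h] Ck_of_real[OF c] by simp_all
 have c2: "Ck 2 V" "Ck 2 H" "Ck 2 C" using c3 Ck_Suc_imp by blast+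
 have w2: "Ck 2 (wirt s j V)" "Ck 2 (wirt s j H)" "Ck 2 (wirt s j C)" for s j using c3 Ck_wirt by blast+
 have df: "F differentiable at x" if "Ck 2 F" for F :: "complex^'n => complex" and x
  using that by (simp add: numeral_2_eq_2)
 have cl: "closed K" using K(1) by (rule compact_imp_closed)
 have Hz: "H x = 0" "wirt s j H x = 0" if "x \<notin> K" for x s j
  using wirt_zero_outside[OF cl, of H x] K(2) that by (auto simp: H_def)
 have cw: "continuous_on UNIV (wirt s j (wirt r k F))" if "Ck 2 F" for s j r k and F :: "complex^'n => complex"
  using that Ck_wirt[OF Ck_wirt[of "Suc 0" F]] by (simp add: numeral_2_eq_2 del: Ck.simps(2))
 have cw1: "continuous_on UNIV (wirt s j F)" if "Ck 2 F" for s j and F :: "complex^'n => complex"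
  using Ck_continuous[OF Ck_wirt[of "Suc 0" F]] that by (simp add: numeral_2_eq_2 del: Ck.simps(2))
 have cc: "continuous_on UNIV F" if "Ck 2 F" for F :: "complex^'n => complex" using Ck_continuous[OF that] .
 have v1: "cHess v x $ m $ j = wirt \<i> j (wirt (- \<i>) m V) x" "cHess v x $ m $ j = wirt (- \<i>) m (wirt \<i> j V) x" for x m j
  unfolding V_def using cHess_wirt[OF C2(1)] by auto
 have h1: "cHess h x $ m $ j = wirt \<i> j (wirt (- \<i>) m H) x" for x m j
  unfolding H_def using cHess_wirt[OF C2(2)] by auto
 have x1: "cHess w x $ m $ j = wirt (- \<i>) m (wirt \<i> j C) x" for x m j
  unfolding C_def using cHess_wirt[OF C2(3)] by auto
 have det_split: "det (\<chi> m. if m = i then (\<chi> j. a * f j + g j * b) else R m)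
   = a * det (\<chi> m. if m = i then (\<chi> j. f j) else R m) + b * det (\<chi> m. if m = i then (\<chi> j. g j) else R m)"
  for i a b and f g :: "'n => complex" and R :: "'n => complex^'n"
 proof -
  have e: "(\<chi> j. a * f j + g j * b) = a *s (\<chi> j. f j) + b *s (\<chi> j. g j)" by (simp add: vec_eq_iff)
  show ?thesis unfolding e by (simp add: det_row_add det_row_mul)
 qed
 have one: "(LBINT x. C x * det (\<chi> m. if m = i then cHess h x $ m else cHess v x $ m))
   = - (LBINT x. det (\<chi> m. if m = i then grad_tensor h w x $ m else cHess v x $ m))" (is "?A i = - ?B i") for i
 proof -
  \<comment> \<open>By the product rule, row i of the determinant splits into w times row i of the
    Hessian of h and row i of the gradient tensor.\<close>
  define X where "X m = (if m = i then (%x. C x * wirt (- \<i>) i H x) else wirt (- \<i>) m V)" for m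
  have "(LBINT x. det (\<chi> m j. wirt \<i> j (X m) x)) = 0"
  proof (rule integral_det_wirt_zero[OF _ K(1), of X i])
   show "Ck 2 (X m)" for m unfolding X_def using w2 c2 by (auto intro: Ck_mult)
  qed (auto simp: X_def Hz)
  moreover have "det (\<chi> m j. wirt \<i> j (X m) x)
    = C x * det (\<chi> m. if m = i then cHess h x $ m else cHess v x $ m)
     + det (\<chi> m. if m = i then grad_tensor h w x $ m else cHess v x $ m)" for x
  proof -
   have "(\<chi> m j. wirt \<i> j (X m) x) = (\<chi> m. if m = i then (\<chi> j. C x * wirt \<i> j (wirt (- \<i>) i H) x + wirt \<i> j C x * wirt (- \<i>) i H x) else cHess v x $ m)"
    by (auto simp: vec_eq_iff X_def v1(1) wirt_mult[OF df[OF c2(3)] df[OF w2(2)]])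
   hence "det (\<chi> m j. wirt \<i> j (X m) x) = C x * det (\<chi> m. if m = i then (\<chi> j. wirt \<i> j (wirt (- \<i>) i H) x) else cHess v x $ m)
    + wirt (- \<i>) i H x * det (\<chi> m. if m = i then (\<chi> j. wirt \<i> j C x) else cHess v x $ m)"
    by (simp only: det_split)
   also have "wirt (- \<i>) i H x * det (\<chi> m. if m = i then (\<chi> j. wirt \<i> j C x) else cHess v x $ m)
    = det (\<chi> m. if m = i then wirt (- \<i>) i H x *s (\<chi> j. wirt \<i> j C x) else cHess v x $ m)"
    by (rule det_row_mul[symmetric])
   also have "(\<chi> m. if m = i then wirt (- \<i>) i H x *s (\<chi> j. wirt \<i> j C x) else cHess v x $ m) = (\<chi> m. if m = i then grad_tensor h w x $ m else cHess v x $ m)"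
    by (auto simp: vec_eq_iff grad_tensor_def H_def C_def)
   also have "(\<chi> m. if m = i then (\<chi> j. wirt \<i> j (wirt (- \<i>) i H) x) else cHess v x $ m) = (\<chi> m. if m = i then cHess h x $ m else cHess v x $ m)"
    by (auto simp: vec_eq_iff h1)
   finally show ?thesis .
  qed
  moreover have "integrable lborel (%x. C x * det (\<chi> m. if m = i then cHess h x $ m else cHess v x $ m))"
  proof (rule compact_support_integrable[OF _ K(1)])
   show "continuous_on UNIV (%x. C x * det (\<chi> m. if m = i then cHess h x $ m else cHess v x $ m))"
    by (intro continuous_on_mult cc[OF c2(3)] continuous_det_row continuous_cHess C2)
   show "C x * det (\<chi> m. if m = i then cHess h x $ m else cHess v x $ m) = 0" if "x \<notin> K" for x
    using cHess_zero_outside[OF cl, of h x] K(2) that by (subst det_zero_row_entries[of _ i]) auto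
  qed
  moreover have "integrable lborel (%x. det (\<chi> m. if m = i then grad_tensor h w x $ m else cHess v x $ m))"
  proof (rule compact_support_integrable[OF _ K(1)])
   have "continuous_on UNIV (%x. grad_tensor h w x $ i $ j)" for i j
    unfolding grad_tensor_def H_def[symmetric] C_def[symmetric] by (simp add: continuous_intros cw1 c2)
   thus "continuous_on UNIV (%x. det (\<chi> m. if m = i then grad_tensor h w x $ m else cHess v x $ m))"
    by (intro continuous_det_row continuous_cHess C2)
   show "det (\<chi> m. if m = i then grad_tensor h w x $ m else cHess v x $ m) = 0" if "x \<notin> K" for x
    using Hz(2)[OF that] by (intro det_zero_row_entries[of _ i]) (auto simp: grad_tensor_def H_def)
  qed
  ultimately show ?thesis by (simp add: eq_neg_iff_add_eq_0)
 qed
 have "integrable lborel (%x. det (\<chi> m. if m = i then grad_tensor h w x $ m else cHess v x $ m))" for i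
 proof (rule compact_support_integrable[OF _ K(1)])
  have "continuous_on UNIV (%x. grad_tensor h w x $ i $ j)" for i j
   unfolding grad_tensor_def H_def[symmetric] C_def[symmetric] by (simp add: continuous_intros cw1 c2)
  thus "continuous_on UNIV (%x. det (\<chi> m. if m = i then grad_tensor h w x $ m else cHess v x $ m))"
   by (intro continuous_det_row continuous_cHess C2)
  show "det (\<chi> m. if m = i then grad_tensor h w x $ m else cHess v x $ m) = 0" if "x \<notin> K" for x
   using Hz(2)[OF that] by (intro det_zero_row_entries[of _ i]) (auto simp: grad_tensor_def H_def)
 qed
 moreover have "integrable lborel (%x. C x * det (\<chi> m. if m = i then cHess h x $ m else cHess v x $ m))" for i
 proof (rule compact_support_integrable[OF _ K(1)])
  show "continuous_on UNIV (%x. C x * det (\<chi> m. if m = i then cHess h x $ m else cHess v x $ m))"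
   by (intro continuous_on_mult cc[OF c2(3)] continuous_det_row continuous_cHess C2)
  show "C x * det (\<chi> m. if m = i then cHess h x $ m else cHess v x $ m) = 0" if "x \<notin> K" for x
   using cHess_zero_outside[OF cl, of h x] K(2) that by (subst det_zero_row_entries[of _ i]) auto
 qed
 ultimately show "(LBINT x. w x * ddet (cHess v x) (cHess h x)) = - (LBINT x. ddet (cHess v x) (grad_tensor h w x))"
  unfolding ddet_def using one unfolding C_def by (simp add: sum_distrib_left integral_sum sum_negf)
 have two: "(LBINT x. H x * det (\<chi> m. if m = i then transpose (cHess w x) $ m else transpose (cHess v x) $ m))
   = - (LBINT x. det (\<chi> m. if m = i then transpose (grad_tensor h w x) $ m else transpose (cHess v x) $ m))
   \<and> integrable lborel (%x. H x * det (\<chi> m. if m = i then transpose (cHess w x) $ m else transpose (cHess v x) $ m))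
   \<and> integrable lborel (%x. det (\<chi> m. if m = i then transpose (grad_tensor h w x) $ m else transpose (cHess v x) $ m))" for i
 proof -
  \<comment> \<open>The same with the roles of h and w, and of rows and columns, exchanged: now h
    stays undifferentiated in the first term and carries the compact support.\<close>
  define X where "X m = (if m = i then (%x. H x * wirt \<i> i C x) else wirt \<i> m V)" for m
  have "(LBINT x. det (\<chi> m j. wirt (- \<i>) j (X m) x)) = 0"
  proof (rule integral_det_wirt_zero[OF _ K(1), of X i])
   show "Ck 2 (X m)" for m unfolding X_def using w2 c2 by (auto intro: Ck_mult)
  qed (auto simp: X_def Hz)
  moreover have "det (\<chi> m j. wirt (- \<i>) j (X m) x)
    = H x * det (\<chi> m. if m = i then transpose (cHess w x) $ m else transpose (cHess v x) $ m)
     + det (\<chi> m. if m = i then transpose (grad_tensor h w x) $ m else transpose (cHess v x) $ m)" for x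
  proof -
   have "(\<chi> m j. wirt (- \<i>) j (X m) x) = (\<chi> m. if m = i then (\<chi> j. H x * wirt (- \<i>) j (wirt \<i> i C) x + wirt (- \<i>) j H x * wirt \<i> i C x) else transpose (cHess v x) $ m)"
    by (auto simp: vec_eq_iff X_def transpose_def v1(2) wirt_mult[OF df[OF c2(2)] df[OF w2(3)]])
   hence "det (\<chi> m j. wirt (- \<i>) j (X m) x) = H x * det (\<chi> m. if m = i then (\<chi> j. wirt (- \<i>) j (wirt \<i> i C) x) else transpose (cHess v x) $ m)
    + wirt \<i> i C x * det (\<chi> m. if m = i then (\<chi> j. wirt (- \<i>) j H x) else transpose (cHess v x) $ m)"
    by (simp only: det_split)
   also have "wirt \<i> i C x * det (\<chi> m. if m = i then (\<chi> j. wirt (- \<i>) j H x) else transpose (cHess v x) $ m)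
    = det (\<chi> m. if m = i then wirt \<i> i C x *s (\<chi> j. wirt (- \<i>) j H x) else transpose (cHess v x) $ m)"
    by (rule det_row_mul[symmetric])
   also have "(\<chi> m. if m = i then wirt \<i> i C x *s (\<chi> j. wirt (- \<i>) j H x) else transpose (cHess v x) $ m) = (\<chi> m. if m = i then transpose (grad_tensor h w x) $ m else transpose (cHess v x) $ m)"
    by (auto simp: vec_eq_iff grad_tensor_def H_def C_def transpose_def)
   also have "(\<chi> m. if m = i then (\<chi> j. wirt (- \<i>) j (wirt \<i> i C) x) else transpose (cHess v x) $ m) = (\<chi> m. if m = i then transpose (cHess w x) $ m else transpose (cHess v x) $ m)"
    by (auto simp: vec_eq_iff x1 transpose_def)
   finally show ?thesis .
  qed
  moreover have i1: "integrable lborel (%x. H x * det (\<chi> m. if m = i then transpose (cHess w x) $ m else transpose (cHess v x) $ m))"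
  proof (rule compact_support_integrable[OF _ K(1)])
   show "continuous_on UNIV (%x. H x * det (\<chi> m. if m = i then transpose (cHess w x) $ m else transpose (cHess v x) $ m))"
    by (intro continuous_on_mult cc[OF c2(2)] continuous_det_row) (simp_all add: continuous_cHess C2 transpose_def)
  qed (simp add: Hz)
  moreover have i2: "integrable lborel (%x. det (\<chi> m. if m = i then transpose (grad_tensor h w x) $ m else transpose (cHess v x) $ m))"
  proof (rule compact_support_integrable[OF _ K(1)])
   have "continuous_on UNIV (%x. grad_tensor h w x $ i $ j)" for i j
    unfolding grad_tensor_def H_def[symmetric] C_def[symmetric] by (simp add: continuous_intros cw1 c2)
   thus "continuous_on UNIV (%x. det (\<chi> m. if m = i then transpose (grad_tensor h w x) $ m else transpose (cHess v x) $ m))"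
    by (intro continuous_det_row) (simp_all add: continuous_cHess C2 transpose_def)
   show "det (\<chi> m. if m = i then transpose (grad_tensor h w x) $ m else transpose (cHess v x) $ m) = 0" if "x \<notin> K" for x
    using Hz(2)[OF that] by (intro det_zero_row_entries[of _ i]) (auto simp: grad_tensor_def H_def transpose_def)
  qed
  ultimately show ?thesis by (simp add: eq_neg_iff_add_eq_0)
 qed
 show "(LBINT x. h x * ddet (cHess v x) (cHess w x)) = - (LBINT x. ddet (cHess v x) (grad_tensor h w x))"
  unfolding ddet_transpose[of "cHess v _", symmetric] unfolding ddet_def
  using two unfolding H_def by (simp add: sum_distrib_left integral_sum sum_negf)
qed

text \<open>The difference of determinants is the integral over t in [0, 1] of the linearised
  determinant along the segment; once the integrals are exchanged, the sign of each slice
  decides.\<close>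

lemma det_variation_integral:
 fixes v h w :: "complex^'n => real"
 assumes v: "Ck 2 v" and h: "Ck 2 h" and w: "continuous_on UNIV w"
  and K: "compact K" "!!x. x \<notin> K ==> h x = 0"
  and le: "!!t. 0 <= t ==> t <= 1 ==> Re (LBINT x. w x * ddet (cHess v x + t *\<^sub>R cHess h x) (cHess h x)) <= 0"
 shows "Re (LBINT x. w x * (det (cHess v x + cHess h x) - det (cHess v x))) <= 0"
proof -
 define \<Psi> where "\<Psi> t x = complex_of_real (w x) * ddet (cHess v x + t *\<^sub>R cHess h x) (cHess h x)" for t x
 have cl: "closed K" using K(1) by (rule compact_imp_closed)
 have hz: "cHess h x = 0" if "x \<notin> K" for x using cHess_zero_outside[OF cl K(2) that] by simp
 have d0: "ddet P 0 = 0" for P :: "complex^'n^'n"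
  unfolding ddet_def by (rule sum.neutral) (auto intro!: det_zero_row_entries)
 have ct: "continuous_on S (%p. \<Psi> (fst p) (snd p))" for S
  unfolding \<Psi>_def
 proof (intro continuous_on_mult continuous_ddet continuous_on_of_real)
  have c: "continuous_on S (%p. cHess v (snd p) $ i $ j)" "continuous_on S (%p. cHess h (snd p) $ i $ j)" for S :: "(real \<times> (complex^'n)) set" and i j
   using continuous_on_compose2[OF continuous_cHess[OF v, of UNIV], of S snd]
    continuous_on_compose2[OF continuous_cHess[OF h, of UNIV], of S snd] continuous_on_snd[OF continuous_on_id, of S]
   by (auto simp: id_def)
  show "continuous_on S (%p. w (snd p))"
   using continuous_on_compose2[OF w, of S snd] continuous_on_snd[OF continuous_on_id, of S] by (auto simp: id_def)
  show "continuous_on S (%p. (cHess v (snd p) + fst p *\<^sub>R cHess h (snd p)) $ i $ j)" for i j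
   by (simp add: continuous_intros c)
  show "continuous_on S (%p. cHess h (snd p) $ i $ j)" for i j by (rule c)
 qed
 define f where "f = (%p. indicator ({0..1} \<times> K) p *\<^sub>R \<Psi> (fst p) (snd p))"
 have fi: "integrable (lborel \<Otimes>\<^sub>M lborel) f"
  unfolding lborel_prod f_def
  by (intro borel_integrable_compact compact_Times K ct) auto
 have inner: "(LBINT t. f (t, x)) = w x * (det (cHess v x + cHess h x) - det (cHess v x))" for x
 proof (cases "x \<in> K")
  case False
  thus ?thesis by (simp add: f_def hz)
 next
  case True
  have "has_bochner_integral lborel (%t. indicator {0..1} t *\<^sub>R \<Psi> t x)
    (w x * det (cHess v x + 1 *\<^sub>R cHess h x) - w x * det (cHess v x + 0 *\<^sub>R cHess h x))"
  proof (rule has_bochner_integral_FTC_Icc)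
   show "((%t. complex_of_real (w x) * det (cHess v x + t *\<^sub>R cHess h x)) has_vector_derivative \<Psi> t x) (at t within {0..1})" for t
    unfolding \<Psi>_def by (intro has_vector_derivative_mult_right has_field_derivative_det)
   show "continuous_on {0..1} (%t. \<Psi> t x)"
    using continuous_on_compose2[OF ct[of UNIV], of "{0..1}" "%t. (t, x)"] by (simp add: continuous_intros)
  qed simp
  thus ?thesis using True
   by (auto simp: f_def indicator_times has_bochner_integral_iff algebra_simps)
 qed
 have outer: "(LBINT x. f (t, x)) = indicator {0..1} t *\<^sub>R (LBINT x. \<Psi> t x)" for t
 proof -
  have "f (t, x) = indicator {0..1} t *\<^sub>R \<Psi> t x" for x
   using hz[of x] by (cases "x \<in> K") (auto simp: f_def indicator_times \<Psi>_def d0)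
  thus ?thesis by simp
 qed
 have "(LBINT x. (LBINT t. f (t, x))) = (LBINT t. (LBINT x. f (t, x)))"
  using lborel_pair.Fubini_integral[of "%t x. f (t, x)"] fi by simp
 hence eq: "(LBINT x. w x * (det (cHess v x + cHess h x) - det (cHess v x))) = (LBINT t. (LBINT x. f (t, x)))"
  by (simp add: inner)
 have "integrable lborel (%t. (LBINT x. f (t, x)))"
  using lborel_pair.integrable_fst'[OF fi] by simp
 hence "Re (LBINT t. (LBINT x. f (t, x))) = (LBINT t. Re (LBINT x. f (t, x)))"
  by (rule integral_Re[symmetric])
 also have "... <= 0"
 proof -
  have "(LBINT t. Re (LBINT x. f (t, x))) <= (\<integral>t. 0 \<partial>(lborel :: real measure))"
   by (rule integral_mono_AE')
     (use le in \<open>auto simp: outer \<Psi>_def indicator_def\<close>)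
  thus ?thesis by simp
 qed
 finally show ?thesis unfolding eq .
qed

text \<open>With equal arguments the tensor has rank one: a column vector times its conjugate
  transpose.\<close>

lemma grad_tensor_self_psd:
 assumes "Ck 1 h" shows "hpsd (grad_tensor h h x)"
proof -
 have d: "h differentiable at x" using assms by simp
 have w: "wirt s i (%x. complex_of_real (h x)) x = (complex_of_real (fd h (axis i 1) x) + s * complex_of_real (fd h (axis i \<i>) x)) / 2" for s i
  unfolding wirt_def using d by (simp add: fd_bounded_linear[OF bounded_linear_of_real])
 define a where "a i = wirt (- \<i>) i (%x. complex_of_real (h x)) x" for i
 have c: "wirt \<i> i (%x. complex_of_real (h x)) x = cnj (a i)" for i unfolding a_def w by simp
 have g: "grad_tensor h h x $ i $ k = a i * cnj (a k)" for i k by (simp add: grad_tensor_def c a_def[symmetric])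
 have "hsesq (grad_tensor h h x) z z = (\<Sum>i\<in>UNIV. a i * z $ i) * cnj (\<Sum>i\<in>UNIV. a i * z $ i)" for z
  unfolding hsesq_def g by (simp add: sum_product mult.commute mult.left_commute)
 hence "hform (grad_tensor h h x) z = (cmod (\<Sum>i\<in>UNIV. a i * z $ i))\<^sup>2" for z
  unfolding hform_def complex_norm_square[symmetric] by simp
 moreover have "hermitian (grad_tensor h h x)" unfolding hermitian_def by (simp add: g mult.commute)
 ultimately show ?thesis by (simp add: hpsd_def)
qed

lemma MA_density_difference_integral:
 fixes v h w :: "complex^'n => real"
 assumes v: "Ck 2 v" and h: "Ck 2 h" and w: "continuous_on UNIV w"
  and K: "compact K" "!!x. x \<notin> K ==> h x = 0"
 shows "(LBINT x. w x * (MA_density (%x. v x + h x) x - MA_density v x))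
   = 4 ^ CARD('n) * fact CARD('n) * Re (LBINT x. w x * (det (cHess v x + cHess h x) - det (cHess v x)))"
proof -
 have cl: "closed K" using K(1) by (rule compact_imp_closed)
 have hz: "cHess h x = 0" if "x \<notin> K" for x using cHess_zero_outside[OF cl K(2) that] by simp
 have "integrable lborel (%x. complex_of_real (w x) * (det (cHess v x + cHess h x) - det (cHess v x)))"
  by (rule compact_support_integrable[OF _ K(1)])
    (auto intro!: continuous_on_mult continuous_on_of_real w continuous_on_diff continuous_det continuous_on_add
     simp: continuous_cHess v h hz)
 hence R: "Re (LBINT x. w x * (det (cHess v x + cHess h x) - det (cHess v x)))
   = (LBINT x. w x * (Re (det (cHess v x + cHess h x)) - Re (det (cHess v x))))"
  by (subst integral_Re[symmetric]) auto
 have "cHess (%x. v x + h x) x = cHess v x + cHess h x" for x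
  using cHess_add_scaled[OF v h, of 1 x] by simp
 hence "w x * (MA_density (%x. v x + h x) x - MA_density v x)
   = 4 ^ CARD('n) * fact CARD('n) * (w x * (Re (det (cHess v x + cHess h x)) - Re (det (cHess v x))))" for x
  by (simp add: MA_density_def algebra_simps)
 thus ?thesis
  unfolding R by (simp only: integral_mult_right_zero)
qed

lemma ddet_segment:
 fixes v h :: "complex^'n => real"
 assumes "Ck 3 v" "Ck 3 h"
 shows "Ck 3 (%x. v x + t * h x)" "cHess v x + t *\<^sub>R cHess h x = cHess (%x. v x + t * h x) x"
 using assms cHess_add_scaled[of v h t x] Ck_le[of 2 3 v] Ck_le[of 2 3 h] by (auto intro!: Ck_add Ck_mult simp del: Ck.simps)

lemma hpsd_segment:
 assumes "hpsd P" "hpsd (P + Q)" "0 <= t" "t <= 1"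
 shows "hpsd (P + t *\<^sub>R Q)"
proof -
 have e: "P + t *\<^sub>R Q = (1 - t) *\<^sub>R P + t *\<^sub>R (P + Q)" by (simp add: algebra_simps)
 show ?thesis unfolding e hpsd_def using assms
  by (auto simp: hpsd_def hform_add hform_scaleR intro!: hermitian_add hermitian_scaleR)
qed

text \<open>Along the segment from b to a, the slice integral of w against dd^c (a - b) is that of a
  - b against dd^c w, and a - b \<le> 0 meets a non-negative linearised determinant. Positivity is
  asked for on K only, as a - b vanishes elsewhere.\<close>

theorem MA_integral_antimono:
 fixes a b w :: "complex^'n => real"
 assumes a: "Ck 3 a" and b: "Ck 3 b" and w: "Ck 3 w"
  and K: "compact K" "!!x. x \<notin> K ==> a x = b x" and le: "!!x. a x <= b x"
  and psd: "!!x. x \<in> K ==> hpsd (cHess a x)" "!!x. x \<in> K ==> hpsd (cHess b x)" "!!x. x \<in> K ==> hpsd (cHess w x)"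
 shows "(LBINT x. w x * (MA_density a x - MA_density b x)) <= 0"
proof -
 define h where "h x = a x - b x" for x
 have h: "Ck 3 h" unfolding h_def by (rule Ck_diff[OF a b])
 have h0: "!!x. x \<notin> K ==> h x = 0" using K(2) by (simp add: h_def)
 have C2: "Ck 2 b" "Ck 2 h" "Ck 2 w" using b h w by (auto intro: Ck_le[of 2 3])
 have ab: "a = (%x. b x + h x)" by (auto simp: h_def)
 have cab: "cHess a x = cHess b x + cHess h x" for x unfolding ab using cHess_add_scaled[OF C2(1,2), of 1 x] by simp
 have "Re (LBINT x. w x * (det (cHess b x + cHess h x) - det (cHess b x))) <= 0"
 proof (rule det_variation_integral[OF C2(1,2) Ck_continuous[OF w] K(1) h0])
  fix t :: real assume t: "0 <= t" "t <= 1"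
  let ?v = "%x. b x + t * h x"
  note seg = ddet_segment[OF b h, where t=t]
  have "(LBINT x. w x * ddet (cHess b x + t *\<^sub>R cHess h x) (cHess h x)) = (LBINT x. h x * ddet (cHess ?v x) (cHess w x))"
   unfolding seg(2) using integral_ddet_by_parts[OF seg(1) h w K(1) h0] by simp
  moreover have "Re (LBINT x. h x * ddet (cHess ?v x) (cHess w x)) = (LBINT x. h x * Re (ddet (cHess ?v x) (cHess w x)))"
  proof -
   have "integrable lborel (%x. complex_of_real (h x) * ddet (cHess ?v x) (cHess w x))"
    by (rule compact_support_integrable[OF _ K(1)])
      (use Ck_le[OF _ seg(1), of 2] in \<open>auto intro!: continuous_on_mult continuous_on_of_real Ck_continuous[OF h] continuous_ddet continuous_cHess C2 simp: h0\<close>)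
   thus ?thesis by (subst integral_Re[symmetric]) auto
  qed
  moreover have "(LBINT x. h x * Re (ddet (cHess ?v x) (cHess w x))) <= (\<integral>x. 0 \<partial>(lborel :: (complex^'n) measure))"
  proof (rule integral_mono_AE')
   show "AE x in lborel. h x * Re (ddet (cHess ?v x) (cHess w x)) <= 0"
   proof (intro always_eventually allI)
    fix x
    show "h x * Re (ddet (cHess ?v x) (cHess w x)) <= 0"
    proof (cases "x \<in> K")
     case True
     have "hpsd (cHess ?v x)" unfolding seg(2)[symmetric]
      using psd True cab t by (intro hpsd_segment) auto
     hence "0 <= Re (ddet (cHess ?v x) (cHess w x))" using psd(3)[OF True] by (rule ddet_nonneg)
     thus ?thesis using le[of x] by (simp add: h_def mult_nonpos_nonneg)
    qed (simp add: h0)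
   qed
  qed auto
  ultimately show "Re (LBINT x. w x * ddet (cHess b x + t *\<^sub>R cHess h x) (cHess h x)) <= 0" by simp
 qed
 thus ?thesis
  using MA_density_difference_integral[OF C2(1,2) Ck_continuous[OF w] K(1) h0]
  unfolding ab[symmetric] by (simp add: mult_nonneg_nonpos)
qed

text \<open>Here the weight is a - b itself, so one integration by parts turns each slice into minus
  the integral of the linearised determinant against a semidefinite rank-one tensor.\<close>

theorem MA_difference_integral_nonpos:
 fixes a b :: "complex^'n => real"
 assumes a: "Ck 3 a" and b: "Ck 3 b"
  and K: "compact K" "!!x. x \<notin> K ==> a x = b x"
  and psd: "!!x. x \<in> K ==> hpsd (cHess a x)" "!!x. x \<in> K ==> hpsd (cHess b x)"
 shows "(LBINT x. (a x - b x) * (MA_density a x - MA_density b x)) <= 0"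
proof -
 define h where "h x = a x - b x" for x
 have h: "Ck 3 h" unfolding h_def by (rule Ck_diff[OF a b])
 have h0: "!!x. x \<notin> K ==> h x = 0" using K(2) by (simp add: h_def)
 have C2: "Ck 2 b" "Ck 2 h" using b h by (auto intro: Ck_le[of 2 3])
 have cl: "closed K" using K(1) by (rule compact_imp_closed)
 have h1: "Ck 1 h" using Ck_le[OF _ h, of 1] by simp
 have ab: "a = (%x. b x + h x)" by (auto simp: h_def)
 have cab: "cHess a x = cHess b x + cHess h x" for x unfolding ab using cHess_add_scaled[OF C2(1,2), of 1 x] by simp
 have gz: "grad_tensor h h x = 0" if "x \<notin> K" for x
  using wirt_zero_outside[OF cl, of "%x. complex_of_real (h x)" x] h0 that by (simp add: grad_tensor_def vec_eq_iff)
 have d0: "ddet P 0 = 0" for P :: "complex^'n^'n"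
  unfolding ddet_def by (rule sum.neutral) (auto intro!: det_zero_row_entries)
 have "Re (LBINT x. h x * (det (cHess b x + cHess h x) - det (cHess b x))) <= 0"
 proof (rule det_variation_integral[OF C2(1,2) Ck_continuous[OF h] K(1) h0])
  fix t :: real assume t: "0 <= t" "t <= 1"
  let ?v = "%x. b x + t * h x"
  note seg = ddet_segment[OF b h, where t=t]
  have 1: "(LBINT x. h x * ddet (cHess b x + t *\<^sub>R cHess h x) (cHess h x)) = - (LBINT x. ddet (cHess ?v x) (grad_tensor h h x))"
   unfolding seg(2) using integral_ddet_by_parts(1)[OF seg(1) h h K(1) h0] by simp
  have cg: "continuous_on UNIV (%x. grad_tensor h h x $ i $ j)" for i j
  proof -
   have "Ck (Suc 0) (%x. complex_of_real (h x))" using Ck_of_real[OF h1] by (simp del: Ck.simps)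
   from Ck_continuous[OF Ck_wirt[OF this]] show ?thesis
    unfolding grad_tensor_def by (simp add: continuous_on_mult)
  qed
  have "Re (LBINT x. ddet (cHess ?v x) (grad_tensor h h x)) = (LBINT x. Re (ddet (cHess ?v x) (grad_tensor h h x)))"
  proof -
   have "integrable lborel (%x. ddet (cHess ?v x) (grad_tensor h h x))"
    by (rule compact_support_integrable[OF _ K(1)])
      (use Ck_le[OF _ seg(1), of 2] in \<open>auto intro!: continuous_ddet continuous_cHess cg simp: gz d0\<close>)
   thus ?thesis by (subst integral_Re[symmetric]) auto
  qed
  moreover have "0 <= (LBINT x. Re (ddet (cHess ?v x) (grad_tensor h h x)))"
  proof (rule Bochner_Integration.integral_nonneg)
   fix x
   show "0 <= Re (ddet (cHess ?v x) (grad_tensor h h x))"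
   proof (cases "x \<in> K")
    case True
    have "hpsd (cHess ?v x)" unfolding seg(2)[symmetric]
     using psd True cab t by (intro hpsd_segment) auto
    thus ?thesis by (rule ddet_nonneg) (rule grad_tensor_self_psd[OF h1])
   qed (simp add: gz d0)
  qed
  ultimately show "Re (LBINT x. h x * ddet (cHess b x + t *\<^sub>R cHess h x) (cHess h x)) <= 0" by (simp add: 1)
 qed
 hence "(LBINT x. h x * (MA_density a x - MA_density b x)) <= 0"
  using MA_density_difference_integral[OF C2(1,2) Ck_continuous[OF h] K(1) h0]
  unfolding ab[symmetric] by (simp add: mult_nonneg_nonpos)
 thus ?thesis by (simp add: h_def)
qed

lemma hpsd_0: "hpsd 0"
 by (simp add: hpsd_def hermitian_def hform_def hsesq_def)

lemma cHess_const: "cHess (%_. c) x = 0"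
proof -
 have z: "fd (%_. c::real) a = (%_. 0)" for a :: "complex^'n" and c by (rule ext, rule fd_eqI) simp
 show ?thesis by (simp add: cHess_def hess_fd z vec_eq_iff)
qed

text \<open>Constants have zero Hessian, so both 1 and -1 are admissible weights in
  \<open>MA_integral_antimono\<close>.\<close>

lemma MA_mass_eq:
 fixes a b :: "complex^'n => real"
 assumes a: "Ck 3 a" and b: "Ck 3 b"
  and K: "compact K" "!!x. x \<notin> K ==> a x = b x" and le: "!!x. a x <= b x"
  and psd: "!!x. x \<in> K ==> hpsd (cHess a x)" "!!x. x \<in> K ==> hpsd (cHess b x)"
 shows "(LBINT x. (MA_density a x - MA_density b x)) = 0"
proof -
 have "(LBINT x. c * (MA_density a x - MA_density b x)) <= 0" for c
  by (rule MA_integral_antimono[OF a b Ck_const K le psd]) (simp_all add: cHess_const hpsd_0)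
 from this[of 1] this[of "-1"] show ?thesis by (simp only: integral_mult_right_zero)
qed

section \<open>Regularised maximum\<close>

text \<open>A quartic spline agreeing with \<open>max 0 s\<close> for \<open>\<bar>s\<bar> \<ge> 3\<close>: the second antiderivative of the quadratic
 B-spline with knots \<open>-3, -1, 1, 3\<close>.\<close>
definition spl :: "nat => real => real" where
 "spl k s = max 0 (s + 3) ^ k - 3 * max 0 (s + 1) ^ k + 3 * max 0 (s - 1) ^ k - max 0 (s - 3) ^ k"

text \<open>The third difference of step 2 of s^4 is 192 s, where 192 = 2^3 * 4!, so dividing by it
  gives slope 1 beyond the last knot; 48 and 16 are what differentiating once and twice
  leaves.\<close>

definition kap :: "real => real" where "kap s = spl 4 s / 192"
definition kap1 :: "real => real" where "kap1 s = spl 3 s / 48"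
definition kap2 :: "real => real" where "kap2 s = spl 2 s / 16"

lemma DERIV_max_power:
 assumes "k > 0"
 shows "((%s. max 0 (s + c) ^ Suc k) has_real_derivative real (Suc k) * max 0 (s + c) ^ k) (at s)"
proof -
 consider "s + c > 0" | "s + c < 0" | "s + c = 0" by linarith
 thus ?thesis
 proof cases
  case 1
  have "((%s. (s + c) ^ Suc k) has_real_derivative real (Suc k) * (s + c) ^ k) (at s)"
   using DERIV_power[of "%s. s + c" 1 s UNIV "Suc k"] by (auto intro!: derivative_eq_intros simp del: power_Suc simp: mult.commute)
  moreover have "\<forall>\<^sub>F y in nhds s. max 0 (y + c) ^ Suc k = (y + c) ^ Suc k"
   using eventually_nhds_in_open[of "{-c<..}" s] 1 by (auto elim!: eventually_mono)
  ultimately show ?thesis using 1 by (subst DERIV_cong_ev[OF refl _ refl]) auto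
 next
  case 2
  have "((%s. max 0 (s + c) ^ Suc k) has_real_derivative 0) (at s)"
   by (rule has_field_derivative_transform_within_open[of "%_. 0" _ _ "{..<-c}"]) (use 2 in auto)
  thus ?thesis using 2 assms by (simp add: zero_power)
 next
  case 3
  have "((%h::real. (max 0 h) ^ k) \<longlongrightarrow> max 0 0 ^ k) (at 0)" by (intro tendsto_intros)
  hence l: "((%h::real. max 0 h ^ k) \<longlongrightarrow> 0) (at 0)" using assms by (simp only: max.idem zero_power)
  have "((%h. (max 0 (s + h + c) ^ Suc k - max 0 (s + c) ^ Suc k) / h) \<longlongrightarrow> 0) (at 0)"
  proof (rule Lim_null_comparison[OF _ l], rule always_eventually, rule allI)
   fix h :: real
   show "norm ((max 0 (s + h + c) ^ Suc k - max 0 (s + c) ^ Suc k) / h) <= max 0 h ^ k"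
   proof -
    have e: "s + h + c = h" using 3 by simp
    show ?thesis unfolding e 3 by (cases "h > 0") (auto simp: max_def)
   qed
  qed
  thus ?thesis using 3 assms by (simp add: DERIV_def zero_power)
 qed
qed

lemma DERIV_spl: "k > 0 ==> (spl (Suc k) has_real_derivative real (Suc k) * spl k s) (at s)"
 unfolding spl_def[abs_def]
 using DERIV_max_power[of k 3 s] DERIV_max_power[of k 1 s] DERIV_max_power[of k "-1" s] DERIV_max_power[of k "-3" s]
  DERIV_diff[OF DERIV_add[OF DERIV_diff[OF DERIV_max_power[of k 3 s] DERIV_cmult[OF DERIV_max_power[of k 1 s], of 3]]
   DERIV_cmult[OF DERIV_max_power[of k "-1" s], of 3]] DERIV_max_power[of k "-3" s]]
 by (simp add: algebra_simps del: power_Suc of_nat_Suc)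

lemma DERIV_kap: "(kap has_real_derivative kap1 s) (at s)"
 using DERIV_cdivide[OF DERIV_spl[of 3 s], of 192] by (simp add: kap_def[abs_def] kap1_def eval_nat_numeral)

lemma DERIV_kap1: "(kap1 has_real_derivative kap2 s) (at s)"
 using DERIV_cdivide[OF DERIV_spl[of 2 s], of 48] by (simp add: kap1_def[abs_def] kap2_def eval_nat_numeral)

lemma Ck_real_derivative:
 fixes g g' :: "real => real"
 assumes "!!s. (g has_real_derivative g' s) (at s)" "Ck k g'"
 shows "Ck (Suc k) g"
 by (rule Ck_SucI[of _ "%s a. g' s * a"]) (use assms in \<open>auto simp: has_field_derivative_def intro: Ck_mult\<close>)

lemma Ck_spl: "Ck k (spl (Suc k))"
proof (induction k)
 case 0
 thus ?case by (auto simp: spl_def[abs_def] intro!: continuous_intros)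
next
 case (Suc k)
 show ?case by (rule Ck_real_derivative[OF DERIV_spl]) (use Suc in \<open>auto intro: Ck_mult\<close>)
qed

lemma Ck_kap: "Ck 3 kap"
 using Ck_mult[OF Ck_spl[of 3] Ck_const[of 3 "1/192"]] by (simp add: kap_def[abs_def] eval_nat_numeral del: Ck.simps)

lemma kap2_nonneg: "0 <= kap2 s"
proof -
 consider "s <= -3" | "-3 <= s" "s <= -1" | "-1 <= s" "s <= 1" | "1 <= s" "s <= 3" | "3 <= s" by linarith
 hence "0 <= spl 2 s"
 proof cases
  case 2
  have "max 0 (s + 1) = 0" "max 0 (s - 1) = 0" "max 0 (s - 3) = 0" using 2 by auto
  thus ?thesis by (simp add: spl_def)
 next
  case 3
  have "s\<^sup>2 <= 1" using 3 by (simp add: abs_square_le_1 abs_le_iff)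
  thus ?thesis using 3 by (simp add: spl_def max_def power2_eq_square algebra_simps)
 next
  case 4
  have "0 <= (s - 3)\<^sup>2" by simp
  thus ?thesis using 4 by (simp add: spl_def max_def power2_eq_square algebra_simps)
 qed (auto simp: spl_def max_def power2_eq_square algebra_simps)
 thus ?thesis by (simp add: kap2_def)
qed

lemma kap_low: "s <= -3 ==> kap s = 0" and kap1_low: "s <= -3 ==> kap1 s = 0"
 by (auto simp: kap_def kap1_def spl_def max_def)

lemma kap_high: "3 <= s ==> kap s = s" and kap1_high: "3 <= s ==> kap1 s = 1"
 by (auto simp: kap_def kap1_def spl_def max_def eval_nat_numeral algebra_simps)

lemma kap1_mono: "s <= t ==> kap1 s <= kap1 t"
 by (rule DERIV_nonneg_imp_nondecreasing[of s t kap1]) (use DERIV_kap1 kap2_nonneg in blast)+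

lemma kap1_bounds: "0 <= kap1 s" "kap1 s <= 1"
 using kap1_mono[of "min s (-3)" s] kap1_mono[of s "max s 3"] kap1_low[of "min s (-3)"] kap1_high[of "max s 3"] by auto

lemma kap_mono: "s <= t ==> kap s <= kap t"
 by (rule DERIV_nonneg_imp_nondecreasing[of s t kap]) (use DERIV_kap kap1_bounds in blast)+

lemma kap_lipschitz: "s <= t ==> kap t - kap s <= t - s"
proof -
 assume "s <= t"
 hence "(%s. s - kap s) s <= (%s. s - kap s) t"
 proof (rule DERIV_nonneg_imp_nondecreasing)
  fix x
  have "((%s. s - kap s) has_real_derivative 1 - kap1 x) (at x)"
   by (auto intro!: derivative_eq_intros DERIV_kap)
  thus "\<exists>y. ((%s. s - kap s) has_real_derivative y) (at x) \<and> 0 <= y" using kap1_bounds[of x] by auto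
 qed
 thus ?thesis by simp
qed

lemma kap_ge: "0 <= kap s" "s <= kap s"
 using kap_mono[of "min s (-3)" s] kap_low[of "min s (-3)"] kap_lipschitz[of s "max s 3"] kap_high[of "max s 3"] by auto

lemma kap_le: "kap s <= max 0 s + 1"
proof -
 have k0: "kap 0 <= 1" by (simp add: kap_def spl_def max_def)
 show ?thesis using k0 kap_mono[of s 0] kap_lipschitz[of 0 s] by (cases "s <= 0") auto
qed

text \<open>Equal to the larger argument as soon as the two differ by \<open>3 * e\<close>; this
  exactness is what makes gluing possible.\<close>

definition rmax :: "real => real => real => real" where
 "rmax e s t = s + e * kap ((t - s) / e)"

lemma rmax_mono:
 assumes e: "e > 0" and "s <= s'" "t <= t'"
 shows "rmax e s t <= rmax e s' t'"
proof -
 have "e * kap ((t - s) / e) - e * kap ((t - s') / e) <= s' - s"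
 proof -
  have "e * (kap ((t - s) / e) - kap ((t - s') / e)) <= e * ((t - s) / e - (t - s') / e)"
   using e assms(2) by (intro mult_left_mono kap_lipschitz divide_right_mono) auto
  moreover have "e * ((t - s) / e - (t - s') / e) = s' - s" using e by (simp add: diff_divide_distrib[symmetric])
  ultimately show ?thesis by (simp add: right_diff_distrib)
 qed
 moreover have "e * kap ((t - s') / e) <= e * kap ((t' - s') / e)"
  using e assms(3) by (intro mult_left_mono kap_mono divide_right_mono) auto
 ultimately show ?thesis by (simp add: rmax_def)
qed

lemma rmax_ge: "e > 0 ==> s <= rmax e s t" "e > 0 ==> t <= rmax e s t"
 using kap_ge(1)[of "(t - s) / e"] kap_ge(2)[of "(t - s) / e"] by (auto simp: rmax_def field_simps)

lemma rmax_le: "e > 0 ==> rmax e s t <= max s t + e"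
proof -
 assume e: "e > 0"
 have "e * kap ((t - s) / e) <= e * (max 0 ((t - s) / e) + 1)" using e by (intro mult_left_mono kap_le) auto
 also have "e * (max 0 ((t - s) / e) + 1) = max 0 (t - s) + e"
  using e by (cases "s <= t") (auto simp: max_def algebra_simps zero_le_divide_iff diff_divide_distrib divide_le_cancel)
 finally show ?thesis by (auto simp: rmax_def max_def split: if_splits)
qed

lemma rmax_eq_left: "e > 0 ==> t <= s - 3 * e ==> rmax e s t = s"
 by (simp add: rmax_def kap_low pos_divide_le_eq)

lemma rmax_eq_right: "e > 0 ==> s <= t - 3 * e ==> rmax e s t = t"
 by (simp add: rmax_def kap_high pos_le_divide_eq)

lemma Ck_rmax: "Ck 3 a ==> Ck 3 b ==> Ck 3 (%x. rmax e (a x) (b x))"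
 unfolding rmax_def divide_inverse
 by (intro Ck_add Ck_mult Ck_const Ck_compose_real[OF Ck_kap] Ck_diff)

text \<open>The weights of the two Hessians are non-negative and sum to 1, and for p = q the extra
  term is a square with non-negative factor: convexity and plurisubharmonicity both survive.\<close>

lemma hess_rmax:
 fixes a b :: "'a::real_normed_vector => real"
 assumes a: "Ck 3 a" and b: "Ck 3 b" and e: "e > 0"
 shows "hess (%x. rmax e (a x) (b x)) x p q
  = (1 - kap1 ((b x - a x) / e)) * hess a x p q + kap1 ((b x - a x) / e) * hess b x p q
   + kap2 ((b x - a x) / e) / e * (fd (%x. b x - a x) p x * fd (%x. b x - a x) q x)"
proof -
 define h where "h x = b x - a x" for x
 have h: "Ck 3 h" unfolding h_def by (rule Ck_diff[OF b a])
 have S: "Ck (Suc (Suc 1)) a" "Ck (Suc (Suc 1)) b" "Ck (Suc (Suc 1)) h" using a b h by (simp_all add: eval_nat_numeral)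
 have d: "(a has_derivative (%v. fd a v x)) (at x)" "(h has_derivative (%v. fd h v x)) (at x)" for x
  using Ck_derivative S by blast+
 have dd: "(fd a p has_derivative (%v. fd (fd a p) v x)) (at x)" "(fd h p has_derivative (%v. fd (fd h p) v x)) (at x)" for x p
  using Ck_derivative[OF Ck_fd] S by blast+
 have "((%x. h x / e) has_derivative (%v. fd h v x / e)) (at x)" for x
  using has_derivative_mult_left[OF d(2), of "1/e" x] by simp
 from has_derivative_compose[OF this DERIV_kap[unfolded has_field_derivative_def]]
 have k: "((%x. kap (h x / e)) has_derivative (%v. kap1 (h x / e) * (fd h v x / e))) (at x)" for x .
 have "((%x. h x / e) has_derivative (%v. fd h v x / e)) (at x)" for x
  using has_derivative_mult_left[OF d(2), of "1/e" x] by simp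
 from has_derivative_compose[OF this DERIV_kap1[unfolded has_field_derivative_def]]
 have k1: "((%x. kap1 (h x / e)) has_derivative (%v. kap2 (h x / e) * (fd h v x / e))) (at x)" for x .
 have 1: "fd (%x. rmax e (a x) (b x)) p = (%x. fd a p x + kap1 (h x / e) * fd h p x)" for p
 proof (rule ext, rule fd_eqI)
  fix x show "((%x. rmax e (a x) (b x)) has_derivative (%v. fd a v x + kap1 (h x / e) * fd h v x)) (at x)"
   unfolding rmax_def h_def[symmetric]
   by (rule has_derivative_eq_rhs[OF has_derivative_add[OF d(1) has_derivative_mult_right[OF k]]])
     (use e in \<open>auto simp: fun_eq_iff\<close>)
 qed
 have 2: "hess (%x. rmax e (a x) (b x)) x p q = fd (fd a p) q x + (kap1 (h x / e) * fd (fd h p) q x + kap2 (h x / e) * (fd h q x / e) * fd h p x)"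
  unfolding hess_fd 1 by (rule fd_eqI[OF has_derivative_add[OF dd(1) has_derivative_mult[OF k1 dd(2)]]])
 have df: "f differentiable at x" if "(f has_derivative D) (at x)" for f :: "'a => real" and D x using that by (auto simp: differentiable_def)
 have 3: "fd h p = (%x. fd b p x - fd a p x)" for p
  unfolding h_def[abs_def] using S by (intro ext fd_diff) auto
 have 4: "fd (fd h p) q x = fd (fd b p) q x - fd (fd a p) q x" unfolding 3 using S by (intro fd_diff) auto
 show ?thesis unfolding 2 h_def[symmetric] unfolding 4 hess_fd by (simp add: algebra_simps)
qed

lemma cHess_rmax:
 fixes a b :: "complex^'n => real"
 assumes a: "Ck 3 a" and b: "Ck 3 b" and e: "e > 0"
 shows "cHess (%x. rmax e (a x) (b x)) x
  = (1 - kap1 ((b x - a x) / e)) *\<^sub>R cHess a x + kap1 ((b x - a x) / e) *\<^sub>R cHess b x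
   + (kap2 ((b x - a x) / e) / e) *\<^sub>R grad_tensor (%x. b x - a x) (%x. b x - a x) x"
proof -
 let ?h = "%x. b x - a x"
 have h: "Ck 3 ?h" by (rule Ck_diff[OF b a])
 have d: "?h differentiable at x" using h by (simp add: eval_nat_numeral)
 have w: "wirt s i (%x. complex_of_real (?h x)) x = (complex_of_real (fd ?h (axis i 1) x) + s * complex_of_real (fd ?h (axis i \<i>) x)) / 2" for s i
  unfolding wirt_def by (simp only: fd_bounded_linear[OF bounded_linear_of_real d])
 have g: "grad_tensor ?h ?h x $ i $ k = (1/4) * (complex_of_real (fd ?h (axis i 1) x * fd ?h (axis k 1) x + fd ?h (axis i \<i>) x * fd ?h (axis k \<i>) x)
   + \<i> * complex_of_real (fd ?h (axis i 1) x * fd ?h (axis k \<i>) x - fd ?h (axis i \<i>) x * fd ?h (axis k 1) x))" for i k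
  unfolding grad_tensor_def vec_lambda_beta w by (simp add: field_simps)
 show ?thesis
  by (simp add: vec_eq_iff g) (use e in \<open>simp add: cHess_def hess_rmax[OF a b e] complex_eq_iff field_simps\<close>)
qed

text \<open>The complex Hessian dominates a convex combination of the two given ones, so
  quasi-concavity of the determinant bounds the density below by the smaller of the two.\<close>

lemma rmax_psd:
 fixes a b :: "complex^'n => real"
 assumes a: "Ck 3 a" and b: "Ck 3 b" and e: "e > 0" and pa: "hpsd (cHess a x)" and pb: "hpsd (cHess b x)"
 shows "hpsd (cHess (%x. rmax e (a x) (b x)) x)"
  and "min (MA_density a x) (MA_density b x) <= MA_density (%x. rmax e (a x) (b x)) x"
proof -
 let ?h = "%x. b x - a x"
 have h: "Ck 1 ?h" using Ck_le[OF _ Ck_diff[OF b a], of 1] by simp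
 note g = grad_tensor_self_psd[OF h, of x]
 define t where "t = 1 - kap1 ((b x - a x) / e)"
 define r where "r = kap2 ((b x - a x) / e) / e"
 have t: "0 <= t" "t <= 1" "0 <= r" using kap1_bounds kap2_nonneg e by (auto simp: t_def r_def)
 have eq: "cHess (%x. rmax e (a x) (b x)) x = t *\<^sub>R cHess a x + (1 - t) *\<^sub>R cHess b x + r *\<^sub>R grad_tensor ?h ?h x"
  unfolding cHess_rmax[OF a b e] t_def r_def by simp
 have herm: "hermitian (cHess (%x. rmax e (a x) (b x)) x)"
  unfolding eq using g pa pb by (simp add: hpsd_def hermitian_add hermitian_scaleR)
 have hf: "hform (cHess (%x. rmax e (a x) (b x)) x) z = t * hform (cHess a x) z + (1 - t) * hform (cHess b x) z + r * hform (grad_tensor ?h ?h x) z" for z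
  unfolding eq by (simp add: hform_add hform_scaleR)
 show "hpsd (cHess (%x. rmax e (a x) (b x)) x)"
  unfolding hpsd_def using herm g pa pb t by (simp add: hf hpsd_def)
 have "min (Re (det (cHess a x))) (Re (det (cHess b x))) <= Re (det (cHess (%x. rmax e (a x) (b x)) x))"
  by (rule hpsd_det_quasiconcave[OF pa pb herm t(1,2)]) (use g t in \<open>simp add: hf hpsd_def\<close>)
 thus "min (MA_density a x) (MA_density b x) <= MA_density (%x. rmax e (a x) (b x)) x"
  unfolding MA_density_def
  using mult_left_mono[of "min (Re (det (cHess a x))) (Re (det (cHess b x)))" _ "4 ^ CARD('n) * fact CARD('n)"]
   min_mult_distrib_left[of "4 ^ CARD('n) * fact CARD('n)" "Re (det (cHess a x))" "Re (det (cHess b x))"] by simp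
qed

section \<open>Smooth decreasing approximation of plurisubharmonic functions\<close>

lemma bounded_support_integrable:
 fixes f :: "'a::euclidean_space => real"
 assumes f: "f \<in> borel_measurable borel" and b: "!!x. \<bar>f x\<bar> <= B" and S: "bounded S" "!!x. x \<notin> S ==> f x = 0"
 shows "integrable lborel f"
proof -
 obtain a where a: "S \<subseteq> cbox (-a) a" using bounded_subset_cbox_symmetric[OF S(1)] by blast
 show ?thesis
 proof (rule integrableI_bounded_set[where A="cbox (-a) a" and B=B])
  show "AE x in lborel. x \<in> cbox (-a) a \<longrightarrow> norm (f x) <= B" using b by simp
  show "AE x in lborel. x \<notin> cbox (-a) a \<longrightarrow> f x = 0" using a S(2) by auto
 qed (use f emeasure_lborel_cbox_finite in auto)
qed

lemma fd_basis_expand: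
 fixes f :: "'a::euclidean_space => real"
 assumes "Ck (Suc k) f"
 shows "fd f h x = (\<Sum>b\<in>Basis. (h \<bullet> b) * fd f b x)"
proof -
 note l = fd_linear[OF assms, of x]
 have "fd f (\<Sum>b\<in>Basis. (h \<bullet> b) *\<^sub>R b) x = (\<Sum>b\<in>Basis. fd f ((h \<bullet> b) *\<^sub>R b) x)"
  using linear_sum[OF l, of "%b. (h \<bullet> b) *\<^sub>R b" Basis] by simp
 thus ?thesis using linear_cmul[OF l] by (simp add: euclidean_representation)
qed

lemma compact_support_uniformly_continuous:
 fixes f :: "'a::euclidean_space => real"
 assumes c: "continuous_on UNIV f" and K: "compact K" "!!x. x \<notin> K ==> f x = 0" and e: "e > 0"
 obtains d where "0 < d" "d <= 1" "!!x y. norm (x - y) < d ==> \<bar>f x - f y\<bar> < e"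
proof -
 obtain r where r: "K \<subseteq> cball 0 r"
  using compact_imp_bounded[OF K(1)] unfolding bounded_iff by (auto simp: subset_iff)
 have "uniformly_continuous_on (cball 0 (r + 1)) f"
  by (intro compact_uniformly_continuous continuous_on_subset[OF c]) auto
 then obtain d where d: "d > 0" "!!x y. x \<in> cball 0 (r + 1) ==> y \<in> cball 0 (r + 1) ==> dist y x < d ==> dist (f y) (f x) < e"
  using e unfolding uniformly_continuous_on_def by metis
 show thesis
 proof (rule that[of "min d 1"])
  fix x y :: 'a assume xy: "norm (x - y) < min d 1"
  show "\<bar>f x - f y\<bar> < e"
  proof (cases "x \<in> K \<or> y \<in> K")
   case True
   hence "norm x <= r \<or> norm y <= r" using r by (auto simp: subset_iff)
   hence "norm x <= r + 1 \<and> norm y <= r + 1"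
    using xy norm_triangle_ineq2[of x y] norm_triangle_ineq2[of y x] by (auto simp: norm_minus_commute)
   thus ?thesis using d(2)[of y x] xy by (auto simp: dist_norm)
  qed (use K(2) e in auto)
 qed (use d in auto)
qed

lemma convolution_estimate:
 fixes \<phi> w :: "'a::euclidean_space => real"
 assumes "w \<in> borel_measurable borel" "!!x. \<bar>w x\<bar> <= M" "\<phi> \<in> borel_measurable borel" "!!z. \<bar>\<phi> z\<bar> <= e"
  and "!!z. z \<notin> cball 0 r ==> \<phi> z = 0"
 shows "integrable lborel (%y. w y * \<phi> (x - y))"
  and "\<bar>(LBINT y. w y * \<phi> (x - y))\<bar> <= M * e * measure lborel (cball (0::'a) r)"
proof -
 have M: "0 <= M" "0 <= e" using assms(2)[of 0] assms(4)[of 0] by auto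
 have b: "\<bar>w y * \<phi> (x - y)\<bar> <= M * e" for y
  unfolding abs_mult using assms(2,4) M by (intro mult_mono) auto
 have z: "w y * \<phi> (x - y) = 0" if "y \<notin> cball x r" for y
  using that assms(5)[of "x - y"] by (auto simp: dist_norm norm_minus_commute)
 show i: "integrable lborel (%y. w y * \<phi> (x - y))"
  by (rule bounded_support_integrable[OF _ b bounded_cball z]) (use assms(1,3) in measurable)
 have ci: "integrable lborel (%y. M * e * indicator (cball x r) y)"
  by (intro integrable_mult_right integrable_real_indicator) (use emeasure_bounded_finite[OF bounded_cball[of x r]] in auto)
 have "\<bar>(LBINT y. w y * \<phi> (x - y))\<bar> <= (LBINT y. \<bar>w y * \<phi> (x - y)\<bar>)"
  by (rule integral_abs_bound)
 also have "... <= (LBINT y. M * e * indicator (cball x r) y)"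
  by (intro integral_mono integrable_abs i ci) (use b z in \<open>auto simp: indicator_def\<close>)
 also have "... = M * e * measure lborel (cball x r)" by simp
 also have "measure lborel (cball x r) = measure lborel (cball (0::'a) r)"
  using measure_translation[of x "cball 0 r"] by (simp add: image_add_cball measure_completion)
 finally show "\<bar>(LBINT y. w y * \<phi> (x - y))\<bar> <= M * e * measure lborel (cball (0::'a) r)" .
qed

text \<open>Derivatives fall on the kernel, so boundedness and measurability of w suffice. Uniform
  continuity of the finitely many basis derivatives of the kernel makes the linear approximation
  uniform in the integration variable.\<close>

lemma Ck_convolution:
 fixes \<phi> w :: "'a::euclidean_space => real"
 assumes w: "w \<in> borel_measurable borel" "!!x. \<bar>w x\<bar> <= M"
 shows "Ck k \<phi> ==> (!!z. z \<notin> cball 0 r ==> \<phi> z = 0) ==> Ck k (%x. (LBINT y. w y * \<phi> (x - y)))"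
proof (induction k arbitrary: \<phi>)
 case 0
 have c: "continuous_on UNIV \<phi>" using 0 by simp
 define V where "V = M * measure lborel (cball (0::'a) (r + 1))"
 have V: "0 <= V" using w(2)[of 0] by (simp add: V_def)
 obtain B where B: "!!z. \<bar>\<phi> z\<bar> <= B"
 proof -
  obtain B where "!!z. z \<in> cball 0 r ==> norm (\<phi> z) <= B"
   using compact_imp_bounded[OF compact_continuous_image[OF continuous_on_subset[OF c] compact_cball[of 0 r]]]
   unfolding bounded_iff by (metis imageI subset_UNIV)
  hence "\<bar>\<phi> z\<bar> <= max B 0" for z using 0(2)[of z] by (cases "z \<in> cball 0 r") fastforce+
  thus thesis using that by blast
 qed
 have m: "\<phi> \<in> borel_measurable borel" using c by (rule borel_measurable_continuous_onI)
 have i: "integrable lborel (%y. w y * \<phi> (x - y))" for x by (rule convolution_estimate(1)[OF w m B 0(2)])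
 have "\<exists>d>0. \<forall>x'. dist x' x < d \<longrightarrow> dist (LBINT y. w y * \<phi> (x' - y)) (LBINT y. w y * \<phi> (x - y)) < e" if e: "e > 0" for x e
 proof -
  define e' where "e' = e / (V + 1)"
  have e': "e' > 0" using e V by (simp add: e'_def)
  obtain d where d: "0 < d" "d <= 1" "!!x y. norm (x - y) < d ==> \<bar>\<phi> x - \<phi> y\<bar> < e'"
   using compact_support_uniformly_continuous[OF c compact_cball 0(2) e'] by blast
  have "dist (LBINT y. w y * \<phi> (x' - y)) (LBINT y. w y * \<phi> (x - y)) < e" if "dist x' x < d" for x'
  proof -
   define h where "h = x' - x"
   have h: "norm h < d" using that by (simp add: h_def dist_norm)
   have "(LBINT y. w y * \<phi> (x' - y)) - (LBINT y. w y * \<phi> (x - y)) = (LBINT y. w y * (%z. \<phi> (z + h) - \<phi> z) (x - y))"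
    using i[of x'] i[of x] by (subst Bochner_Integration.integral_diff[symmetric]) (auto simp: h_def algebra_simps)
   also have "\<bar>...\<bar> <= M * e' * measure lborel (cball (0::'a) (r + 1))"
   proof (rule convolution_estimate(2)[OF w])
    show "(%z. \<phi> (z + h) - \<phi> z) \<in> borel_measurable borel" using m by measurable
    show "\<bar>\<phi> (z + h) - \<phi> z\<bar> <= e'" for z using d(3)[of "z + h" z] h by (simp add: less_imp_le)
    show "\<phi> (z + h) - \<phi> z = 0" if "z \<notin> cball 0 (r + 1)" for z
     using that 0(2)[of z] 0(2)[of "z + h"] norm_triangle_ineq2[of z "-h"] h d(2) by auto
   qed
   also have "... = V * e'" by (simp add: V_def)
   also have "... < e" using e V by (simp add: e'_def divide_simps)
   finally show ?thesis by (simp add: dist_norm)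
  qed
  thus ?thesis using d(1) by blast
 qed
 thus ?case by (simp add: continuous_on_iff)
next
 case (Suc k)
 let ?F = "%\<phi> x. (LBINT y. w y * \<phi> (x - y))"
 have z: "fd \<phi> a z = 0" if "z \<notin> cball 0 r" for a z
  by (rule fd_zero_outside[OF closed_cball Suc.prems(2) that])
 have ckf: "Ck k (?F (fd \<phi> a))" for a
  by (rule Suc.IH[OF Ck_fd[OF Suc.prems(1)] z])
 have cf: "continuous_on UNIV (fd \<phi> a)" for a using Ck_continuous[OF Ck_fd[OF Suc.prems(1)]] .
 have c: "continuous_on UNIV \<phi>" using Ck_continuous[OF Suc.prems(1)] .
 have bd: "\<exists>B. \<forall>z. \<bar>g z\<bar> <= B" if gc: "continuous_on UNIV g" and gz: "!!z. z \<notin> cball 0 r ==> g z = 0" for g :: "'a => real"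
 proof -
  obtain B where "!!z. z \<in> cball 0 r ==> norm (g z) <= B"
   using compact_imp_bounded[OF compact_continuous_image[OF continuous_on_subset[OF gc] compact_cball[of 0 r]]]
   unfolding bounded_iff by (metis imageI subset_UNIV)
  hence "\<bar>g z\<bar> <= max B 0" for z using gz[of z] by (cases "z \<in> cball 0 r") fastforce+
  thus ?thesis by blast
 qed
 have i: "integrable lborel (%y. w y * g (x - y))" if "continuous_on UNIV g" "!!z. z \<notin> cball 0 r ==> g z = 0" for g x
  using bd[OF that] convolution_estimate(1)[OF w borel_measurable_continuous_onI[OF that(1)] _ that(2)] by blast
 define N where "N = real (DIM('a))"
 define V where "V = M * measure lborel (cball (0::'a) (r + 1))"
 have V: "0 <= V" "0 < N" using w(2)[of 0] by (auto simp: V_def N_def)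
 have lin: "linear (%a. ?F (fd \<phi> a) x)" for x
 proof (rule linearI)
  note l = fd_linear[OF Suc.prems(1)]
  show "?F (fd \<phi> (a + b)) x = ?F (fd \<phi> a) x + ?F (fd \<phi> b) x" for a b
   using i[OF cf z, of a x] i[OF cf z, of b x]
   by (simp add: linear_add[OF l] algebra_simps)
  show "?F (fd \<phi> (t *\<^sub>R a)) x = t *\<^sub>R ?F (fd \<phi> a) x" for t a
   by (simp add: linear_cmul[OF l] mult.left_commute)
 qed
 have der: "(?F \<phi> has_derivative (%a. ?F (fd \<phi> a) x)) (at x)" for x
  unfolding has_derivative_at_alt
 proof (intro conjI allI impI)
  show "bounded_linear (%a. ?F (fd \<phi> a) x)" using lin by (simp add: linear_conv_bounded_linear)
  fix e :: real assume e: "e > 0"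
  define e' where "e' = e / ((V + 1) * N)"
  have e': "e' > 0" using e V by (simp add: e'_def)
  have "\<exists>d>0. d <= 1 \<and> (\<forall>x y. norm (x - y) < d \<longrightarrow> \<bar>fd \<phi> b x - fd \<phi> b y\<bar> < e')" for b
   using compact_support_uniformly_continuous[OF cf compact_cball z e'] by metis
  then obtain d where d: "!!b. 0 < d b \<and> d b <= 1 \<and> (\<forall>x y. norm (x - y) < d b \<longrightarrow> \<bar>fd \<phi> b x - fd \<phi> b y\<bar> < e')" by metis
  define d0 where "d0 = Min (d ` Basis)"
  have d0: "0 < d0" "d0 <= 1" using d by (auto simp: d0_def Min_gr_iff Min_le_iff ex_in_conv)
  have d0b: "\<bar>fd \<phi> b x - fd \<phi> b y\<bar> < e'" if "b \<in> Basis" "norm (x - y) < d0" for b x y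
   using d[of b] that by (auto simp: d0_def)
  show "\<exists>d>0. \<forall>y. norm (y - x) < d \<longrightarrow> norm (?F \<phi> y - ?F \<phi> x - ?F (fd \<phi> (y - x)) x) <= e * norm (y - x)"
  proof (intro exI[of _ d0] conjI allI impI)
   fix x' assume "norm (x' - x) < d0"
   define h where "h = x' - x"
   have h: "norm h < d0" using \<open>norm (x' - x) < d0\<close> by (simp add: h_def)
   define g where "g z = \<phi> (z + h) - \<phi> z - fd \<phi> h z" for z
   have "?F \<phi> x' - ?F \<phi> x - ?F (fd \<phi> h) x = ?F g x"
    using i[OF c Suc.prems(2), of x'] i[OF c Suc.prems(2), of x] i[OF cf z, of h x]
    by (simp add: g_def h_def algebra_simps)
   moreover have "\<bar>?F g x\<bar> <= M * (N * e' * norm h) * measure lborel (cball (0::'a) (r + 1))"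
   proof (rule convolution_estimate(2)[OF w])
    show "g \<in> borel_measurable borel"
     unfolding g_def[abs_def]
     by (intro borel_measurable_continuous_onI continuous_intros cf continuous_on_compose2[OF c]) auto
    show "g z = 0" if "z \<notin> cball 0 (r + 1)" for z
     using that Suc.prems(2)[of z] Suc.prems(2)[of "z + h"] z[of z h] norm_triangle_ineq2[of z "-h"] h d0(2)
     by (auto simp: g_def)
    show "\<bar>g z\<bar> <= N * e' * norm h" for z
    proof -
     have "\<exists>t. 0 < t \<and> t < 1 \<and> \<phi> (z + 1 *\<^sub>R h) - \<phi> (z + 0 *\<^sub>R h) = (1 - 0) * fd \<phi> h (z + t *\<^sub>R h)"
      by (rule MVT2) (auto intro!: line_derivative[OF Suc.prems(1)])
     then obtain t where t: "0 < t" "t < 1" "\<phi> (z + h) - \<phi> z = fd \<phi> h (z + t *\<^sub>R h)" by auto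
     have "g z = (\<Sum>b\<in>Basis. (h \<bullet> b) * (fd \<phi> b (z + t *\<^sub>R h) - fd \<phi> b z))"
      unfolding g_def t(3) fd_basis_expand[OF Suc.prems(1), of h] by (simp add: sum_subtractf[symmetric] algebra_simps)
     also have "\<bar>...\<bar> <= (\<Sum>b\<in>(Basis::'a set). norm h * e')"
     proof (rule sum_abs[THEN order_trans], rule sum_mono)
      fix b :: 'a assume b: "b \<in> Basis"
      have "norm (z + t *\<^sub>R h - z) < d0" using t h mult_left_le_one_le[of "norm h" t] by simp
      thus "\<bar>(h \<bullet> b) * (fd \<phi> b (z + t *\<^sub>R h) - fd \<phi> b z)\<bar> <= norm h * e'"
       unfolding abs_mult using d0b[OF b, of "z + t *\<^sub>R h" z] Basis_le_norm[OF b, of h] by (intro mult_mono) auto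
     qed
     finally show ?thesis by (simp add: N_def mult_ac)
    qed
   qed
   moreover have "M * (N * e' * norm h) * measure lborel (cball (0::'a) (r + 1)) <= e * norm h"
   proof -
    have "M * (N * e' * norm h) * measure lborel (cball (0::'a) (r + 1)) = (V * (N * e')) * norm h" by (simp add: V_def mult_ac)
    also have "... = V * (e / (V + 1)) * norm h" using V by (simp add: e'_def)
    also have "V * (e / (V + 1)) * norm h <= e * norm h" using V e by (intro mult_right_mono) (auto simp: field_simps)
    finally show ?thesis .
   qed
   ultimately show "norm (?F \<phi> x' - ?F \<phi> x - ?F (fd \<phi> (x' - x)) x) <= e * norm (x' - x)" by (simp add: h_def)
  qed (use d0 in auto)
 qed
 show ?case by (rule Ck_SucI[OF der ckf])
qed

section \<open>The mollification kernel and sub-mean values\<close>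

text \<open>The power 4 provides the three continuous derivatives used throughout; dependence on the
  norm alone gives invariance under unimodular factors.\<close>

definition kern0 :: "real => complex^'n => real" where
 "kern0 d y = max 0 (1 - (y \<bullet> y) / d\<^sup>2) ^ 4"

definition kern :: "real => complex^'n => real" where
 "kern d y = kern0 d y / (\<integral>y. kern0 d y \<partial>(lborel :: (complex^'n) measure))"

lemma Ck_max_power: "Ck k (%s::real. max 0 s ^ Suc k)"
proof (induction k)
 case 0
 thus ?case by (auto intro!: continuous_intros)
next
 case (Suc k)
 show ?case
  by (rule Ck_real_derivative[of _ "%s. real (Suc (Suc k)) * max 0 s ^ Suc k"])
    (use DERIV_max_power[of "Suc k" 0] Suc in \<open>auto intro: Ck_mult simp del: power_Suc of_nat_Suc\<close>)
qed

lemma Ck_kern0: "Ck 3 (kern0 d :: complex^'n => real)"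
proof -
 have 1: "Ck 3 (%s::real. max 0 s ^ 4)" using Ck_max_power[of 3] by (simp add: eval_nat_numeral del: Ck.simps)
 have 2: "Ck 3 (%y::complex^'n. 1 - (y \<bullet> y) * inverse (d\<^sup>2))"
  by (intro Ck_diff Ck_const Ck_mult Ck_inner Ck_id)
 show ?thesis unfolding kern0_def[abs_def] divide_inverse by (rule Ck_compose_real[OF 1 2])
qed

lemma kern0_support: "d > 0 ==> z \<notin> ball 0 d ==> kern0 d z = 0"
proof -
 assume d: "d > 0" and z: "z \<notin> ball 0 d"
 have "d\<^sup>2 <= (norm z)\<^sup>2" using d z by (intro power_mono) auto
 hence "1 - (z \<bullet> z) / d\<^sup>2 <= 0" using d by (simp add: dot_square_norm)
 thus ?thesis by (simp add: kern0_def max_def)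
qed

lemma kern0_nonneg: "0 <= kern0 d z" by (simp add: kern0_def)

lemma kern0_integrable: "d > 0 ==> integrable lborel (kern0 d)"
 by (rule compact_support_integrable[OF Ck_continuous[OF Ck_kern0] compact_cball[of 0 d]]) (auto intro: kern0_support)

lemma kern0_integral_pos: "d > 0 ==> 0 < (\<integral>y. kern0 d y \<partial>(lborel :: (complex^'n) measure))"
proof -
 assume d: "d > 0"
 have "(\<integral>y. kern0 d y \<partial>(lborel :: (complex^'n) measure)) \<noteq> 0"
 proof
  assume "(\<integral>y. kern0 d y \<partial>(lborel :: (complex^'n) measure)) = 0"
  hence "AE y in (lborel :: (complex^'n) measure). kern0 d y = 0"
   using kern0_integrable[OF d] kern0_nonneg by (subst (asm) integral_nonneg_eq_0_iff_AE) auto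
  hence "negligible {y :: complex^'n. kern0 d y \<noteq> 0}"
  proof -
   have "open {y :: complex^'n. kern0 d y \<noteq> 0}"
    by (intro open_Collect_neq Ck_continuous[OF Ck_kern0] continuous_on_const)
   hence "{y :: complex^'n. kern0 d y \<noteq> 0} \<in> null_sets lborel"
    using AE_iff_null_sets[of "{y :: complex^'n. kern0 d y \<noteq> 0}" lborel] \<open>AE y in lborel. kern0 d y = 0\<close> by auto
   thus ?thesis by (simp add: negligible_iff_null_sets null_sets_completionI)
  qed
  moreover have "ball 0 d \<subseteq> {y :: complex^'n. kern0 d y \<noteq> 0}"
  proof
   fix y :: "complex^'n" assume "y \<in> ball 0 d"
   hence "(norm y)\<^sup>2 < d\<^sup>2" using d by (intro power_strict_mono) auto
   hence "0 < 1 - (y \<bullet> y) / d\<^sup>2" using d by (simp add: dot_square_norm)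
   hence "max 0 (1 - (y \<bullet> y) / d\<^sup>2) \<noteq> 0" by linarith
   thus "y \<in> {y. kern0 d y \<noteq> 0}" by (metis kern0_def mem_Collect_eq power_not_zero)
  qed
  ultimately have "negligible (ball (0::complex^'n) d)" using negligible_subset by blast
  thus False using open_not_negligible[of "ball (0::complex^'n) d"] d by simp
 qed
 moreover have "0 <= (\<integral>y. kern0 d y \<partial>(lborel :: (complex^'n) measure))" using kern0_nonneg by (intro Bochner_Integration.integral_nonneg)
 ultimately show ?thesis by simp
qed

lemma kern:
 assumes "d > 0"
 shows "Ck 3 (kern d :: complex^'n => real)" "!!z. 0 <= kern d (z :: complex^'n)" "!!z :: complex^'n. z \<notin> ball 0 d ==> kern d z = 0"
  "integrable lborel (kern d :: complex^'n => real)" "(\<integral>y. kern d y \<partial>(lborel :: (complex^'n) measure)) = 1"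
  "!!z c. cmod c = 1 ==> kern d (c *s z) = kern d (z :: complex^'n)"
proof -
 note p = kern0_integral_pos[OF assms, where 'n='n]
 show "Ck 3 (kern d :: complex^'n => real)" unfolding kern_def[abs_def] divide_inverse by (intro Ck_mult Ck_kern0 Ck_const)
 show "0 <= kern d z" for z :: "complex^'n" unfolding kern_def by (rule divide_nonneg_pos[OF kern0_nonneg p])
 show "kern d z = 0" if "z \<notin> ball 0 d" for z :: "complex^'n" using kern0_support[OF assms that] by (simp add: kern_def)
 show "integrable lborel (kern d :: complex^'n => real)" unfolding kern_def[abs_def] by (intro integrable_divide_zero kern0_integrable assms)
 show "(\<integral>y. kern d y \<partial>(lborel :: (complex^'n) measure)) = 1" unfolding kern_def using p by simp
 show "kern d (c *s z) = kern d z" if "cmod c = 1" for z :: "complex^'n" and c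
 proof -
  have "norm (c *s z) = norm z" using that by (simp add: norm_vec_def norm_mult)
  thus ?thesis by (simp add: kern_def kern0_def dot_square_norm)
 qed
qed


definition mollify :: "real => (complex^'n => real) => complex^'n => real" where
 "mollify d w x = (LBINT y. w y * kern d (x - y))"

definition circle_mean :: "(complex^'n => real) => complex^'n => complex^'n => real => real" where
 "circle_mean w z v r = (1 / (2 * pi)) * (LBINT \<theta>=0..2*pi. w (z + (complex_of_real r * cis \<theta>) *s v))"

text \<open>The mean value half of \<open>psh_on\<close>, kept apart because it passes to increasing
  limits whose semicontinuity is not yet known.\<close>

definition submean :: "(complex^'n) set => (complex^'n => real) => bool" where
 "submean S w \<longleftrightarrow> (\<forall>z v r. 0 < r \<and> (\<forall>\<zeta>. cmod \<zeta> <= r \<longrightarrow> z + \<zeta> *s v \<in> S) \<longrightarrow> w z <= circle_mean w z v r)"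

lemma psh_on_submean: "psh_on S u \<longleftrightarrow> usc_on S u \<and> submean S u"
proof -
 have "z \<in> S" if "0 < r" "\<forall>\<zeta>. cmod \<zeta> <= r \<longrightarrow> z + \<zeta> *s v \<in> S" for z v and r :: real
  using that(2)[rule_format, of 0] that(1) by simp
 thus ?thesis unfolding psh_on_def submean_def circle_mean_def by blast
qed

lemma submean_subset: "submean S w ==> T \<subseteq> S ==> submean T w"
 unfolding submean_def by blast

lemma circle_mean_Icc:
 "circle_mean w z v r = (1 / (2 * pi)) * (LBINT \<theta>. indicator {0..2*pi} \<theta> * w (z + (complex_of_real r * cis \<theta>) *s v))"
 using interval_integral_Icc[of 0 "2*pi" "%\<theta>. w (z + (complex_of_real r * cis \<theta>) *s v)"]
 by (simp add: circle_mean_def set_lebesgue_integral_def zero_ereal_def)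

lemma circle_point_measurable:
 fixes z v :: "complex^'n"
 assumes "w \<in> borel_measurable borel"
 shows "(%\<theta>. w (z + (complex_of_real r * cis \<theta>) *s v)) \<in> borel_measurable borel"
proof -
 have "continuous_on UNIV (%\<theta>. z + (complex_of_real r * cis \<theta>) *s v)"
  unfolding vector_scalar_mult_def by (intro continuous_intros)
 thus ?thesis using assms by (intro measurable_compose[OF borel_measurable_continuous_onI assms])
qed

lemma circle_integrable:
 fixes w :: "complex^'n => real"
 assumes "w \<in> borel_measurable borel" "!!x. \<bar>w x\<bar> <= M"
 shows "integrable lborel (%\<theta>. indicator {0..2*pi} \<theta> * w (z + (complex_of_real r * cis \<theta>) *s v))"
 by (rule bounded_support_integrable[of _ M "{0..2*pi}"])
   (use circle_point_measurable[OF assms(1)] assms(2) order_trans[OF abs_ge_zero assms(2)] in \<open>auto simp: indicator_def\<close>)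

lemma mollify_alt:
 assumes "w \<in> borel_measurable borel" "d > 0"
 shows "mollify d w x = (LBINT y. w (x - y) * kern d y)"
proof -
 have m: "(%y. w y * kern d (x - y)) \<in> borel_measurable borel"
  using assms kern(1)[OF assms(2), THEN Ck_continuous, THEN borel_measurable_continuous_onI] by measurable
 have nm: "distr lborel borel uminus = (lborel :: (complex^'n) measure)"
  by (subst lborel_affine[of "-1" 0]) (auto simp: density_1)
 have "mollify d w x = (LBINT y. w (x + y) * kern d (x - (x + y)))"
  unfolding mollify_def using integral_shift[OF m, of x] by simp
 also have "... = (LBINT y. w (x + - y) * kern d (- (- y)))"
 proof -
  have "(%y. w (x + y) * kern d (- y)) \<in> borel_measurable borel"
   using assms kern(1)[OF assms(2), THEN Ck_continuous, THEN borel_measurable_continuous_onI] by measurable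
  thus ?thesis
   by (subst nm[symmetric], subst integral_distr) auto
 qed
 finally show ?thesis by simp
qed

context
 fixes w :: "complex^'n => real" and M d :: real
 assumes w: "w \<in> borel_measurable borel" and M: "!!x. \<bar>w x\<bar> <= M" and d: "d > 0"
begin

lemmas kern' = kern[OF d, where 'n='n]

lemma Ck_mollify: "Ck 3 (mollify d w)"
 unfolding mollify_def[abs_def]
 by (rule Ck_convolution[OF w M kern'(1), of d]) (use kern'(3) in auto)

lemma kern_measurable [measurable]: "(kern d :: complex^'n => real) \<in> borel_measurable borel"
 using kern'(1)[THEN Ck_continuous, THEN borel_measurable_continuous_onI] .

lemma mollify_integrable: "integrable lborel (%y. w (x - y) * kern d y)"
proof (rule Bochner_Integration.integrable_bound)
 show "integrable lborel (%y :: complex^'n. M * kern d y)" using kern'(4) by simp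
 show "(%y. w (x - y) * kern d y) \<in> borel_measurable lborel" using w by measurable
 show "AE y in lborel. norm (w (x - y) * kern d y) <= norm (M * kern d y)"
  using M order_trans[OF abs_ge_zero M] by (auto simp: abs_mult intro!: mult_right_mono)
qed

lemma mollify_le:
 assumes "!!y. y \<in> ball x d ==> w y <= c"
 shows "mollify d w x <= c"
proof -
 have "mollify d w x <= (\<integral>y. c * kern d y \<partial>(lborel :: (complex^'n) measure))"
  unfolding mollify_alt[OF w d]
 proof (intro integral_mono mollify_integrable)
  show "integrable lborel (%y :: complex^'n. c * kern d y)" using kern'(4) by simp
  fix y :: "complex^'n"
  show "w (x - y) * kern d y <= c * kern d y"
  proof (cases "y \<in> ball 0 d")
   case True
   thus ?thesis using assms[of "x - y"] kern'(2)[of y] by (intro mult_right_mono) (auto simp: dist_norm)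
  qed (simp add: kern'(3))
 qed
 thus ?thesis using kern'(5) by simp
qed

lemma mollify_ge:
 assumes "!!y. y \<in> ball x d ==> c <= w y"
 shows "c <= mollify d w x"
proof -
 have "(\<integral>y. c * kern d y \<partial>(lborel :: (complex^'n) measure)) <= mollify d w x"
  unfolding mollify_alt[OF w d]
 proof (intro integral_mono mollify_integrable)
  show "integrable lborel (%y :: complex^'n. c * kern d y)" using kern'(4) by simp
  fix y :: "complex^'n"
  show "c * kern d y <= w (x - y) * kern d y"
  proof (cases "y \<in> ball 0 d")
   case True
   thus ?thesis using assms[of "x - y"] kern'(2)[of y] by (intro mult_right_mono) (auto simp: dist_norm)
  qed (simp add: kern'(3))
 qed
 thus ?thesis using kern'(5) by simp
qed

lemma mollify_bound: "\<bar>mollify d w x\<bar> <= M"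
 using mollify_le[of x M] mollify_ge[of x "-M"] M by (auto simp: abs_le_iff minus_le_iff)

text \<open>Fubini for kernel and circle, with the point of evaluation left general: it serves
  circles translated by y as well as circles around a fixed centre whose radius is set by y.\<close>

lemma mollify_circle_swap:
 assumes G: "continuous_on UNIV (%p. G (fst p) (snd p) :: complex^'n)"
 shows "(\<integral>y. kern d y * (LBINT \<theta>. indicator {0..2*pi} \<theta> * w (G y \<theta>)) \<partial>(lborel :: (complex^'n) measure))
    = (LBINT \<theta>. indicator {0..2*pi} \<theta> * (\<integral>y. w (G y \<theta>) * kern d y \<partial>(lborel :: (complex^'n) measure)))"
proof -
 define f where "f p = kern d (fst p) * (indicator {0..2*pi} (snd p) * w (G (fst p) (snd p)))" for p
 have Gm: "(%p. G (fst p) (snd p)) \<in> borel_measurable borel" using G by (rule borel_measurable_continuous_onI)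
 have wG: "(%p. w (G (fst p) (snd p))) \<in> borel_measurable borel" by (rule measurable_compose[OF Gm w])
 obtain B where B: "!!y :: complex^'n. kern d y <= B"
 proof -
  have "bounded (kern d ` cball (0 :: complex^'n) d)"
   by (intro compact_imp_bounded compact_continuous_image Ck_continuous[OF kern'(1)]) auto
  then obtain B where "\<forall>y\<in>cball (0 :: complex^'n) d. norm (kern d y) <= B" unfolding bounded_iff by auto
  hence "kern d y <= max B 0" for y :: "complex^'n"
   using kern'(3)[of y] by (cases "y \<in> cball 0 d") fastforce+
  thus thesis using that by blast
 qed
 have "integrable (lborel :: ((complex^'n) \<times> real) measure) f"
 proof (rule bounded_support_integrable)
  show "f \<in> borel_measurable borel"
  proof -
   have "(%p::(complex^'n) \<times> real. indicator {0..2*pi} (snd p) :: real) = indicator (UNIV \<times> {0..2*pi})"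
    by (auto simp: indicator_def fun_eq_iff)
   hence 1: "(%p::(complex^'n) \<times> real. indicator {0..2*pi} (snd p) :: real) \<in> borel_measurable borel"
    by (simp add: borel_closed closed_Times)
   have 2: "(%p::(complex^'n) \<times> real. kern d (fst p)) \<in> borel_measurable borel"
    by (intro borel_measurable_continuous_onI continuous_on_compose2[OF Ck_continuous[OF kern'(1), of UNIV]] continuous_intros) auto
   show ?thesis unfolding f_def[abs_def] by (intro borel_measurable_times 1 2 wG)
  qed
  have B0: "0 <= B" using kern'(2)[of 0] B[of 0] by simp
  have M0: "0 <= M" using M[of 0] by simp
  show "\<bar>f p\<bar> <= B * M" for p
   unfolding f_def abs_mult using B[of "fst p"] kern'(2)[of "fst p"] M[of "G (fst p) (snd p)"] B0 M0
   by (intro mult_mono) (auto simp: indicator_def)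
  show "bounded (cball (0 :: complex^'n) d \<times> {0..2*pi})" by (intro bounded_Times) auto
  show "f p = 0" if "p \<notin> cball 0 d \<times> {0..2*pi}" for p
   using that kern'(3)[of "fst p"] by (cases p) (auto simp: f_def)
 qed
 hence fi: "integrable (lborel \<Otimes>\<^sub>M lborel) f" by (simp add: lborel_prod)
 have "(LBINT y. (LBINT \<theta>. f (y, \<theta>))) = (LBINT \<theta>. (LBINT y. f (y, \<theta>)))"
  using lborel_pair.Fubini_integral[of "%y \<theta>. f (y, \<theta>)"] fi by simp
 moreover have "(LBINT \<theta>. f (y, \<theta>)) = kern d y * (LBINT \<theta>. indicator {0..2*pi} \<theta> * w (G y \<theta>))" for y
  unfolding f_def fst_conv snd_conv by (rule integral_mult_right_zero)
 moreover have "(LBINT y. f (y, \<theta>)) = indicator {0..2*pi} \<theta> * (LBINT y. w (G y \<theta>) * kern d y)" for \<theta>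
 proof -
  have "f (y, \<theta>) = indicator {0..2*pi} \<theta> * (w (G y \<theta>) * kern d y)" for y by (simp add: f_def)
  thus ?thesis by (simp only: integral_mult_right_zero)
 qed
 ultimately show ?thesis by simp
qed

lemma circle_mean_mollify_eq:
 "circle_mean (mollify d w) z v r = (\<integral>y. kern d y * circle_mean w (z - y) v r \<partial>(lborel :: (complex^'n) measure))"
proof -
 have G: "continuous_on UNIV (%p. (z - fst p) + (complex_of_real r * cis (snd p)) *s v)"
  unfolding vector_scalar_mult_def by (intro continuous_intros)
 have sh: "(z + (complex_of_real r * cis \<theta>) *s v) - y = (z - y) + (complex_of_real r * cis \<theta>) *s v" for \<theta> and y :: "complex^'n" by simp
 have "circle_mean (mollify d w) z v r
   = (1 / (2 * pi)) * (LBINT \<theta>. indicator {0..2*pi} \<theta> * (LBINT y. w ((z - y) + (complex_of_real r * cis \<theta>) *s v) * kern d y))"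
  by (simp only: circle_mean_Icc mollify_alt[OF w d] sh)
 also have "... = (1 / (2 * pi)) * (LBINT y. kern d y * (LBINT \<theta>. indicator {0..2*pi} \<theta> * w ((z - y) + (complex_of_real r * cis \<theta>) *s v)))"
  using mollify_circle_swap[of "%y \<theta>. (z - y) + (complex_of_real r * cis \<theta>) *s v"] G by simp
 finally show ?thesis unfolding circle_mean_Icc by (simp add: mult.left_commute)
qed

lemma circle_mean_bound: "\<bar>circle_mean w z v r\<bar> <= M"
proof -
 have "\<bar>(LBINT \<theta>. indicator {0..2*pi} \<theta> * w (z + (complex_of_real r * cis \<theta>) *s v))\<bar>
  <= (LBINT \<theta>. \<bar>indicator {0..2*pi} \<theta> * w (z + (complex_of_real r * cis \<theta>) *s v)\<bar>)" by (rule integral_abs_bound)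
 also have "... <= (LBINT \<theta>. M * indicator {0..2*pi} \<theta>)"
 proof (intro integral_mono integrable_abs circle_integrable[OF w M])
  show "integrable lborel (%\<theta>. M * indicator {0..2*pi} \<theta>)" by (intro integrable_mult_right integrable_real_indicator) auto
 qed (use M in \<open>auto simp: indicator_def\<close>)
 also have "... = M * (2 * pi)" by simp
 finally show ?thesis unfolding circle_mean_Icc by (simp add: abs_mult field_simps)
qed

lemma circle_mean_kern_integrable: "integrable lborel (%y. kern d y * circle_mean w (z - y) v r)"
proof (rule Bochner_Integration.integrable_bound)
 show "integrable lborel (%y :: complex^'n. M * kern d y)" using kern'(4) by simp
 have Gm: "(%p. (z - fst p) + (complex_of_real r * cis (snd p)) *s v) \<in> borel_measurable borel"
  unfolding vector_scalar_mult_def by (intro borel_measurable_continuous_onI continuous_intros)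
 have "(%p. w ((z - fst p) + (complex_of_real r * cis (snd p)) *s v)) \<in> borel_measurable (lborel \<Otimes>\<^sub>M lborel)"
  using measurable_compose[OF Gm w] by (simp add: lborel_prod)
 hence "(%p. indicator {0..2*pi} (snd p) * w ((z - fst p) + (complex_of_real r * cis (snd p)) *s v)) \<in> borel_measurable (lborel \<Otimes>\<^sub>M lborel)"
  by measurable
 hence "(%y. circle_mean w (z - y) v r) \<in> borel_measurable lborel"
  unfolding circle_mean_Icc
  by (intro borel_measurable_times borel_measurable_const lborel.borel_measurable_lebesgue_integral) (simp add: case_prod_beta)
 thus "(%y. kern d y * circle_mean w (z - y) v r) \<in> borel_measurable lborel" by measurable
 show "AE y in lborel. norm (kern d y * circle_mean w (z - y) v r) <= norm (M * kern d y)"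
  using mult_right_mono[OF circle_mean_bound abs_ge_zero] order_trans[OF abs_ge_zero M]
  by (intro AE_I2) (simp add: abs_mult mult.commute)
qed

lemma mollify_submean:
 assumes S: "submean S w" and T: "!!x y. x \<in> T ==> y \<in> ball 0 d ==> x - y \<in> S"
 shows "submean T (mollify d w)"
 unfolding submean_def
proof (intro allI impI, elim conjE)
 fix z v and r :: real assume r: "0 < r" and disc: "\<forall>\<zeta>. cmod \<zeta> <= r \<longrightarrow> z + \<zeta> *s v \<in> T"
 have "mollify d w z = (LBINT y. w (z - y) * kern d y)" by (rule mollify_alt[OF w d])
 also have "... <= (LBINT y. kern d y * circle_mean w (z - y) v r)"
 proof (intro integral_mono mollify_integrable circle_mean_kern_integrable)
  fix y
  show "w (z - y) * kern d y <= kern d y * circle_mean w (z - y) v r"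
  proof (cases "y \<in> ball 0 d")
   case True
   have "z - y + \<zeta> *s v \<in> S" if "cmod \<zeta> <= r" for \<zeta>
    using T[OF disc[rule_format, OF that] True] by (simp add: algebra_simps)
   hence "w (z - y) <= circle_mean w (z - y) v r" using S r unfolding submean_def by blast
   thus ?thesis using kern'(2)[of y] by (simp add: mult.commute mult_left_mono)
  qed (simp add: kern'(3))
 qed
 also have "... = circle_mean (mollify d w) z v r" by (rule circle_mean_mollify_eq[symmetric])
 finally show "mollify d w z <= circle_mean (mollify d w) z v r" .
qed

text \<open>The kernel is invariant under multiplying y by \<open>cis \<theta>\<close>, so the
  mollification does not change when averaged over \<theta>; it then is a weighted mean of circle
  means centred at x, each at least \<open>w x\<close>.\<close>

lemma mollify_ge_submean:
 assumes S: "submean S w" and x: "cball x d \<subseteq> S"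
 shows "w x <= mollify d w x"
proof -
 have rot: "(LBINT y. w (x - cis \<theta> *s y) * kern d y) = mollify d w x" for \<theta>
 proof -
  let ?L = "%y::complex^'n. cis \<theta> *s y"
  have lin: "linear ?L" by (rule linearI) (auto simp: vec_eq_iff algebra_simps)
  have bij: "bij ?L" by (rule o_bij[of "%y. cis (-\<theta>) *s y"]) (auto simp: fun_eq_iff vec_eq_iff mult.assoc[symmetric] cis_mult)
  have nrm: "norm (?L y) = norm y" for y by (simp add: norm_vec_def norm_mult)
  have Lm: "?L \<in> borel_measurable borel"
   using lin by (intro borel_measurable_continuous_onI linear_continuous_on) (simp add: linear_conv_bounded_linear)
  have "distr lborel borel ?L = lborel"
  proof (rule measure_eqI)
   fix A :: "(complex^'n) set" assume "A \<in> sets (distr lborel borel ?L)"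
   hence A: "A \<in> sets borel" by simp
   have v: "?L -` A \<in> sets borel" using Lm A by (metis measurable_sets_borel)
   have "?L ` (?L -` A) = A" using bij by (simp add: bij_is_surj surj_image_vimage_eq)
   with emeasure_linear_bij_image(1)[OF lin bij v] vol_factor_isometry[OF bij nrm] A Lm
   show "emeasure (distr lborel borel ?L) A = emeasure lborel A" by (simp add: emeasure_distr)
  qed simp
  hence "mollify d w x = (\<integral>y. w (x - y) * kern d y \<partial>distr lborel borel ?L)" by (simp add: mollify_alt[OF w d])
  also have "... = (LBINT y. w (x - ?L y) * kern d (?L y))"
   by (subst integral_distr) (use w Lm in measurable)
  finally show ?thesis using kern'(6) by simp
 qed
 have G: "continuous_on UNIV (%p. x - cis (snd p) *s fst p)"
  unfolding vector_scalar_mult_def by (intro continuous_intros)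
 have cm: "circle_mean w x (- y) 1 = (1 / (2 * pi)) * (LBINT \<theta>. indicator {0..2*pi} \<theta> * w (x - cis \<theta> *s y))" for y
  unfolding circle_mean_Icc by simp
 have "(LBINT y. kern d y * circle_mean w x (- y) 1)
   = (1 / (2 * pi)) * (LBINT y. kern d y * (LBINT \<theta>. indicator {0..2*pi} \<theta> * w (x - cis \<theta> *s y)))"
  unfolding cm by (simp add: mult.left_commute)
 also have "... = (1 / (2 * pi)) * (LBINT \<theta>. indicator {0..2*pi} \<theta> * mollify d w x)"
  using mollify_circle_swap[of "%y \<theta>. x - cis \<theta> *s y"] G by (simp add: rot)
 also have "... = mollify d w x" by simp
 finally have eq: "mollify d w x = (LBINT y. kern d y * circle_mean w x (- y) 1)" by simp
 have Gm: "(%p. x - cis (snd p) *s fst p) \<in> borel_measurable borel"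
  using G by (rule borel_measurable_continuous_onI)
 have "(%p. w (x - cis (snd p) *s fst p)) \<in> borel_measurable (lborel \<Otimes>\<^sub>M lborel)"
  using measurable_compose[OF Gm w] by (simp add: lborel_prod)
 hence "(%p. indicator {0..2*pi} (snd p) * w (x - cis (snd p) *s fst p)) \<in> borel_measurable (lborel \<Otimes>\<^sub>M lborel)"
  by measurable
 hence cmm: "(%y. circle_mean w x (- y) 1) \<in> borel_measurable lborel"
  unfolding cm
  by (intro borel_measurable_times borel_measurable_const lborel.borel_measurable_lebesgue_integral) (simp add: case_prod_beta)
 have int: "integrable lborel (%y. kern d y * circle_mean w x (- y) 1)"
 proof (rule Bochner_Integration.integrable_bound)
  show "integrable lborel (%y :: complex^'n. M * kern d y)" using kern'(4) by simp
  show "(%y. kern d y * circle_mean w x (- y) 1) \<in> borel_measurable lborel" using cmm by measurable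
  show "AE y in lborel. norm (kern d y * circle_mean w x (- y) 1) <= norm (M * kern d y)"
   using mult_right_mono[OF circle_mean_bound abs_ge_zero] order_trans[OF abs_ge_zero M]
   by (intro AE_I2) (simp add: abs_mult mult.commute)
 qed
 have "w x = (\<integral>y. w x * kern d y \<partial>(lborel :: (complex^'n) measure))" using kern'(5) by simp
 also have "... <= (LBINT y. kern d y * circle_mean w x (- y) 1)"
 proof (intro integral_mono int)
  show "integrable lborel (%y :: complex^'n. w x * kern d y)" using kern'(4) by simp
  fix y :: "complex^'n"
  show "w x * kern d y <= kern d y * circle_mean w x (- y) 1"
  proof (cases "y \<in> ball 0 d")
   case True
   have "x + \<zeta> *s (- y) \<in> S" if "cmod \<zeta> <= 1" for \<zeta>
   proof -
    have "norm (\<zeta> *s y) = cmod \<zeta> * norm y"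
     by (simp add: norm_vec_def norm_mult L2_set_right_distrib)
    also have "... <= 1 * d" using that True by (intro mult_mono) auto
    finally have "x + \<zeta> *s (- y) \<in> cball x d" by (simp add: dist_norm)
    thus ?thesis using x by auto
   qed
   hence "w x <= circle_mean w x (- y) 1" using S unfolding submean_def by simp
   from mult_left_mono[OF this kern'(2)[of y]] show ?thesis by (simp add: mult.commute)
  qed (simp add: kern'(3))
 qed
 finally show ?thesis using eq by simp
qed

end

section \<open>Shrunken domains and decreasing smooth approximation\<close>

text \<open>For x in \<open>inner_part \<Omega> (r + s)\<close> a mollification of radius s only
  looks at \<open>inner_part \<Omega> r\<close>.\<close>

definition inner_part :: "'a::euclidean_space set => real => 'a set" where
 "inner_part \<Omega> r = {x. r < infdist x (- \<Omega>)}"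

lemma inner_part_mono: "r <= s ==> inner_part \<Omega> s \<subseteq> inner_part \<Omega> r"
 by (auto simp: inner_part_def)

lemma open_inner_part: "open (inner_part \<Omega> r)"
 unfolding inner_part_def by (intro open_Collect_less continuous_intros)

lemma inner_part_shift: "x \<in> inner_part \<Omega> (r + s) ==> norm y <= s ==> x - y \<in> inner_part \<Omega> r"
 using infdist_triangle[of x "- \<Omega>" "x - y"] by (auto simp: inner_part_def dist_norm)

lemma inner_part_subset: "0 <= r ==> inner_part \<Omega> r \<subseteq> \<Omega>"
 by (auto simp: inner_part_def) (metis ComplI infdist_zero not_less order_less_imp_le)

lemma usc_borel:
 assumes "open \<Omega>" "usc_on \<Omega> (u::'a::euclidean_space => real)"
 shows "(%x. if x \<in> \<Omega> then u x else 0) \<in> borel_measurable borel"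
proof (rule borel_measurableI_less)
 fix c :: real
 have "open {x \<in> \<Omega>. u x < c}"
 proof (rule openI)
  fix x assume x: "x \<in> {x \<in> \<Omega>. u x < c}"
  hence "eventually (%y. u y < c) (at x within \<Omega>)" using assms(2) by (auto simp: usc_on_def)
  moreover have "at x within \<Omega> = at x" using x assms(1) at_within_open by blast
  ultimately have "eventually (%y. u y < c) (at x)" by (simp only:)
  then obtain e1 where e1: "e1 > 0" "!!y. y \<noteq> x ==> dist y x < e1 ==> u y < c" unfolding eventually_at by auto
  obtain e2 where e2: "e2 > 0" "ball x e2 \<subseteq> \<Omega>" using openE[OF assms(1), of x] x by blast
  show "\<exists>e>0. ball x e \<subseteq> {x \<in> \<Omega>. u x < c}"
  proof (intro exI[of _ "min e1 e2"] conjI subsetI)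
   show "0 < min e1 e2" using e1 e2 by simp
   fix y assume y: "y \<in> ball x (min e1 e2)"
   hence "y \<in> \<Omega>" using e2(2) by auto
   moreover have "u y < c" using e1(2)[of y] x y by (cases "y = x") (auto simp: dist_commute)
   ultimately show "y \<in> {x \<in> \<Omega>. u x < c}" by simp
  qed
 qed
 hence 1: "{x \<in> \<Omega>. u x < c} \<in> sets borel" by simp
 have 2: "{x. x \<notin> \<Omega> \<and> 0 < c} \<in> sets borel"
 proof (cases "0 < c")
  case True
  hence "{x. x \<notin> \<Omega> \<and> 0 < c} = - \<Omega>" by auto
  thus ?thesis using assms(1) by simp
 qed simp
 have "{x \<in> space borel. (if x \<in> \<Omega> then u x else 0) < c} = {x \<in> \<Omega>. u x < c} \<union> {x. x \<notin> \<Omega> \<and> 0 < c}" by auto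
 thus "{x \<in> space borel. (if x \<in> \<Omega> then u x else 0) < c} \<in> sets borel" using 1 2 by simp
qed

text \<open>\<open>iter_moll u d k j\<close> mollifies with the radii d_(j+k-1), ..., d_j in this
  order, so raising k inserts a new innermost mollification.\<close>

fun iter_moll :: "(complex^'n => real) => (nat => real) => nat => nat => complex^'n => real" where
 "iter_moll u d 0 j = u"
| "iter_moll u d (Suc k) j = mollify (d j) (iter_moll u d k (Suc j))"

text \<open>Composing mollifications of radii \<open>d_j, d_{j+1}, ...\<close> yields \<open>v_j = mollify d_j v_{j+1}\<close>, so that
 \<open>v_{j+1} <= v_j\<close> needs only the sub-mean value property and not the monotonicity of circular means.\<close>
theorem psh_smooth_approximation:
 fixes \<Omega> :: "(complex^'n) set" and u :: "complex^'n => real"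
 assumes \<Omega>: "open \<Omega>" and psh: "psh_on \<Omega> u" and bd: "!!x. x \<in> \<Omega> ==> \<bar>u x\<bar> <= M" and M0: "0 <= M" and r: "r > 0"
 obtains v where "!!j. Ck 3 (v j)" "!!j. psh_on (inner_part \<Omega> r) (v j)"
  "!!j x. x \<in> inner_part \<Omega> r ==> v (Suc j) x <= v j x"
  "!!x. x \<in> inner_part \<Omega> r ==> (%j. v j x) \<longlonglongrightarrow> u x"
  "!!j x. x \<in> inner_part \<Omega> r ==> u x <= v j x"
  "!!j x. \<bar>v j x\<bar> <= M"
proof -
 define u0 where "u0 x = (if x \<in> \<Omega> then u x else 0)" for x
 \<comment> \<open>The radii from index j on add up to \<open>2 * d j\<close>, at most r: all
   iterates at level j depend on u only within that distance.\<close>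
 define d where "d j = r / 2 ^ Suc j" for j
 have d: "d j > 0" "2 * d (Suc j) = d j" "2 * d j <= r" for j
  using r by (auto simp: d_def field_simps)
 define S where "S j = inner_part \<Omega> (2 * d j)" for j
 have SO: "S j \<subseteq> \<Omega>" for j using inner_part_subset[of "2 * d j" \<Omega>] d(1)[of j] by (simp add: S_def)
 have Sopen: "open (S j)" for j by (simp add: S_def open_inner_part)
 have Ssh: "x - y \<in> S (Suc j)" if "x \<in> S j" "norm y <= d j" for x y j
  using inner_part_shift[of x \<Omega> "d j" "d j" y] that unfolding S_def d(2) by simp
 have Sball: "y \<in> S (Suc j)" if "x \<in> S j" "dist x y <= d j" for x y j
  using Ssh[OF that(1), of "x - y"] that(2) by (simp add: dist_norm)
 have SS: "S j \<subseteq> S (Suc j)" for j using Sball[of _ j] d(1)[of j] by fastforce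
 have SR: "inner_part \<Omega> r \<subseteq> S j" for j unfolding S_def by (rule inner_part_mono[OF d(3)])
 have usc: "usc_on \<Omega> u" and sm: "submean \<Omega> u" using psh by (auto simp: psh_on_submean)
 have u0m: "u0 \<in> borel_measurable borel" unfolding u0_def[abs_def] by (rule usc_borel[OF \<Omega> usc])
 have u0b: "\<bar>u0 x\<bar> <= M" for x using bd M0 by (simp add: u0_def)
 have mean_cong: "circle_mean w z a s = circle_mean w' z a s"
  if "!!\<zeta>. cmod \<zeta> <= s ==> w (z + \<zeta> *s a) = w' (z + \<zeta> *s a)" "s > 0" for w w' :: "complex^'n => real" and z a s
  unfolding circle_mean_def using that by (simp add: norm_mult)
 have sm0: "submean \<Omega> u0"
  unfolding submean_def
 proof (intro allI impI, elim conjE)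
  fix z a and s :: real assume s: "0 < s" and disc: "\<forall>\<zeta>. cmod \<zeta> <= s \<longrightarrow> z + \<zeta> *s a \<in> \<Omega>"
  have "u z <= circle_mean u z a s" using sm s disc unfolding submean_def by blast
  moreover have "circle_mean u z a s = circle_mean u0 z a s"
   using disc s by (intro mean_cong) (auto simp: u0_def)
  moreover have "z \<in> \<Omega>" using disc[rule_format, of 0] s by simp
  ultimately show "u0 z <= circle_mean u0 z a s" by (simp add: u0_def)
 qed
 define it where "it k j = iter_moll u0 d k j" for k j
 have itS: "it (Suc k) j = mollify (d j) (it k (Suc j))" and it0: "it 0 j = u0" for k j by (simp_all add: it_def)
 have itb: "it k j \<in> borel_measurable borel \<and> (\<forall>x. \<bar>it k j x\<bar> <= M)" for k j
 proof (induction k arbitrary: j)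
  case (Suc k)
  note IH = Suc[of "Suc j"]
  show ?case unfolding itS
   using Ck_continuous[OF Ck_mollify[of "it k (Suc j)" M "d j"]] mollify_bound[of "it k (Suc j)" M "d j"] IH d(1)[of j]
   by (auto intro: borel_measurable_continuous_onI)
 qed (use u0m u0b in \<open>auto simp: it0\<close>)
 have itm: "it k j \<in> borel_measurable borel" and itB: "\<bar>it k j x\<bar> <= M" for k j x using itb by auto
 have itsm: "submean (S j) (it k j)" for k j
 proof (induction k arbitrary: j)
  case 0 thus ?case using submean_subset[OF sm0 SO] by (simp add: it0)
 next
  case (Suc k)
  show ?case unfolding itS
   by (rule mollify_submean[OF itm itB d(1) Suc[of "Suc j"]]) (use Ssh in auto)
 qed
 \<comment> \<open>A mollification inserted directly on u raises it by the sub-mean value property,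
   and the outer mollifications preserve the order.\<close>
 have itmono: "it k j x <= it (Suc k) j x" if "x \<in> S j" for k j x
  using that
 proof (induction k arbitrary: j x)
  case 0
  have "cball x (d j) \<subseteq> \<Omega>" using Sball[OF 0] SO[of "Suc j"] by (auto simp: subset_iff)
  thus ?case unfolding itS it0 by (rule mollify_ge_submean[OF u0m u0b d(1) sm0])
 next
  case (Suc k)
  have ab: "mollify (d j) (it k (Suc j)) x <= mollify (d j) (it (Suc k) (Suc j)) x"
   unfolding mollify_alt[OF itm d(1)]
  proof (intro integral_mono mollify_integrable[OF itm itB d(1)])
   fix y :: "complex^'n"
   show "it k (Suc j) (x - y) * kern (d j) y <= it (Suc k) (Suc j) (x - y) * kern (d j) y"
   proof (cases "y \<in> ball 0 (d j)")
    case True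
    hence "x - y \<in> S (Suc j)" using Ssh[OF Suc.prems, of y] by simp
    thus ?thesis using Suc.IH kern(2)[OF d(1)[of j], of y] by (intro mult_right_mono) auto
   qed (simp add: kern(3)[OF d(1)])
  qed
  thus ?case unfolding itS .
 qed
 \<comment> \<open>Quantifies the locality of the iterates: this is how upper semicontinuity of u
   will bound the limit from above.\<close>
 have itle: "it k j x <= c" if "x \<in> S j" "!!y. dist x y < 2 * d j ==> u0 y <= c" for k j x c
  using that
 proof (induction k arbitrary: j x)
  case 0
  thus ?case using d(1)[of j] by (simp add: it0)
 next
  case (Suc k)
  show ?case unfolding itS
  proof (rule mollify_le[OF itm itB d(1)])
   fix y assume y: "y \<in> ball x (d j)"
   show "it k (Suc j) y <= c"
   proof (rule Suc.IH)
    show "y \<in> S (Suc j)" using Sball[OF Suc.prems(1)] y by auto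
    fix z assume "dist y z < 2 * d (Suc j)"
    hence "dist x z < 2 * d j" using y d(2)[of j] dist_triangle[of x z y] by auto
    thus "u0 z <= c" by (rule Suc.prems(2))
   qed
  qed
 qed
 \<comment> \<open>The increasing limit in k is only Borel a priori. Mollifying the limit of the
   next level gives a smooth function, which by dominated convergence coincides with
   \<open>wl j\<close> on \<open>S j\<close>.\<close>
 define wl where "wl j x = (if x \<in> S j then lim (%k. it k j x) else 0)" for j x
 have itlim: "(%k. it k j x) \<longlonglongrightarrow> wl j x" if "x \<in> S j" for j x
 proof -
  have "incseq (%k. it k j x)" using itmono[OF that] by (rule incseq_SucI)
  moreover have "Bseq (%k. it k j x)" using itB by (intro BseqI'[of _ M]) auto
  ultimately have "convergent (%k. it k j x)" by (intro Bseq_monoseq_convergent) (auto simp: monoseq_iff)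
  thus ?thesis using that by (simp add: wl_def convergent_LIMSEQ_iff)
 qed
 have wlm: "wl j \<in> borel_measurable borel" for j
 proof -
  have "(%x. indicator (S j) x * it k j x) \<in> borel_measurable borel" for k
   by (intro borel_measurable_times borel_measurable_indicator itm) (use Sopen[of j] in simp)
  thus ?thesis
   by (rule borel_measurable_LIMSEQ_real[rotated, where u="%k x. indicator (S j) x * it k j x"])
     (use itlim in \<open>auto simp: wl_def indicator_def\<close>)
 qed
 have wlB: "\<bar>wl j x\<bar> <= M" for j x
 proof (cases "x \<in> S j")
  case True
  show ?thesis using tendsto_rabs[OF itlim[OF True]] by (rule LIMSEQ_le_const2) (use itB in auto)
 qed (use M0 in \<open>simp add: wl_def\<close>)
 have itle_wl: "it k j x <= wl j x" if "x \<in> S j" for k j x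
  by (rule incseq_le[OF incseq_SucI itlim[OF that]]) (rule itmono[OF that])
 have wlsm: "submean (S j) (wl j)" for j
  unfolding submean_def
 proof (intro allI impI, elim conjE)
  fix z a and s :: real assume s: "0 < s" and disc: "\<forall>\<zeta>. cmod \<zeta> <= s \<longrightarrow> z + \<zeta> *s a \<in> S j"
  have zS: "z \<in> S j" using disc[rule_format, of 0] s by simp
  have "it k j z <= circle_mean (wl j) z a s" for k
  proof -
   have "it k j z <= circle_mean (it k j) z a s" using itsm[of j k] s disc unfolding submean_def by blast
   also have "... <= circle_mean (wl j) z a s"
    unfolding circle_mean_Icc
   proof (rule mult_left_mono, rule integral_mono[OF circle_integrable[OF itm itB] circle_integrable[OF wlm wlB]])
    fix \<theta> :: real
    have "z + (complex_of_real s * cis \<theta>) *s a \<in> S j" using disc s by (simp add: norm_mult)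
    from itle_wl[OF this] show "indicator {0..2*pi} \<theta> * it k j (z + (complex_of_real s * cis \<theta>) *s a)
      <= indicator {0..2*pi} \<theta> * wl j (z + (complex_of_real s * cis \<theta>) *s a)" by (intro mult_left_mono) auto
   qed auto
   finally show ?thesis .
  qed
  thus "wl j z <= circle_mean (wl j) z a s" by (intro LIMSEQ_le_const2[OF itlim[OF zS]]) auto
 qed
 define v where "v j = mollify (d j) (wl (Suc j))" for j
 have vwl: "v j x = wl j x" if x: "x \<in> S j" for j x
 proof -
  have "(%k. it (Suc k) j x) \<longlonglongrightarrow> v j x"
   unfolding itS v_def mollify_alt[OF itm d(1)] mollify_alt[OF wlm d(1)]
  proof (rule integral_dominated_convergence[where w="%y. M * kern (d j) y"])
   have km: "(kern (d j) :: complex^'n => real) \<in> borel_measurable borel"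
    using kern(1)[OF d(1), THEN Ck_continuous, THEN borel_measurable_continuous_onI] .
   show "(%y. wl (Suc j) (x - y) * kern (d j) y) \<in> borel_measurable lborel" using wlm km by measurable
   show "(%y. it k (Suc j) (x - y) * kern (d j) y) \<in> borel_measurable lborel" for k using itm km by measurable
   show "integrable lborel (%y :: complex^'n. M * kern (d j) y)" using kern(4)[OF d(1), where 'n='n] by simp
   show "AE y in lborel. (%k. it k (Suc j) (x - y) * kern (d j) y) \<longlonglongrightarrow> wl (Suc j) (x - y) * kern (d j) y"
   proof (rule AE_I2)
    fix y :: "complex^'n"
    show "(%k. it k (Suc j) (x - y) * kern (d j) y) \<longlonglongrightarrow> wl (Suc j) (x - y) * kern (d j) y"
    proof (cases "y \<in> ball 0 (d j)")
     case True
     thus ?thesis using Ssh[OF x, of y] by (intro tendsto_intros itlim) auto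
    qed (simp add: kern(3)[OF d(1)])
   qed
   show "AE y in lborel. norm (it k (Suc j) (x - y) * kern (d j) y) <= M * kern (d j) y" for k
    using itB kern(2)[OF d(1), where 'n='n] by (intro AE_I2) (auto simp: abs_mult intro!: mult_right_mono)
  qed
  moreover have "(%k. it (Suc k) j x) \<longlonglongrightarrow> wl j x" using itlim[OF x] by (rule LIMSEQ_Suc)
  ultimately show ?thesis by (rule LIMSEQ_unique)
 qed
 have vc: "Ck 3 (v j)" for j unfolding v_def by (rule Ck_mollify[OF wlm wlB d(1)])
 have uv: "u x <= v j x" if "x \<in> S j" for j x
  using itle_wl[OF that, of 0] subsetD[OF SO that] vwl[OF that] by (simp add: it0 u0_def)
 show thesis
 proof (rule that[of v])
  show "Ck 3 (v j)" for j by (rule vc)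
  show "psh_on (inner_part \<Omega> r) (v j)" for j
   unfolding psh_on_submean
  proof
   have "isCont (v j) x" for x using Ck_continuous[OF vc, of UNIV] by (simp add: continuous_on_eq_continuous_at)
   thus "usc_on (inner_part \<Omega> r) (v j)"
    unfolding usc_on_def isCont_def
    by (auto intro: order_tendstoD(2) tendsto_within_subset[of _ _ _ UNIV])
   have "submean (S j) (v j)" unfolding v_def
    by (rule mollify_submean[OF wlm wlB d(1) wlsm]) (use Ssh in auto)
   thus "submean (inner_part \<Omega> r) (v j)" using SR by (rule submean_subset)
  qed
  fix j x
  show "\<bar>v j x\<bar> <= M" unfolding v_def by (rule mollify_bound[OF wlm wlB d(1)])
  assume "x \<in> inner_part \<Omega> r"
  hence x: "x \<in> S j" for j using SR by blast
  show "u x <= v j x" by (rule uv[OF x])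
  have "cball x (d j) \<subseteq> S (Suc j)" using Sball[OF x] by auto
  from mollify_ge_submean[OF wlm wlB d(1) wlsm this]
  show "v (Suc j) x <= v j x" using vwl[OF x] by (simp add: v_def)
 next
  fix x assume "x \<in> inner_part \<Omega> r"
  hence x: "x \<in> S j" for j using SR by blast
  have xO: "x \<in> \<Omega>" using x[of 0] SO by auto
  have lo: "u x <= v j x" for j by (rule uv[OF x])
  show "(%j. v j x) \<longlonglongrightarrow> u x"
  proof (rule order_tendstoI)
   fix c assume "c < u x"
   thus "\<forall>\<^sub>F j in sequentially. c < v j x" using lo by (intro always_eventually) (auto intro: less_le_trans)
  next
   fix c assume c: "u x < c"
   define c' where "c' = (u x + c) / 2"
   have c': "u x < c'" "c' < c" using c by (auto simp: c'_def)
   have "eventually (%y. u y < c') (at x within \<Omega>)" using usc xO c'(1) unfolding usc_on_def by blast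
   hence "eventually (%y. u y < c') (at x)" by (simp only: at_within_open[OF xO \<Omega>])
   then obtain e1 where e1: "e1 > 0" "!!y. y \<noteq> x ==> dist y x < e1 ==> u y < c'" unfolding eventually_at by auto
   obtain e2 where e2: "e2 > 0" "ball x e2 \<subseteq> \<Omega>" using openE[OF \<Omega> xO] by blast
   have "(%j. r * (1/2) ^ j) \<longlonglongrightarrow> r * 0" by (intro tendsto_intros LIMSEQ_power_zero) auto
   hence "\<forall>\<^sub>F j in sequentially. r * (1/2) ^ j < min e1 e2" using e1 e2 by (intro order_tendstoD(2)[of _ 0]) auto
   thus "\<forall>\<^sub>F j in sequentially. v j x < c"
   proof (rule eventually_mono)
    fix j assume j: "r * (1/2) ^ j < min e1 e2"
    have dj: "2 * d j = r * (1/2) ^ j" by (simp add: d_def power_divide)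
    have "it k j x <= c'" for k
    proof (rule itle[OF x])
     fix y assume "dist x y < 2 * d j"
     hence y: "dist x y < e1" "dist x y < e2" using j dj by auto
     have "u y < c'" using e1(2)[of y] y c'(1) by (cases "y = x") (auto simp: dist_commute)
     moreover have "y \<in> \<Omega>" using y e2(2) by auto
     ultimately show "u0 y <= c'" by (simp add: u0_def)
    qed
    hence "wl j x <= c'" by (intro LIMSEQ_le_const2[OF itlim[OF x]]) auto
    thus "v j x < c" using c'(2) vwl[OF x] by simp
   qed
  qed
 qed
qed

section \<open>Complex Hessians of smooth plurisubharmonic functions\<close>

lemma hess_linear:
 assumes "Ck 2 u"
 shows "linear (%b. hess u x a b)" "linear (%a. hess u x a b)"
proof -
 have u2: "Ck (Suc (Suc 0)) u" using assms by (simp add: numeral_2_eq_2)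
 show "linear (%b. hess u x a b)" unfolding hess_fd by (rule fd_linear[OF Ck_fd[OF u2]])
 have d: "fd u a differentiable at x" for a using u2 by simp
 show "linear (%a. hess u x a b)"
 proof (rule linearI)
  fix a a'
  have "fd u (a + a') = (%y. fd u a y + fd u a' y)" using linear_add[OF fd_linear[OF u2]] by auto
  thus "hess u x (a + a') b = hess u x a b + hess u x a' b" unfolding hess_fd using fd_add[OF d d] by simp
 next
  fix c a
  have "fd u (c *\<^sub>R a) = (%y. c *\<^sub>R fd u a y)" using linear_cmul[OF fd_linear[OF u2]] by auto
  thus "hess u x (c *\<^sub>R a) b = c *\<^sub>R hess u x a b"
   unfolding hess_fd using fd_bounded_linear[OF bounded_linear_scaleR_right d] by simp
 qed
qed

lemma complex_vec_expand: "\<xi> = (\<Sum>j\<in>UNIV. Re (\<xi> $ j) *\<^sub>R axis j 1 + Im (\<xi> $ j) *\<^sub>R axis j \<i>)"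
proof -
 have "(\<Sum>j\<in>UNIV. Re (\<xi> $ j) *\<^sub>R axis j 1 + Im (\<xi> $ j) *\<^sub>R axis j \<i>) $ k = (\<Sum>j\<in>UNIV. if j = k then \<xi> $ k else 0)" for k
  unfolding sum_component by (rule sum.cong) (auto simp: axis_def complex_eq_iff)
 thus ?thesis by (simp add: vec_eq_iff)
qed

lemma hform_cHess:
 assumes u: "Ck 2 u"
 shows "4 * hform (cHess u x) \<xi> = hess u x \<xi> \<xi> + hess u x (\<i> *s \<xi>) (\<i> *s \<xi>)"
proof -
 note l1 = hess_linear(1)[OF u] and l2 = hess_linear(2)[OF u]
 have ex: "hess u x \<eta> \<eta> = (\<Sum>j\<in>UNIV. \<Sum>k\<in>UNIV.
    Re (\<eta> $ j) * Re (\<eta> $ k) * hess u x (axis j 1) (axis k 1) + Re (\<eta> $ j) * Im (\<eta> $ k) * hess u x (axis j 1) (axis k \<i>)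
   + Im (\<eta> $ j) * Re (\<eta> $ k) * hess u x (axis j \<i>) (axis k 1) + Im (\<eta> $ j) * Im (\<eta> $ k) * hess u x (axis j \<i>) (axis k \<i>))" for \<eta>
 proof -
  have "hess u x \<eta> \<eta> = hess u x (\<Sum>j\<in>UNIV. Re (\<eta> $ j) *\<^sub>R axis j 1 + Im (\<eta> $ j) *\<^sub>R axis j \<i>)
    (\<Sum>k\<in>UNIV. Re (\<eta> $ k) *\<^sub>R axis k 1 + Im (\<eta> $ k) *\<^sub>R axis k \<i>)"
   by (subst (1 2) complex_vec_expand[of \<eta>]) simp
  also have "... = (\<Sum>j\<in>UNIV. \<Sum>k\<in>UNIV. hess u x (Re (\<eta> $ j) *\<^sub>R axis j 1 + Im (\<eta> $ j) *\<^sub>R axis j \<i>)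
    (Re (\<eta> $ k) *\<^sub>R axis k 1 + Im (\<eta> $ k) *\<^sub>R axis k \<i>))"
   by (simp add: linear_sum[OF l2] linear_sum[OF l1]) (rule sum.swap)
  finally show ?thesis
   by (simp add: linear_add[OF l1] linear_add[OF l2] linear_cmul[OF l1] linear_cmul[OF l2] algebra_simps)
 qed
 show ?thesis
  unfolding ex hform_def hsesq_def cHess_def
  by (simp add: sum.distrib[symmetric] sum_distrib_left) (intro sum.cong refl, simp add: field_simps)
qed

lemma taylor2_line:
 assumes f: "Ck 2 (f::'a::real_normed_vector => real)" and r: "r > 0"
 obtains t where "0 < t" "t < r" "f (x + r *\<^sub>R w) = f x + r * fd f w x + r\<^sup>2 / 2 * hess f (x + t *\<^sub>R w) w w"
proof -
 have f2: "Ck (Suc (Suc 0)) f" using f by (simp add: numeral_2_eq_2)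
 define g where "g t = f (x + t *\<^sub>R w)" for t
 define diff where "diff m = (if m = 0 then g else if m = Suc 0 then (%t. fd f w (x + t *\<^sub>R w)) else (%t. hess f (x + t *\<^sub>R w) w w))" for m :: nat
 have "\<forall>m t. m < 2 \<and> 0 <= t \<and> t <= r \<longrightarrow> DERIV (diff m) t :> diff (Suc m) t"
  using line_derivative[OF f2, of x w] line_derivative[OF Ck_fd[OF f2], of w x w]
  by (auto simp: diff_def g_def[abs_def] hess_fd less_2_cases_iff)
 hence "\<exists>t. 0 < t \<and> t < r \<and> g r = (\<Sum>m<2. diff m 0 / fact m * r ^ m) + diff 2 t / fact 2 * r ^ 2"
  using r by (intro Maclaurin) (auto simp: diff_def)
 thus thesis using that by (auto simp: diff_def g_def numeral_2_eq_2 algebra_simps)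
qed

text \<open>Second-order Taylor expansion on a small circle in direction \<xi>: averaging removes
  the first-order and mixed terms and leaves, up to a small error, r^2/4 times the sum of the second
  derivatives along \<xi> and \<open>\<i> *s \<xi>\<close>, which is four times the form.\<close>

lemma psh_hpsd:
 fixes v :: "complex^'n => real"
 assumes v: "Ck 2 v" and V: "open V" "x \<in> V" and psh: "psh_on V v"
 shows "hpsd (cHess v x)"
 unfolding hpsd_def
proof (intro conjI allI)
 show "hermitian (cHess v x)" by (rule cHess_hermitian[OF v])
 fix \<xi> :: "complex^'n"
 define P Q S where "P y = hess v y \<xi> \<xi>" and "Q y = hess v y \<xi> (\<i> *s \<xi>)" and "S y = hess v y (\<i> *s \<xi>) (\<i> *s \<xi>)" for y
 define A B where "A = fd v \<xi> x" and "B = fd v (\<i> *s \<xi>) x"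
 have cont: "isCont P x" "isCont Q x" "isCont S x"
  unfolding P_def Q_def S_def using Ck_2_hess_continuous[OF v, of UNIV] by (auto simp: continuous_on_eq_continuous_at)
 have v1: "Ck (Suc 1) v" using v by (simp add: numeral_2_eq_2)
 have dir: "cis \<theta> *s \<xi> = cos \<theta> *\<^sub>R \<xi> + sin \<theta> *\<^sub>R (\<i> *s \<xi>)" for \<theta>
  by (simp add: vec_eq_iff cis_conv_exp[symmetric] complex_eq_iff)
 have hd: "hess v y (cis \<theta> *s \<xi>) (cis \<theta> *s \<xi>) = (cos \<theta>)\<^sup>2 * P y + 2 * sin \<theta> * cos \<theta> * Q y + (sin \<theta>)\<^sup>2 * S y" for y \<theta>
 proof -
  have sy: "hess v y (\<i> *s \<xi>) \<xi> = Q y" unfolding Q_def hess_fd by (rule fd_symmetric[OF v])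
  note l1 = hess_linear(1)[OF v] and l2 = hess_linear(2)[OF v]
  show ?thesis unfolding dir
   by (simp add: linear_add[OF l1] linear_add[OF l2] linear_cmul[OF l1] linear_cmul[OF l2] sy P_def[symmetric] Q_def[symmetric] S_def[symmetric] power2_eq_square algebra_simps)
 qed
 have fdir: "fd v (cis \<theta> *s \<xi>) x = cos \<theta> * A + sin \<theta> * B" for \<theta>
  unfolding dir A_def B_def using linear_add[OF fd_linear[OF v1]] linear_cmul[OF fd_linear[OF v1]] by simp
 have nrm: "norm (c *s \<xi>) = cmod c * norm \<xi>" for c by (simp add: norm_vec_def norm_mult L2_set_right_distrib)
 have key: "0 <= P x + S x + 8 * e" if e: "e > 0" for e
 proof -
  have ed: "\<exists>d>0. \<forall>y. dist y x < d \<longrightarrow> \<bar>F y - F x\<bar> < e" if "isCont F x" for F :: "complex^'n => real"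
   using that e unfolding continuous_at_eps_delta dist_real_def by blast
  obtain dP dQ dS where dd: "dP > 0" "dQ > 0" "dS > 0" "!!y. dist y x < dP ==> \<bar>P y - P x\<bar> < e"
   "!!y. dist y x < dQ ==> \<bar>Q y - Q x\<bar> < e" "!!y. dist y x < dS ==> \<bar>S y - S x\<bar> < e"
   using ed[OF cont(1)] ed[OF cont(2)] ed[OF cont(3)] by blast
  define d1 where "d1 = min dP (min dQ dS)"
  have d1: "d1 > 0" "!!y. dist y x < d1 ==> \<bar>P y - P x\<bar> < e \<and> \<bar>Q y - Q x\<bar> < e \<and> \<bar>S y - S x\<bar> < e"
   using dd by (auto simp: d1_def)
  obtain d2 where d2: "d2 > 0" "ball x d2 \<subseteq> V" using openE[OF V] by blast
  define r where "r = min d1 d2 / (2 * (norm \<xi> + 1))"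
  have r: "r > 0" using d1 d2 by (auto simp: r_def intro!: divide_pos_pos add_nonneg_pos)
  have rn: "r * norm \<xi> < min d1 d2"
  proof -
   have "r * norm \<xi> <= r * (norm \<xi> + 1)" using r by simp
   also have "... = min d1 d2 / 2" unfolding r_def by (simp add: field_simps add_nonneg_eq_0_iff)
   also have "... < min d1 d2" using d1(1) d2(1) by linarith
   finally show ?thesis .
  qed
  have "x + \<zeta> *s \<xi> \<in> V" if "cmod \<zeta> <= r" for \<zeta>
  proof -
   have "norm (\<zeta> *s \<xi>) <= r * norm \<xi>" unfolding nrm using that by (intro mult_right_mono) auto
   thus ?thesis using rn d2(2) by (auto simp: subset_iff dist_norm)
  qed
  hence sm: "v x <= circle_mean v x \<xi> r" using psh r unfolding psh_on_submean submean_def by blast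
  \<comment> \<open>The slack \<open>4 * e\<close> covers the oscillation of the second derivatives:
    e for P, e for S and 2 e for the mixed term.\<close>
  define g where "g \<theta> = v x + r * (cos \<theta> * A + sin \<theta> * B) + r\<^sup>2/2 * ((cos \<theta>)\<^sup>2 * P x + 2 * sin \<theta> * cos \<theta> * Q x + (sin \<theta>)\<^sup>2 * S x + 4 * e)" for \<theta>
  have le: "v (x + (complex_of_real r * cis \<theta>) *s \<xi>) <= g \<theta>" for \<theta>
  proof -
   obtain t where t: "0 < t" "t < r" "v (x + r *\<^sub>R (cis \<theta> *s \<xi>)) = v x + r * fd v (cis \<theta> *s \<xi>) x + r\<^sup>2 / 2 * hess v (x + t *\<^sub>R (cis \<theta> *s \<xi>)) (cis \<theta> *s \<xi>) (cis \<theta> *s \<xi>)"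
    using taylor2_line[OF v r] by blast
   define y where "y = x + t *\<^sub>R (cis \<theta> *s \<xi>)"
   have "dist y x = t * norm \<xi>" using t by (simp add: y_def dist_norm nrm)
   also have "... <= r * norm \<xi>" using t by (intro mult_right_mono) auto
   also have "... < d1" using rn by simp
   finally have D: "\<bar>P y - P x\<bar> < e" "\<bar>Q y - Q x\<bar> < e" "\<bar>S y - S x\<bar> < e" using d1(2) by auto
   have hlp: "b * t <= e" if "0 <= b" "b <= 1" "\<bar>t\<bar> < e" for b t
   proof -
    have "b * t <= b * \<bar>t\<bar>" using that by (intro mult_left_mono) auto
    also have "... <= 1 * \<bar>t\<bar>" using that by (intro mult_right_mono) auto
    finally show ?thesis using that by simp
   qed
   have "(cos \<theta>)\<^sup>2 * (P y - P x) <= e" by (rule hlp) (use D(1) in \<open>auto simp: abs_square_le_1\<close>)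
   moreover have "(sin \<theta>)\<^sup>2 * (S y - S x) <= e" by (rule hlp) (use D(3) in \<open>auto simp: abs_square_le_1\<close>)
   moreover have "2 * sin \<theta> * cos \<theta> * (Q y - Q x) <= 2 * e"
   proof -
    have "\<bar>sin \<theta> * cos \<theta>\<bar> <= 1 * 1" unfolding abs_mult by (intro mult_mono) auto
    hence "\<bar>sin \<theta> * cos \<theta>\<bar> * \<bar>Q y - Q x\<bar> <= 1 * e" using D(2) by (intro mult_mono) auto
    hence "sin \<theta> * cos \<theta> * (Q y - Q x) <= e" by (metis abs_ge_self abs_mult mult_1 order_trans)
    thus ?thesis by simp
   qed
   ultimately have "hess v y (cis \<theta> *s \<xi>) (cis \<theta> *s \<xi>) <= (cos \<theta>)\<^sup>2 * P x + 2 * sin \<theta> * cos \<theta> * Q x + (sin \<theta>)\<^sup>2 * S x + 4 * e"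
    unfolding hd by (simp add: algebra_simps)
   hence "r\<^sup>2 / 2 * hess v y (cis \<theta> *s \<xi>) (cis \<theta> *s \<xi>) <= r\<^sup>2/2 * ((cos \<theta>)\<^sup>2 * P x + 2 * sin \<theta> * cos \<theta> * Q x + (sin \<theta>)\<^sup>2 * S x + 4 * e)"
    by (intro mult_left_mono) auto
   moreover have "r *\<^sub>R (cis \<theta> *s \<xi>) = (complex_of_real r * cis \<theta>) *s \<xi>"
    by (simp add: vec_eq_iff scaleR_conv_of_real[where 'a=complex])
   ultimately show ?thesis using t(3) by (simp add: g_def fdir y_def)
  qed
  define G where "G \<theta> = v x * \<theta> + r * (A * sin \<theta> - B * cos \<theta>)
    + r\<^sup>2/2 * (P x * (\<theta>/2 + sin \<theta> * cos \<theta> / 2) + Q x * (sin \<theta>)\<^sup>2 + S x * (\<theta>/2 - sin \<theta> * cos \<theta> / 2) + 4 * e * \<theta>)" for \<theta>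
  have gi: "has_bochner_integral lborel (%\<theta>. indicator {0..2*pi} \<theta> *\<^sub>R g \<theta>) (G (2*pi) - G 0)"
  proof (rule has_bochner_integral_FTC_Icc)
   show "continuous_on {0..2*pi} g" unfolding g_def by (intro continuous_intros)
   fix \<theta> :: real
   have s2: "(sin \<theta>)\<^sup>2 = 1 - (cos \<theta>)\<^sup>2" by (rule sin_squared_eq)
   have d: "((%\<theta>. sin \<theta> * cos \<theta> / 2) has_real_derivative ((cos \<theta>)\<^sup>2 - (sin \<theta>)\<^sup>2) / 2) (at \<theta> within {0..2*pi})"
    by (auto intro!: derivative_eq_intros simp: power2_eq_square field_simps)
   have d1: "((%\<theta>. \<theta>/2 + sin \<theta> * cos \<theta> / 2) has_real_derivative (cos \<theta>)\<^sup>2) (at \<theta> within {0..2*pi})"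
    by (rule DERIV_cong[OF DERIV_add[OF _ d], of _ "1/2"]) (auto intro!: derivative_eq_intros simp: s2 field_simps)
   have d2: "((%\<theta>. \<theta>/2 - sin \<theta> * cos \<theta> / 2) has_real_derivative (sin \<theta>)\<^sup>2) (at \<theta> within {0..2*pi})"
    by (rule DERIV_cong[OF DERIV_diff[OF _ d], of _ "1/2"]) (auto intro!: derivative_eq_intros simp: s2 field_simps)
   have d3: "((%\<theta>. (sin \<theta>)\<^sup>2) has_real_derivative 2 * sin \<theta> * cos \<theta>) (at \<theta> within {0..2*pi})"
    by (auto intro!: derivative_eq_intros)
   have d4: "((%\<theta>. A * sin \<theta> - B * cos \<theta>) has_real_derivative cos \<theta> * A + sin \<theta> * B) (at \<theta> within {0..2*pi})"
    by (auto intro!: derivative_eq_intros)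
   have "(G has_real_derivative v x * 1 + r * (cos \<theta> * A + sin \<theta> * B)
     + r\<^sup>2/2 * (P x * (cos \<theta>)\<^sup>2 + Q x * (2 * sin \<theta> * cos \<theta>) + S x * (sin \<theta>)\<^sup>2 + 4 * e * 1)) (at \<theta> within {0..2*pi})"
    unfolding G_def[abs_def] by (intro DERIV_add DERIV_cmult DERIV_ident d1 d2 d3 d4)
   hence "(G has_real_derivative g \<theta>) (at \<theta> within {0..2*pi})" by (simp add: g_def mult.commute)
   thus "(G has_vector_derivative g \<theta>) (at \<theta> within {0..2*pi})"
    by (simp add: has_real_derivative_iff_has_vector_derivative)
  qed simp
  have vm: "v \<in> borel_measurable borel" using Ck_continuous[OF v] by (rule borel_measurable_continuous_onI)
  have cv: "continuous_on UNIV (%\<theta>. v (x + (complex_of_real r * cis \<theta>) *s \<xi>))"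
   unfolding vector_scalar_mult_def by (intro continuous_on_compose2[OF Ck_continuous[OF v, of UNIV]] continuous_intros) auto
  have "(LBINT \<theta>. indicator {0..2*pi} \<theta> * v (x + (complex_of_real r * cis \<theta>) *s \<xi>)) <= (LBINT \<theta>. indicator {0..2*pi} \<theta> *\<^sub>R g \<theta>)"
  proof (rule integral_mono)
   have "integrable lborel (%\<theta>. indicator {0..2*pi} \<theta> *\<^sub>R v (x + (complex_of_real r * cis \<theta>) *s \<xi>))"
    by (rule borel_integrable_compact) (auto intro: continuous_on_subset[OF cv])
   thus "integrable lborel (%\<theta>. indicator {0..2*pi} \<theta> * v (x + (complex_of_real r * cis \<theta>) *s \<xi>))" by simp
   show "integrable lborel (%\<theta>. indicator {0..2*pi} \<theta> *\<^sub>R g \<theta>)" using gi by (simp add: has_bochner_integral_iff)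
  qed (use le in \<open>auto simp: indicator_def\<close>)
  also have "... = G (2*pi) - G 0" using gi by (simp add: has_bochner_integral_iff)
  also have "... = 2 * pi * v x + r\<^sup>2/2 * (pi * (P x + S x + 8 * e))" by (simp add: G_def algebra_simps)
  finally have "circle_mean v x \<xi> r <= (1/(2*pi)) * (2 * pi * v x + r\<^sup>2/2 * (pi * (P x + S x + 8 * e)))"
   unfolding circle_mean_Icc by (intro mult_left_mono) auto
  also have "... = v x + r\<^sup>2/4 * (P x + S x + 8 * e)" by (simp add: field_simps)
  finally have "0 <= r\<^sup>2/4 * (P x + S x + 8 * e)" using sm by simp
  thus ?thesis using r by (simp add: zero_le_mult_iff)
 qed
 have "0 <= P x + S x"
 proof (rule field_le_epsilon)
  fix e :: real assume "e > 0"
  thus "0 <= P x + S x + e" using key[of "e / 8"] by simp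
 qed
 thus "0 <= hform (cHess v x) \<xi>" using hform_cHess[OF v, of x \<xi>] by (simp add: P_def S_def)
qed

lemma MA_density_nonneg: "hpsd (cHess v x) ==> 0 <= MA_density v x"
 by (simp add: MA_density_def hpsd_det(2))

lemma continuous_MA_density: "Ck 2 v ==> continuous_on S (MA_density v)"
 unfolding MA_density_def[abs_def] by (intro continuous_intros continuous_det continuous_cHess)

lemma MA_density_cong_open:
 assumes "open U" "x \<in> U" "!!y. y \<in> U ==> f y = g y"
 shows "MA_density f x = MA_density g x"
 using cHess_cong_open[OF assms] by (simp add: MA_density_def)

section \<open>Paraboloids and energies of decreasing sequences\<close>

definition parab :: "complex^'n => real => real => complex^'n => real" where
 "parab a A B x = A * ((x - a) \<bullet> (x - a)) - B"

lemma Ck_parab: "Ck k (parab a A B)"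
 unfolding parab_def[abs_def] by (intro Ck_diff Ck_mult Ck_inner Ck_const Ck_id)

lemma hess_parab: "hess (parab a A B) x p q = 2 * A * (p \<bullet> q)"
proof -
 have 1: "fd (parab a A B) p = (%x. 2 * A * ((x - a) \<bullet> p))" for p
  unfolding parab_def[abs_def]
  by (rule ext, rule fd_eqI) (auto intro!: derivative_eq_intros simp: inner_commute algebra_simps)
 show ?thesis unfolding hess_fd 1
  by (rule fd_eqI) (auto intro!: derivative_eq_intros simp: inner_commute)
qed

lemma cHess_parab: "cHess (parab a A B) x = A *\<^sub>R mat 1"
 by (auto simp: vec_eq_iff cHess_def hess_parab mat_def inner_axis_axis inner_complex_def complex_eq_iff)

lemma hpsd_parab: "0 <= A ==> hpsd (cHess (parab a A B) x)"
 unfolding cHess_parab hpsd_def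
 by (auto simp: hform_scaleR hform_mat_1 intro!: hermitian_scaleR hermitian_mat_1)

lemma MA_density_parab: "MA_density (parab a A B :: complex^'n => real) x = 4 ^ CARD('n) * fact CARD('n) * A ^ CARD('n)"
proof -
 have "det (A *\<^sub>R mat 1 :: complex^'n^'n) = (\<Prod>i\<in>UNIV. (A *\<^sub>R mat 1 :: complex^'n^'n) $ i $ i)"
  by (rule det_diagonal) (simp add: mat_def)
 thus ?thesis by (simp add: MA_density_def cHess_parab mat_def scaleR_conv_of_real[where 'a=complex])
qed

text \<open>This replaces quasi-continuity: by monotonicity the numbers \<open>a i l = \<integral> v_i (dd^c v_l)^n\<close> decrease in both indices.\<close>
lemma decreasing_energy_small:
 fixes v :: "nat => complex^'n => real"
 assumes v: "!!j. Ck 3 (v j)" and psd: "!!j x. x \<in> cball a \<rho> ==> hpsd (cHess (v j) x)"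
  and dec: "!!j x. x \<in> cball a \<rho> ==> v (Suc j) x <= v j x" and M: "!!j x. \<bar>v j x\<bar> <= M"
  and \<rho>: "\<rho> > 0" and \<kappa>: "\<kappa> > 0"
 shows "\<exists>i. \<forall>\<^sub>F l in sequentially. (LBINT x. indicator (ball a (\<rho>/2)) x * ((v i x - v l x) * MA_density (v l) x)) <= \<kappa>"
proof -
 define K where "K = cball a \<rho>"
 have cK: "compact K" by (simp add: K_def)
 \<comment> \<open>The paraboloid p is then at most -(M + 3) on the half ball and at least M + 3
   outside the ball. Gaps of 3 are what \<open>rmax 1\<close> needs to coincide with
   \<open>v j\<close> inside and with p outside, so all \<open>w j\<close> agree off
   \<open>K\<close>.\<close>
 define A where "A = 4 * (M + 3) / \<rho>\<^sup>2"
 have M0: "0 <= M" using M[of 0 0] by simp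
 have A: "A * \<rho>\<^sup>2 / 4 = M + 3" "A \<ge> 0" using \<rho> M0 by (auto simp: A_def)
 define p where "p = parab a A (A * \<rho>\<^sup>2 / 2)"
 have pC: "Ck 3 p" unfolding p_def by (rule Ck_parab)
 define w where "w j x = rmax 1 (v j x) (p x)" for j x
 have wC: "Ck 3 (w j)" for j unfolding w_def[abs_def] by (rule Ck_rmax[OF v pC])
 have w2: "Ck 2 (w j)" for j using Ck_le[OF _ wC, of 2] by simp
 have p_eq: "p x = A * (norm (x - a))\<^sup>2 - A * \<rho>\<^sup>2 / 2" for x by (simp add: p_def parab_def dot_square_norm)
 have win: "w j x = v j x" if "norm (x - a) <= \<rho>/2" for j x
 proof -
  have "(norm (x - a))\<^sup>2 <= (\<rho>/2)\<^sup>2" using that by (intro power_mono) auto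
  hence "A * (norm (x - a))\<^sup>2 <= A * (\<rho>/2)\<^sup>2" using A by (intro mult_left_mono) auto
  hence "p x <= - (A * \<rho>\<^sup>2 / 4)" unfolding p_eq by (simp add: power_divide)
  thus ?thesis unfolding w_def using M[of j x] A(1) by (intro rmax_eq_left) auto
 qed
 have wout: "w j x = p x" if "\<rho> <= norm (x - a)" for j x
 proof -
  have "\<rho>\<^sup>2 <= (norm (x - a))\<^sup>2" using that \<rho> by (intro power_mono) auto
  hence "A * \<rho>\<^sup>2 <= A * (norm (x - a))\<^sup>2" using A by (intro mult_left_mono) auto
  moreover have "0 <= A * \<rho>\<^sup>2" using A(2) by (intro mult_nonneg_nonneg) auto
  ultimately have "A * \<rho>\<^sup>2 / 4 <= p x" unfolding p_eq by linarith
  thus ?thesis unfolding w_def using M[of j x] A(1) by (intro rmax_eq_right) auto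
 qed
 have wpsd: "hpsd (cHess (w j) x)" if "x \<in> K" for j x
  unfolding w_def[abs_def]
  by (rule rmax_psd(1)[OF v pC]) (use that psd hpsd_parab[OF A(2)] in \<open>auto simp: K_def p_def\<close>)
 have wdec1: "w (Suc j) x <= w j x" for j x
 proof (cases "x \<in> K")
  case True
  thus ?thesis unfolding w_def using dec by (intro rmax_mono) (auto simp: K_def)
 next
  case False
  thus ?thesis using wout[of x] by (auto simp: K_def dist_norm norm_minus_commute)
 qed
 have wdec: "w l x <= w i x" if "i <= l" for i l x
  using that by (induction rule: dec_induct) (auto intro: order_trans[OF wdec1])
 have weq: "w l x = w i x" if "x \<notin> K" for i l x
  using that wout[of x] by (auto simp: K_def dist_norm norm_minus_commute)
 have MAeq: "MA_density (w l) x = MA_density (w i) x" if "x \<notin> K" for i l x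
  by (rule MA_density_cong_open[of "- K"]) (use that weq compact_imp_closed[OF cK] in auto)
 have wM: "- M <= w j x" for j x
  using rmax_ge(1)[of 1 "v j x" "p x"] M[of j x] by (auto simp: w_def)
 define I where "I f = (LBINT x. indicator K x *\<^sub>R f x)" for f :: "complex^'n => real"
 have int: "integrable lborel (%x. indicator K x *\<^sub>R f x)" if "continuous_on UNIV f" for f :: "complex^'n => real"
  using that by (intro borel_integrable_compact cK) (auto intro: continuous_on_subset)
 have cw: "continuous_on UNIV (w j)" for j by (rule Ck_continuous[OF wC])
 have cm: "continuous_on UNIV (MA_density (w j))" for j by (rule continuous_MA_density[OF w2])
 have Idiff: "I f - I g = I (%x. f x - g x)" if "continuous_on UNIV f" "continuous_on UNIV g" for f g
  unfolding I_def using int[OF that(1)] int[OF that(2)]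
  by (subst Bochner_Integration.integral_diff[symmetric]) (auto simp: algebra_simps)
 have Imono: "I f <= I g" if "continuous_on UNIV f" "continuous_on UNIV g" "!!x. x \<in> K ==> f x <= g x" for f g
  unfolding I_def by (rule integral_mono[OF int[OF that(1)] int[OF that(2)]]) (use that(3) in \<open>auto simp: indicator_def\<close>)
 define a' where "a' i l = I (%x. w i x * MA_density (w l) x)" for i l
 have full: "I (%x. f x * (MA_density (w l) x - MA_density (w i) x)) = (LBINT x. f x * (MA_density (w l) x - MA_density (w i) x))" for f i l
  unfolding I_def by (intro Bochner_Integration.integral_cong) (auto simp: indicator_def MAeq[of _ l i])
 have a_dec: "a' i l' <= a' i l" if "l <= l'" for i l l'
 proof -
  have "(LBINT x. w i x * (MA_density (w l') x - MA_density (w l) x)) <= 0"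
   by (rule MA_integral_antimono[OF wC wC wC cK weq wdec[OF that] wpsd wpsd wpsd])
  moreover have "a' i l' - a' i l = I (%x. w i x * (MA_density (w l') x - MA_density (w l) x))"
   unfolding a'_def by (subst Idiff) (auto intro!: continuous_intros cw cm simp: algebra_simps)
  ultimately show ?thesis using full[of "w i" l' l] by simp
 qed
 define m where "m = I (MA_density (w 0))"
 have mass: "I (MA_density (w l)) = m" for l
 proof -
  have "(LBINT x. (MA_density (w l) x - MA_density (w 0) x)) = 0"
   by (rule MA_mass_eq[OF wC wC cK weq wdec wpsd wpsd]) auto
  moreover have "I (MA_density (w l)) - m = I (%x. 1 * (MA_density (w l) x - MA_density (w 0) x))"
   unfolding m_def by (subst Idiff) (auto intro!: cm)
  ultimately show ?thesis using full[of "%_. 1" l 0] by simp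
 qed
 have a_low: "- M * m <= a' i l" for i l
 proof -
  have "I (%x. - M * MA_density (w l) x) <= a' i l"
   unfolding a'_def
  proof (rule Imono)
   fix x assume "x \<in> K"
   from mult_right_mono[OF wM[of i x] MA_density_nonneg[OF wpsd[OF this, of l]]]
   show "- M * MA_density (w l) x <= w i x * MA_density (w l) x" by simp
  qed (auto intro!: continuous_intros cw cm)
  moreover have "I (%x. - M * MA_density (w l) x) = - M * m"
  proof -
   have "I (%x. - M * MA_density (w l) x) = - M * I (MA_density (w l))"
    unfolding I_def by (simp add: mult.left_commute)
   thus ?thesis by (simp add: mass)
  qed
  ultimately show ?thesis by simp
 qed
 define L where "L i = (INF l. a' i l)" for i
 have bdd: "bdd_below (range (a' i))" for i using a_low by (intro bdd_belowI[of _ "- M * m"]) auto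
 have L_le: "L i <= a' i l" for i l unfolding L_def by (rule cINF_lower[OF bdd]) simp
 have L_low: "- M * m <= L i" for i unfolding L_def by (rule cINF_greatest) (use a_low in auto)
 \<comment> \<open>The index i is nearly optimal for the infimum over both indices:
   \<open>a' i l\<close> comes within \<kappa> of \<open>L0\<close> for large l, while
   \<open>a' l l\<close> stays above \<open>L0\<close>.\<close>
 define L0 where "L0 = (INF i. L i)"
 have bdd0: "bdd_below (range L)" using L_low by (intro bdd_belowI[of _ "- M * m"]) auto
 obtain i where i: "L i < L0 + \<kappa> / 2"
  using cINF_less_iff[OF _ bdd0, of "L0 + \<kappa>/2"] \<kappa> by (auto simp: L0_def)
 obtain l0 where l0: "a' i l0 < L i + \<kappa> / 2"
  using cINF_less_iff[OF _ bdd[of i], of "L i + \<kappa>/2"] \<kappa> by (auto simp: L_def)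
 have "(LBINT x. indicator (ball a (\<rho>/2)) x * ((v i x - v l x) * MA_density (v l) x)) <= \<kappa>" if l: "l0 <= l" "i <= l" for l
 proof -
  have vw: "MA_density (v l) x = MA_density (w l) x" if "x \<in> ball a (\<rho>/2)" for x
   by (rule MA_density_cong_open[of "ball a (\<rho>/2)"]) (use that win in \<open>auto simp: dist_norm norm_minus_commute\<close>)
  have sub: "ball a (\<rho>/2) \<subseteq> K" using \<rho> by (auto simp: K_def)
  have ic: "integrable lborel (%x. indicator K x *\<^sub>R ((w i x - w l x) * MA_density (w l) x))"
   by (intro int continuous_intros cw cm)
  have "(LBINT x. indicator (ball a (\<rho>/2)) x * ((v i x - v l x) * MA_density (v l) x))
    = (LBINT x. indicator (ball a (\<rho>/2)) x * (indicator K x *\<^sub>R ((w i x - w l x) * MA_density (w l) x)))"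
  proof (intro Bochner_Integration.integral_cong refl)
   fix x
   show "indicator (ball a (\<rho>/2)) x * ((v i x - v l x) * MA_density (v l) x)
    = indicator (ball a (\<rho>/2)) x * (indicator K x *\<^sub>R ((w i x - w l x) * MA_density (w l) x))"
   proof (cases "x \<in> ball a (\<rho>/2)")
    case True
    hence "norm (x - a) <= \<rho>/2" "x \<in> K" using sub by (auto simp: dist_norm norm_minus_commute)
    thus ?thesis using win vw[OF True] by simp
   qed simp
  qed
  also have "... <= I (%x. (w i x - w l x) * MA_density (w l) x)"
   unfolding I_def
  proof (rule integral_mono)
   show "integrable lborel (%x. indicator (ball a (\<rho>/2)) x * (indicator K x *\<^sub>R ((w i x - w l x) * MA_density (w l) x)))"
    using integrable_mult_indicator[OF _ ic, of "ball a (\<rho>/2)"] by simp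
   fix x
   have "0 <= indicator K x *\<^sub>R ((w i x - w l x) * MA_density (w l) x)"
    using wdec[OF l(2), of x] MA_density_nonneg[OF wpsd[of x l]] by (auto simp: indicator_def)
   thus "indicator (ball a (\<rho>/2)) x * (indicator K x *\<^sub>R ((w i x - w l x) * MA_density (w l) x)) <= indicator K x *\<^sub>R ((w i x - w l x) * MA_density (w l) x)"
    by (auto simp: indicator_def)
  qed (rule ic)
  also have "... = a' i l - a' l l"
   unfolding a'_def by (subst Idiff) (auto intro!: continuous_intros cw cm simp: algebra_simps)
  also have "... <= a' i l0 - L0"
   using a_dec[OF l(1), of i] L_le[of l l] cINF_lower[OF bdd0, of l] by (auto simp: L0_def)
  also have "... <= \<kappa>" using i l0 by simp
  finally show ?thesis .
 qed
 thus ?thesis by (intro exI[of _ i] eventually_sequentiallyI[of "max l0 i"]) auto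
qed

section \<open>Convex subsolutions and their upper envelope\<close>

lemma hess_nonneg_hpsd: "Ck 2 u ==> (!!a. 0 <= hess u x a a) ==> hpsd (cHess u x)"
 unfolding hpsd_def using hform_cHess[of u x] cHess_hermitian[of u x]
 by (metis add_nonneg_nonneg mult_le_0_iff not_numeral_le_zero zero_le_mult_iff)

lemma hess_nonneg_convex_on:
 fixes u :: "'a::real_normed_vector => real"
 assumes u: "Ck 2 u" and B: "convex B" and h: "!!x a. x \<in> B ==> 0 <= hess u x a a"
 shows "convex_on B u"
proof (rule convex_onI[OF _ B])
 fix t :: real and x y assume t: "0 < t" "t < 1" and xy: "x \<in> B" "y \<in> B"
 have u2: "Ck (Suc (Suc 0)) u" using u by (simp add: numeral_2_eq_2)
 have seg: "x + s *\<^sub>R (y - x) \<in> B" if "s \<in> {0..1}" for s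
  using convexD_alt[OF B xy, of s] that by (simp add: algebra_simps)
 have "convex_on {0..1} (%s. u (x + s *\<^sub>R (y - x)))"
 proof (rule f''_ge0_imp_convex)
  show "((%s. u (x + s *\<^sub>R (y - x))) has_real_derivative fd u (y - x) (x + s *\<^sub>R (y - x))) (at s)" for s
   by (rule line_derivative[OF u2])
  show "((%s. fd u (y - x) (x + s *\<^sub>R (y - x))) has_real_derivative hess u (x + s *\<^sub>R (y - x)) (y - x) (y - x)) (at s)" for s
   unfolding hess_fd by (rule line_derivative[OF Ck_fd[OF u2]])
 qed (use h seg in auto)
 from convex_onD[OF this, of t 0 1] t
 show "u ((1 - t) *\<^sub>R x + t *\<^sub>R y) <= (1 - t) * u x + t * u y" by (simp add: algebra_simps)
qed

text \<open>Real convexity, stronger than plurisubharmonicity, provides the tangent planes that the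
  contact set asks for and local Lipschitz bounds.\<close>

definition cvx_sub :: "(complex^'n => real) => complex^'n => real => (complex^'n => real) set" where
 "cvx_sub g c R = {\<psi>. Ck 3 \<psi> \<and> (\<forall>x\<in>ball c R. (\<forall>a. 0 <= hess \<psi> x a a) \<and> g x <= MA_density \<psi> x \<and> \<psi> x <= 0)}"

lemma cvx_sub_convex: "\<psi> \<in> cvx_sub g c R ==> convex_on (ball c R) \<psi>"
 by (rule hess_nonneg_convex_on) (auto simp: cvx_sub_def intro: Ck_le[of 2 3])

definition perron :: "(complex^'n => real) => complex^'n => real => complex^'n => real" where
 "perron g c R x = (SUP \<psi>\<in>cvx_sub g c R. \<psi> x)"

lemma hess_minus_const: "Ck 2 u ==> hess (%x. u x - k) x a b = hess u x a b"
proof -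
 assume "Ck 2 u"
 hence u2: "Ck (Suc (Suc 0)) u" by (simp add: numeral_2_eq_2)
 have "fd (%x. u x - k) a = fd u a" for a
  by (rule ext, rule fd_eqI) (auto intro!: derivative_eq_intros Ck_derivative[OF u2])
 thus ?thesis by (simp add: hess_fd)
qed

lemma MA_minus_const: "Ck 2 u ==> MA_density (%x. u x - k) x = MA_density u x"
 by (simp add: MA_density_def cHess_def hess_minus_const)

text \<open>The regularised maximum exceeds the maximum by at most e; subtracting e keeps the
  function non-positive.\<close>

lemma cvx_sub_combine:
 assumes "\<psi>1 \<in> cvx_sub g c R" "\<psi>2 \<in> cvx_sub g c R" "e > 0"
 shows "\<exists>\<psi>\<in>cvx_sub g c R. \<forall>x. \<psi>1 x - e <= \<psi> x \<and> \<psi>2 x - e <= \<psi> x"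
proof (intro bexI[of _ "%x. rmax e (\<psi>1 x) (\<psi>2 x) - e"] allI conjI)
 have C: "Ck 3 \<psi>1" "Ck 3 \<psi>2" using assms by (auto simp: cvx_sub_def)
 have C2: "Ck 2 \<psi>1" "Ck 2 \<psi>2" using C by (auto intro: Ck_le[of 2 3])
 have Cr: "Ck 3 (%x. rmax e (\<psi>1 x) (\<psi>2 x))" by (rule Ck_rmax[OF C])
 have Cr2: "Ck 2 (%x. rmax e (\<psi>1 x) (\<psi>2 x))" using Cr by (rule Ck_le[rotated]) simp
 show "(%x. rmax e (\<psi>1 x) (\<psi>2 x) - e) \<in> cvx_sub g c R"
  unfolding cvx_sub_def mem_Collect_eq
 proof (intro conjI ballI allI)
  show "Ck 3 (%x. rmax e (\<psi>1 x) (\<psi>2 x) - e)" by (intro Ck_diff Cr Ck_const)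
  fix x assume x: "x \<in> ball c R"
  have h: "0 <= hess \<psi>1 x a a" "0 <= hess \<psi>2 x a a" for a using assms x by (auto simp: cvx_sub_def)
  show "0 <= hess (%x. rmax e (\<psi>1 x) (\<psi>2 x) - e) x a a" for a
   unfolding hess_minus_const[OF Cr2] hess_rmax[OF C assms(3)]
   using h kap1_bounds kap2_nonneg assms(3)
   by (intro add_nonneg_nonneg mult_nonneg_nonneg divide_nonneg_pos zero_le_square) auto
  have "g x <= min (MA_density \<psi>1 x) (MA_density \<psi>2 x)" using assms x by (auto simp: cvx_sub_def)
  also have "... <= MA_density (%x. rmax e (\<psi>1 x) (\<psi>2 x)) x"
   by (rule rmax_psd(2)[OF C assms(3)]) (use h hess_nonneg_hpsd C2 in auto)
  finally show "g x <= MA_density (%x. rmax e (\<psi>1 x) (\<psi>2 x) - e) x" by (simp add: MA_minus_const[OF Cr2])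
  show "rmax e (\<psi>1 x) (\<psi>2 x) - e <= 0"
  proof -
   have "\<psi>1 x <= 0" "\<psi>2 x <= 0" using assms x by (auto simp: cvx_sub_def)
   thus ?thesis using rmax_le[OF assms(3), of "\<psi>1 x" "\<psi>2 x"] by linarith
  qed
 qed
 fix x
 show "\<psi>1 x - e <= rmax e (\<psi>1 x) (\<psi>2 x) - e" "\<psi>2 x - e <= rmax e (\<psi>1 x) (\<psi>2 x) - e"
  using rmax_ge[OF assms(3)] by auto
qed

lemma cvx_sub_combine_finite:
 assumes "finite F" "F \<noteq> {}" "F \<subseteq> cvx_sub g c R"
 shows "e > 0 ==> \<exists>\<psi>\<in>cvx_sub g c R. \<forall>\<psi>'\<in>F. \<forall>x. \<psi>' x - e <= \<psi> x"
 using assms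
proof (induction F arbitrary: e rule: finite_ne_induct)
 case (singleton \<psi>)
 thus ?case by (intro bexI[of _ \<psi>]) auto
next
 case (insert \<psi>0 F)
 obtain \<psi>1 where p1: "\<psi>1 \<in> cvx_sub g c R" "\<forall>\<psi>'\<in>F. \<forall>x. \<psi>' x - e/2 <= \<psi>1 x"
  using insert.IH[of "e/2"] insert.prems by auto
 obtain \<psi> where p: "\<psi> \<in> cvx_sub g c R" "\<forall>x. \<psi>0 x - e/2 <= \<psi> x \<and> \<psi>1 x - e/2 <= \<psi> x"
  using cvx_sub_combine[of \<psi>0 g c R \<psi>1 "e/2"] p1(1) insert.prems by auto
 have "\<psi>' x - e <= \<psi> x" if "\<psi>' \<in> insert \<psi>0 F" for \<psi>' x
 proof (cases "\<psi>' = \<psi>0")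
  case True
  thus ?thesis using p(2)[rule_format, of x] insert.prems(1) by simp
 next
  case False
  hence "\<psi>' x - e/2 <= \<psi>1 x" using that p1(2) by auto
  thus ?thesis using p(2)[rule_format, of x] by simp
 qed
 thus ?case using p(1) by blast
qed

locale perron_setup =
 fixes g :: "complex^'n => real" and c :: "complex^'n" and R :: real
 assumes R: "R > 0" and g: "continuous_on UNIV g" and gpos: "!!x. 0 < g x"
begin

abbreviation "B \<equiv> ball c R"
abbreviation "\<Phi> \<equiv> perron g c R"

lemma barrier: "\<exists>A\<ge>0. parab c A (A * R\<^sup>2) \<in> cvx_sub g c R"
proof -
 have "bounded (g ` cball c R)" by (intro compact_imp_bounded compact_continuous_image continuous_on_subset[OF g]) auto
 then obtain G where "\<forall>y\<in>g ` cball c R. norm y <= G" unfolding bounded_iff by blast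
 hence G: "g x <= G" if "x \<in> cball c R" for x
  using that by (metis abs_ge_self imageI order_trans real_norm_def)
 define A where "A = max 1 G"
 have A: "A \<ge> 1" "G <= A" by (auto simp: A_def)
 have "G <= 4 ^ CARD('n) * fact CARD('n) * A ^ CARD('n)"
 proof -
  have one: "1 <= (4 ^ CARD('n) * fact CARD('n) :: real)"
   using mult_mono[OF one_le_power[of "4::real" "CARD('n)"] fact_ge_1[of "CARD('n)"]] by simp
  have "A <= A ^ CARD('n)" using A by (simp add: self_le_power)
  also have "... <= (4 ^ CARD('n) * fact CARD('n)) * A ^ CARD('n)"
   using mult_right_mono[OF one, of "A ^ CARD('n)"] A by simp
  finally show ?thesis using A by simp
 qed
 moreover have "parab c A (A * R\<^sup>2) x <= 0" if "x \<in> B" for x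
 proof -
  have "(norm (x - c))\<^sup>2 <= R\<^sup>2" using that by (intro power_mono) (auto simp: dist_norm norm_minus_commute)
  thus ?thesis using A by (simp add: parab_def dot_square_norm mult_left_mono)
 qed
 ultimately have "parab c A (A * R\<^sup>2) \<in> cvx_sub g c R"
  unfolding cvx_sub_def using G A by (auto simp: Ck_parab hess_parab MA_density_parab intro!: order_trans[OF G])
 thus ?thesis using A by (intro exI[of _ A]) auto
qed

lemma cvx_sub_nonempty: "cvx_sub g c R \<noteq> {}" using barrier by blast

lemma bdd: "x \<in> B ==> bdd_above ((%\<psi>. \<psi> x) ` cvx_sub g c R)"
 by (intro bdd_aboveI[of _ 0]) (auto simp: cvx_sub_def)

lemma perron_ge: "\<psi> \<in> cvx_sub g c R ==> x \<in> B ==> \<psi> x <= \<Phi> x"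
 unfolding perron_def by (rule cSUP_upper[OF _ bdd])

lemma perron_approx: "x \<in> B ==> y < \<Phi> x ==> \<exists>\<psi>\<in>cvx_sub g c R. y < \<psi> x"
 unfolding perron_def using less_cSUP_iff[OF cvx_sub_nonempty bdd] by blast

lemma perron_convex: "convex_on B \<Phi>"
proof (rule convex_onI[OF _ convex_ball])
 fix t :: real and x y assume t: "0 < t" "t < 1" and xy: "x \<in> B" "y \<in> B"
 have z: "(1 - t) *\<^sub>R x + t *\<^sub>R y \<in> B" using convexD_alt[OF convex_ball xy, of t] t by simp
 show "\<Phi> ((1 - t) *\<^sub>R x + t *\<^sub>R y) <= (1 - t) * \<Phi> x + t * \<Phi> y"
  unfolding perron_def[of g c R "(1 - t) *\<^sub>R x + t *\<^sub>R y"]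
 proof (rule cSUP_least[OF cvx_sub_nonempty])
  fix \<psi> assume \<psi>: "\<psi> \<in> cvx_sub g c R"
  have "\<psi> ((1 - t) *\<^sub>R x + t *\<^sub>R y) <= (1 - t) * \<psi> x + t * \<psi> y"
   using convex_onD[OF cvx_sub_convex[OF \<psi>], of t x y] t xy by simp
  also have "... <= (1 - t) * \<Phi> x + t * \<Phi> y"
   using t perron_ge[OF \<psi>] xy by (intro add_mono mult_left_mono) auto
  finally show "\<psi> ((1 - t) *\<^sub>R x + t *\<^sub>R y) <= (1 - t) * \<Phi> x + t * \<Phi> y" .
 qed
qed

lemma perron_continuous: "continuous_on B \<Phi>"
 by (rule convex_on_continuous[OF open_ball perron_convex])

text \<open>Gluing the regularised maximum of a member of the family and a slightly raised q into D
  gives another member, so even the raised q stays below the envelope.\<close>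

lemma perron_min_principle:
 assumes D: "open D" "closure D \<subseteq> B"
  and q: "Ck 3 q" "!!x a. x \<in> D ==> 0 <= hess q x a a" "!!x. x \<in> D ==> g x <= MA_density q x"
  and fr: "!!x. x \<in> frontier D ==> q x < \<Phi> x" and x: "x \<in> D"
 shows "q x < \<Phi> x"
proof -
 have bD: "bounded D" using D(2) bounded_subset[OF bounded_ball] closure_subset by blast
 have cF: "compact (frontier D)" using bD by (rule compact_frontier_bounded)
 have FB: "frontier D \<subseteq> B" using D(2) by (auto simp: frontier_def)
 have DB: "D \<subseteq> B" using D(2) closure_subset by blast
 have FD: "frontier D \<inter> D = {}" using D(1) by (auto simp: frontier_def interior_open)
 have exit: "\<exists>d>0. x + d *\<^sub>R l \<in> frontier D" if "x \<in> D" "l \<noteq> 0" for x l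
  using ray_to_frontier[OF bD _ that(2), of x] that(1) D(1) by (metis interior_open)
 have Fne: "frontier D \<noteq> {}" using exit[OF x, of "axis undefined 1"] by (auto simp: axis_eq_0_iff)
 have cq: "continuous_on UNIV q" using Ck_continuous[OF q(1)] .
 have "continuous_on (frontier D) (%x. \<Phi> x - q x)"
  by (intro continuous_intros continuous_on_subset[OF perron_continuous FB] continuous_on_subset[OF cq]) auto
 from continuous_attains_inf[OF cF Fne this] obtain x1 where x1: "x1 \<in> frontier D" "!!y. y \<in> frontier D ==> \<Phi> x1 - q x1 <= \<Phi> y - q y" by blast
 \<comment> \<open>The least gap on the frontier is \<open>5 * \<eta>\<close>: shares of \<eta> go
   to approximating the envelope by members, to combining finitely many of them, to raising q and to
   the transition zone \<open>3 * (\<eta>/3)\<close> of \<open>rmax\<close>.\<close>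
 define \<eta> where "\<eta> = (\<Phi> x1 - q x1) / 5"
 have \<eta>: "\<eta> > 0" using fr[OF x1(1)] by (simp add: \<eta>_def)
 have gap: "q y + 4 * \<eta> < \<Phi> y" if "y \<in> frontier D" for y
 proof -
  have "5 * \<eta> = \<Phi> x1 - q x1" by (simp add: \<eta>_def)
  thus ?thesis using x1(2)[OF that] \<eta> by linarith
 qed
 have "\<forall>y\<in>frontier D. \<exists>\<psi>\<in>cvx_sub g c R. q y + 4 * \<eta> < \<psi> y"
  using perron_approx gap FB by blast
 then obtain \<Psi> where \<Psi>: "!!y. y \<in> frontier D ==> \<Psi> y \<in> cvx_sub g c R \<and> q y + 4 * \<eta> < \<Psi> y y" by metis
 have op: "open {z. q z + 4 * \<eta> < \<Psi> y z}" if "y \<in> frontier D" for y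
 proof -
  have "Ck 3 (\<Psi> y)" using \<Psi>[OF that] by (simp add: cvx_sub_def)
  thus ?thesis by (intro open_Collect_less continuous_intros cq Ck_continuous[of 3])
 qed
 obtain F where F: "F \<subseteq> frontier D" "finite F" "frontier D \<subseteq> (\<Union>y\<in>F. {z. q z + 4 * \<eta> < \<Psi> y z})"
  by (rule compactE_image[OF cF, of "frontier D" "%y. {z. q z + 4 * \<eta> < \<Psi> y z}"]) (use op \<Psi> in auto)
 have "F \<noteq> {}" using F(3) Fne by auto
 then obtain \<psi> where \<psi>: "\<psi> \<in> cvx_sub g c R" "\<forall>\<psi>'\<in>\<Psi> ` F. \<forall>x. \<psi>' x - \<eta> <= \<psi> x"
  using cvx_sub_combine_finite[of "\<Psi> ` F" g c R \<eta>] F \<Psi> \<eta> by blast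
 have \<psi>F: "q y + 2 * \<eta> < \<psi> y" if "y \<in> frontier D" for y
 proof -
  obtain y' where y': "y' \<in> F" "q y + 4 * \<eta> < \<Psi> y' y" using F(3) \<open>y \<in> frontier D\<close> by auto
  have "\<Psi> y' y - \<eta> <= \<psi> y" using \<psi>(2) y'(1) by blast
  thus ?thesis using y'(2) \<eta> by linarith
 qed
 have \<psi>C: "Ck 3 \<psi>" using \<psi>(1) by (simp add: cvx_sub_def)
 define N where "N = {z. q z + 2 * \<eta> < \<psi> z}"
 have oN: "open N" unfolding N_def by (intro open_Collect_less continuous_intros cq Ck_continuous[OF \<psi>C])
 define q1 where "q1 x = q x + \<eta>" for x
 have q1C: "Ck 3 q1" unfolding q1_def[abs_def] by (intro Ck_add q(1) Ck_const)
 define m where "m x = rmax (\<eta>/3) (\<psi> x) (q1 x)" for x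
 have mC: "Ck 3 m" unfolding m_def[abs_def] by (rule Ck_rmax[OF \<psi>C q1C])
 have mN: "m z = \<psi> z" if "z \<in> N" for z
  unfolding m_def by (rule rmax_eq_left) (use that \<eta> in \<open>auto simp: N_def q1_def\<close>)
 define \<psi>' where "\<psi>' z = (if z \<in> D then m z else \<psi> z)" for z
 have loc: "\<exists>U. open U \<and> z \<in> U \<and> ((z \<in> D \<and> (\<forall>y\<in>U. \<psi>' y = m y)) \<or> (\<forall>y\<in>U. \<psi>' y = \<psi> y))" for z
 proof -
  consider "z \<in> D" | "z \<in> frontier D" | "z \<notin> closure D" using closure_Un_frontier by blast
  thus ?thesis
  proof cases
   case 1 thus ?thesis using D(1) by (intro exI[of _ D]) (auto simp: \<psi>'_def)
  next
   case 2 thus ?thesis using oN \<psi>F mN by (intro exI[of _ N]) (auto simp: \<psi>'_def N_def)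
  next
   case 3 thus ?thesis using closure_subset[of D] by (intro exI[of _ "- closure D"]) (auto simp: \<psi>'_def)
  qed
 qed
 have \<psi>'C: "Ck 3 \<psi>'"
 proof (rule Ck_local)
  fix z show "\<exists>U g. open U \<and> z \<in> U \<and> Ck 3 g \<and> (\<forall>y\<in>U. \<psi>' y = g y)" using loc[of z] mC \<psi>C by blast
 qed
 have C2: "Ck 2 \<psi>" "Ck 2 q" "Ck 2 q1" "Ck 2 \<psi>'" using \<psi>C q(1) q1C \<psi>'C by (auto intro: Ck_le[of 2 3])
 have hq1: "hess q1 z a b = hess q z a b" and Mq1: "MA_density q1 z = MA_density q z" for z a b
  using hess_minus_const[OF C2(2), of "-\<eta>"] MA_minus_const[OF C2(2), of "-\<eta>"] by (simp_all add: q1_def[abs_def])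
 have props: "(\<forall>a. 0 <= hess \<psi>' z a a) \<and> g z <= MA_density \<psi>' z" if z: "z \<in> B" for z
 proof -
  have ps: "!!a. 0 <= hess \<psi> z a a" "g z <= MA_density \<psi> z" using \<psi>(1) z by (auto simp: cvx_sub_def)
  obtain U where U: "open U" "z \<in> U" "(z \<in> D \<and> (\<forall>y\<in>U. \<psi>' y = m y)) \<or> (\<forall>y\<in>U. \<psi>' y = \<psi> y)" using loc by blast
  from U(3) show ?thesis
  proof
   assume "\<forall>y\<in>U. \<psi>' y = \<psi> y"
   hence "hess \<psi>' z a b = hess \<psi> z a b" "MA_density \<psi>' z = MA_density \<psi> z" for a b
    using hess_cong_open[OF U(1,2), of \<psi>' \<psi>] MA_density_cong_open[OF U(1,2), of \<psi>' \<psi>] by auto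
   thus ?thesis using ps by simp
  next
   assume zD: "z \<in> D \<and> (\<forall>y\<in>U. \<psi>' y = m y)"
   have eq: "hess \<psi>' z a b = hess m z a b" "MA_density \<psi>' z = MA_density m z" for a b
    using hess_cong_open[OF U(1,2), of \<psi>' m] MA_density_cong_open[OF U(1,2), of \<psi>' m] zD by auto
   have e: "\<eta>/3 > 0" using \<eta> by simp
   have hq: "!!a. 0 <= hess q1 z a a" using q(2) zD by (simp add: hq1)
   have "0 <= hess m z a a" for a
    unfolding m_def[abs_def] hess_rmax[OF \<psi>C q1C e]
    using ps hq kap1_bounds kap2_nonneg \<eta>
    by (intro add_nonneg_nonneg mult_nonneg_nonneg divide_nonneg_pos zero_le_square) auto
   moreover have "min (MA_density \<psi> z) (MA_density q1 z) <= MA_density m z"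
    unfolding m_def[abs_def]
    by (rule rmax_psd(2)[OF \<psi>C q1C e hess_nonneg_hpsd[OF C2(1) ps(1)] hess_nonneg_hpsd[OF C2(3) hq]])
   hence "g z <= MA_density m z" using ps(2) q(3)[of z] zD by (simp add: Mq1)
   ultimately show ?thesis by (simp add: eq)
  qed
 qed
 have conv: "convex_on B \<psi>'" by (rule hess_nonneg_convex_on[OF C2(4) convex_ball]) (use props in blast)
 \<comment> \<open>A point of D lies on a segment between two frontier points, where the glued
   function is \<open>\<psi>\<close> and hence non-positive; convexity does the rest.\<close>
 have neg: "\<psi>' z <= 0" if z: "z \<in> B" for z
 proof (cases "z \<in> D")
  case False
  thus ?thesis using \<psi>(1) z by (auto simp: \<psi>'_def cvx_sub_def)
 next
  case True
  define l where "l = (axis undefined 1 :: complex^'n)"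
  have l: "l \<noteq> 0" "- l \<noteq> 0" by (auto simp: l_def axis_eq_0_iff)
  obtain d1 where d1: "d1 > 0" "z + d1 *\<^sub>R l \<in> frontier D" using exit[OF True l(1)] by blast
  obtain d2 where d2: "d2 > 0" "z + d2 *\<^sub>R (- l) \<in> frontier D" using exit[OF True l(2)] by blast
  have f: "\<psi>' y <= 0 \<and> y \<in> B" if "y \<in> frontier D" for y
   using that FD FB \<psi>(1) by (auto simp: \<psi>'_def cvx_sub_def)
  define t where "t = d1 / (d1 + d2)"
  have t: "0 <= t" "t <= 1" using d1 d2 by (auto simp: t_def)
  have "(1 - t) * d1 = t * d2" using d1 d2 by (simp add: t_def field_simps)
  hence "((1 - t) * d1 - t * d2) *\<^sub>R l = 0" by simp
  moreover have "(1 - t) *\<^sub>R (z + d1 *\<^sub>R l) + t *\<^sub>R (z + d2 *\<^sub>R (- l)) = z + ((1 - t) * d1 - t * d2) *\<^sub>R l"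
   by (simp only: scaleR_add_right scaleR_minus_right scaleR_scaleR scaleR_diff_left scaleR_one) simp
  ultimately have "(1 - t) *\<^sub>R (z + d1 *\<^sub>R l) + t *\<^sub>R (z + d2 *\<^sub>R (- l)) = z" by simp
  hence "\<psi>' z <= (1 - t) * \<psi>' (z + d1 *\<^sub>R l) + t * \<psi>' (z + d2 *\<^sub>R (- l))"
   using convex_onD[OF conv t, of "z + d1 *\<^sub>R l" "z + d2 *\<^sub>R (- l)"] f[OF d1(2)] f[OF d2(2)] by simp
  also have "... <= 0" using t f[OF d1(2)] f[OF d2(2)] by (intro add_nonpos_nonpos mult_nonneg_nonpos) auto
  finally show ?thesis .
 qed
 have "\<psi>' \<in> cvx_sub g c R" unfolding cvx_sub_def using \<psi>'C props neg by blast
 hence "\<psi>' x <= \<Phi> x" using perron_ge x DB by blast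
 moreover have "q1 x <= \<psi>' x" using x rmax_ge(2)[of "\<eta>/3" "q1 x" "\<psi> x"] \<eta> by (simp add: \<psi>'_def m_def)
 ultimately show ?thesis using \<eta> by (simp add: q1_def)
qed

end

section \<open>Volumes of convex sets and complex frames\<close>

lemma emeasure_lborel_affine:
 fixes S :: "'a::euclidean_space set"
 assumes "S \<in> sets borel" "m \<noteq> 0"
 shows "emeasure lborel ((%x. m *\<^sub>R x + a) ` S) = ennreal (\<bar>m\<bar> ^ DIM('a)) * emeasure lborel S"
  and "(%x. m *\<^sub>R x + a) ` S \<in> sets borel"
proof -
 have eq: "(%x. m *\<^sub>R x + a) ` S = (%y. (1/m) *\<^sub>R (y - a)) -` S"
 proof (intro set_eqI iffI)
  fix y assume "y \<in> (%y. (1/m) *\<^sub>R (y - a)) -` S"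
  thus "y \<in> (%x. m *\<^sub>R x + a) ` S" using assms(2) by (intro image_eqI[of _ _ "(1/m) *\<^sub>R (y - a)"]) auto
 qed (use assms(2) in auto)
 show b: "(%x. m *\<^sub>R x + a) ` S \<in> sets borel"
  unfolding eq by (rule measurable_sets_borel[OF _ assms(1)]) (intro borel_measurable_continuous_onI continuous_intros)
 thus "emeasure lborel ((%x. m *\<^sub>R x + a) ` S) = ennreal (\<bar>m\<bar> ^ DIM('a)) * emeasure lborel S"
  using emeasure_lebesgue_affine[of m a S] assms(1) by simp
qed

lemma open_differences:
 fixes X :: "'a::real_normed_vector set"
 assumes "open X"
 shows "open {a - b |a b. a \<in> X \<and> b \<in> X}"
proof -
 have "{a - b |a b. a \<in> X \<and> b \<in> X} = (\<Union>b\<in>X. (%x. x - b) ` X)" by auto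
 moreover have "open ((%x. x - b) ` X)" for b using open_translation_subtract[OF assms, of b] by (simp add: image_def)
 ultimately show ?thesis by auto
qed

text \<open>For \<open>z = (a - b) / 2\<close> the set \<open>X \<inter> (X + z)\<close> contains \<open>(X + a) / 2\<close>; integrate over \<open>z\<close>.\<close>
lemma emeasure_differences_le:
 fixes X :: "'a::euclidean_space set"
 assumes X: "open X" "convex X" "bounded X" "X \<noteq> {}"
 shows "emeasure lborel {a - b |a b. a \<in> X \<and> b \<in> X} <= ennreal (4 ^ DIM('a)) * emeasure lborel X"
proof -
 define Y where "Y = {a - b |a b. a \<in> X \<and> b \<in> X}"
 define Z where "Z = (%y. (1/2) *\<^sub>R y + 0) ` Y"
 define N where "N = DIM('a)"
 have bX: "X \<in> sets borel" using X(1) by simp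
 have bY: "Y \<in> sets borel" using open_differences[OF X(1)] by (simp add: Y_def)
 have bZ: "Z \<in> sets borel" unfolding Z_def by (rule emeasure_lborel_affine(2)[OF bY]) simp
 have eZ: "emeasure lborel Z = ennreal ((1/2)^N) * emeasure lborel Y"
  unfolding Z_def N_def using emeasure_lborel_affine(1)[OF bY, of "1/2" 0] by simp
 have Ydef: "Y = (\<Union>x\<in>X. \<Union>y\<in>X. {x - y})" by (auto simp: Y_def)
 have bdY: "bounded Y" unfolding Ydef using bounded_differences[OF X(3) X(3)] by simp
 have fX: "emeasure lborel X < \<infinity>" and fY: "emeasure lborel Y < \<infinity>" using emeasure_bounded_finite X(3) bdY by auto
 have pX: "emeasure lborel X > 0"
  using open_not_negligible[OF X(1,4)] by (auto simp: negligible_iff_null_sets null_sets_def bX zero_less_iff_neq_zero)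
 define F where "F z x = (indicator X x * indicator X (x - z) :: ennreal)" for z x
 have mF: "(%(z, x). F z x) \<in> borel_measurable (lborel \<Otimes>\<^sub>M lborel)"
 proof -
  have "{p :: 'a \<times> 'a. snd p - fst p \<in> X} = (%p. snd p - fst p) -` X" by auto
  hence "open {p :: 'a \<times> 'a. snd p - fst p \<in> X}"
   by (simp only:) (intro open_vimage X(1) continuous_intros)
  hence "{p :: 'a \<times> 'a. snd p - fst p \<in> X} \<in> sets (borel \<Otimes>\<^sub>M borel)"
   unfolding borel_prod by (rule borel_open)
  moreover have "UNIV \<times> X \<in> sets (borel \<Otimes>\<^sub>M (borel :: 'a measure))" using bX by simp
  moreover have "(%(z, x). F z x) = (%p. indicator (UNIV \<times> X) p * indicator {p :: 'a \<times> 'a. snd p - fst p \<in> X} p)"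
   by (auto simp: F_def fun_eq_iff indicator_def)
  ultimately show ?thesis
   unfolding measurable_cong_sets[OF sets_pair_measure_cong[OF sets_lborel sets_lborel] refl]
   by (simp only:) (intro borel_measurable_times_ennreal borel_measurable_indicator)
 qed
 have tr: "(\<integral>\<^sup>+z. indicator X (x - z) \<partial>lborel) = emeasure lborel X" for x
 proof -
  have "(\<integral>\<^sup>+z. indicator X (x - z) \<partial>lborel) = (\<integral>\<^sup>+z. indicator ((%y. (-1) *\<^sub>R y + x) ` X) z \<partial>lborel)"
  proof (intro nn_integral_cong)
   fix z show "indicator X (x - z) = (indicator ((%y. (-1) *\<^sub>R y + x) ` X) z :: ennreal)"
    unfolding indicator_def by (auto intro!: image_eqI[of _ _ "x - z"])
  qed
  also have "... = emeasure lborel ((%y. (-1) *\<^sub>R y + x) ` X)"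
   using emeasure_lborel_affine(2)[OF bX, of "-1" x] by (intro nn_integral_indicator) simp
  finally show ?thesis using emeasure_lborel_affine(1)[OF bX, of "-1" x] by simp
 qed
 have lower: "ennreal ((1/2)^N) * emeasure lborel X * indicator Z z <= (\<integral>\<^sup>+x. F z x \<partial>lborel)" for z
 proof (cases "z \<in> Z")
  case True
  then obtain a b where ab: "a \<in> X" "b \<in> X" "z = (1/2) *\<^sub>R (a - b)" by (auto simp: Z_def Y_def)
  let ?H = "(%x. (1/2) *\<^sub>R x + (1/2) *\<^sub>R a) ` X"
  have "indicator ?H x <= F z x" for x
  proof -
   have eq: "(1/2) *\<^sub>R y' + (1/2) *\<^sub>R a - z = (1/2) *\<^sub>R y' + (1/2) *\<^sub>R b" for y' by (simp add: ab(3) algebra_simps)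
   have "y' \<in> X ==> (1/2) *\<^sub>R y' + (1/2) *\<^sub>R a \<in> X \<and> (1/2) *\<^sub>R y' + (1/2) *\<^sub>R a - z \<in> X" for y'
    unfolding eq using convexD[OF X(2), of y' a "1/2" "1/2"] convexD[OF X(2), of y' b "1/2" "1/2"] ab(1,2) by auto
   thus ?thesis by (auto simp: F_def indicator_def)
  qed
  hence "(\<integral>\<^sup>+x. indicator ?H x \<partial>lborel) <= (\<integral>\<^sup>+x. F z x \<partial>lborel)" by (intro nn_integral_mono)
  moreover have "(\<integral>\<^sup>+x. indicator ?H x \<partial>lborel) = ennreal ((1/2)^N) * emeasure lborel X"
   using emeasure_lborel_affine[OF bX, of "1/2" "(1/2) *\<^sub>R a"] by (simp add: N_def)
  ultimately show ?thesis using True by simp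
 qed simp
 have "ennreal ((1/2)^N) * emeasure lborel X * emeasure lborel Z = (\<integral>\<^sup>+z. ennreal ((1/2)^N) * emeasure lborel X * indicator Z z \<partial>lborel)"
  using bZ by (simp add: nn_integral_cmult_indicator)
 also have "... <= (\<integral>\<^sup>+z. (\<integral>\<^sup>+x. F z x \<partial>lborel) \<partial>lborel)" by (intro nn_integral_mono lower)
 also have "... = (\<integral>\<^sup>+x. (\<integral>\<^sup>+z. F z x \<partial>lborel) \<partial>lborel)"
  using lborel_pair.Fubini'[OF mF] by simp
 also have "... = (\<integral>\<^sup>+x. indicator X x * emeasure lborel X \<partial>lborel)"
 proof (intro nn_integral_cong)
  fix x
  have "{z. x - z \<in> X} = (%z. x - z) -` X" by auto
  hence "open {z. x - z \<in> X}" by (simp only:) (intro open_vimage X(1) continuous_intros)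
  moreover have "(%z. indicator X (x - z)) = (indicator {z. x - z \<in> X} :: 'a => ennreal)" by (auto simp: indicator_def)
  ultimately have "(%z. indicator X (x - z) :: ennreal) \<in> borel_measurable lborel" by simp
  thus "(\<integral>\<^sup>+z. F z x \<partial>lborel) = indicator X x * emeasure lborel X"
   unfolding F_def by (subst nn_integral_cmult) (auto simp: tr)
 qed
 also have "... = emeasure lborel X * emeasure lborel X" using bX by (subst nn_integral_multc) auto
 finally have main: "ennreal ((1/2)^N) * emeasure lborel X * (ennreal ((1/2)^N) * emeasure lborel Y) <= emeasure lborel X * emeasure lborel X"
  unfolding eZ .
 obtain x where x: "emeasure lborel X = ennreal x" "x \<ge> 0" using fX by (cases "emeasure lborel X") auto
 obtain y where y: "emeasure lborel Y = ennreal y" "y \<ge> 0" using fY by (cases "emeasure lborel Y") auto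
 have "x > 0" using pX x by simp
 from main have "(1/2)^N * x * ((1/2)^N * y) <= x * x" using x y by (simp flip: ennreal_mult)
 hence "((1/2)^N * (1/2)^N) * y <= x" using \<open>x > 0\<close> by (simp add: mult.assoc mult.left_commute[of _ x])
 hence "y <= 4^N * x" by (simp add: power_mult_distrib[symmetric] power_divide field_simps)
 thus ?thesis using x y by (simp add: N_def Y_def[symmetric] flip: ennreal_mult)
qed

section \<open>Frames of maximal determinant\<close>

lemma max_det_frame:
 fixes K :: "(complex^'n) set"
 assumes K: "compact K" "K \<noteq> {}"
 obtains W :: "complex^'n^'n" where "!!i. W $ i \<in> K" "!!V. (!!i. V $ i \<in> K) ==> cmod (det V) <= cmod (det W)"
proof -
 define L where "L = {V :: complex^'n^'n. \<forall>i. V $ i \<in> K}"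
 have "L = (\<Inter>i. (%V. V $ i) -` K)" by (auto simp: L_def)
 moreover have "closed ((%V :: complex^'n^'n. V $ i) -` K)" for i
  by (intro closed_vimage compact_imp_closed K continuous_intros)
 ultimately have cl: "closed L" by auto
 obtain k where k: "!!x. x \<in> K ==> norm x <= k" using compact_imp_bounded[OF K(1)] by (auto simp: bounded_iff)
 have "norm S <= (\<Sum>i\<in>(UNIV::'n set). k)" if "S \<in> L" for S
  using that order_trans[OF L2_set_le_sum[of UNIV "%i. norm (S $ i)"] sum_mono, of "%_. k"] k
  by (simp add: norm_vec_def[of S] L_def)
 hence "bounded L" unfolding bounded_iff by blast
 with cl have cL: "compact L" by (simp add: compact_eq_bounded_closed)
 obtain x where "x \<in> K" using K by blast
 hence "(\<chi> i. x) \<in> L" by (simp add: L_def)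
 moreover have "continuous_on L (%S. cmod (det S))" unfolding det_def by (intro continuous_intros)
 ultimately obtain W where "W \<in> L" "!!V. V \<in> L ==> cmod (det V) <= cmod (det W)"
  using continuous_attains_sup[OF cL] by blast
 thus thesis using that by (auto simp: L_def)
qed

text \<open>Auerbach's argument: by Cramer's rule, replacing row k by p multiplies the determinant
  by c_k, which maximality forbids to exceed 1 in modulus.\<close>

lemma max_det_frame_coords:
 fixes W :: "complex^'n^'n"
 assumes W: "!!i. W $ i \<in> K" "!!V. (!!i. V $ i \<in> K) ==> cmod (det V) <= cmod (det W)"
  and d: "det W \<noteq> 0" and p: "p \<in> K"
 obtains c :: "complex^'n" where "!!i. cmod (c $ i) <= 1" "p = (\<Sum>i\<in>UNIV. c $ i *s W $ i)"
proof -
 have "surj (%c. c v* W)" using vector_matrix_mult_bij[OF d] by (rule bij_is_surj)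
 then obtain c where "p = c v* W" by (auto simp: surj_def)
 hence c: "p = (\<Sum>i\<in>UNIV. c $ i *s W $ i)"
  by (simp add: vec_eq_iff vector_matrix_mult_def mult.commute)
 have r: "row i W = W $ i" for i by (simp add: row_def vec_eq_iff)
 have "cmod (c $ k) <= 1" for k
 proof -
  have "det (\<chi> i. if i = k then p else W $ i) = c $ k * det W"
   using cramer_lemma_transpose[of k c W] unfolding r c[symmetric] .
  moreover have "cmod (det (\<chi> i. if i = k then p else W $ i)) <= cmod (det W)" by (rule W(2)) (simp add: W(1) p)
  ultimately show ?thesis using d by (simp add: norm_mult)
 qed
 thus thesis using c that by blast
qed

text \<open>If all n-tuples from K are dependent, the complex span is a proper subspace, hence of
  smaller real dimension.\<close>

lemma negligible_degenerate_frames: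
 fixes K :: "(complex^'n) set"
 assumes "!!V. (!!i. V $ i \<in> K) ==> det V = 0"
 shows "negligible K"
proof -
 have ne: "vec.span K \<noteq> UNIV"
 proof
  assume sp: "vec.span K = UNIV"
  obtain B where B: "B \<subseteq> K" "vec.independent B" "K \<subseteq> vec.span B" "card B = vec.dim K" by (rule vec.basis_exists)
  have "vec.dim K = CARD('n)" using vec.dim_span[of K] vec_dim_card[where 'a=complex and 'n='n] sp by simp
  hence card: "card B = card (UNIV :: 'n set)" using B(4) by simp
  hence "finite B" by (metis card.infinite finite_UNIV_card_ge_0 finite less_irrefl)
  then obtain h where h: "bij_betw h (UNIV :: 'n set) B" using finite_same_card_bij[of "UNIV::'n set" B] card by auto
  define V where "V = (\<chi> i. h i)"
  have "rows V = B" using h by (auto simp: rows_def row_def V_def bij_betw_def vec_lambda_eta)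
  moreover have "vec.span B = UNIV" using B(3) sp by (metis vec.span_mono vec.span_span top.extremum_uniqueI)
  ultimately obtain V' where "V' ** V = mat 1" using matrix_left_invertible_span_rows_gen[of V] by auto
  hence "det V' * det V = 1" by (metis det_mul det_I)
  moreover have "det V = 0" by (rule assms) (use B(1) h in \<open>auto simp: V_def bij_betw_def\<close>)
  ultimately show False by simp
 qed
 have "subspace (vec.span K)"
  unfolding subspace_def
 proof (intro conjI ballI allI)
  fix r :: real and x assume "x \<in> vec.span K"
  hence "complex_of_real r *s x \<in> vec.span K" by (rule vec.span_scale)
  moreover have "complex_of_real r *s x = r *\<^sub>R x" by (simp add: vec_eq_iff scaleR_conv_of_real[where 'a=complex])
  ultimately show "r *\<^sub>R x \<in> vec.span K" by simp
 qed (auto intro: vec.span_add vec.span_zero)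
 hence "dim (vec.span K) < DIM(complex^'n)"
  using ne dim_eq_full[of "vec.span K"] dim_subset_UNIV[of "vec.span K"] by (metis le_neq_implies_less span_eq_iff)
 hence "negligible (vec.span K)" by (rule negligible_lowdim)
 thus ?thesis by (rule negligible_subset) (rule vec.span_superset)
qed

text \<open>The two model bodies: coordinates with respect to a maximal frame stay in the polydisc;
  dually, a suitable linear image of a difference body contains \<open>crosspoly\<close>.\<close>

definition polydisc :: "(complex^'n) set" where "polydisc = {c. \<forall>i. cmod (c $ i) <= 1}"
definition crosspoly :: "(complex^'n) set" where "crosspoly = {c. (\<Sum>i\<in>UNIV. cmod (c $ i)) < 1}"

lemma polydisc_borel: "(polydisc :: (complex^'n) set) \<in> sets borel" and polydisc_bounded: "bounded (polydisc :: (complex^'n) set)"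
proof -
 have eq: "(polydisc :: (complex^'n) set) = (\<Inter>i. {c. cmod (c $ i) <= 1})" by (auto simp: polydisc_def)
 have "closed (polydisc :: (complex^'n) set)"
  unfolding eq by (intro closed_INT ballI closed_Collect_le continuous_intros)
 thus "(polydisc :: (complex^'n) set) \<in> sets borel" by simp
 have "norm c <= (\<Sum>i\<in>(UNIV::'n set). 1)" if "c \<in> polydisc" for c :: "complex^'n"
  using that order_trans[OF L2_set_le_sum[of UNIV "%i. norm (c $ i)"] sum_mono, of "%_. 1"]
  by (simp add: norm_vec_def[of c] polydisc_def)
 thus "bounded (polydisc :: (complex^'n) set)" unfolding bounded_iff by blast
qed

lemma crosspoly_open: "open (crosspoly :: (complex^'n) set)" and crosspoly_ne: "(0 :: complex^'n) \<in> crosspoly"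
 and crosspoly_subset: "(crosspoly :: (complex^'n) set) \<subseteq> polydisc"
proof -
 show "open (crosspoly :: (complex^'n) set)" unfolding crosspoly_def by (intro open_Collect_less continuous_intros)
 show "(crosspoly :: (complex^'n) set) \<subseteq> polydisc"
 proof
  fix c :: "complex^'n" assume "c \<in> crosspoly"
  moreover have "cmod (c $ i) <= (\<Sum>i\<in>UNIV. cmod (c $ i))" for i by (rule member_le_sum) auto
  ultimately show "c \<in> polydisc" unfolding crosspoly_def polydisc_def by (auto intro: less_imp_le order_trans)
 qed
qed (simp add: crosspoly_def)

lemma crosspoly_finite: "emeasure lborel (crosspoly :: (complex^'n) set) < \<infinity>"
 and polydisc_finite: "emeasure lborel (polydisc :: (complex^'n) set) < \<infinity>"
 by (rule emeasure_bounded_finite, rule bounded_subset[OF polydisc_bounded crosspoly_subset])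
  (rule emeasure_bounded_finite, rule polydisc_bounded)

text \<open>In the coordinates of a frame of maximal determinant K lies in the polydisc; if all
  frames degenerate, K is null.\<close>

lemma compact_emeasure_le_frame:
 fixes K :: "(complex^'n) set"
 assumes K: "compact K" "K \<noteq> {}"
 obtains W :: "complex^'n^'n" where "!!i. W $ i \<in> K"
  "emeasure lborel K <= ennreal ((cmod (det W))\<^sup>2) * emeasure lborel (polydisc :: (complex^'n) set)"
proof -
 obtain W where W: "!!i. W $ i \<in> K" "!!V. (!!i. V $ i \<in> K) ==> cmod (det V) <= cmod (det W)"
  using max_det_frame[OF K] by blast
 have "emeasure lborel K <= ennreal ((cmod (det W))\<^sup>2) * emeasure lborel (polydisc :: (complex^'n) set)"
 proof (cases "det W = 0")
  case True
  hence "negligible K" by (intro negligible_degenerate_frames) (use W(2) in force)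
  hence "emeasure lborel K = 0" using K(1) by (auto simp: negligible_iff_null_sets null_sets_def compact_imp_closed)
  thus ?thesis by simp
 next
  case False
  have dt: "det (transpose W) \<noteq> 0" using False by simp
  have "K \<subseteq> (%c. transpose W *v c) ` polydisc"
  proof
   fix p assume "p \<in> K"
   obtain c where c: "!!i. cmod (c $ i) <= 1" "p = (\<Sum>i\<in>UNIV. c $ i *s W $ i)"
    using max_det_frame_coords[OF W False \<open>p \<in> K\<close>] by blast
   have "p = transpose W *v c" unfolding c(2) by (simp add: vec_eq_iff matrix_vector_mult_def transpose_def mult.commute)
   thus "p \<in> (%c. transpose W *v c) ` polydisc" using c(1) by (auto simp: polydisc_def)
  qed
  hence "emeasure lborel K <= emeasure lborel ((%c. transpose W *v c) ` polydisc)"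
   by (rule emeasure_mono) (use emeasure_matrix_image(2)[OF dt polydisc_borel] in \<open>simp only: sets_lborel\<close>)
  thus ?thesis unfolding emeasure_matrix_image(1)[OF dt polydisc_borel] by simp
 qed
 thus thesis using W(1) that by blast
qed

text \<open>Dual to the preceding bound: the maximal frame W is taken in the polar Q of the
  difference body Y. If some z outside Y were mapped into the cross-polytope, a separating
  functional, normalised to 1 at z, would lie in Q; its frame coordinates have modulus at most 1,
  which forces its value at z below 1. Passing from Y back to X costs 4^(2n) = 16^n.\<close>

lemma convex_emeasure_ge_frame:
 fixes X :: "(complex^'n) set"
 assumes X: "open X" "convex X" "bounded X" "X \<noteq> {}"
 obtains W :: "complex^'n^'n" where "!!i a b. a \<in> X ==> b \<in> X ==> \<bar>W $ i \<bullet> (a - b)\<bar> <= 1"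
  "emeasure lborel (crosspoly :: (complex^'n) set) <= ennreal ((cmod (det W))\<^sup>2 * 16 ^ CARD('n)) * emeasure lborel X"
proof -
 define Y where "Y = {a - b |a b. a \<in> X \<and> b \<in> X}"
 define Q where "Q = {w. \<forall>y\<in>Y. w \<bullet> y <= 1}"
 obtain x0 r where x0: "r > 0" "ball x0 r \<subseteq> X" using X(1,4) open_contains_ball by blast
 have Yball: "ball 0 r \<subseteq> Y"
 proof
  fix y assume "y \<in> ball (0::complex^'n) r"
  hence "x0 + y \<in> ball x0 r" by (simp add: dist_norm)
  hence "x0 + y \<in> X" "x0 \<in> X" using x0 by auto
  thus "y \<in> Y" unfolding Y_def by (intro CollectI exI[of _ "x0 + y"] exI[of _ x0]) simp
 qed
 have Ydef: "Y = (\<Union>x\<in>X. \<Union>y\<in>X. {x - y})" by (auto simp: Y_def)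
 have convY: "convex Y" unfolding Ydef using convex_differences[OF X(2) X(2)] by simp
 have bdY: "bounded Y" unfolding Ydef using bounded_differences[OF X(3) X(3)] by simp
 have oY: "open Y" using open_differences[OF X(1)] by (simp add: Y_def)
 have "Q = (\<Inter>y\<in>Y. {w. w \<bullet> y <= 1})" by (auto simp: Q_def)
 moreover have "closed {w :: complex^'n. w \<bullet> y <= 1}" for y by (intro closed_Collect_le continuous_intros)
 ultimately have clQ: "closed Q" by auto
 have dir: "\<exists>y\<in>Y. w \<bullet> y = (r/2) * norm w" if "w \<noteq> 0" for w
 proof (intro bexI[of _ "(r / (2 * norm w)) *\<^sub>R w"])
  show "(r / (2 * norm w)) *\<^sub>R w \<in> Y" using x0(1) that by (intro subsetD[OF Yball]) auto
  show "w \<bullet> ((r / (2 * norm w)) *\<^sub>R w) = (r/2) * norm w" using that by (simp add: dot_square_norm power2_eq_square)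
 qed
 have "norm w <= 2 / r" if "w \<in> Q" for w
 proof (cases "w = 0")
  case False
  thus ?thesis using dir[OF False] that x0(1) by (force simp: Q_def field_simps)
 qed (use x0(1) in simp)
 hence "bounded Q" unfolding bounded_iff by blast
 hence cQ: "compact Q" using clQ by (simp add: compact_eq_bounded_closed)
 obtain k where k: "k > 0" "!!y. y \<in> Y ==> norm y <= k" using bdY by (auto simp: bounded_pos)
 have kQ: "w \<in> Q" if "norm w <= 1 / k" for w
 proof -
  have "w \<bullet> y <= 1" if "y \<in> Y" for y
  proof -
   have "w \<bullet> y <= norm w * norm y" by (rule norm_cauchy_schwarz)
   also have "... <= (1/k) * k" using \<open>norm w <= 1 / k\<close> k that by (intro mult_mono) auto
   finally show ?thesis using k by simp
  qed
  thus ?thesis by (simp add: Q_def)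
 qed
 hence "Q \<noteq> {}" using k(1) by (metis divide_nonneg_pos empty_iff le_numeral_extra(3) less_imp_le norm_zero zero_le_one)
 then obtain W where W: "!!i. W $ i \<in> Q" "!!V. (!!i. V $ i \<in> Q) ==> cmod (det V) <= cmod (det W)"
  using max_det_frame[OF cQ] by blast
 \<comment> \<open>The polar contains a small ball, hence a nonzero multiple of the standard
   frame.\<close>
 have d: "det W \<noteq> 0"
 proof -
  define V :: "complex^'n^'n" where "V = (\<chi> i. axis i (complex_of_real (1 / k)))"
  have "V $ i \<in> Q" for i
  proof (rule kQ)
   have "(norm (V $ i))\<^sup>2 = (1/k)\<^sup>2"
    by (simp add: V_def power2_norm_eq_inner inner_axis_axis inner_complex_def power2_eq_square[symmetric])
   thus "norm (V $ i) <= 1 / k" by (rule power2_le_imp_le[OF eq_refl]) (use k(1) in simp)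
  qed
  hence "cmod (det V) <= cmod (det W)" by (rule W(2))
  moreover have "det V = (\<Prod>i\<in>UNIV. V $ i $ i)" by (rule det_diagonal) (auto simp: V_def axis_def)
  hence "det V = (\<Prod>i\<in>(UNIV::'n set). complex_of_real (1 / k))" by (simp add: V_def axis_def)
  hence "det V \<noteq> 0" using k(1) by simp
  ultimately show ?thesis by auto
 qed
 \<comment> \<open>The real inner product is the real part of the Hermitian one, hence the
   conjugated entries.\<close>
 define M :: "complex^'n^'n" where "M = (\<chi> i j. cnj (W $ i $ j))"
 have dM: "cmod (det M) = cmod (det W)"
 proof -
  have "det M = det (transpose M)" by simp
  also have "transpose M = (\<chi> i j. cnj (W $ j $ i))" by (simp add: M_def transpose_def)
  finally show ?thesis by (simp add: det_conjugate_transpose)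
 qed
 have dM0: "det M \<noteq> 0" using d dM by auto
 have inY: "z \<in> Y" if z: "M *v z \<in> crosspoly" for z
 proof (rule ccontr)
  assume "z \<notin> Y"
  moreover have "0 \<in> Y" using Yball x0(1) by auto
  ultimately obtain a b where ab: "a \<noteq> 0" "!!y. y \<in> Y ==> a \<bullet> y <= b" "a \<bullet> z \<ge> b"
   using separating_hyperplane_sets[OF convY convex_singleton[of z]] by auto
  obtain y where y: "y \<in> Y" "a \<bullet> y = (r/2) * norm a" using dir[OF ab(1)] by blast
  have "0 < (r/2) * norm a" using x0(1) ab(1) by simp
  hence az: "a \<bullet> z > 0" using ab(2)[OF y(1)] y(2) ab(3) by linarith
  define v where "v = (1 / (a \<bullet> z)) *\<^sub>R a"
  have vz: "v \<bullet> z = 1" using az by (simp add: v_def)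
  have "v \<in> Q" unfolding Q_def
  proof (intro CollectI ballI)
   fix y assume "y \<in> Y"
   hence "a \<bullet> y <= a \<bullet> z" using ab(2,3) order_trans by blast
   thus "v \<bullet> y <= 1" using az by (simp add: v_def field_simps)
  qed
  then obtain c where c: "!!i. cmod (c $ i) <= 1" "v = (\<Sum>i\<in>UNIV. c $ i *s W $ i)"
   using max_det_frame_coords[OF W d] by blast
  have "v \<bullet> z = (\<Sum>k\<in>UNIV. Re (cnj (v $ k) * z $ k))" by (simp add: inner_vec_def inner_complex_def)
  also have "... = Re (\<Sum>k\<in>UNIV. \<Sum>i\<in>UNIV. cnj (c $ i) * (cnj (W $ i $ k) * z $ k))"
   unfolding c(2) by (simp add: sum_distrib_right mult.assoc)
  also have "... = Re (\<Sum>i\<in>UNIV. cnj (c $ i) * (M *v z) $ i)"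
   by (subst sum.swap) (simp add: M_def matrix_vector_mult_def sum_distrib_left)
  also have "... <= cmod (\<Sum>i\<in>UNIV. cnj (c $ i) * (M *v z) $ i)" by (rule complex_Re_le_cmod)
  also have "... <= (\<Sum>i\<in>UNIV. cmod ((M *v z) $ i))"
  proof (rule order_trans[OF norm_sum sum_mono])
   fix i show "cmod (cnj (c $ i) * (M *v z) $ i) <= cmod ((M *v z) $ i)"
    using mult_right_mono[OF c(1)[of i], of "cmod ((M *v z) $ i)"] by (simp add: norm_mult)
  qed
  also have "... < 1" using z by (simp add: crosspoly_def)
  finally show False using vz by simp
 qed
 have "crosspoly \<subseteq> (%z. M *v z) ` Y"
 proof
  fix x :: "complex^'n" assume x: "x \<in> crosspoly"
  have "invertible M" using dM0 by (simp add: invertible_det_nz)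
  then obtain M' where "M ** M' = mat 1" by (auto simp: invertible_def)
  hence "M *v (M' *v x) = x" by (simp add: matrix_vector_mul_assoc)
  thus "x \<in> (%z. M *v z) ` Y" using inY[of "M' *v x"] x by (metis image_eqI)
 qed
 hence "emeasure lborel (crosspoly :: (complex^'n) set) <= emeasure lborel ((%z. M *v z) ` Y)"
  by (rule emeasure_mono) (use emeasure_matrix_image(2)[OF dM0, of Y] oY in simp)
 also have "... = ennreal ((cmod (det W))\<^sup>2) * emeasure lborel Y"
  using emeasure_matrix_image(1)[OF dM0, of Y] oY dM by simp
 also have "... <= ennreal ((cmod (det W))\<^sup>2) * (ennreal (4 ^ DIM(complex^'n)) * emeasure lborel X)"
  unfolding Y_def by (intro mult_left_mono emeasure_differences_le X) auto
 also have "... = ennreal ((cmod (det W))\<^sup>2 * 16 ^ CARD('n)) * emeasure lborel X"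
 proof -
  have "(4::real) ^ DIM(complex^'n) = 4 ^ (2 * CARD('n))" by (simp add: mult.commute)
  also have "... = 16 ^ CARD('n)" unfolding power_mult by simp
  finally show ?thesis by (simp add: ennreal_mult mult.assoc)
 qed
 finally have fin: "emeasure lborel (crosspoly :: (complex^'n) set) <= ennreal ((cmod (det W))\<^sup>2 * 16 ^ CARD('n)) * emeasure lborel X" .
 show thesis
 proof (rule that[OF _ fin])
  fix i a b assume ab: "a \<in> X" "b \<in> X"
  have "W $ i \<bullet> (a - b) <= 1" "W $ i \<bullet> (b - a) <= 1" using W(1)[of i] ab by (auto simp: Q_def Y_def)
  thus "\<bar>W $ i \<bullet> (a - b)\<bar> <= 1" by (simp add: inner_diff_right)
 qed
qed

section \<open>An Alexandrov type estimate for the envelope\<close>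

definition cquad :: "complex^'n => complex^'n => complex^'n^'n => real => real => complex^'n => real" where
 "cquad y p W \<alpha> \<kappa> z = \<alpha> + p \<bullet> (z - y) + \<kappa> * (\<Sum>i\<in>UNIV. (W $ i \<bullet> (z - y)) * (W $ i \<bullet> (z - y)))"

lemma Ck_cquad: "Ck k (cquad y p W \<alpha> \<kappa>)"
 unfolding cquad_def[abs_def] by (intro Ck_add Ck_diff Ck_mult Ck_inner Ck_sum Ck_const Ck_id)

lemma hess_cquad: "hess (cquad y p W \<alpha> \<kappa>) z a b = 2 * \<kappa> * (\<Sum>i\<in>UNIV. (W $ i \<bullet> a) * (W $ i \<bullet> b))"
proof -
 have 1: "fd (cquad y p W \<alpha> \<kappa>) a = (%z. p \<bullet> a + 2 * \<kappa> * (\<Sum>i\<in>UNIV. (W $ i \<bullet> a) * (W $ i \<bullet> (z - y))))" for a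
 proof (rule ext)
  fix z
  have "(cquad y p W \<alpha> \<kappa> has_derivative (%a. p \<bullet> a + \<kappa> * (\<Sum>i\<in>UNIV. (W $ i \<bullet> (z - y)) * (W $ i \<bullet> a) + (W $ i \<bullet> a) * (W $ i \<bullet> (z - y))))) (at z)"
   unfolding cquad_def[abs_def] by (auto intro!: derivative_eq_intros)
  note d = fd_eqI[OF this, of a]
  have two: "(W $ i \<bullet> (z - y)) * (W $ i \<bullet> a) + (W $ i \<bullet> a) * (W $ i \<bullet> (z - y)) = 2 * ((W $ i \<bullet> a) * (W $ i \<bullet> (z - y)))" for i
   by simp
  show "fd (cquad y p W \<alpha> \<kappa>) a z = p \<bullet> a + 2 * \<kappa> * (\<Sum>i\<in>UNIV. (W $ i \<bullet> a) * (W $ i \<bullet> (z - y)))"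
   unfolding d two by (simp only: sum_distrib_left[symmetric] mult.assoc mult.left_commute[of \<kappa>])
 qed
 have "((%z. p \<bullet> a + 2 * \<kappa> * (\<Sum>i\<in>UNIV. (W $ i \<bullet> a) * (W $ i \<bullet> (z - y)))) has_derivative
   (%b. 2 * \<kappa> * (\<Sum>i\<in>UNIV. (W $ i \<bullet> a) * (W $ i \<bullet> b)))) (at z)"
  by (auto intro!: derivative_eq_intros)
 from fd_eqI[OF this, of b] show ?thesis unfolding hess_fd 1 .
qed

text \<open>The complex Hessian is \<kappa>/2 times the conjugate transpose of W times W; the factor
  4^n of the normalisation turns (\<kappa>/2)^n into (2 \<kappa>)^n.\<close>

lemma MA_density_cquad:
 fixes W :: "complex^'n^'n"
 shows "MA_density (cquad y p W \<alpha> \<kappa>) z = (2 * \<kappa>) ^ CARD('n) * fact CARD('n) * (cmod (det W))\<^sup>2"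
proof -
 define V :: "complex^'n^'n" where "V = (\<chi> i j. cnj (W $ j $ i))"
 have re: "w \<bullet> axis j 1 = Re (w $ j)" "w \<bullet> axis j \<i> = Im (w $ j)" for w :: "complex^'n" and j
  by (simp_all add: inner_axis inner_complex_def)
 have ent: "cHess (cquad y p W \<alpha> \<kappa>) z $ j $ k = complex_of_real (\<kappa>/2) * (\<Sum>i\<in>UNIV. cnj (W $ i $ j) * W $ i $ k)" for j k
  by (simp add: cHess_def hess_cquad re complex_eq_iff sum.distrib[symmetric] sum_subtractf[symmetric] sum_distrib_left algebra_simps add_divide_distrib diff_divide_distrib)
 have "cHess (cquad y p W \<alpha> \<kappa>) z = (\<chi> i j. if i = j then complex_of_real (\<kappa>/2) else 0) ** (V ** W)"
  by (simp add: vec_eq_iff ent matrix_matrix_mult_def V_def if_distrib[of "%t. t * _"] cong: if_cong)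
 moreover have "det (\<chi> i j. if i = j then complex_of_real (\<kappa>/2) else 0 :: complex^'n^'n) = complex_of_real (\<kappa>/2) ^ CARD('n)"
  by (subst det_diagonal) auto
 ultimately have "det (cHess (cquad y p W \<alpha> \<kappa>) z) = complex_of_real (\<kappa>/2) ^ CARD('n) * (cnj (det W) * det W)"
  by (simp add: det_mul V_def det_conjugate_transpose)
 also have "... = complex_of_real ((\<kappa>/2) ^ CARD('n) * (cmod (det W))\<^sup>2)"
  using complex_norm_square[of "det W"] by (simp add: mult.commute)
 finally have "MA_density (cquad y p W \<alpha> \<kappa>) z = 4 ^ CARD('n) * fact CARD('n) * ((\<kappa>/2) ^ CARD('n) * (cmod (det W))\<^sup>2)"
  by (simp add: MA_density_def del: of_real_mult of_real_power)
 also have "... = (4 * (\<kappa>/2)) ^ CARD('n) * fact CARD('n) * (cmod (det W))\<^sup>2" by (simp only: power_mult_distrib) simp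
 finally show ?thesis by simp
qed

context perron_setup
begin

text \<open>On the frontier of X the quadratic rises by at most h/2 above the plane and so stays
  below the envelope, yet it meets the envelope at y. By the minimum principle it cannot be a
  subsolution, so its constant density does not exceed G.\<close>

lemma perron_quadratic:
 fixes W :: "complex^'n^'n" and h L G :: real
 assumes X: "open X" "closure X \<subseteq> B" and y: "y \<in> X" and h: "h > 0" "L > 0"
  and fr: "!!z. z \<in> frontier X ==> \<Phi> y + p \<bullet> (z - y) + h <= \<Phi> z"
  and w: "!!z i. z \<in> X ==> \<bar>W $ i \<bullet> (z - y)\<bar> <= L" and G: "!!z. z \<in> X ==> g z <= G"
 shows "(h / (CARD('n) * L\<^sup>2)) ^ CARD('n) * fact CARD('n) * (cmod (det W))\<^sup>2 <= G"
proof (rule ccontr)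
 assume neg: "\<not> ?thesis"
 define \<kappa> where "\<kappa> = h / (2 * CARD('n) * L\<^sup>2)"
 have \<kappa>: "\<kappa> > 0" "2 * \<kappa> = h / (CARD('n) * L\<^sup>2)" using h by (auto simp: \<kappa>_def)
 define q where "q = cquad y p W (\<Phi> y) \<kappa>"
 have "q y < \<Phi> y"
 proof (rule perron_min_principle[OF X])
  show "Ck 3 q" unfolding q_def by (rule Ck_cquad)
  show "0 <= hess q x a a" for x a unfolding q_def hess_cquad using \<kappa>(1) by (intro mult_nonneg_nonneg sum_nonneg zero_le_square) auto
  show "g x <= MA_density q x" if "x \<in> X" for x
   unfolding q_def MA_density_cquad \<kappa>(2) using G[OF that] neg by linarith
  show "q z < \<Phi> z" if z: "z \<in> frontier X" for z
  proof -
   have "X \<subseteq> {z. \<bar>W $ i \<bullet> (z - y)\<bar> <= L}" for i using w by auto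
   moreover have "closed {z. \<bar>W $ i \<bullet> (z - y)\<bar> <= L}" for i by (intro closed_Collect_le continuous_intros)
   ultimately have "closure X \<subseteq> {z. \<bar>W $ i \<bullet> (z - y)\<bar> <= L}" for i by (rule closure_minimal)
   hence zi: "\<bar>W $ i \<bullet> (z - y)\<bar> <= L" for i using z by (auto simp: frontier_def)
   have "(\<Sum>i\<in>UNIV. (W $ i \<bullet> (z - y)) * (W $ i \<bullet> (z - y))) <= (\<Sum>i\<in>(UNIV::'n set). L\<^sup>2)"
   proof (rule sum_mono)
    fix i show "(W $ i \<bullet> (z - y)) * (W $ i \<bullet> (z - y)) <= L\<^sup>2"
     using power_mono[OF zi[of i], of 2] by (simp add: power2_eq_square)
   qed
   hence "\<kappa> * (\<Sum>i\<in>UNIV. (W $ i \<bullet> (z - y)) * (W $ i \<bullet> (z - y))) <= \<kappa> * (CARD('n) * L\<^sup>2)"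
    using \<kappa>(1) by (intro mult_left_mono) auto
   also have "... = h / 2" using h by (simp add: \<kappa>_def)
   finally show ?thesis using fr[OF z] h unfolding q_def cquad_def by linarith
  qed
  show "y \<in> X" by fact
 qed
 thus False by (simp add: q_def cquad_def)
qed

section \<open>Legendre transform and sections of the envelope\<close>

text \<open>The Legendre transform of the envelope with origin at c. Accordingly
  \<open>exc p\<close> is the gap in Young's inequality and \<open>sec p k\<close> the section of
  slope p and height k.\<close>

definition leg :: "complex^'n => real" where "leg p = (SUP y\<in>B. p \<bullet> (y - c) - \<Phi> y)"

definition exc :: "complex^'n => complex^'n => real" where "exc p y = \<Phi> y - p \<bullet> (y - c) + leg p"

definition sec :: "complex^'n => real => (complex^'n) set" where "sec p k = {y \<in> B. exc p y < k}"

lemma perron_lower: "\<exists>A>0. \<forall>y\<in>B. A * ((norm (y - c))\<^sup>2 - R\<^sup>2) <= \<Phi> y"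
proof -
 obtain A where A: "A \<ge> 0" "parab c A (A * R\<^sup>2) \<in> cvx_sub g c R" using barrier by blast
 \<comment> \<open>The barrier only gives A \<ge> 0; A + 1 is positive, and the bound becomes weaker
   because the bracket is non-positive.\<close>
 have "(A + 1) * ((norm (y - c))\<^sup>2 - R\<^sup>2) <= \<Phi> y" if "y \<in> B" for y
 proof -
  have "(norm (y - c))\<^sup>2 <= R\<^sup>2" using that by (intro power_mono) (auto simp: dist_norm norm_minus_commute)
  hence "(A + 1) * ((norm (y - c))\<^sup>2 - R\<^sup>2) <= A * ((norm (y - c))\<^sup>2 - R\<^sup>2)" by (intro mult_right_mono_neg) auto
  also have "... = parab c A (A * R\<^sup>2) y" by (simp add: parab_def dot_square_norm algebra_simps)
  also have "... <= \<Phi> y" by (rule perron_ge[OF A(2) that])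
  finally show ?thesis .
 qed
 thus ?thesis using A(1) by (intro exI[of _ "A + 1"]) auto
qed

lemma slope_bound: "y \<in> B ==> p \<bullet> (y - c) <= norm p * R"
 by (rule order_trans[OF norm_cauchy_schwarz mult_left_mono]) (auto simp: dist_norm norm_minus_commute)

lemma leg_bdd: "bdd_above ((%y. p \<bullet> (y - c) - \<Phi> y) ` B)"
proof -
 obtain A where A: "A > 0" "!!y. y \<in> B ==> A * ((norm (y - c))\<^sup>2 - R\<^sup>2) <= \<Phi> y" using perron_lower by blast
 have "p \<bullet> (y - c) - \<Phi> y <= norm p * R + A * R\<^sup>2" if "y \<in> B" for y
 proof -
  have "A * (0 - R\<^sup>2) <= A * ((norm (y - c))\<^sup>2 - R\<^sup>2)" using A(1) by (intro mult_left_mono) auto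
  thus ?thesis using A(2)[OF that] slope_bound[OF that, of p] by (simp add: algebra_simps)
 qed
 thus ?thesis by (intro bdd_aboveI) auto
qed

lemma leg_ge: "y \<in> B ==> p \<bullet> (y - c) - \<Phi> y <= leg p"
 unfolding leg_def by (rule cSUP_upper[OF _ leg_bdd])

lemma exc_nonneg: "y \<in> B ==> 0 <= exc p y"
 using leg_ge[of y p] by (simp add: exc_def)

lemma B_ne: "B \<noteq> {}" using R by simp

lemma leg_lipschitz: "leg p <= leg p' + R * norm (p - p')"
 unfolding leg_def[of p]
proof (rule cSUP_least[OF B_ne])
 fix y assume "y \<in> B"
 thus "p \<bullet> (y - c) - \<Phi> y <= leg p' + R * norm (p - p')"
  using leg_ge[of y p'] slope_bound[of y "p - p'"] by (simp add: inner_diff_left mult.commute)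
qed

lemma leg_midpoint: "2 * leg p <= leg (p + a) + leg (p - a)"
proof -
 have "leg p <= (leg (p + a) + leg (p - a)) / 2"
  unfolding leg_def[of p]
 proof (rule cSUP_least[OF B_ne])
  fix y assume "y \<in> B"
  thus "p \<bullet> (y - c) - \<Phi> y <= (leg (p + a) + leg (p - a)) / 2"
   using leg_ge[of y "p + a"] leg_ge[of y "p - a"] by (simp add: inner_diff_left inner_add_left field_simps)
 qed
 thus ?thesis by simp
qed

lemma leg_continuous: "continuous_on S leg"
proof (rule continuous_on_subset[OF _ subset_UNIV], unfold continuous_on_iff, intro ballI allI impI)
 fix p :: "complex^'n" and e :: real assume e: "e > 0"
 show "\<exists>d>0. \<forall>p'\<in>UNIV. dist p' p < d \<longrightarrow> dist (leg p') (leg p) < e"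
 proof (intro exI[of _ "e / R"] conjI ballI impI)
  fix p' assume "dist p' p < e / R"
  hence "R * norm (p' - p) < e" using R by (simp add: dist_norm field_simps)
  thus "dist (leg p') (leg p) < e"
   using leg_lipschitz[of p p'] leg_lipschitz[of p' p] by (simp add: dist_real_def norm_minus_commute[of p p'])
 qed (use e R in simp)
qed

lemma exc_continuous: "continuous_on B (exc p)"
 unfolding exc_def[abs_def] by (intro continuous_intros perron_continuous)

lemma sec_open: "open (sec p k)"
proof -
 have "sec p k = B \<inter> exc p -` {..<k}" by (auto simp: sec_def)
 thus ?thesis using continuous_open_preimage[OF exc_continuous open_ball open_lessThan, of p k] by simp
qed

lemma sec_convex: "convex (sec p k)"
proof -
 have iff: "exc p y < k \<longleftrightarrow> \<Phi> y - p \<bullet> (y - c) < k - leg p" for y by (auto simp: exc_def)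
 have cv: "convex_on B (%y. \<Phi> y - p \<bullet> (y - c))"
 proof (rule convex_onI[OF _ convex_ball])
  fix t :: real and x y assume t: "0 < t" "t < 1" and xy: "x \<in> B" "y \<in> B"
  have "p \<bullet> ((1 - t) *\<^sub>R x + t *\<^sub>R y - c) = (1 - t) * (p \<bullet> (x - c)) + t * (p \<bullet> (y - c))"
   by (simp add: inner_diff_right inner_add_right algebra_simps)
  thus "\<Phi> ((1 - t) *\<^sub>R x + t *\<^sub>R y) - p \<bullet> ((1 - t) *\<^sub>R x + t *\<^sub>R y - c)
    <= (1 - t) * (\<Phi> x - p \<bullet> (x - c)) + t * (\<Phi> y - p \<bullet> (y - c))"
   using convex_onD[OF perron_convex, of t x y] t xy by (simp add: algebra_simps)
 qed
 show ?thesis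
  unfolding convex_alt
 proof (intro ballI allI impI)
  fix x y and u :: real assume u: "0 <= u \<and> u <= 1" and s: "x \<in> sec p k" "y \<in> sec p k"
  hence xy: "x \<in> B" "y \<in> B" "exc p x < k" "exc p y < k" by (auto simp: sec_def)
  have "\<Phi> ((1 - u) *\<^sub>R x + u *\<^sub>R y) - p \<bullet> ((1 - u) *\<^sub>R x + u *\<^sub>R y - c)
   <= (1 - u) * (\<Phi> x - p \<bullet> (x - c)) + u * (\<Phi> y - p \<bullet> (y - c))"
   using convex_onD[OF cv, of u x y] u xy by simp
  also have "... < k - leg p" using xy(3,4) u unfolding iff by (intro convex_bound_lt) auto
  finally have "exc p ((1 - u) *\<^sub>R x + u *\<^sub>R y) < k" unfolding iff .
  thus "(1 - u) *\<^sub>R x + u *\<^sub>R y \<in> sec p k"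
   using convexD_alt[OF convex_ball xy(1,2), of u] u by (simp add: sec_def)
 qed
qed

end

text \<open>The radius r0 is such that slopes of norm at most r0 change the linear part by at most
  M/8 on the ball. Sections of such slopes of height up to M/4 then stay in \<open>K\<close>, where
  the envelope is at most -M/2.\<close>

locale perron_point = perron_setup g c R for g :: "complex^'n => real" and c R +
 fixes x0 :: "complex^'n" and M r0 :: real
 assumes x0: "x0 \<in> ball c R" and M: "perron g c R x0 = - M" "M > 0" and r0: "r0 = M / (8 * R)"
begin

definition "K = {y \<in> B. \<Phi> y <= - M / 2}"

lemma r0_pos: "r0 > 0" using M R by (simp add: r0)

text \<open>A paraboloid below the envelope vanishes on the boundary sphere, so the sublevel set
  keeps away from it.\<close>

lemma K_compact: "compact K"
proof -
 obtain A where A: "A > 0" "!!y. y \<in> B ==> A * ((norm (y - c))\<^sup>2 - R\<^sup>2) <= \<Phi> y" using perron_lower by blast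
 define \<rho> where "\<rho> = sqrt (max 0 (R\<^sup>2 - M / (2 * A)))"
 have "R\<^sup>2 - M / (2 * A) < R\<^sup>2" using M A by simp
 hence "max 0 (R\<^sup>2 - M / (2 * A)) < R\<^sup>2" using R by simp
 hence \<rho>: "\<rho> < R" using R real_sqrt_less_mono[of "max 0 (R\<^sup>2 - M / (2 * A))" "R\<^sup>2"] by (simp add: \<rho>_def)
 have KB: "K \<subseteq> cball c \<rho>"
 proof
  fix y assume y: "y \<in> K"
  hence "A * ((norm (y - c))\<^sup>2 - R\<^sup>2) <= - M / 2" using A(2)[of y] by (auto simp: K_def)
  hence "(norm (y - c))\<^sup>2 <= R\<^sup>2 - M / (2 * A)" using A(1) by (simp add: field_simps)
  hence "norm (y - c) <= \<rho>" unfolding \<rho>_def by (intro real_le_rsqrt) simp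
  thus "y \<in> cball c \<rho>" by (simp add: dist_norm norm_minus_commute)
 qed
 have sub: "cball c \<rho> \<subseteq> B" using \<rho> by auto
 have "K = cball c \<rho> \<inter> \<Phi> -` {..- M / 2}" using KB sub by (auto simp: K_def)
 moreover have "closed (cball c \<rho> \<inter> \<Phi> -` {..- M / 2})"
  by (rule continuous_closed_preimage[OF continuous_on_subset[OF perron_continuous sub]]) auto
 ultimately have "closed K" by simp
 thus ?thesis using bounded_subset[OF bounded_cball KB] by (simp add: compact_eq_bounded_closed)
qed

lemma K_sub: "K \<subseteq> B" by (auto simp: K_def)

lemma exc_small_K:
 assumes "norm p <= r0" "y \<in> B" "exc p y <= M / 4"
 shows "y \<in> K"
proof -
 have r: "norm p * R <= M / 8" using mult_right_mono[OF assms(1), of R] R by (simp add: r0)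
 have "(- p) \<bullet> (x0 - c) <= M / 8" "p \<bullet> (y - c) <= M / 8"
  using slope_bound[OF x0, of "- p"] slope_bound[OF assms(2), of p] r by auto
 thus ?thesis using assms(2,3) leg_ge[OF x0, of p] M(1) by (simp add: K_def exc_def)
qed

lemma exc_minimizer:
 assumes p: "norm p <= r0"
 shows "\<exists>x\<in>K. exc p x = 0"
proof -
 have near: "\<exists>y\<in>K. exc p y < e" if e: "0 < e" "e <= M/4" for e
 proof -
  have "leg p - e < leg p" using e by simp
  then obtain y where "y \<in> B" "leg p - e < p \<bullet> (y - c) - \<Phi> y"
   unfolding leg_def using less_cSUP_iff[OF B_ne leg_bdd] by blast
  thus ?thesis using exc_small_K[OF p, of y] e by (intro bexI[of _ y]) (auto simp: exc_def)
 qed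
 have "K \<noteq> {}" using near[of "M/4"] M(2) by auto
 moreover have "continuous_on K (exc p)" by (rule continuous_on_subset[OF exc_continuous K_sub])
 ultimately obtain x where x: "x \<in> K" "!!y. y \<in> K ==> exc p x <= exc p y"
  using continuous_attains_inf[OF K_compact] by blast
 have "exc p x <= 0"
 proof (rule ccontr)
  assume "\<not> exc p x <= 0"
  hence "0 < min (exc p x) (M/4)" "min (exc p x) (M/4) <= M/4" using M(2) by auto
  then obtain y where "y \<in> K" "exc p y < min (exc p x) (M/4)" using near by blast
  thus False using x(2)[of y] by simp
 qed
 thus ?thesis using x(1) exc_nonneg[of x p] K_sub by (intro bexI[of _ x]) auto
qed

lemma sec_sub_K: "norm p <= r0 ==> k <= M/4 ==> sec p k \<subseteq> K"
 using exc_small_K by (force simp: sec_def)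

text \<open>A frame W is taken for which the section has width at most 1 in every direction W_i and
  volume at least a constant over |det W|^2; the quadratic comparison with L = 1 bounds |det W|^2
  from above.\<close>

lemma section_volume_lower:
 fixes h G :: real
 assumes p: "norm p <= r0" and h: "0 < h" "h <= M / 4" and G: "!!z. z \<in> sec p h ==> g z <= G"
 shows "(h / CARD('n)) ^ CARD('n) * fact CARD('n) * measure lborel (crosspoly :: (complex^'n) set)
  <= 16 ^ CARD('n) * G * measure lborel (sec p h)"
proof -
 let ?X = "sec p h"
 obtain x where x: "x \<in> K" "exc p x = 0" using exc_minimizer[OF p] by blast
 have xX: "x \<in> ?X" using x h K_sub by (auto simp: sec_def)
 have bX: "bounded ?X" by (rule bounded_subset[OF bounded_ball[of c R]]) (auto simp: sec_def)
 have clX: "closure ?X \<subseteq> K" by (rule closure_minimal[OF sec_sub_K[OF p h(2)] compact_imp_closed[OF K_compact]])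
 obtain W :: "complex^'n^'n" where W: "!!i a b. a \<in> ?X ==> b \<in> ?X ==> \<bar>W $ i \<bullet> (a - b)\<bar> <= 1"
  "emeasure lborel (crosspoly :: (complex^'n) set) <= ennreal ((cmod (det W))\<^sup>2 * 16 ^ CARD('n)) * emeasure lborel ?X"
  using convex_emeasure_ge_frame[OF sec_open sec_convex bX] xX by blast
 have q: "(h / (real CARD('n) * 1\<^sup>2)) ^ CARD('n) * fact CARD('n) * (cmod (det W))\<^sup>2 <= G"
 proof (rule perron_quadratic[OF sec_open _ xX h(1) zero_less_one])
  show "closure ?X \<subseteq> B" using clX K_sub by blast
  show "\<bar>W $ i \<bullet> (z - x)\<bar> <= 1" if "z \<in> ?X" for z i by (rule W(1)[OF that xX])
  show "g z <= G" if "z \<in> ?X" for z by (rule G[OF that])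
  show "\<Phi> x + p \<bullet> (z - x) + h <= \<Phi> z" if z: "z \<in> frontier ?X" for z
  proof -
   have "z \<notin> ?X" "z \<in> B" using z clX K_sub sec_open[of p h] by (auto simp: frontier_def interior_open)
   hence "h <= exc p z" by (auto simp: sec_def)
   thus ?thesis using x(2) by (simp add: exc_def inner_diff_right)
  qed
 qed
 have f: "emeasure lborel ?X = ennreal (measure lborel ?X)"
  "emeasure lborel (crosspoly :: (complex^'n) set) = ennreal (measure lborel (crosspoly :: (complex^'n) set))"
  using emeasure_bounded_finite[OF bX] crosspoly_finite[where 'n='n]
  by (auto simp: emeasure_eq_ennreal_measure top.not_eq_extremum)
 have cp: "measure lborel (crosspoly :: (complex^'n) set) <= (cmod (det W))\<^sup>2 * 16 ^ CARD('n) * measure lborel ?X"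
  using W(2) unfolding f by (simp flip: ennreal_mult)
 have "(h / CARD('n)) ^ CARD('n) * fact CARD('n) * measure lborel (crosspoly :: (complex^'n) set)
   <= (h / CARD('n)) ^ CARD('n) * fact CARD('n) * ((cmod (det W))\<^sup>2 * 16 ^ CARD('n) * measure lborel ?X)"
  using h by (intro mult_left_mono[OF cp]) auto
 also have "... = ((h / CARD('n)) ^ CARD('n) * fact CARD('n) * (cmod (det W))\<^sup>2) * (16 ^ CARD('n) * measure lborel ?X)"
  by (simp only: mult.assoc)
 also have "... <= G * (16 ^ CARD('n) * measure lborel ?X)" using q by (intro mult_right_mono) auto
 finally show ?thesis by (simp add: mult_ac)
qed

text \<open>A frame W of maximal determinant among the differences from p0 bounds the volume of T by
  |det W|^2 times that of the polydisc. The set D cut off at height h by the mean of the n + 1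
  slopes p0 and p0 + W_i is thin in all directions W_i, so the quadratic comparison on D bounds |det
  W|^2.\<close>

lemma slopes_volume_upper:
 fixes h G :: real
 assumes T: "compact T" "T \<noteq> {}" "T \<subseteq> cball 0 r0" and y: "y \<in> B" and h: "0 < h" "h <= M / 8"
  and e: "!!p. p \<in> T ==> exc p y <= h" and G: "!!p z. p \<in> T ==> z \<in> sec p (2 * h) ==> g z <= G"
 shows "fact CARD('n) * measure lborel T
  <= (CARD('n) * (2 * CARD('n) + 2)\<^sup>2 * h) ^ CARD('n) * measure lborel (polydisc :: (complex^'n) set) * G"
proof -
 obtain p0 where p0: "p0 \<in> T" using T(2) by blast
 define T' where "T' = (%p. 1 *\<^sub>R p + (- p0)) ` T"
 have T': "compact T'" "T' \<noteq> {}" unfolding T'_def using T by (auto intro!: compact_continuous_image continuous_intros)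
 have eT: "emeasure lborel T' = emeasure lborel T"
  unfolding T'_def using emeasure_lborel_affine(1)[of T 1 "- p0"] compact_imp_closed[OF T(1)] by simp
 obtain W :: "complex^'n^'n" where W: "!!i. W $ i \<in> T'"
  "emeasure lborel T' <= ennreal ((cmod (det W))\<^sup>2) * emeasure lborel (polydisc :: (complex^'n) set)"
  using compact_emeasure_le_frame[OF T'] by blast
 have pi: "p0 + W $ i \<in> T" for i using W(1)[of i] by (auto simp: T'_def)
 define n where "n = real CARD('n)"
 have n: "n > 0" by (simp add: n_def)
 \<comment> \<open>p0 + s is the mean of the n + 1 slopes. For z in D the numbers -m and a_i - m are
   all below 2 h, and since these n + 1 numbers sum to 0, they are bounded below as well.\<close>
 define s where "s = (1 / (n + 1)) *\<^sub>R (\<Sum>i\<in>UNIV. W $ i)"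
 define D where "D = {z \<in> B. \<Phi> z < \<Phi> y + (p0 + s) \<bullet> (z - y) + h}"
 have eq: "exc p z = \<Phi> z - \<Phi> y - p \<bullet> (z - y) + exc p y" for p z by (simp add: exc_def inner_diff_right)
 have Dprop: "(\<forall>i. \<bar>W $ i \<bullet> (z - y)\<bar> <= (2 * n + 2) * h) \<and> (\<exists>p\<in>T. z \<in> sec p (2 * h))" if z: "z \<in> D" for z
 proof -
  define a where "a i = W $ i \<bullet> (z - y)" for i
  define m where "m = s \<bullet> (z - y)"
  have sm: "(\<Sum>i\<in>UNIV. a i) = (n + 1) * m"
   unfolding a_def m_def s_def using n by (simp add: inner_sum_left)
  have zB: "z \<in> B" and lt: "\<Phi> z < \<Phi> y + p0 \<bullet> (z - y) + m + h"
   using z by (auto simp: D_def m_def inner_add_left)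
  have up: "- m < 2 * h" "a i - m < 2 * h" for i
   using exc_nonneg[OF zB, of p0] e[OF p0] eq[of p0 z] lt
    exc_nonneg[OF zB, of "p0 + W $ i"] e[OF pi, of i] eq[of "p0 + W $ i" z]
   by (auto simp: a_def inner_add_left)
  have cs: "(\<Sum>i\<in>(UNIV::'n set). k) = n * k" for k :: real by (simp add: n_def)
  have "(\<Sum>i\<in>UNIV. a i - m) <= (\<Sum>i\<in>(UNIV::'n set). 2 * h)" using up(2) by (intro sum_mono) (simp add: less_imp_le)
  hence m1: "m <= 2 * n * h" unfolding sum_subtractf cs sm by (simp add: algebra_simps)
  have lo: "- (2 * n * h) <= a i - m" for i
  proof -
   have "(\<Sum>j\<in>UNIV - {i}. a j - m) <= (\<Sum>j\<in>UNIV - {i}. 2 * h)" using up(2) by (intro sum_mono) (simp add: less_imp_le)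
   also have "... = (n - 1) * (2 * h)" by (simp add: n_def card_Diff_singleton of_nat_diff)
   finally have "(\<Sum>j\<in>UNIV - {i}. a j - m) <= (n - 1) * (2 * h)" .
   moreover have "(\<Sum>j\<in>UNIV. a j - m) = (a i - m) + (\<Sum>j\<in>UNIV - {i}. a j - m)" by (rule sum.remove) auto
   moreover have "(\<Sum>j\<in>UNIV. a j - m) = m" unfolding sum_subtractf cs sm by (simp add: algebra_simps)
   ultimately show ?thesis using up(1) by (simp add: algebra_simps)
  qed
  have "\<bar>a i\<bar> <= (2 * n + 2) * h" for i
   using lo[of i] up(2)[of i] up(1) m1 by (simp add: abs_le_iff algebra_simps)
  \<comment> \<open>One of the n + 1 slopes does at least as well at z as their mean.\<close>
  moreover have "\<exists>p\<in>T. z \<in> sec p (2 * h)"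
  proof (cases "m <= 0")
   case True
   hence "exc p0 z < 2 * h" using eq[of p0 z] e[OF p0] lt by linarith
   thus ?thesis using p0 zB by (auto simp: sec_def)
  next
   case False
   have "\<exists>i. m <= a i"
   proof (rule ccontr)
    assume "\<nexists>i. m <= a i"
    hence "(\<Sum>i\<in>UNIV. a i) <= (\<Sum>i\<in>(UNIV::'n set). m)" by (intro sum_mono) (auto simp: not_le less_imp_le)
    thus False using False unfolding cs sm by (simp add: algebra_simps)
   qed
   then obtain i where "m <= a i" by blast
   hence "exc (p0 + W $ i) z < 2 * h"
    using eq[of "p0 + W $ i" z] e[OF pi, of i] lt by (simp add: a_def inner_add_left)
   thus ?thesis using pi[of i] zB by (auto simp: sec_def)
  qed
  ultimately show ?thesis by (simp add: a_def)
 qed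
 have DK: "D \<subseteq> K"
 proof
  fix z assume "z \<in> D"
  then obtain p where "p \<in> T" "z \<in> sec p (2 * h)" using Dprop by blast
  thus "z \<in> K" using sec_sub_K[of p "2 * h"] T(3) h by (auto simp: subset_iff)
 qed
 hence clD: "closure D \<subseteq> K" by (rule closure_minimal[OF _ compact_imp_closed[OF K_compact]])
 have oD: "open D"
 proof -
  have "D = B \<inter> (%z. \<Phi> z - (p0 + s) \<bullet> (z - y)) -` {..<\<Phi> y + h}" by (auto simp: D_def)
  moreover have "continuous_on B (%z. \<Phi> z - (p0 + s) \<bullet> (z - y))" by (intro continuous_intros perron_continuous)
  ultimately show ?thesis using continuous_open_preimage[OF _ open_ball open_lessThan] by metis
 qed
 define L where "L = (2 * n + 2) * h"
 have L: "L > 0" using n h by (simp add: L_def)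
 have "(h / (CARD('n) * L\<^sup>2)) ^ CARD('n) * fact CARD('n) * (cmod (det W))\<^sup>2 <= G"
 proof (rule perron_quadratic[OF oD _ _ h(1) L])
  show "closure D \<subseteq> B" using clD K_sub by blast
  show "y \<in> D" using y h by (simp add: D_def)
  show "\<bar>W $ i \<bullet> (z - y)\<bar> <= L" if "z \<in> D" for z i using Dprop[OF that] by (simp add: L_def)
  show "g z <= G" if "z \<in> D" for z using Dprop[OF that] G by blast
  show "\<Phi> y + (p0 + s) \<bullet> (z - y) + h <= \<Phi> z" if z: "z \<in> frontier D" for z
  proof -
   have "z \<notin> D" "z \<in> B" using z clD K_sub oD by (auto simp: frontier_def interior_open)
   thus ?thesis by (simp add: D_def)
  qed
 qed
 moreover define E where "E = n * (2 * n + 2)\<^sup>2 * h"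
 have E: "E > 0" using n h by (simp add: E_def)
 have "h / (CARD('n) * L\<^sup>2) = 1 / E"
  using h n by (simp add: L_def E_def n_def power_mult_distrib power2_eq_square)
 ultimately have dE: "fact CARD('n) * (cmod (det W))\<^sup>2 <= E ^ CARD('n) * G"
  using E by (simp add: power_divide field_simps)
 have f: "emeasure lborel T = ennreal (measure lborel T)"
  "emeasure lborel (polydisc :: (complex^'n) set) = ennreal (measure lborel (polydisc :: (complex^'n) set))"
  using emeasure_bounded_finite[OF compact_imp_bounded[OF T(1)]] polydisc_finite[where 'n='n]
  by (auto simp: emeasure_eq_ennreal_measure top.not_eq_extremum)
 have "measure lborel T <= (cmod (det W))\<^sup>2 * measure lborel (polydisc :: (complex^'n) set)"
  using W(2) unfolding eT f by (simp flip: ennreal_mult)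
 hence "fact CARD('n) * measure lborel T <= fact CARD('n) * ((cmod (det W))\<^sup>2 * measure lborel (polydisc :: (complex^'n) set))"
  by (intro mult_left_mono) auto
 also have "... = (fact CARD('n) * (cmod (det W))\<^sup>2) * measure lborel (polydisc :: (complex^'n) set)" by (simp only: mult.assoc)
 also have "... <= E ^ CARD('n) * G * measure lborel (polydisc :: (complex^'n) set)" using dE by (intro mult_right_mono) auto
 also have "... = E ^ CARD('n) * measure lborel (polydisc :: (complex^'n) set) * G" by (simp only: mult.assoc mult.commute[of G])
 finally show ?thesis unfolding E_def n_def by (simp add: add.commute)
qed

end

section \<open>Regular slopes and the double count\<close>

context perron_point
begin

text \<open>Second differences of a convex function are non-negative, so Markov's inequality
  applies. Their integral over a ball telescopes into integrals of the first difference over the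
  ball and a shifted ball; these cancel outside a thin shell, where the first difference is at most
  R t in modulus.\<close>

lemma second_difference_volume:
 fixes t \<delta> :: real
 assumes b: "norm b = 1" and t: "0 < t" "t < r0" and \<delta>: "\<delta> > 0"
 shows "measure lborel {p \<in> cball 0 r0. t * \<delta> < leg (p + t *\<^sub>R b) + leg (p - t *\<^sub>R b) - 2 * leg p}
  <= (R / \<delta>) * (measure lborel (cball (0::complex^'n) (r0 + t)) - measure lborel (cball (0::complex^'n) (r0 - t)))"
proof -
 let ?P = "cball (0::complex^'n) r0"
 define \<psi> where "\<psi> p = leg (p + t *\<^sub>R b) - leg p" for p
 define Q where "Q p = leg (p + t *\<^sub>R b) + leg (p - t *\<^sub>R b) - 2 * leg p" for p
 define E where "E = {p \<in> ?P. t * \<delta> < Q p}"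
 have lc: "continuous_on UNIV leg" by (rule leg_continuous)
 have c\<psi>: "continuous_on UNIV \<psi>" unfolding \<psi>_def
  by (intro continuous_intros continuous_on_compose2[OF lc]) auto
 have cQ: "continuous_on UNIV Q" unfolding Q_def
  by (intro continuous_intros continuous_on_compose2[OF lc]) auto
 have \<psi>b: "\<bar>\<psi> p\<bar> <= R * t" for p
  using leg_lipschitz[of p "p + t *\<^sub>R b"] leg_lipschitz[of "p + t *\<^sub>R b" p] b t by (auto simp: \<psi>_def abs_le_iff)
 have Q\<psi>: "Q p = \<psi> p - \<psi> (p - t *\<^sub>R b)" for p by (simp add: Q_def \<psi>_def)
 have Q0: "0 <= Q p" for p using leg_midpoint[of p "t *\<^sub>R b"] by (simp add: Q_def)
 have mE: "E \<in> sets borel"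
 proof -
  have "E = ?P \<inter> {p. t * \<delta> < Q p}" by (auto simp: E_def)
  moreover have "open {p. t * \<delta> < Q p}" by (intro open_Collect_less continuous_intros cQ)
  ultimately show ?thesis by simp
 qed
 have fin: "emeasure lborel S < \<infinity>" if "S \<subseteq> cball (0::complex^'n) r" for S r
  by (rule emeasure_bounded_finite[OF bounded_subset[OF bounded_cball that]])
 have EP: "E \<subseteq> ?P" by (auto simp: E_def)
 have iE: "integrable lborel (%p. indicator E p * (t * \<delta>) :: real)"
  using fin[OF EP] mE by (intro integrable_mult_left integrable_real_indicator) auto
 have i1: "integrable lborel (%p. indicator ?P p *\<^sub>R f p)" if "continuous_on UNIV f" for f :: "complex^'n => real"
  by (rule borel_integrable_compact[OF compact_cball continuous_on_subset[OF that]]) auto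
 have c\<psi>': "continuous_on UNIV (%p. \<psi> (p - t *\<^sub>R b))" by (intro continuous_on_compose2[OF c\<psi>] continuous_intros) auto
 have m\<psi>: "\<psi> \<in> borel_measurable borel" by (rule borel_measurable_continuous_onI[OF c\<psi>])
 define F where "F p = (indicator ?P p * \<psi> (p - t *\<^sub>R b) :: real)" for p
 have mF: "F \<in> borel_measurable borel" unfolding F_def
  by (intro borel_measurable_times borel_measurable_continuous_onI[OF c\<psi>'] borel_measurable_indicator) simp
 have sF: "(LBINT p. F (t *\<^sub>R b + p)) = (LBINT p. F p)" by (rule integral_shift[OF mF])
 have i2: "integrable lborel (%p. F (t *\<^sub>R b + p))"
 proof (rule bounded_support_integrable[where S="cball 0 (r0 + t)" and B="R * t"])
  show "(%p. F (t *\<^sub>R b + p)) \<in> borel_measurable borel" using mF by measurable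
  show "\<bar>F (t *\<^sub>R b + p)\<bar> <= R * t" for p using \<psi>b[of p] R t by (auto simp: F_def indicator_def)
  show "F (t *\<^sub>R b + p) = 0" if "p \<notin> cball 0 (r0 + t)" for p
   using that norm_triangle_ineq2[of p "- (t *\<^sub>R b)"] b t by (auto simp: F_def indicator_def add.commute)
 qed auto
 let ?S = "cball (0::complex^'n) (r0 + t) - cball 0 (r0 - t)"
 have "t * \<delta> * measure lborel E = (LBINT p. indicator E p * (t * \<delta>))"
  using mE fin[OF EP] by (simp add: mult.commute)
 also have "... <= (LBINT p. indicator ?P p *\<^sub>R Q p)"
  by (rule integral_mono[OF iE i1[OF cQ]]) (use Q0 in \<open>auto simp: E_def indicator_def\<close>)
 also have "... = (LBINT p. indicator ?P p *\<^sub>R \<psi> p - indicator ?P p *\<^sub>R \<psi> (p - t *\<^sub>R b))"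
  unfolding Q\<psi> by (simp add: right_diff_distrib)
 also have "... = (LBINT p. indicator ?P p *\<^sub>R \<psi> p) - (LBINT p. F p)"
  using i1[OF c\<psi>] i1[OF c\<psi>'] by (subst Bochner_Integration.integral_diff) (auto simp: F_def[abs_def])
 also have "... = (LBINT p. indicator ?P p *\<^sub>R \<psi> p - F (t *\<^sub>R b + p))"
  unfolding sF[symmetric] by (rule Bochner_Integration.integral_diff[symmetric, OF i1[OF c\<psi>] i2])
 also have "... <= (LBINT p. indicator ?S p * (R * t))"
 proof (rule integral_mono[OF Bochner_Integration.integrable_diff[OF i1[OF c\<psi>] i2]])
  show "integrable lborel (%p. indicator ?S p * (R * t) :: real)"
   using fin[of ?S "r0 + t"] by (intro integrable_mult_left integrable_real_indicator) auto
  fix p :: "complex^'n"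
  have nb: "norm (t *\<^sub>R b) = t" using b t by simp
  have "indicator ?P p *\<^sub>R \<psi> p - F (t *\<^sub>R b + p) = (indicator ?P p - indicator ?P (t *\<^sub>R b + p)) * \<psi> p"
   by (simp add: F_def left_diff_distrib)
  also have "... <= indicator ?S p * (R * t)"
  proof -
   have 1: "norm p <= norm (t *\<^sub>R b + p) + t" "norm (t *\<^sub>R b + p) <= norm p + t"
    using norm_triangle_ineq4[of "t *\<^sub>R b + p" "t *\<^sub>R b"] norm_triangle_ineq[of "t *\<^sub>R b" p] nb by auto
   consider "norm p <= r0 - t" | "r0 + t < norm p" | "r0 - t < norm p" "norm p <= r0 + t" by linarith
   thus ?thesis
   proof cases
    case 3
    hence "p \<in> ?S" by simp
    moreover have "(indicator ?P p - indicator ?P (t *\<^sub>R b + p)) * \<psi> p <= R * t"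
     using \<psi>b[of p] R t by (auto simp: indicator_def abs_le_iff)
    ultimately show ?thesis by simp
   qed (use 1 t in \<open>auto simp: indicator_def\<close>)
  qed
  finally show "indicator ?P p *\<^sub>R \<psi> p - F (t *\<^sub>R b + p) <= indicator ?S p * (R * t)" .
 qed
 also have "... = R * t * measure lborel ?S" using fin[of ?S "r0 + t"] by (simp add: mult.commute)
 also have "measure lborel ?S = measure lborel (cball (0::complex^'n) (r0 + t)) - measure lborel (cball (0::complex^'n) (r0 - t))"
  using t fin[of "cball 0 (r0 + t)" "r0 + t"] by (intro measure_Diff) auto
 finally have "t * \<delta> * measure lborel E <= R * t * (measure lborel (cball (0::complex^'n) (r0 + t)) - measure lborel (cball (0::complex^'n) (r0 - t)))" .
 hence "t * (\<delta> * measure lborel E) <= t * (R * (measure lborel (cball (0::complex^'n) (r0 + t)) - measure lborel (cball (0::complex^'n) (r0 - t))))"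
  by (simp only: mult.assoc mult.left_commute[of R])
 hence "measure lborel E <= R * (measure lborel (cball (0::complex^'n) (r0 + t)) - measure lborel (cball (0::complex^'n) (r0 - t))) / \<delta>"
  using t \<delta> by (simp add: pos_le_divide_eq mult.commute)
 thus ?thesis unfolding E_def Q_def by simp
qed

lemma g_bounds: "\<exists>e>0. \<forall>x\<in>K. e <= g x"
proof (cases "K = {}")
 case False
 obtain x where "x \<in> K" "!!y. y \<in> K ==> g x <= g y"
  using continuous_attains_inf[OF K_compact False continuous_on_subset[OF g]] by auto
 thus ?thesis using gpos by blast
qed (auto intro: exI[of _ 1])

lemma g_oscillation: "\<exists>\<delta>>0. \<forall>x\<in>K. \<forall>y\<in>K. dist x y <= \<delta> \<longrightarrow> g x <= (3/2) * g y"
proof -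
 obtain e where e: "e > 0" "!!x. x \<in> K ==> e <= g x" using g_bounds by blast
 have "uniformly_continuous_on K g" by (rule compact_uniformly_continuous[OF continuous_on_subset[OF g] K_compact]) auto
 then obtain d where d: "d > 0" "!!x y. x \<in> K ==> y \<in> K ==> dist x y < d ==> dist (g x) (g y) < e / 2"
  unfolding uniformly_continuous_on_def using e(1) by (metis half_gt_zero dist_commute)
 have "g x <= (3/2) * g y" if "x \<in> K" "y \<in> K" "dist x y <= d / 2" for x y
 proof -
  have "dist x y < d" using that(3) d(1) by linarith
  hence "\<bar>g x - g y\<bar> < e / 2" using d(2)[OF that(1,2)] by (simp add: dist_real_def)
  thus ?thesis using e(2)[OF that(2)] by linarith
 qed
 thus ?thesis using d(1) by (intro exI[of _ "d / 2"]) auto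
qed

text \<open>A quantitative substitute for differentiability of \<open>leg\<close> at p, in closed
  form so that the set is compact; it forces sections of height t \<delta> / 2 to have diameter of
  order \<delta>.\<close>

definition regular_slopes :: "real => real => (complex^'n) set" where
 "regular_slopes t \<delta> = {p \<in> cball 0 r0. \<forall>b\<in>Basis. leg (p + t *\<^sub>R b) + leg (p - t *\<^sub>R b) - 2 * leg p <= t * \<delta>}"

lemma regular_slopes_compact: "compact (regular_slopes t \<delta>)"
proof -
 have lc: "continuous_on UNIV leg" by (rule leg_continuous)
 have "regular_slopes t \<delta> = cball 0 r0 \<inter> (\<Inter>b\<in>Basis. {p. leg (p + t *\<^sub>R b) + leg (p - t *\<^sub>R b) - 2 * leg p <= t * \<delta>})"
  by (auto simp: regular_slopes_def)
 moreover have "closed (\<Inter>b\<in>Basis. {p. leg (p + t *\<^sub>R b) + leg (p - t *\<^sub>R b) - 2 * leg p <= t * \<delta>})"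
  by (intro closed_INT ballI closed_Collect_le continuous_intros continuous_on_compose2[OF lc]) auto
 ultimately show ?thesis by (simp add: compact_Int_closed)
qed

text \<open>For each of the finitely many basis directions the exceptional slopes have volume at
  most R / \<delta> times that of a shell whose width tends to 0.\<close>

lemma regular_slopes_half:
 assumes \<delta>: "\<delta> > 0"
 shows "\<forall>\<^sub>F t in at_right 0. measure lborel (cball (0::complex^'n) r0) <= 2 * measure lborel (regular_slopes t \<delta>)"
proof -
 let ?N = "DIM(complex^'n)"
 define \<omega> where "\<omega> = measure lborel (cball (0::complex^'n) r0)"
 define V where "V t = real ?N * ((R / \<delta>) * (unit_ball_vol ?N * (r0 + t) ^ ?N - unit_ball_vol ?N * (r0 - t) ^ ?N))" for t :: real
 have "isCont V 0" unfolding V_def by (intro continuous_intros)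
 hence "(V \<longlongrightarrow> V 0) (at_right 0)" by (simp add: isCont_def filterlim_at_split)
 moreover have "V 0 = 0" by (simp add: V_def)
 moreover have "\<omega> > 0" unfolding \<omega>_def using r0_pos by (subst content_cball) auto
 ultimately have "\<forall>\<^sub>F t in at_right 0. V t < \<omega> / 2" by (intro order_tendstoD(2)) auto
 moreover have "\<forall>\<^sub>F t in at_right (0::real). t < r0" using r0_pos by (rule eventually_at_rightI[where b=r0, rotated]) auto
 moreover have "\<forall>\<^sub>F t in at_right (0::real). 0 < t" by (simp add: eventually_at_right_less)
 ultimately show ?thesis
 proof eventually_elim
  case (elim t)
  define E where "E b = {p \<in> cball 0 r0. t * \<delta> < leg (p + t *\<^sub>R b) + leg (p - t *\<^sub>R b) - 2 * leg p}" for b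
  have lc: "continuous_on UNIV leg" by (rule leg_continuous)
  have mE: "E b \<in> sets lborel" for b
  proof -
   have "E b = cball 0 r0 \<inter> {p. t * \<delta> < leg (p + t *\<^sub>R b) + leg (p - t *\<^sub>R b) - 2 * leg p}" by (auto simp: E_def)
   moreover have "open {p. t * \<delta> < leg (p + t *\<^sub>R b) + leg (p - t *\<^sub>R b) - 2 * leg p}"
    by (intro open_Collect_less continuous_intros continuous_on_compose2[OF lc]) auto
   ultimately show ?thesis by simp
  qed
  have fE: "E b \<in> fmeasurable lborel" for b
  proof -
   have "E b \<subseteq> cball 0 r0" by (auto simp: E_def)
   hence "emeasure lborel (E b) < \<infinity>" by (rule emeasure_bounded_finite[OF bounded_subset[OF bounded_cball]])
   thus ?thesis using mE by (simp add: fmeasurable_def)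
  qed
  have fP: "regular_slopes t \<delta> \<in> fmeasurable lborel"
   using regular_slopes_compact[of t \<delta>] by (simp add: fmeasurable_compact)
  have sub: "cball 0 r0 \<subseteq> regular_slopes t \<delta> \<union> (\<Union>b\<in>Basis. E b)"
   by (auto simp: regular_slopes_def E_def not_le)
  have "\<omega> <= measure lborel (regular_slopes t \<delta> \<union> (\<Union>b\<in>Basis. E b))"
   unfolding \<omega>_def using sub by (rule measure_mono_fmeasurable) (use fP fE in \<open>auto intro!: fmeasurable.Un fmeasurable.finite_UN\<close>)
  also have "... <= measure lborel (regular_slopes t \<delta>) + measure lborel (\<Union>b\<in>Basis. E b)"
   using mE fP by (intro measure_Un_le) (auto simp: fmeasurable_def)
  also have "measure lborel (\<Union>b\<in>Basis. E b) <= (\<Sum>b\<in>Basis. measure lborel (E b))"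
   using fE by (intro measure_UNION_le) (auto simp: fmeasurable_def)
  also have "... <= (\<Sum>b\<in>(Basis::(complex^'n) set). (R / \<delta>) * (measure lborel (cball (0::complex^'n) (r0 + t)) - measure lborel (cball (0::complex^'n) (r0 - t))))"
   unfolding E_def by (intro sum_mono second_difference_volume) (use elim \<delta> in auto)
  also have "... = V t" unfolding V_def using elim by (subst (1 2) content_cball) auto
  finally show ?case using elim unfolding \<omega>_def by simp
 qed
qed

text \<open>Young's inequality at slope p + t b with point y and at slope p - t b with point z,
  added up, bounds t times the b-component of y - z by the second difference of \<open>leg\<close>
  plus the two gaps.\<close>

lemma regular_section_diameter:
 fixes t \<delta> :: real
 assumes p: "p \<in> regular_slopes t \<delta>" and t: "t > 0" and yz: "y \<in> sec p (t * \<delta> / 2)" "z \<in> sec p (t * \<delta> / 2)"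
 shows "dist y z <= real DIM(complex^'n) * (2 * \<delta>)"
proof -
 have one: "b \<bullet> (y - z) <= 2 * \<delta>" if b: "b \<in> Basis" and yz: "y \<in> sec p (t * \<delta> / 2)" "z \<in> sec p (t * \<delta> / 2)" for b y z
 proof -
  have "(p + t *\<^sub>R b) \<bullet> (y - c) - \<Phi> y <= leg (p + t *\<^sub>R b)" "(p - t *\<^sub>R b) \<bullet> (z - c) - \<Phi> z <= leg (p - t *\<^sub>R b)"
   using yz by (auto simp: sec_def intro!: leg_ge)
  moreover have "leg (p + t *\<^sub>R b) + leg (p - t *\<^sub>R b) - 2 * leg p <= t * \<delta>" using p b by (auto simp: regular_slopes_def)
  moreover have "\<Phi> y - p \<bullet> (y - c) + leg p < t * \<delta> / 2" "\<Phi> z - p \<bullet> (z - c) + leg p < t * \<delta> / 2"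
   using yz by (auto simp: sec_def exc_def)
  ultimately have "t * (b \<bullet> (y - c)) - t * (b \<bullet> (z - c)) <= 2 * (t * \<delta>)"
   by (simp add: inner_add_left inner_diff_left)
  hence "t * (b \<bullet> (y - z)) <= t * (2 * \<delta>)" by (simp add: inner_diff_right algebra_simps)
  thus ?thesis using t by simp
 qed
 have "dist y z <= (\<Sum>b\<in>Basis. \<bar>(y - z) \<bullet> b\<bar>)" unfolding dist_norm by (rule norm_le_l1)
 also have "... <= (\<Sum>b\<in>(Basis::(complex^'n) set). 2 * \<delta>)"
 proof (rule sum_mono)
  fix b :: "complex^'n" assume b: "b \<in> Basis"
  show "\<bar>(y - z) \<bullet> b\<bar> <= 2 * \<delta>"
   using one[OF b yz] one[OF b yz(2,1)] by (simp add: inner_diff_right inner_commute[of _ b] abs_le_iff)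
 qed
 finally show ?thesis by simp
qed

text \<open>Both sides estimate the \<open>g\<close>-weighted volume of \<open>{(p, y). exc p y <= h}\<close> with \<open>h = t \<delta> / 4\<close>; the powers of \<open>h\<close> cancel.\<close>
lemma slopes_volume_le:
 "(1 / CARD('n)) ^ CARD('n) * fact CARD('n) * measure lborel (crosspoly :: (complex^'n) set) * fact CARD('n)
   * measure lborel (cball (0::complex^'n) r0)
  <= 8 * 16 ^ CARD('n) * (CARD('n) * (2 * CARD('n) + 2)\<^sup>2) ^ CARD('n) * measure lborel (polydisc :: (complex^'n) set)
   * (LBINT x. indicator B x * (g x)\<^sup>2)"
proof -
 obtain \<delta>0 where \<delta>0: "\<delta>0 > 0" "!!x y. x \<in> K ==> y \<in> K ==> dist x y <= \<delta>0 ==> g x <= (3/2) * g y" using g_oscillation by blast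
 \<comment> \<open>Sections of regular slopes then have diameter at most \<open>\<delta>0\<close>, a
   scale on which g varies by a factor of at most 3/2.\<close>
 define \<delta> where "\<delta> = \<delta>0 / (2 * DIM(complex^'n))"
 have \<delta>: "\<delta> > 0" "DIM(complex^'n) * (2 * \<delta>) = \<delta>0" using \<delta>0 by (auto simp: \<delta>_def)
 have "\<forall>\<^sub>F t in at_right (0::real). t < M / (2 * \<delta>)" using M \<delta> by (intro eventually_at_rightI[where b="M / (2 * \<delta>)"]) auto
 hence "\<forall>\<^sub>F t in at_right 0. measure lborel (cball (0::complex^'n) r0) <= 2 * measure lborel (regular_slopes t \<delta>) \<and> t < M / (2 * \<delta>) \<and> 0 < t"
  using regular_slopes_half[OF \<delta>(1)] eventually_at_right_less[of "0::real"] by eventually_elim auto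
 then obtain t where t: "measure lborel (cball (0::complex^'n) r0) <= 2 * measure lborel (regular_slopes t \<delta>)" "t < M / (2 * \<delta>)" "0 < t"
  by (metis (mono_tags, lifting) eventually_happens' trivial_limit_at_right_real)
 define h where "h = t * \<delta> / 4"
 have h: "0 < h" "h <= M / 8" "2 * h = t * \<delta> / 2" using t \<delta> by (auto simp: h_def field_simps)
 define P where "P = regular_slopes t \<delta>"
 have PB: "P \<subseteq> cball 0 r0" by (auto simp: P_def regular_slopes_def)
 have cP: "compact P" unfolding P_def by (rule regular_slopes_compact)
 have osc: "g z <= (3/2) * g y" if "p \<in> P" "y \<in> sec p (2 * h)" "z \<in> sec p (2 * h)" for p y z
 proof (rule \<delta>0(2))
  show "z \<in> K" "y \<in> K" using sec_sub_K[of p "2 * h"] that PB h(1,2) by (auto simp: subset_iff)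
  show "dist z y <= \<delta>0" using regular_section_diameter[of p t \<delta> z y] that t(3) \<delta>(2) h(3) by (simp add: P_def)
 qed
 define A where "A = {x \<in> P \<times> K. exc (fst x) (snd x) <= h}"
 have cA: "compact A"
 proof -
  have "continuous_on (P \<times> K) (%x. exc (fst x) (snd x))"
   unfolding exc_def
   by (intro continuous_intros continuous_on_compose2[OF leg_continuous[of UNIV]] continuous_on_compose2[OF perron_continuous]) (use K_sub in auto)
  hence "closed ((P \<times> K) \<inter> (%x. exc (fst x) (snd x)) -` {..h})"
   by (rule continuous_closed_preimage[OF _ compact_imp_closed[OF compact_Times[OF cP K_compact]] closed_atMost])
  moreover have "A = (P \<times> K) \<inter> (%x. exc (fst x) (snd x)) -` {..h}" by (auto simp: A_def)
  ultimately have "closed A" by simp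
  moreover have "bounded A" by (rule bounded_subset[OF compact_imp_bounded[OF compact_Times[OF cP K_compact]]]) (auto simp: A_def)
  ultimately show ?thesis by (simp add: compact_eq_bounded_closed)
 qed
 define F where "F p y = (indicator A (p, y) * ennreal (g y))" for p y
 have mg: "(%y. ennreal (g y)) \<in> borel_measurable borel" using borel_measurable_continuous_onI[OF g] by simp
 have mF: "(%(p, y). F p y) \<in> borel_measurable (lborel \<Otimes>\<^sub>M lborel)"
 proof -
  have "A \<in> sets (borel \<Otimes>\<^sub>M borel)" unfolding borel_prod using compact_imp_closed[OF cA] by (rule borel_closed)
  hence "(%x. indicator A x * ennreal (g (snd x))) \<in> borel_measurable (borel \<Otimes>\<^sub>M borel)"
   using measurable_compose[OF measurable_snd mg] by (intro borel_measurable_times_ennreal borel_measurable_indicator) auto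
  thus ?thesis
   unfolding measurable_cong_sets[OF sets_pair_measure_cong[OF sets_lborel sets_lborel] refl] F_def case_prod_beta' by simp
 qed
 define c2 where "c2 = (1 / CARD('n)) ^ CARD('n) * fact CARD('n) * measure lborel (crosspoly :: (complex^'n) set)"
 define c1 where "c1 = (CARD('n) * (2 * CARD('n) + 2)\<^sup>2) ^ CARD('n) * measure lborel (polydisc :: (complex^'n) set)"
 have c12: "0 <= c1" "0 <= c2" by (auto simp: c1_def c2_def)
 \<comment> \<open>The factor 4/9 = (2/3)^2 pays twice for the oscillation of g: for the upper bound
   (3/2) g(x) in the volume estimate and for replacing g(y) by (2/3) g(x) in the integral.\<close>
 define k where "k = 4 * (h ^ CARD('n) * c2) / (9 * 16 ^ CARD('n))"
 have k: "k \<ge> 0" using h c12 by (simp add: k_def)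
 have lower: "ennreal k * indicator P p <= (\<integral>\<^sup>+y. F p y \<partial>lborel)" for p
 proof (cases "p \<in> P")
  case True
  hence np: "norm p <= r0" using PB by auto
  obtain x where x: "x \<in> K" "exc p x = 0" using exc_minimizer[OF np] by blast
  hence xs: "x \<in> sec p (2 * h)" using K_sub h by (auto simp: sec_def)
  have sub: "sec p h \<subseteq> sec p (2 * h)" using h by (auto simp: sec_def)
  have "(h / CARD('n)) ^ CARD('n) * fact CARD('n) * measure lborel (crosspoly :: (complex^'n) set)
   <= 16 ^ CARD('n) * ((3/2) * g x) * measure lborel (sec p h)"
   by (rule section_volume_lower[OF np h(1)]) (use h osc[OF True xs] sub M in auto)
  hence "h ^ CARD('n) * c2 <= 16 ^ CARD('n) * ((3/2) * g x) * measure lborel (sec p h)"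
   by (simp add: c2_def power_divide)
  hence kk: "k <= (2/3) * g x * measure lborel (sec p h)"
   by (simp add: k_def field_simps)
  have "bounded (sec p h)" by (rule bounded_subset[OF bounded_ball[of c R]]) (auto simp: sec_def)
  hence f: "emeasure lborel (sec p h) = ennreal (measure lborel (sec p h))"
   by (intro emeasure_eq_ennreal_measure) (use emeasure_bounded_finite[of "sec p h"] in auto)
  have "ennreal k <= ennreal ((2/3) * g x) * emeasure lborel (sec p h)"
   unfolding f using kk gpos[of x] by (simp add: ennreal_leI flip: ennreal_mult)
  also have "... = (\<integral>\<^sup>+y. ennreal ((2/3) * g x) * indicator (sec p h) y \<partial>lborel)"
   using sec_open[of p h] by (simp add: nn_integral_cmult_indicator)
  also have "... <= (\<integral>\<^sup>+y. F p y \<partial>lborel)"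
  proof (rule nn_integral_mono)
   fix y show "ennreal ((2/3) * g x) * indicator (sec p h) y <= F p y"
   proof (cases "y \<in> sec p h")
    case y: True
    have "y \<in> K" using sec_sub_K[OF np, of h] h M y by auto
    hence "(p, y) \<in> A" using y True by (auto simp: A_def sec_def)
    moreover have "(2/3) * g x <= g y" using osc[OF True _ xs, of y] sub y by auto
    ultimately show ?thesis using y by (simp add: F_def ennreal_leI)
   qed simp
  qed
  finally show ?thesis using True by simp
 qed simp
 have upper: "(\<integral>\<^sup>+p. F p y \<partial>lborel) <= ennreal (h ^ CARD('n) * c1 * (3/2) / fact CARD('n)) * (indicator B y * ennreal ((g y)\<^sup>2))" for y
 proof (cases "\<exists>p. (p, y) \<in> A")
  case False
  thus ?thesis by (simp add: F_def)
 next
  case True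
  hence yK: "y \<in> K" by (auto simp: A_def)
  define T where "T = {p. (p, y) \<in> A}"
  have T: "compact T" "T \<noteq> {}" "T \<subseteq> cball 0 r0"
  proof -
   have "T = (%p. (p, y)) -` A" by (auto simp: T_def)
   hence "closed T" by (simp only:) (intro closed_vimage compact_imp_closed[OF cA] continuous_intros)
   moreover show "T \<subseteq> cball 0 r0" using PB by (auto simp: T_def A_def)
   ultimately show "compact T" using bounded_subset[OF bounded_cball] by (auto simp: compact_eq_bounded_closed)
  qed (use True T_def in auto)
  have "fact CARD('n) * measure lborel T
   <= (CARD('n) * (2 * CARD('n) + 2)\<^sup>2 * h) ^ CARD('n) * measure lborel (polydisc :: (complex^'n) set) * ((3/2) * g y)"
  proof (rule slopes_volume_upper[OF T _ h(1,2)])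
   show "y \<in> B" using yK K_sub by blast
   show "exc p y <= h" if "p \<in> T" for p using that by (simp add: T_def A_def)
   show "g z <= (3/2) * g y" if "p \<in> T" "z \<in> sec p (2 * h)" for p z
    by (rule osc[of p]) (use that h yK K_sub in \<open>auto simp: T_def A_def sec_def\<close>)
  qed
  also have "... = h ^ CARD('n) * c1 * (3/2) * g y" by (simp add: c1_def power_mult_distrib)
  finally have "measure lborel T <= h ^ CARD('n) * c1 * (3/2) / fact CARD('n) * g y" by (simp add: field_simps)
  hence le: "measure lborel T * g y <= h ^ CARD('n) * c1 * (3/2) / fact CARD('n) * (g y)\<^sup>2"
   unfolding power2_eq_square mult.assoc[symmetric, of _ "g y"] using gpos[of y] by (intro mult_right_mono) auto
  have "(\<integral>\<^sup>+p. F p y \<partial>lborel) = (\<integral>\<^sup>+p. ennreal (g y) * indicator T p \<partial>lborel)"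
   by (intro nn_integral_cong) (auto simp: F_def T_def indicator_def)
  also have "... = ennreal (g y) * emeasure lborel T"
   using compact_imp_closed[OF T(1)] by (simp add: nn_integral_cmult_indicator)
  also have "emeasure lborel T = ennreal (measure lborel T)"
   using emeasure_bounded_finite[OF compact_imp_bounded[OF T(1)]] by (intro emeasure_eq_ennreal_measure) auto
  also have "ennreal (g y) * ennreal (measure lborel T) = ennreal (measure lborel T * g y)"
   using gpos[of y] by (simp add: ennreal_mult mult.commute less_imp_le)
  also have "... <= ennreal (h ^ CARD('n) * c1 * (3/2) / fact CARD('n) * (g y)\<^sup>2)" using le by (rule ennreal_leI)
  also have "... = ennreal (h ^ CARD('n) * c1 * (3/2) / fact CARD('n)) * ennreal ((g y)\<^sup>2)"
   using h c12 by (intro ennreal_mult) auto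
  finally show ?thesis using yK K_sub by (auto simp: indicator_def)
 qed
 have iB: "integrable lborel (%x. indicator B x * (g x)\<^sup>2)"
 proof -
  have "bounded (g ` cball c R)" by (intro compact_imp_bounded compact_continuous_image continuous_on_subset[OF g]) auto
  then obtain G where "\<forall>y\<in>g ` cball c R. norm y <= G" unfolding bounded_iff by blast
  hence G: "\<bar>g x\<bar> <= G" if "x \<in> cball c R" for x using that by (metis imageI real_norm_def)
  show ?thesis
  proof (rule bounded_support_integrable[where S=B and B="G\<^sup>2"])
   show "\<bar>indicator B x * (g x)\<^sup>2\<bar> <= G\<^sup>2" for x
    using power_mono[OF G[of x] abs_ge_zero, of 2] by (auto simp: indicator_def)
   show "(%x. indicator B x * (g x)\<^sup>2) \<in> borel_measurable borel"
    using borel_measurable_continuous_onI[OF g] by (intro borel_measurable_times borel_measurable_power borel_measurable_indicator) auto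
  qed auto
 qed
 define I where "I = (LBINT x. indicator B x * (g x)\<^sup>2)"
 have I0: "0 <= I" unfolding I_def by (intro integral_nonneg_AE) auto
 have nnI: "(\<integral>\<^sup>+y. indicator B y * ennreal ((g y)\<^sup>2) \<partial>lborel) = ennreal I"
 proof -
  have "(\<integral>\<^sup>+y. indicator B y * ennreal ((g y)\<^sup>2) \<partial>lborel) = (\<integral>\<^sup>+y. ennreal (indicator B y * (g y)\<^sup>2) \<partial>lborel)"
   by (intro nn_integral_cong) (auto simp: indicator_def)
  thus ?thesis unfolding I_def using nn_integral_eq_integral[OF iB] by simp
 qed
 have fP: "emeasure lborel P = ennreal (measure lborel P)"
  using emeasure_bounded_finite[OF compact_imp_bounded[OF cP]] by (intro emeasure_eq_ennreal_measure) auto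
 have "ennreal (k * measure lborel P) = ennreal k * emeasure lborel P" unfolding fP using k by (simp add: ennreal_mult)
 also have "... = (\<integral>\<^sup>+p. ennreal k * indicator P p \<partial>lborel)"
  using compact_imp_closed[OF cP] by (simp add: nn_integral_cmult_indicator)
 also have "... <= (\<integral>\<^sup>+p. (\<integral>\<^sup>+y. F p y \<partial>lborel) \<partial>lborel)" by (intro nn_integral_mono lower)
 also have "... = (\<integral>\<^sup>+y. (\<integral>\<^sup>+p. F p y \<partial>lborel) \<partial>lborel)" using lborel_pair.Fubini'[OF mF] by simp
 also have "... <= (\<integral>\<^sup>+y. ennreal (h ^ CARD('n) * c1 * (3/2) / fact CARD('n)) * (indicator B y * ennreal ((g y)\<^sup>2)) \<partial>lborel)"
  by (intro nn_integral_mono upper)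
 also have "... = ennreal (h ^ CARD('n) * c1 * (3/2) / fact CARD('n)) * ennreal I"
  unfolding nnI[symmetric]
 proof (rule nn_integral_cmult)
  show "(%y. indicator B y * ennreal ((g y)\<^sup>2)) \<in> borel_measurable lborel"
   using borel_measurable_continuous_onI[OF g] by (intro borel_measurable_times_ennreal borel_measurable_indicator) auto
 qed
 also have "... = ennreal (h ^ CARD('n) * c1 * (3/2) / fact CARD('n) * I)"
  by (rule ennreal_mult[symmetric]) (use h c12 I0 in auto)
 finally have "k * measure lborel P <= h ^ CARD('n) * c1 * (3/2) / fact CARD('n) * I"
  by (subst (asm) ennreal_le_iff) (use h c12 I0 in auto)
 hence "h ^ CARD('n) * (4 * c2 * fact CARD('n) * measure lborel P) <= h ^ CARD('n) * (9 * 16 ^ CARD('n) * c1 * (3/2) * I)"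
  by (simp add: k_def field_simps)
 hence "4 * c2 * fact CARD('n) * measure lborel P <= 9 * 16 ^ CARD('n) * c1 * (3/2) * I" using h(1) by simp
 moreover have "c2 * fact CARD('n) * measure lborel (cball (0::complex^'n) r0) <= c2 * fact CARD('n) * (2 * measure lborel P)"
  using t(1) c12 by (intro mult_left_mono) (auto simp: P_def)
 moreover have "0 <= 16 ^ CARD('n) * c1 * I" using c12 I0 by simp
 \<comment> \<open>Half of the slopes being regular, the constant is 2 * (27/2) / 4 = 27/4, rounded
   up to 8.\<close>
 ultimately have "c2 * fact CARD('n) * measure lborel (cball (0::complex^'n) r0) <= 8 * (16 ^ CARD('n) * c1 * I)" by linarith
 thus ?thesis unfolding c1_def c2_def I_def by (simp add: mult.assoc)
qed

end

lemma perron_lower_bound: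
 obtains C :: real where "C > 0"
  "!!(g :: complex^'n => real) c R (x :: complex^'n). R > 0 ==> continuous_on UNIV g ==> (!!x. 0 < g x) ==> x \<in> ball c R ==>
   (max 0 (- perron g c R x)) ^ (2 * CARD('n)) <= C * R ^ (2 * CARD('n)) * (LBINT x. indicator (ball c R) x * (g x)\<^sup>2)"
proof -
 define a where "a = (1 / CARD('n)) ^ CARD('n) * fact CARD('n) * measure lborel (crosspoly :: (complex^'n) set) * fact CARD('n)"
 define b where "b = 8 * 16 ^ CARD('n) * (CARD('n) * (2 * CARD('n) + 2)\<^sup>2) ^ CARD('n) * measure lborel (polydisc :: (complex^'n) set)"
 define v where "v = unit_ball_vol (DIM(complex^'n))"
 have v: "v > 0" by (simp add: v_def)
 have cp: "0 < measure lborel (crosspoly :: (complex^'n) set)"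
  using open_not_negligible[OF crosspoly_open[where 'n='n]] crosspoly_ne[where 'n='n] crosspoly_open[where 'n='n]
   crosspoly_finite[where 'n='n]
  by (auto simp: negligible_iff_null_sets null_sets_def zero_less_measure_iff emeasure_eq_ennreal_measure)
 have a: "a > 0" using cp by (simp add: a_def)
 have b: "b \<ge> 0" by (simp add: b_def)
 \<comment> \<open>The summand 1 makes the constant positive, as b is only known to be non-negative
   here.\<close>
 define C where "C = 8 ^ (2 * CARD('n)) * b / (a * v) + 1"
 have C: "C > 0" using a b v by (simp add: C_def add_nonneg_pos)
 show thesis
 proof (rule that[OF C])
  fix g :: "complex^'n => real" and c R and x :: "complex^'n"
  assume A: "R > 0" "continuous_on UNIV g" "!!x. 0 < g x" "x \<in> ball c R"
  define I where "I = (LBINT x. indicator (ball c R) x * (g x)\<^sup>2)"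
  have I0: "0 <= I" unfolding I_def by (intro integral_nonneg_AE) auto
  define M where "M = - perron g c R x"
  show "(max 0 (- perron g c R x)) ^ (2 * CARD('n)) <= C * R ^ (2 * CARD('n)) * I"
  proof (cases "M > 0")
   case False
   thus ?thesis using C A(1) I0 by (simp add: M_def max_def power_0_left)
  next
   case True
   interpret perron_point g c R x M "M / (8 * R)"
    by unfold_locales (use A True in \<open>auto simp: M_def\<close>)
   have "a * measure lborel (cball (0::complex^'n) (M / (8 * R))) <= b * I"
    using slopes_volume_le unfolding a_def b_def I_def by (simp add: mult.assoc)
   moreover have "measure lborel (cball (0::complex^'n) (M / (8 * R))) = v * (M / (8 * R)) ^ (2 * CARD('n))"
    unfolding v_def using A(1) True by (subst content_cball) (auto simp: mult.commute)
   ultimately have "a * v * (M / (8 * R)) ^ (2 * CARD('n)) <= b * I" by (simp add: mult.assoc)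
   hence "(M / (8 * R)) ^ (2 * CARD('n)) <= b * I / (a * v)" using a v by (simp add: field_simps)
   hence "M ^ (2 * CARD('n)) <= (8 * R) ^ (2 * CARD('n)) * (b * I / (a * v))"
    using A(1) by (simp add: power_divide field_simps)
   also have "... = (8 ^ (2 * CARD('n)) * b / (a * v)) * R ^ (2 * CARD('n)) * I" by (simp add: power_mult_distrib)
   also have "... <= C * R ^ (2 * CARD('n)) * I" using A(1) I0 by (intro mult_right_mono) (auto simp: C_def)
   finally show ?thesis using True by (simp add: M_def max_def)
  qed
 qed
qed

section \<open>Local comparison with smooth functions\<close>

lemma integrable_indicator_ball_continuous:
 fixes f :: "'a::euclidean_space => real"
 assumes "continuous_on UNIV f"
 shows "integrable lborel (%x. indicator (ball a s) x * f x)"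
proof -
 have "integrable lborel (%x. indicator (cball a s) x *\<^sub>R f x)"
  by (rule borel_integrable_compact[OF compact_cball continuous_on_subset[OF assms]]) auto
 hence "integrable lborel (%x. indicator (ball a s) x *\<^sub>R (indicator (cball a s) x *\<^sub>R f x))"
  by (rule integrable_mult_indicator[rotated]) simp
 moreover have "(%x. indicator (ball a s) x *\<^sub>R (indicator (cball a s) x *\<^sub>R f x)) = (%x. indicator (ball a s) x * f x)"
  by (auto simp: indicator_def fun_eq_iff)
 ultimately show ?thesis by simp
qed

text \<open>The bound on subsets of \<Omega> and nullity of the complement order \<mu> below the
  measure with density F. Integrability of the product keeps the right-hand integral from defaulting
  to 0.\<close>

lemma integral_dominated_measure:
 fixes H F :: "'a::euclidean_space => real"
 assumes sets: "sets \<mu> = sets borel" and null: "emeasure \<mu> (- \<Omega>) = 0" "\<Omega> \<in> sets borel"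
  and dom: "!!A. A \<in> sets borel ==> A \<subseteq> \<Omega> ==> emeasure \<mu> A <= (\<integral>\<^sup>+x. indicator A x * ennreal (F x) \<partial>lborel)"
  and F: "F \<in> borel_measurable borel" "!!x. 0 <= F x" and H: "H \<in> borel_measurable borel" "!!x. 0 <= H x"
  and int: "integrable lborel (%x. H x * F x)"
 shows "(\<integral>x. H x \<partial>\<mu>) <= (LBINT x. H x * F x)"
proof -
 define D where "D = density lborel (%x. ennreal (F x))"
 have sD: "sets \<mu> = sets D" by (simp add: D_def sets)
 have "emeasure \<mu> A <= emeasure D A" if A: "A \<in> sets \<mu>" for A
 proof -
  have Ab: "A \<in> sets borel" using A sets by simp
  have "emeasure \<mu> A <= emeasure \<mu> (A \<inter> \<Omega>) + emeasure \<mu> (A \<inter> - \<Omega>)"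
   using Ab null(2) sets by (subst plus_emeasure) (auto simp: Int_Un_distrib[symmetric])
  also have "emeasure \<mu> (A \<inter> - \<Omega>) <= emeasure \<mu> (- \<Omega>)" using null(2) sets by (intro emeasure_mono) auto
  also have "emeasure \<mu> (A \<inter> \<Omega>) <= (\<integral>\<^sup>+x. indicator (A \<inter> \<Omega>) x * ennreal (F x) \<partial>lborel)" using Ab null(2) by (intro dom) auto
  also have "... <= (\<integral>\<^sup>+x. ennreal (F x) * indicator A x \<partial>lborel)" by (intro nn_integral_mono) (auto simp: indicator_def)
  also have "... = emeasure D A" unfolding D_def using Ab F(1) by (subst emeasure_density) auto
  finally show ?thesis using null(1) by simp
 qed
 moreover have "emeasure \<mu> A <= emeasure D A" if "A \<notin> sets \<mu>" for A using that sD by (simp add: emeasure_notin_sets)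
 ultimately have "\<mu> <= D" using sD sets_eq_imp_space_eq[OF sD] by (auto simp: le_measure_iff le_fun_def)
 hence "(\<integral>\<^sup>+x. ennreal (H x) \<partial>\<mu>) <= (\<integral>\<^sup>+x. ennreal (H x) \<partial>D)" by (rule nn_integral_mono_measure[OF sD])
 also have "... = (\<integral>\<^sup>+x. ennreal (F x) * ennreal (H x) \<partial>lborel)" unfolding D_def using F H by (intro nn_integral_density) auto
 also have "... = (\<integral>\<^sup>+x. ennreal (H x * F x) \<partial>lborel)" using F(2) H(2) by (intro nn_integral_cong) (simp add: ennreal_mult mult.commute)
 also have "... = ennreal (LBINT x. H x * F x)" using F(2) H(2) by (intro nn_integral_eq_integral int) auto
 finally have le: "(\<integral>\<^sup>+x. ennreal (H x) \<partial>\<mu>) <= ennreal (LBINT x. H x * F x)" .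
 have "H \<in> borel_measurable \<mu>" using H(1) sets measurable_cong_sets[OF sets refl] by blast
 hence "(\<integral>x. H x \<partial>\<mu>) = enn2real (\<integral>\<^sup>+x. ennreal (H x) \<partial>\<mu>)" using H(2) by (intro integral_eq_nn_integral) auto
 also have "... <= enn2real (ennreal (LBINT x. H x * F x))" by (intro enn2real_mono le) auto
 also have "... = (LBINT x. H x * F x)" using F(2) H(2) by (intro enn2real_ennreal integral_nonneg_AE) auto
 finally show ?thesis .
qed

text \<open>For the regularised maximum w_j of v_j and q, the comparison inequality bounds the mass
  of q by the integral of \<open>H j\<close> against (dd^c v_j)^n, with a test function that moves
  with j. As \<open>H l - H i\<close> is at most v_i - v_l, replacing \<open>H l\<close> by the
  fixed \<open>H i\<close> costs an energy, small on finitely many balls covering K; weak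
  convergence then passes to \<mu>, and the density F takes over.\<close>

lemma local_comparison:
 fixes \<Omega> :: "(complex^'n) set"
 assumes \<Omega>: "open \<Omega>" "bounded \<Omega>" and \<mu>: "MA_measure \<Omega> u \<mu>"
  and F: "F \<in> borel_measurable borel" "!!x. 0 <= F x" "integrable lborel F"
  and dom: "!!A. A \<in> sets borel ==> A \<subseteq> \<Omega> ==> emeasure \<mu> A <= (\<integral>\<^sup>+x. indicator A x * ennreal (F x) \<partial>lborel)"
  and r: "r > 0" and V: "V = inner_part \<Omega> r"
  and v: "!!j. Ck 3 (v j)" "!!j. psh_on V (v j)" and dec: "!!j x. x \<in> V ==> v (Suc j) x <= v j x"
  and lim: "!!x. x \<in> V ==> (%j. v j x) \<longlonglongrightarrow> u x"
  and ge: "!!j x. x \<in> V ==> u x <= v j x" and bd: "!!j x. \<bar>v j x\<bar> <= M"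
  and K: "compact K" "K \<subseteq> inner_part \<Omega> (2 * r)"
  and q: "Ck 3 q" "!!x. x \<in> K ==> hpsd (cHess q x)"
  and e: "e > 0" and off: "!!x. x \<in> V - K ==> q x <= u x - 3 * e" and \<kappa>: "\<kappa> > 0"
 shows "\<exists>i\<ge>i0. (LBINT x. indicator {x \<in> K. 3 * e < q x - v i x} x * (e * kap ((q x - v i x) / e) * MA_density q x))
  <= (LBINT x. indicator K x * (e * kap ((q x - v i x) / e)) * F x) + \<kappa>"
proof -
 have oV: "open V" unfolding V by (rule open_inner_part)
 have KV: "K \<subseteq> V" using K(2) inner_part_mono[of r "2 * r" \<Omega>] r by (auto simp: V)
 have v2: "Ck 2 (v j)" for j using Ck_le[OF _ v(1), of 2] by simp
 have q2: "Ck 2 q" using Ck_le[OF _ q(1), of 2] by simp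
 have vpsd: "hpsd (cHess (v j) x)" if "x \<in> V" for j x by (rule psh_hpsd[OF v2 oV that v(2)])
 have decle: "v j x <= v i x" if "x \<in> V" "i <= j" for i j x
  using lift_Suc_antimono_le[of "%j. v j x", OF dec[OF that(1)] that(2)] .
 \<comment> \<open>On V, v_j + H_j is the regularised maximum. Off K, q lies \<open>3 * e\<close>
   below u \<le> v_j, so \<open>H j\<close> vanishes there and its extension by 0 is smooth.\<close>
 define H where "H i x = (if x \<in> V then e * kap ((q x - v i x) / e) else 0)" for i x
 have H0: "H i x = 0" if "x \<notin> K" for i x
 proof (cases "x \<in> V")
  case True
  hence "q x - v i x <= - 3 * e" using off[of x] ge[OF True, of i] that by auto
  hence "(q x - v i x) / e <= - 3" using e by (simp add: pos_divide_le_eq)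
  thus ?thesis by (simp add: H_def kap_low)
 qed (simp add: H_def)
 have HK: "H i x = indicator K x * (e * kap ((q x - v i x) / e))" for i x
  using H0[of x i] KV by (cases "x \<in> K") (auto simp: H_def)
 have Hnn: "0 <= H i x" for i x using e kap_ge(1) by (simp add: H_def)
 have Hr: "v i x + H i x = rmax e (v i x) (q x)" if "x \<in> V" for i x using that by (simp add: H_def rmax_def)
 have HC: "Ck 3 (H i)" for i
 proof (rule Ck_local)
  fix x
  show "\<exists>U g. open U \<and> x \<in> U \<and> Ck 3 g \<and> (\<forall>y\<in>U. H i y = g y)"
  proof (cases "x \<in> V")
   case True
   have "Ck 3 (%x. rmax e (v i x) (q x) - v i x)" by (intro Ck_diff Ck_rmax v q)
   moreover have "\<forall>y\<in>V. H i y = rmax e (v i y) (q y) - v i y" by (auto simp: Hr[symmetric])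
   ultimately show ?thesis using oV True by blast
  next
   case False
   hence "x \<in> - K" using KV by blast
   moreover have "open (- K)" using compact_imp_closed[OF K(1)] by (rule open_Compl)
   moreover have "\<forall>y\<in>- K. H i y = 0" using H0 by simp
   ultimately show ?thesis using Ck_const by blast
  qed
 qed
 have Hc: "continuous_on UNIV (H i)" for i by (rule Ck_continuous[OF HC])
 define w where "w i x = v i x + H i x" for i x
 have wC: "Ck 3 (w i)" for i unfolding w_def[abs_def] by (intro Ck_add v HC)
 have w2: "Ck 2 (w j)" for j using Ck_le[OF _ wC, of 2] by simp
 have wpsd: "hpsd (cHess (w i) x)" if x: "x \<in> K" for i x
 proof -
  have "cHess (w i) x = cHess (%x. rmax e (v i x) (q x)) x"
   by (rule cHess_cong_open[OF oV]) (use x KV Hr in \<open>auto simp: w_def\<close>)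
  thus ?thesis using rmax_psd(1)[OF v(1) q(1) e vpsd q(2)[OF x]] x KV by auto
 qed
 have iH: "integrable lborel (%x. H i x * G x)" if "continuous_on UNIV G" for i G
  by (rule compact_support_integrable[OF _ K(1)]) (use H0 in \<open>auto intro!: continuous_intros Hc that\<close>)
 have cMA: "continuous_on UNIV (MA_density f)" if "Ck 2 f" for f :: "complex^'n => real" by (rule continuous_MA_density[OF that])
 have cmp: "(LBINT x. H j x * MA_density (w j) x) <= (LBINT x. H j x * MA_density (v j) x)" for j
 proof -
  have "(LBINT x. (w j x - v j x) * (MA_density (w j) x - MA_density (v j) x)) <= 0"
   by (rule MA_difference_integral_nonpos[OF wC v(1) K(1)]) (use H0 wpsd vpsd KV in \<open>auto simp: w_def\<close>)
  hence "(LBINT x. H j x * MA_density (w j) x - H j x * MA_density (v j) x) <= 0"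
   by (simp add: w_def right_diff_distrib)
  thus ?thesis using iH[OF cMA[OF w2]] iH[OF cMA[OF v2]] by (simp add: Bochner_Integration.integral_diff)
 qed
 \<comment> \<open>For j \<ge> i also v_j \<le> v_i, so near points of this set the regularised
   maximum is q, with the density of q, for all such j at once.\<close>
 define S where "S i = {x \<in> K. 3 * e < q x - v i x}" for i
 have bS: "S i \<in> sets borel" for i
 proof -
  have "S i = K \<inter> {x. 3 * e < q x - v i x}" by (auto simp: S_def)
  moreover have "open {x. 3 * e < q x - v i x}"
   by (intro open_Collect_less continuous_intros Ck_continuous[OF q(1)] Ck_continuous[OF v(1)])
  ultimately show ?thesis using compact_imp_closed[OF K(1)] by simp
 qed
 define L where "L i = (LBINT x. indicator (S i) x * (e * kap ((q x - v i x) / e) * MA_density q x))" for i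
 have lower: "L i <= (LBINT x. H j x * MA_density (w j) x)" if ij: "i <= j" for i j
 proof -
  have "L i = (LBINT x. indicator (S i) x *\<^sub>R (H i x * MA_density q x))"
   unfolding L_def by (intro Bochner_Integration.integral_cong) (auto simp: S_def HK indicator_def)
  also have "... <= (LBINT x. H j x * MA_density (w j) x)"
  proof (rule integral_mono)
   show "integrable lborel (%x. indicator (S i) x *\<^sub>R (H i x * MA_density q x))"
    by (rule integrable_mult_indicator[OF _ iH[OF cMA[OF q2]]]) (simp add: bS)
   show "integrable lborel (%x. H j x * MA_density (w j) x)" by (rule iH[OF cMA[OF w2]])
   fix x
   show "indicator (S i) x *\<^sub>R (H i x * MA_density q x) <= H j x * MA_density (w j) x"
   proof (cases "x \<in> S i")
    case False
    thus ?thesis using Hnn[of j x] H0[of x j] wpsd[of x j] MA_density_nonneg[of "w j" x] by (cases "x \<in> K") auto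
   next
    case True
    hence x: "x \<in> K" "x \<in> V" and lt: "3 * e < q x - v i x" using KV by (auto simp: S_def)
    have "MA_density (w j) x = MA_density q x"
    proof (rule MA_density_cong_open[of "V \<inter> {x. 3 * e < q x - v j x}"])
     show "open (V \<inter> {x. 3 * e < q x - v j x})"
      by (intro open_Int oV open_Collect_less continuous_intros Ck_continuous[OF q(1)] Ck_continuous[OF v(1)])
     show "x \<in> V \<inter> {x. 3 * e < q x - v j x}" using x lt decle[OF x(2) ij] by auto
     fix y assume "y \<in> V \<inter> {x. 3 * e < q x - v j x}"
     thus "w j y = q y" unfolding w_def using Hr[of y j] rmax_eq_right[OF e, of "v j y" "q y"] by auto
    qed
    moreover have "H i x <= H j x"
     using x e decle[OF x(2) ij] by (auto simp: H_def intro!: mult_left_mono kap_mono divide_right_mono)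
    moreover have "0 <= MA_density q x" by (rule MA_density_nonneg[OF q(2)[OF x(1)]])
    ultimately show ?thesis using True by (simp add: mult_right_mono)
   qed
  qed
  finally show ?thesis .
 qed
 define \<E> where "\<E> a i l = (LBINT x. indicator (ball a (r/2)) x * ((v i x - v l x) * MA_density (v l) x))" for a i l
 have iE: "integrable lborel (%x. indicator (ball a (r/2)) x * ((v i x - v l x) * MA_density (v l) x))" for a i l
  by (rule integrable_indicator_ball_continuous) (intro continuous_intros Ck_continuous[OF v(1)] cMA v2)
 have bV: "cball a r \<subseteq> V" if a: "a \<in> K" for a
 proof
  fix x assume "x \<in> cball a r"
  thus "x \<in> V" using inner_part_shift[of a \<Omega> r r "a - x"] K(2) a by (auto simp: V dist_norm)
 qed
 obtain T where T: "T \<subseteq> K" "finite T" "K \<subseteq> (\<Union>a\<in>T. ball a (r/2))"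
  by (rule compactE_image[OF K(1), of K "%a. ball a (r/2)"]) (use r in auto)
 have bV2: "x \<in> V" if "a \<in> T" "x \<in> ball a (r/2)" for a x
 proof -
  have "x \<in> cball a r" using that(2) r by simp
  thus ?thesis using bV T(1) that(1) by blast
 qed
 \<comment> \<open>All covering balls together cost at most \<kappa> / 2; the added 1 covers an
   empty cover.\<close>
 define \<tau> where "\<tau> = \<kappa> / (2 * (real (card T) + 1))"
 have \<tau>: "\<tau> > 0" "real (card T) * \<tau> <= \<kappa> / 2" using \<kappa> by (auto simp: \<tau>_def field_simps)
 have "\<exists>i. \<forall>\<^sub>F l in sequentially. \<E> a i l <= \<tau>" if a: "a \<in> T" for a
  unfolding \<E>_def by (rule decreasing_energy_small[OF v(1) _ _ bd r \<tau>(1)]) (use bV[of a] a T(1) vpsd dec in blast)+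
 then obtain I where I: "!!a. a \<in> T ==> \<forall>\<^sub>F l in sequentially. \<E> a (I a) l <= \<tau>" by metis
 define i where "i = Max (insert i0 (I ` T))"
 have ii: "i0 <= i" "!!a. a \<in> T ==> I a <= i" using T(2) by (auto simp: i_def)
 have small: "\<forall>\<^sub>F l in sequentially. \<E> a i l <= \<tau>" if a: "a \<in> T" for a
 proof -
  have "\<E> a i l <= \<E> a (I a) l" if "l \<ge> i" for l
   unfolding \<E>_def
  proof (rule integral_mono[OF iE iE])
   fix x
   show "indicator (ball a (r/2)) x * ((v i x - v l x) * MA_density (v l) x)
    <= indicator (ball a (r/2)) x * ((v (I a) x - v l x) * MA_density (v l) x)"
   proof (cases "x \<in> ball a (r/2)")
    case True
    hence x: "x \<in> V" by (rule bV2[OF a])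
    thus ?thesis using True decle[OF x ii(2)[OF a]] MA_density_nonneg[OF vpsd[OF x, of l]] by (simp add: mult_right_mono)
   qed simp
  qed
  note mono = this
  show ?thesis using I[OF a] eventually_ge_at_top[of i]
  proof eventually_elim
   case (elim l)
   thus ?case using mono[of l] by linarith
  qed
 qed
 have ev: "\<forall>\<^sub>F l in sequentially. L i - \<kappa> / 2 <= (LBINT x. H i x * MA_density (v l) x)"
 proof -
  have "\<forall>\<^sub>F l in sequentially. \<forall>a\<in>T. \<E> a i l <= \<tau>" using T(2) small by (simp add: eventually_ball_finite_distrib)
  thus ?thesis using eventually_ge_at_top[of i]
  proof eventually_elim
   case (elim l)
   have "L i <= (LBINT x. H l x * MA_density (v l) x)" using lower[OF elim(2)] cmp order_trans by blast
   also have "... <= (LBINT x. H i x * MA_density (v l) x + (\<Sum>a\<in>T. indicator (ball a (r/2)) x * ((v i x - v l x) * MA_density (v l) x)))"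
   proof (rule integral_mono[OF iH[OF cMA[OF v2]] Bochner_Integration.integrable_add[OF iH[OF cMA[OF v2]] Bochner_Integration.integrable_sum[OF iE]]])
    fix x
    have nn: "0 <= indicator (ball a (r/2)) x * ((v i x - v l x) * MA_density (v l) x)" if "a \<in> T" for a
    proof (cases "x \<in> ball a (r/2)")
     case True
     hence x: "x \<in> V" by (rule bV2[OF that])
     thus ?thesis using True decle[OF x elim(2)] MA_density_nonneg[OF vpsd[OF x, of l]] by simp
    qed simp
    show "H l x * MA_density (v l) x <= H i x * MA_density (v l) x + (\<Sum>a\<in>T. indicator (ball a (r/2)) x * ((v i x - v l x) * MA_density (v l) x))"
    proof (cases "x \<in> K")
     case False
     thus ?thesis using H0 nn by (simp add: sum_nonneg)
    next
     case True
     hence x: "x \<in> V" using KV by blast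
     obtain a where a: "a \<in> T" "x \<in> ball a (r/2)" using T(3) True by blast
     have m: "0 <= MA_density (v l) x" by (rule MA_density_nonneg[OF vpsd[OF x]])
     \<comment> \<open>\<open>kap\<close> has Lipschitz constant 1, which turns the change of test
       function into the energy integrand v_i - v_l.\<close>
     have "H l x - H i x = e * (kap ((q x - v l x) / e) - kap ((q x - v i x) / e))" using x by (simp add: H_def right_diff_distrib)
     also have "... <= e * ((q x - v l x) / e - (q x - v i x) / e)"
      using e decle[OF x elim(2)] by (intro mult_left_mono kap_lipschitz divide_right_mono) auto
     also have "... = v i x - v l x" using e by (simp add: field_simps)
     finally have "(H l x - H i x) * MA_density (v l) x <= (v i x - v l x) * MA_density (v l) x" using m by (rule mult_right_mono)
     also have "... = indicator (ball a (r/2)) x * ((v i x - v l x) * MA_density (v l) x)" using a by simp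
     also have "... <= (\<Sum>a\<in>T. indicator (ball a (r/2)) x * ((v i x - v l x) * MA_density (v l) x))"
      by (rule member_le_sum[OF a(1) _ T(2)]) (use nn in auto)
     finally show ?thesis by (simp add: left_diff_distrib)
    qed
   qed
   also have "... = (LBINT x. H i x * MA_density (v l) x) + (\<Sum>a\<in>T. \<E> a i l)"
    unfolding \<E>_def using iH[OF cMA[OF v2]] iE by (subst Bochner_Integration.integral_add) auto
   also have "(\<Sum>a\<in>T. \<E> a i l) <= real (card T) * \<tau>" using elim(1) by (intro sum_bounded_above) auto
   finally show ?case using \<tau>(2) by linarith
  qed
 qed
 have conv: "(%l. (LBINT x. H i x * MA_density (v l) x)) \<longlonglongrightarrow> (\<integral>x. H i x \<partial>\<mu>)"
 proof -
  define U where "U = inner_part \<Omega> (2 * r)"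
  have "U \<subseteq> {x. 2 * r <= infdist x (- \<Omega>)}" by (auto simp: U_def inner_part_def)
  moreover have "closed {x. 2 * r <= infdist x (- \<Omega>)}" by (intro closed_Collect_le continuous_intros)
  ultimately have "closure U \<subseteq> {x. 2 * r <= infdist x (- \<Omega>)}" by (rule closure_minimal)
  hence cU: "closure U \<subseteq> V" using r by (auto simp: V inner_part_def)
  have VO: "V \<subseteq> \<Omega>" unfolding V using inner_part_subset[of r \<Omega>] r by simp
  have "bounded U" using bounded_subset[OF \<Omega>(2)] inner_part_subset[of "2 * r" \<Omega>] r by (simp add: U_def)
  hence "compact (closure U)" by (simp add: compact_closure)
  moreover have "open U" by (simp add: U_def open_inner_part)
  moreover have "\<exists>K. compact K \<and> K \<subseteq> U \<and> (\<forall>x. x \<notin> K \<longrightarrow> H i x = 0)" using K H0 by (auto simp: U_def)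
  ultimately show ?thesis
   using \<mu>[unfolded MA_measure_def, THEN conjunct2, THEN conjunct2, THEN conjunct2, rule_format, of U V v "H i"]
    cU VO oV Ck_2_C2_on[OF v2 oV] v(2) dec lim Hc by blast
 qed
 have "L i - \<kappa> / 2 <= (\<integral>x. H i x \<partial>\<mu>)" by (rule tendsto_lowerbound[OF conv ev]) simp
 also have "... <= (LBINT x. H i x * F x)"
 proof (rule integral_dominated_measure[OF _ _ _ dom F(1,2) _ Hnn])
  show "sets \<mu> = sets borel" "emeasure \<mu> (- \<Omega>) = 0" using \<mu> by (auto simp: MA_measure_def)
  show "\<Omega> \<in> sets borel" using \<Omega>(1) by simp
  show mH: "H i \<in> borel_measurable borel" by (rule borel_measurable_continuous_onI[OF Hc])
  have "bounded (H i ` K)" by (intro compact_imp_bounded compact_continuous_image continuous_on_subset[OF Hc] K) auto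
  then obtain C where C: "C > 0" "!!x. x \<in> K ==> \<bar>H i x\<bar> <= C" by (auto simp: bounded_pos)
  have "\<bar>H i x\<bar> <= C" for x using C H0[of x i] by (cases "x \<in> K") auto
  thus "integrable lborel (%x. H i x * F x)"
   by (intro Bochner_Integration.integrable_bound[OF integrable_mult_right[OF F(3), of C]])
    (use mH F C in \<open>auto simp: abs_mult intro!: mult_right_mono\<close>)
 qed
 finally have "L i <= (LBINT x. H i x * F x) + \<kappa>" using \<kappa> by simp
 thus ?thesis using ii(1) unfolding L_def S_def HK by blast
qed

section \<open>Lower semicontinuous regularisation and the contact set\<close>

text \<open>Otherwise every x has a point \<open>Y x\<close> with a smaller value; by semicontinuity
  h stays above \<open>h (Y x)\<close> near x, and the smallest of finitely many such values is
  undercut by another of them.\<close>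

lemma lsc_attains_min:
 fixes h :: "'a::topological_space => real"
 assumes S: "compact S" "S \<noteq> {}"
  and lsc: "!!x k. x \<in> S ==> k < h x ==> \<exists>U. open U \<and> x \<in> U \<and> (\<forall>y\<in>U \<inter> S. k < h y)"
 shows "\<exists>x\<in>S. \<forall>y\<in>S. h x <= h y"
proof (rule ccontr)
 assume "\<not> ?thesis"
 hence "\<forall>x\<in>S. \<exists>y\<in>S. h y < h x" by (auto simp: not_le)
 then obtain Y where Y: "!!x. x \<in> S ==> Y x \<in> S \<and> h (Y x) < h x" by metis
 hence "\<forall>x\<in>S. \<exists>U. open U \<and> x \<in> U \<and> (\<forall>y\<in>U \<inter> S. h (Y x) < h y)" using lsc by blast
 then obtain U where U: "!!x. x \<in> S ==> open (U x) \<and> x \<in> U x \<and> (\<forall>y\<in>U x \<inter> S. h (Y x) < h y)" by metis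
 obtain T where T: "T \<subseteq> S" "finite T" "S \<subseteq> (\<Union>x\<in>T. U x)"
  by (rule compactE_image[OF S(1), of S U]) (use U in auto)
 have "T \<noteq> {}" using T(3) S(2) by auto
 hence "Min ((%t. h (Y t)) ` T) \<in> (%t. h (Y t)) ` T" using T(2) by (intro Min_in) auto
 then obtain t where t: "t \<in> T" "h (Y t) = Min ((%t. h (Y t)) ` T)" by auto
 have tmin: "h (Y t) <= h (Y t')" if "t' \<in> T" for t' unfolding t(2) using T(2) that by (intro Min_le) auto
 have "Y t \<in> S" using Y t(1) T(1) by blast
 then obtain t' where t': "t' \<in> T" "Y t \<in> U t'" using T(3) by blast
 hence "h (Y t') < h (Y t)" using U[of t'] T(1) \<open>Y t \<in> S\<close> by auto
 thus False using tmin[OF t'(1)] by simp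
qed

lemma borel_of_open_superlevel:
 fixes h :: "'a::topological_space => real"
 assumes "!!k. open {x. k < h x}"
 shows "h \<in> borel_measurable borel"
 unfolding borel_measurable_iff_greater using assms by auto

section \<open>The lower semicontinuous regularisation and its extension\<close>

locale bounded_usc =
 fixes \<Omega> :: "(complex^'n) set" and u :: "complex^'n => real" and M :: real
 assumes \<Omega>: "open \<Omega>" "bounded \<Omega>" "\<Omega> \<noteq> {}" and usc: "usc_on \<Omega> u" and uM: "!!x. x \<in> \<Omega> ==> \<bar>u x\<bar> <= M"
begin

abbreviation "ul \<equiv> lsc_reg \<Omega> u"
abbreviation "ut \<equiv> u_tilde \<Omega> u"
definition "s = (SUP y\<in>frontier \<Omega>. negpart (ul y))"

lemma M0: "0 <= M" using uM \<Omega>(3) by (metis abs_ge_zero all_not_in_conv order_trans)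

lemma nontriv: "w \<in> closure \<Omega> ==> at w within \<Omega> \<noteq> bot"
 unfolding trivial_limit_within using interior_limit_point[of w \<Omega>] \<Omega>(1) by (auto simp: closure_def interior_open)

lemma in_\<Omega>: "\<forall>\<^sub>F z in at w within \<Omega>. z \<in> \<Omega>"
 by (simp add: eventually_at_filter)

lemma lsc_ereal:
 assumes "w \<in> closure \<Omega>"
 shows "ereal (ul w) = Liminf (at w within \<Omega>) (%z. ereal (u z))" and "\<bar>ul w\<bar> <= M"
proof -
 let ?L = "Liminf (at w within \<Omega>) (%z. ereal (u z))"
 have 1: "ereal (- M) <= ?L" by (rule Liminf_bounded, rule eventually_mono[OF in_\<Omega>]) (use uM in \<open>fastforce simp: abs_le_iff\<close>)
 have 2: "?L <= ereal M" by (rule Liminf_le[OF nontriv[OF assms]], rule eventually_mono[OF in_\<Omega>]) (use uM in \<open>fastforce simp: abs_le_iff\<close>)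
 from 1 2 obtain k where k: "?L = ereal k" by (cases ?L) auto
 thus "ereal (ul w) = ?L" by (simp add: lsc_reg_def)
 show "\<bar>ul w\<bar> <= M" using 1 2 k by (simp add: lsc_reg_def abs_le_iff)
qed

lemma lsc_less:
 assumes "w \<in> closure \<Omega>" "k < ul w"
 shows "\<forall>\<^sub>F z in at w within \<Omega>. k < u z"
proof -
 have "ereal (ul w) <= Liminf (at w within \<Omega>) (%z. ereal (u z))" using lsc_ereal(1)[OF assms(1)] by simp
 hence "\<forall>\<^sub>F z in at w within \<Omega>. ereal k < ereal (u z)" using assms(2) unfolding le_Liminf_iff by (elim allE[of _ "ereal k"]) simp
 thus ?thesis by simp
qed

lemma lsc_ge:
 assumes "w \<in> closure \<Omega>" "\<forall>\<^sub>F z in at w within \<Omega>. k <= u z"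
 shows "k <= ul w"
proof -
 have "ereal k <= Liminf (at w within \<Omega>) (%z. ereal (u z))" by (rule Liminf_bounded) (use assms(2) in simp)
 thus ?thesis using lsc_ereal(1)[OF assms(1)] by (metis ereal_less_eq(3))
qed

text \<open>The lower limit leaves out the point itself, so this is where upper semicontinuity
  enters: near x, u stays below any k > u x.\<close>

lemma lsc_le: "x \<in> \<Omega> ==> ul x <= u x"
proof (rule ccontr)
 assume x: "x \<in> \<Omega>" and "\<not> ul x <= u x"
 then obtain k where k: "u x < k" "k < ul x" using dense not_le by metis
 have xc: "x \<in> closure \<Omega>" using x closure_subset by blast
 have "\<forall>\<^sub>F z in at x within \<Omega>. u z < k" using usc x k(1) by (auto simp: usc_on_def)
 with lsc_less[OF xc k(2)] have "\<forall>\<^sub>F z in at x within \<Omega>. False" by eventually_elim auto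
 thus False using nontriv[OF xc] by simp
qed

lemma lsc_nbhd:
 assumes w: "w \<in> closure \<Omega>" "k < ul w"
 shows "\<exists>U. open U \<and> w \<in> U \<and> (\<forall>y\<in>U \<inter> closure \<Omega>. k <= ul y)"
proof -
 obtain U where U: "open U" "w \<in> U" "!!z. z \<in> U ==> z \<noteq> w ==> z \<in> \<Omega> ==> k < u z"
  using lsc_less[OF w] unfolding eventually_at_topological by blast
 have "k <= ul y" if y: "y \<in> U" "y \<in> closure \<Omega>" for y
 proof (cases "y = w")
  case False
  have "open (U - {w})" "y \<in> U - {w}" using U(1) y False by auto
  hence "\<forall>\<^sub>F z in at y within \<Omega>. z \<in> U - {w}" unfolding eventually_at_topological by blast
  with in_\<Omega>[of y] have "\<forall>\<^sub>F z in at y within \<Omega>. k <= u z" by eventually_elim (use U(3) in \<open>auto intro: less_imp_le\<close>)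
  thus ?thesis by (rule lsc_ge[OF y(2)])
 qed (use w in simp)
 thus ?thesis using U by blast
qed

lemma frontier_ne: "frontier \<Omega> \<noteq> {}"
 using \<Omega>(2,3) not_bounded_UNIV[where 'a="complex^'n"] by (auto simp: frontier_eq_empty)

lemma s_bdd: "bdd_above ((%y. negpart (ul y)) ` frontier \<Omega>)"
proof (intro bdd_aboveI[of _ M], clarify)
 fix y assume "y \<in> frontier \<Omega>"
 thus "negpart (ul y) <= M" using lsc_ereal(2)[of y] M0 by (auto simp: frontier_def negpart_def)
qed

lemma s_ge: "y \<in> frontier \<Omega> ==> - ul y <= s"
 using cSUP_upper[OF _ s_bdd, of y] by (simp add: s_def negpart_def)

lemma s_nonneg: "0 <= s"
proof -
 obtain y where "y \<in> frontier \<Omega>" using frontier_ne by blast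
 thus ?thesis using cSUP_upper[OF _ s_bdd, of y] by (simp add: s_def negpart_def)
qed

lemma ut_eq: "ut x = (if x \<in> \<Omega> then min (ul x + s) 0 else 0)"
 by (simp add: u_tilde_def s_def)

lemma ut_le_0: "ut x <= 0" by (simp add: ut_eq)

lemma ut_ge: "- M <= ut x"
 using lsc_ereal(2)[of x] closure_subset[of \<Omega>] s_nonneg M0 by (auto simp: ut_eq abs_le_iff)

lemma ut_le: "x \<in> \<Omega> ==> ut x <= u x + s"
 using lsc_le[of x] by (simp add: ut_eq)

text \<open>At boundary points \<open>ul + s\<close> is non-negative by the choice of
  \<open>s\<close>, so the values inside \<Omega> cannot drop below the zero extension in the
  limit.\<close>

lemma ut_lsc:
 assumes "k < ut w"
 shows "\<exists>U. open U \<and> w \<in> U \<and> (\<forall>y\<in>U. k < ut y)"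
proof -
 obtain k' where k': "k < k'" "k' < ut w" using dense[OF assms] by blast
 have k0: "k' < 0" using k' ut_le_0[of w] by linarith
 consider "w \<in> closure \<Omega>" "k' - s < ul w" | "w \<notin> closure \<Omega>"
 proof -
  have "k' - s < ul w" if "w \<in> closure \<Omega>"
  proof (cases "w \<in> \<Omega>")
   case True
   thus ?thesis using k'(2) by (simp add: ut_eq)
  next
   case False
   hence "w \<in> frontier \<Omega>" using that \<Omega>(1) by (simp add: frontier_def interior_open)
   thus ?thesis using s_ge[of w] k0 by linarith
  qed
  thus thesis using that by blast
 qed
 thus ?thesis
 proof cases
  case 1
  from lsc_nbhd[OF 1] obtain U where U: "open U" "w \<in> U" "!!y. y \<in> U ==> y \<in> closure \<Omega> ==> k' - s <= ul y" by blast
  have "k < ut y" if "y \<in> U" for y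
  proof (cases "y \<in> \<Omega>")
   case True
   hence "k' - s <= ul y" using U(3)[OF that] closure_subset by blast
   thus ?thesis using True k' k0 by (simp add: ut_eq)
  qed (use k' k0 in \<open>simp add: ut_eq\<close>)
  thus ?thesis using U by blast
 next
  case 2
  have "k < ut y" if "y \<in> - closure \<Omega>" for y
  proof -
   have "y \<notin> \<Omega>" using that closure_subset by blast
   thus ?thesis using k0 k' by (simp add: ut_eq)
  qed
  thus ?thesis using 2 by (intro exI[of _ "- closure \<Omega>"]) auto
 qed
qed

lemma ut_superlevel_open: "open {x. k < ut x}"
 unfolding open_subopen[of "{x. k < ut x}"]
proof
 fix w assume "w \<in> {x. k < ut x}"
 hence "k < ut w" by simp
 from ut_lsc[OF this] obtain U where "open U" "w \<in> U" "\<forall>y\<in>U. k < ut y" by blast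
 thus "\<exists>T. open T \<and> w \<in> T \<and> T \<subseteq> {x. k < ut x}" by (intro exI[of _ U]) auto
qed

lemma minorant_bdd:
 "x \<in> ball c t ==> bdd_above ((%l. l x) ` {l. (\<exists>p b. l = (%y. p \<bullet> y + b)) \<and> (\<forall>y\<in>ball c t. l y <= ut y)})"
 by (rule bdd_aboveI[of _ "ut x"]) auto

lemma minorant_ne: "{l. (\<exists>p b. l = (%y::complex^'n. p \<bullet> y + b)) \<and> (\<forall>y\<in>ball c t. l y <= ut y)} \<noteq> {}"
proof -
 have "(%y. 0 \<bullet> y + (- M)) \<in> {l. (\<exists>p b. l = (%y::complex^'n. p \<bullet> y + b)) \<and> (\<forall>y\<in>ball c t. l y <= ut y)}"
  using ut_ge by (intro CollectI conjI exI[of _ 0] exI[of _ "- M"]) auto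
 thus ?thesis by blast
qed

text \<open>The envelope is a supremum of affine functions, so its superlevel sets in the ball are
  open; it is extended by 0 to be compared with \<open>ut\<close> on the whole space.\<close>

lemma contact_set_borel: "contact_set \<Omega> u c d \<in> sets borel"
proof -
 let ?B = "ball c (2 * d)"
 let ?A = "{l. (\<exists>p b. l = (%y::complex^'n. p \<bullet> y + b)) \<and> (\<forall>y\<in>?B. l y <= ut y)}"
 define G where "G x = (if x \<in> ?B then conv_env ?B ut x else 0)" for x
 have "G \<in> borel_measurable borel"
  unfolding borel_measurable_iff_greater
 proof
  fix k
  have "{w \<in> space borel. k < G w} = (?B \<inter> (\<Union>l\<in>?A. {x. k < l x})) \<union> (if k < 0 then - ?B else {})"
  proof -
   have "k < conv_env ?B ut x \<longleftrightarrow> (\<exists>l\<in>?A. k < l x)" if "x \<in> ?B" for x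
    unfolding conv_env_def by (rule less_cSUP_iff[OF minorant_ne minorant_bdd[OF that]])
   thus ?thesis by (auto simp: G_def)
  qed
  moreover have "open (\<Union>l\<in>?A. {x. k < l x})"
   by (intro open_UN ballI) (auto intro!: open_Collect_less continuous_intros)
  ultimately show "{w \<in> space borel. k < G w} \<in> sets borel" by auto
 qed
 moreover have "ut \<in> borel_measurable borel" by (rule borel_of_open_superlevel[OF ut_superlevel_open])
 ultimately have "{x \<in> space borel. G x = ut x} \<in> sets borel" by measurable
 moreover have "contact_set \<Omega> u c d = ?B \<inter> {x \<in> space borel. G x = ut x}" by (auto simp: contact_set_def G_def)
 ultimately show ?thesis by auto
qed

text \<open>Supporting planes are asked for only up to e: in the application they are tangent planes
  of smooth approximants of a convex limit.\<close>

lemma contact_setI: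
 assumes x: "x \<in> ball c (2 * d)"
  and ex: "!!e. e > 0 ==> \<exists>p. \<forall>y\<in>ball c (2 * d). ut x - e + p \<bullet> (y - x) <= ut y"
 shows "x \<in> contact_set \<Omega> u c d"
proof -
 let ?B = "ball c (2 * d)"
 let ?A = "{l. (\<exists>p b. l = (%y::complex^'n. p \<bullet> y + b)) \<and> (\<forall>y\<in>?B. l y <= ut y)}"
 have "conv_env ?B ut x <= ut x" unfolding conv_env_def by (rule cSUP_least[OF minorant_ne]) (use x in auto)
 moreover have "ut x <= conv_env ?B ut x"
 proof (rule field_le_epsilon)
  fix e :: real assume "e > 0"
  then obtain p where p: "!!y. y \<in> ?B ==> ut x - e + p \<bullet> (y - x) <= ut y" using ex by blast
  define l where "l y = p \<bullet> y + (ut x - e - p \<bullet> x)" for y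
  have "l \<in> ?A"
  proof (intro CollectI conjI exI[of _ p] exI[of _ "ut x - e - p \<bullet> x"] ballI)
   show "l = (%y. p \<bullet> y + (ut x - e - p \<bullet> x))" by (simp add: l_def[abs_def])
   show "l y <= ut y" if "y \<in> ?B" for y using p[OF that] by (simp add: l_def inner_diff_right)
  qed
  hence "l x <= conv_env ?B ut x" unfolding conv_env_def by (rule cSUP_upper[OF _ minorant_bdd[OF x]])
  thus "ut x <= conv_env ?B ut x + e" by (simp add: l_def)
 qed
 ultimately show ?thesis using x by (simp add: contact_set_def)
qed

end

section \<open>Tangent planes and continuous right-hand sides\<close>

lemma convex_tangent:
 fixes \<psi> :: "complex^'n => real"
 assumes \<psi>: "\<psi> \<in> cvx_sub g c R" and xy: "x \<in> ball c R"
 shows "\<exists>p. \<forall>y\<in>ball c R. \<psi> x + p \<bullet> (y - x) <= \<psi> y"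
proof -
 have C: "Ck 3 \<psi>" and h: "!!x a. x \<in> ball c R ==> 0 <= hess \<psi> x a a" using \<psi> by (auto simp: cvx_sub_def)
 have C2: "Ck 2 \<psi>" using Ck_le[OF _ C, of 2] by simp
 have lin: "linear (%a. fd \<psi> a x)" using fd_linear[of 2 \<psi> x] C by (simp add: numeral_3_eq_3)
 \<comment> \<open>The gradient as a vector: the adjoint of the derivative, applied to 1, represents
   it.\<close>
 define p where "p = adjoint (%a. fd \<psi> a x) 1"
 have p: "fd \<psi> a x = p \<bullet> a" for a using adjoint_works[OF lin, of a 1] by (simp add: p_def inner_commute)
 have "\<psi> x + p \<bullet> (y - x) <= \<psi> y" if y: "y \<in> ball c R" for y
 proof -
  obtain t where t: "0 < t" "t < 1" "\<psi> (x + 1 *\<^sub>R (y - x)) = \<psi> x + 1 * fd \<psi> (y - x) x + 1\<^sup>2 / 2 * hess \<psi> (x + t *\<^sub>R (y - x)) (y - x) (y - x)"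
   using taylor2_line[OF C2, of 1 x "y - x"] by auto
  have "x + t *\<^sub>R (y - x) \<in> ball c R" using convexD_alt[OF convex_ball xy y, of t] t by (simp add: algebra_simps)
  thus ?thesis using h[of "x + t *\<^sub>R (y - x)" "y - x"] t(3) by (simp add: p)
 qed
 thus ?thesis by blast
qed

text \<open>F is truncated at k, approximated by continuous functions clamped to [0, k] so that
  dominated convergence applies, and shifted by e0, which keeps \<open>g k\<close> positive. The
  bound on squares is uniform in k; convergence to \<open>F + e0\<close> is in L^1.\<close>

lemma continuous_L2_approximation:
 fixes F :: "'a::euclidean_space => real"
 assumes F: "F \<in> borel_measurable borel" "!!x. 0 <= F x" "integrable lborel F" "integrable lborel (%x. (F x)\<^sup>2)"
  and B: "bounded B" "B \<in> sets borel" and \<epsilon>: "\<epsilon> > 0"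
 obtains e0 g where "e0 > 0" "!!k. continuous_on UNIV (g k)" "!!k x. e0 <= g k x"
  "!!k. (LBINT x. indicator B x * (g k x)\<^sup>2) <= (LBINT x. (F x)\<^sup>2) + \<epsilon>"
  "!!k. integrable lborel (%x. indicator B x * \<bar>g k x - (F x + e0)\<bar>)"
  "(%k. (LBINT x. indicator B x * \<bar>g k x - (F x + e0)\<bar>)) \<longlonglongrightarrow> 0"
proof -
 have fB: "emeasure lborel B < \<infinity>" by (rule emeasure_bounded_finite[OF B(1)])
 have iB: "integrable lborel (indicator B :: 'a => real)" using B(2) fB by (intro integrable_real_indicator) auto
 define b where "b = measure lborel B"
 define I where "I = (LBINT x. F x)"
 have I: "I \<ge> 0" unfolding I_def using F(2) by (intro integral_nonneg_AE) auto
 have b: "b \<ge> 0" by (simp add: b_def)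
 \<comment> \<open>The shift costs 2 e0 I + e0^2 b in the integral of the square, and this choice
   makes that at most \<epsilon> / 2; the cap 1 lets e0^2 be estimated by e0.\<close>
 define e0 where "e0 = min 1 (\<epsilon> / (2 * (2 * I + b + 1)))"
 have den: "2 * I + b + 1 > 0" using I b by linarith
 have e0: "e0 > 0" "e0 <= 1" using \<epsilon> den by (auto simp: e0_def)
 have e0e: "2 * e0 * I + e0\<^sup>2 * b <= \<epsilon> / 2"
 proof -
  have "e0\<^sup>2 * b <= e0 * b" using e0 b by (intro mult_right_mono) (auto simp: power2_eq_square mult_left_le)
  hence "2 * e0 * I + e0\<^sup>2 * b <= e0 * (2 * I + b + 1)" using e0 by (simp add: algebra_simps)
  also have "... <= (\<epsilon> / (2 * (2 * I + b + 1))) * (2 * I + b + 1)" using den by (intro mult_right_mono) (auto simp: e0_def)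
  also have "... = \<epsilon> / 2" using den nonzero_divide_mult_cancel_right[of "2 * I + b + 1" \<epsilon>]
   by (simp only: divide_divide_eq_left[symmetric] times_divide_eq_left) (simp add: field_simps)
  finally show ?thesis .
 qed
 define Fk where "Fk k x = min (F x) (real k)" for k :: nat and x
 have mFk: "Fk k \<in> borel_measurable borel" for k unfolding Fk_def using F(1) by measurable
 have Fk: "0 <= Fk k x" "Fk k x <= real k" "Fk k x <= F x" for k x using F(2) by (auto simp: Fk_def)
 have iFe: "integrable lborel (%x. (F x)\<^sup>2 + 2 * e0 * F x + e0\<^sup>2 * indicator B x)"
  using F(3,4) iB by auto
 have sq: "(LBINT x. indicator B x * (Fk k x + e0)\<^sup>2) <= (LBINT x. (F x)\<^sup>2) + \<epsilon> / 2" for k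
 proof -
  have "(LBINT x. indicator B x * (Fk k x + e0)\<^sup>2) <= (LBINT x. (F x)\<^sup>2 + 2 * e0 * F x + e0\<^sup>2 * indicator B x)"
  proof (rule integral_mono'[OF iFe])
   fix x
   have "(Fk k x + e0)\<^sup>2 <= (F x + e0)\<^sup>2" using Fk[of k x] e0 by (intro power_mono) auto
   thus "indicator B x * (Fk k x + e0)\<^sup>2 <= (F x)\<^sup>2 + 2 * e0 * F x + e0\<^sup>2 * indicator B x"
    using F(2)[of x] e0 by (auto simp: indicator_def power2_sum mult_ac)
   show "0 <= (F x)\<^sup>2 + 2 * e0 * F x + e0\<^sup>2 * indicator B x" using F(2)[of x] e0 by simp
  qed
  also have "... = (LBINT x. (F x)\<^sup>2) + 2 * e0 * I + e0\<^sup>2 * b"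
   unfolding I_def b_def using F(3,4) iB fB B(2) by simp
  finally show ?thesis using e0e by linarith
 qed
 define Q where "Q k h \<longleftrightarrow> continuous_on UNIV h \<and> (\<forall>x. e0 <= h x \<and> h x <= real k + e0) \<and>
   (LBINT x. indicator B x * (h x)\<^sup>2) <= (LBINT x. (F x)\<^sup>2) + \<epsilon> \<and>
   (LBINT x. indicator B x * \<bar>h x - (Fk k x + e0)\<bar>) <= 1 / (real k + 1)" for k :: nat and h
 have ex: "\<exists>h. Q k h" for k
 proof -
  have "Fk k measurable_on UNIV"
   using mFk[of k] by (intro lebesgue_measurable_imp_measurable_on) (auto intro: measurable_completion)
  then obtain N a where N: "negligible N" and a: "!!n. continuous_on UNIV (a n)" "!!x. x \<notin> N ==> (%n. a n x) \<longlonglongrightarrow> Fk k x"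
   unfolding measurable_on_def by auto
  define h where "h n x = max 0 (min (a n x) (real k)) + e0" for n x
  have hc: "continuous_on UNIV (h n)" for n unfolding h_def by (intro continuous_intros a)
  have hm: "h n \<in> borel_measurable borel" for n by (rule borel_measurable_continuous_onI[OF hc])
  have hb: "e0 <= h n x \<and> h n x <= real k + e0" for n x by (auto simp: h_def)
  have hl: "(%n. h n x) \<longlonglongrightarrow> Fk k x + e0" if "x \<notin> N" for x
  proof -
   have "(%n. max 0 (min (a n x) (real k)) + e0) \<longlonglongrightarrow> max 0 (min (Fk k x) (real k)) + e0"
    by (intro tendsto_intros a(2) that)
   thus ?thesis using Fk[of k x] by (simp add: h_def)
  qed
  have "AE x in lebesgue. x \<notin> N" using N by (intro AE_not_in) (simp add: negligible_iff_null_sets)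
  hence AEN: "AE x in lborel. x \<notin> N" by (simp add: AE_completion_iff)
  have lim1: "(%n. (LBINT x. indicator B x * (h n x)\<^sup>2)) \<longlonglongrightarrow> (LBINT x. indicator B x * (Fk k x + e0)\<^sup>2)"
  proof (rule integral_dominated_convergence[where w="%x. (real k + e0)\<^sup>2 * indicator B x"])
   show "AE x in lborel. (%n. indicator B x * (h n x)\<^sup>2) \<longlonglongrightarrow> indicator B x * (Fk k x + e0)\<^sup>2"
    using AEN by eventually_elim (intro tendsto_intros hl)
   show "AE x in lborel. norm (indicator B x * (h n x)\<^sup>2) <= (real k + e0)\<^sup>2 * indicator B x" for n
    using hb[of n] e0 by (intro AE_I2) (auto simp: indicator_def intro!: power_mono order_trans[OF less_imp_le[OF e0(1)]])
   show "integrable lborel (%x. (real k + e0)\<^sup>2 * indicator B x)" using iB by simp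
  qed (use mFk[of k] hm B(2) in measurable)
  have lim2: "(%n. (LBINT x. indicator B x * \<bar>h n x - (Fk k x + e0)\<bar>)) \<longlonglongrightarrow> (\<integral>x. indicator B x * \<bar>0\<bar> \<partial>(lborel :: 'a measure))"
  proof (rule integral_dominated_convergence[where w="%x. real k * indicator B x"])
   have z: "(%n. indicator B x * \<bar>h n x - (Fk k x + e0)\<bar>) \<longlonglongrightarrow> indicator B x * \<bar>Fk k x + e0 - (Fk k x + e0)\<bar>" if "x \<notin> N" for x
    by (intro tendsto_intros hl that)
   show "AE x in lborel. (%n. indicator B x * \<bar>h n x - (Fk k x + e0)\<bar>) \<longlonglongrightarrow> indicator B x * \<bar>0\<bar>"
    using AEN by eventually_elim (use z in simp)
   show "AE x in lborel. norm (indicator B x * \<bar>h n x - (Fk k x + e0)\<bar>) <= real k * indicator B x" for n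
   proof (rule AE_I2)
    fix x
    show "norm (indicator B x * \<bar>h n x - (Fk k x + e0)\<bar>) <= real k * indicator B x"
     using hb[of n x] Fk[of k x] by (auto simp: indicator_def abs_le_iff)
   qed
   show "integrable lborel (%x. real k * indicator B x)" using iB by simp
  qed (use mFk[of k] hm B(2) in measurable)
  have "\<forall>\<^sub>F n in sequentially. (LBINT x. indicator B x * (h n x)\<^sup>2) < (LBINT x. indicator B x * (Fk k x + e0)\<^sup>2) + \<epsilon> / 2"
   by (rule order_tendstoD(2)[OF lim1]) (use \<epsilon> in simp)
  moreover have "\<forall>\<^sub>F n in sequentially. (LBINT x. indicator B x * \<bar>h n x - (Fk k x + e0)\<bar>) < 1 / (real k + 1)"
   by (rule order_tendstoD(2)[OF lim2]) simp
  ultimately have "\<forall>\<^sub>F n in sequentially. (LBINT x. indicator B x * (h n x)\<^sup>2) <= (LBINT x. (F x)\<^sup>2) + \<epsilon> \<and>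
    (LBINT x. indicator B x * \<bar>h n x - (Fk k x + e0)\<bar>) <= 1 / (real k + 1)"
   by eventually_elim (use sq[of k] in auto)
  then obtain n where "(LBINT x. indicator B x * (h n x)\<^sup>2) <= (LBINT x. (F x)\<^sup>2) + \<epsilon>"
    "(LBINT x. indicator B x * \<bar>h n x - (Fk k x + e0)\<bar>) <= 1 / (real k + 1)"
   by (auto simp: eventually_sequentially)
  hence "Q k (h n)" unfolding Q_def using hc hb by blast
  thus ?thesis by blast
 qed
 have "\<forall>k. \<exists>h. Q k h" using ex by blast
 from choice[OF this] obtain g where g': "\<forall>k. Q k (g k)" by blast
 have g: "continuous_on UNIV (g k)" "e0 <= g k x" "g k x <= real k + e0"
   "(LBINT x. indicator B x * (g k x)\<^sup>2) <= (LBINT x. (F x)\<^sup>2) + \<epsilon>"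
   "(LBINT x. indicator B x * \<bar>g k x - (Fk k x + e0)\<bar>) <= 1 / (real k + 1)" for k x
  using spec[OF g', of k] unfolding Q_def by simp_all
 have gm: "g k \<in> borel_measurable borel" for k by (rule borel_measurable_continuous_onI[OF g(1)])
 have ig1: "integrable lborel (%x. indicator B x * \<bar>g k x - (Fk k x + e0)\<bar>)" for k
 proof (rule Bochner_Integration.integrable_bound[where f="%x. real k * indicator B x"])
  show "AE x in lborel. norm (indicator B x * \<bar>g k x - (Fk k x + e0)\<bar>) <= norm (real k * indicator B x)"
  proof (rule AE_I2)
   fix x
   show "norm (indicator B x * \<bar>g k x - (Fk k x + e0)\<bar>) <= norm (real k * indicator B x)"
    using g(2,3)[of k x] Fk[of k x] by (auto simp: indicator_def abs_le_iff)
  qed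
 qed (use iB in simp, use mFk[of k] gm B(2) in measurable)
 have iFF: "integrable lborel (%x. F x - Fk k x)" for k
  by (rule Bochner_Integration.integrable_bound[OF F(3)]) (use F(1,2) mFk[of k] Fk[of k] in auto)
 have ig: "integrable lborel (%x. indicator B x * \<bar>g k x - (F x + e0)\<bar>)" for k
 proof (rule Bochner_Integration.integrable_bound[OF Bochner_Integration.integrable_add[OF ig1[of k] iFF[of k]]])
  show "AE x in lborel. norm (indicator B x * \<bar>g k x - (F x + e0)\<bar>) <= norm (indicator B x * \<bar>g k x - (Fk k x + e0)\<bar> + (F x - Fk k x))"
  proof (rule AE_I2)
   fix x
   show "norm (indicator B x * \<bar>g k x - (F x + e0)\<bar>) <= norm (indicator B x * \<bar>g k x - (Fk k x + e0)\<bar> + (F x - Fk k x))"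
    using Fk(3)[of k x] by (auto simp: indicator_def)
  qed
 qed (use F(1) gm B(2) in measurable)
 have "(%k. (LBINT x. F x - Fk k x)) \<longlonglongrightarrow> (\<integral>x. 0 \<partial>(lborel :: 'a measure))"
 proof (rule integral_dominated_convergence[where w=F])
  have "(%k. F x - Fk k x) \<longlonglongrightarrow> 0" for x
  proof (rule tendsto_eventually)
   show "\<forall>\<^sub>F k in sequentially. F x - Fk k x = 0"
    using eventually_ge_at_top[of "nat \<lceil>F x\<rceil>"]
   proof eventually_elim
    case (elim k)
    hence "F x <= real k" by linarith
    thus ?case by (simp add: Fk_def)
   qed
  qed
  thus "AE x in lborel. (%k. F x - Fk k x) \<longlonglongrightarrow> 0" by simp
  show "AE x in lborel. norm (F x - Fk k x) <= F x" for k using Fk[of k] F(2) by auto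
 qed (use F mFk in auto)
 hence Z: "(%k. (LBINT x. F x - Fk k x)) \<longlonglongrightarrow> 0" by simp
 have "(%k. 1 / (real k + 1) + (LBINT x. F x - Fk k x)) \<longlonglongrightarrow> 0 + 0"
  using LIMSEQ_inverse_real_of_nat by (intro tendsto_add Z) (simp add: inverse_eq_divide add.commute)
 hence up: "(%k. 1 / (real k + 1) + (LBINT x. F x - Fk k x)) \<longlonglongrightarrow> 0" by simp
 have le: "(LBINT x. indicator B x * \<bar>g k x - (F x + e0)\<bar>) <= 1 / (real k + 1) + (LBINT x. F x - Fk k x)" for k
 proof -
  have "(LBINT x. indicator B x * \<bar>g k x - (F x + e0)\<bar>) <= (LBINT x. indicator B x * \<bar>g k x - (Fk k x + e0)\<bar> + (F x - Fk k x))"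
  proof (rule integral_mono[OF ig Bochner_Integration.integrable_add[OF ig1 iFF]])
   fix x
   show "indicator B x * \<bar>g k x - (F x + e0)\<bar> <= indicator B x * \<bar>g k x - (Fk k x + e0)\<bar> + (F x - Fk k x)"
    using Fk(3)[of k x] by (auto simp: indicator_def)
  qed
  also have "... = (LBINT x. indicator B x * \<bar>g k x - (Fk k x + e0)\<bar>) + (LBINT x. F x - Fk k x)"
   by (rule Bochner_Integration.integral_add[OF ig1 iFF])
  finally show ?thesis using g(5)[of k] by linarith
 qed
 have "(%k. (LBINT x. indicator B x * \<bar>g k x - (F x + e0)\<bar>)) \<longlonglongrightarrow> 0"
  by (rule tendsto_sandwich[OF _ _ tendsto_const up]) (use le in \<open>auto intro!: always_eventually integral_nonneg_AE\<close>)
 thus thesis using that[of e0 g] e0(1) g(1,2,4) ig by blast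
qed

section \<open>The contact set estimate\<close>

text \<open>Prolonging the segment from y to x0 by half its length stays in the ball of radius 3d,
  where \<psi> \<le> 0, and convexity gives \<psi> y \<ge> -3 \<beta>. Prolonging a chord of the
  2d-ball by d/4 stays in the ball of radius 5/2 d, where \<psi> oscillates by at most 3 \<beta>;
  this gives the slope 12 \<beta> / d.\<close>

lemma cvx_sub_bounds:
 fixes \<psi> :: "complex^'n => real"
 assumes \<psi>: "\<psi> \<in> cvx_sub g c (3 * d)" and d: "d > 0" and x0: "x0 \<in> ball c d" and \<beta>: "- \<beta> <= \<psi> x0"
 shows "y \<in> ball c (5/2 * d) ==> - (3 * \<beta>) <= \<psi> y \<and> \<psi> y <= 0"
  and "x \<in> cball c (2 * d) ==> y \<in> cball c (2 * d) ==> \<bar>\<psi> x - \<psi> y\<bar> <= 12 * \<beta> / d * norm (x - y)"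
proof -
 have cv: "convex_on (ball c (3 * d)) \<psi>" by (rule cvx_sub_convex[OF \<psi>])
 have neg: "!!y. y \<in> ball c (3 * d) ==> \<psi> y <= 0" using \<psi> by (auto simp: cvx_sub_def)
 have n0: "norm (x0 - c) < d" using x0 by (simp add: dist_norm norm_minus_commute)
 have b0: "\<beta> \<ge> 0" using \<beta> neg[of x0] x0 d by auto
 have A: "- (3 * \<beta>) <= \<psi> y \<and> \<psi> y <= 0" if y: "y \<in> ball c (5/2 * d)" for y
 proof -
  have ny: "norm (y - c) < 5/2 * d" using y by (simp add: dist_norm norm_minus_commute)
  define z where "z = x0 + (1/2) *\<^sub>R (x0 - y)"
  have "z - c = (3/2) *\<^sub>R (x0 - c) - (1/2) *\<^sub>R (y - c)"
  proof -
   have "(3/2) *\<^sub>R w = w + (1/2) *\<^sub>R w" for w :: "complex^'n" using scaleR_add_left[of 1 "1/2" w] by simp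
   thus ?thesis by (simp add: z_def scaleR_diff_right)
  qed
  hence "norm (z - c) <= (3/2) * norm (x0 - c) + (1/2) * norm (y - c)"
   using norm_triangle_ineq4[of "(3/2) *\<^sub>R (x0 - c)" "(1/2) *\<^sub>R (y - c)"] by simp
  hence "norm (z - c) < 3 * d" using n0 ny d by linarith
  hence z: "z \<in> ball c (3 * d)" by (simp add: dist_norm norm_minus_commute)
  have y3: "y \<in> ball c (3 * d)" using y d by simp
  have "(1 - 1/3) *\<^sub>R z + (1/3) *\<^sub>R y = x0"
  proof -
   have "(1 - 1/3::real) *\<^sub>R z = (2/3) *\<^sub>R x0 + ((2/3) * (1/2)) *\<^sub>R (x0 - y)" by (simp add: z_def scaleR_add_right)
   also have "... = (2/3) *\<^sub>R x0 + (1/3) *\<^sub>R x0 - (1/3) *\<^sub>R y" by (simp add: scaleR_diff_right)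
   also have "(2/3) *\<^sub>R x0 + (1/3) *\<^sub>R x0 = x0" by (simp flip: scaleR_add_left)
   finally show ?thesis by simp
  qed
  hence "\<psi> x0 <= (1 - 1/3) * \<psi> z + (1/3) * \<psi> y" using convex_onD[OF cv, of "1/3" z y] z y3 by simp
  thus ?thesis using neg[OF z] neg[OF y3] \<beta> by simp
 qed
 thus "y \<in> ball c (5/2 * d) ==> - (3 * \<beta>) <= \<psi> y \<and> \<psi> y <= 0" .
 have L: "\<psi> y - \<psi> x <= 12 * \<beta> / d * norm (x - y)" if xy: "x \<in> cball c (2 * d)" "y \<in> cball c (2 * d)" for x y
 proof (cases "x = y")
  case False
  define \<tau> where "\<tau> = norm (y - x)"
  have \<tau>: "\<tau> > 0" using False by (simp add: \<tau>_def)
  define z where "z = y + (d / (4 * \<tau>)) *\<^sub>R (y - x)"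
  define \<theta> where "\<theta> = \<tau> / (\<tau> + d / 4)"
  have \<theta>: "0 <= \<theta>" "\<theta> <= 1" using \<tau> d by (auto simp: \<theta>_def)
  have "norm (z - y) = d / 4" using \<tau> d by (simp add: z_def \<tau>_def[symmetric])
  moreover have "norm (z - c) <= norm (z - y) + norm (y - c)" using norm_triangle_ineq[of "z - y" "y - c"] by simp
  moreover have "norm (y - c) <= 2 * d" using xy by (simp add: dist_norm norm_minus_commute)
  ultimately have "norm (z - c) < 5/2 * d" using d by linarith
  hence z: "z \<in> ball c (5/2 * d)" by (simp add: dist_norm norm_minus_commute)
  have z3: "z \<in> ball c (3 * d)" "x \<in> ball c (3 * d)" using z xy d by auto
  have x5: "x \<in> ball c (5/2 * d)" using xy d by auto
  have "z - x = (1 + d / (4 * \<tau>)) *\<^sub>R (y - x)" by (simp add: z_def scaleR_add_left)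
  moreover have "\<theta> * (1 + d / (4 * \<tau>)) = 1"
  proof -
   have "1 + d / (4 * \<tau>) = (\<tau> + d / 4) / \<tau>" using \<tau> by (simp add: add_divide_distrib)
   moreover have "\<tau> + d / 4 \<noteq> 0" using \<tau> d by linarith
   ultimately show ?thesis using \<tau> by (simp add: \<theta>_def)
  qed
  ultimately have "\<theta> *\<^sub>R (z - x) = y - x" by simp
  hence "(1 - \<theta>) *\<^sub>R x + \<theta> *\<^sub>R z = y" by (simp add: scaleR_diff_left scaleR_diff_right algebra_simps)
  hence "\<psi> y <= (1 - \<theta>) * \<psi> x + \<theta> * \<psi> z" using convex_onD[OF cv \<theta>, of x z] z3 by simp
  hence "\<psi> y - \<psi> x <= \<theta> * (\<psi> z - \<psi> x)" by (simp add: algebra_simps)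
  also have "... <= \<theta> * (3 * \<beta>)" using A[OF z] A[OF x5] \<theta> by (intro mult_left_mono) linarith+
  also have "... <= (\<tau> / (d / 4)) * (3 * \<beta>)"
   unfolding \<theta>_def using \<tau> d b0 by (intro mult_right_mono divide_left_mono) auto
  also have "... = 12 * \<beta> / d * norm (x - y)" using d by (simp add: \<tau>_def norm_minus_commute)
  finally show ?thesis .
 qed simp
 show "\<bar>\<psi> x - \<psi> y\<bar> <= 12 * \<beta> / d * norm (x - y)" if "x \<in> cball c (2 * d)" "y \<in> cball c (2 * d)"
  using L[OF that] L[OF that(2,1)] by (simp add: abs_le_iff norm_minus_commute)
qed

text \<open>Contradiction by mass balance: near a negative minimum of \<open>ut - \<psi>\<close> a
  lifted barrier q exceeds u on a set of positive measure, where its density surpasses F by about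
  e0. The gain A would have to be absorbed by three losses, each at most A/4.\<close>

lemma (in bounded_usc) no_touching:
 fixes \<mu> :: "(complex^'n) measure"
 assumes psh: "psh_on \<Omega> u" and \<mu>: "MA_measure \<Omega> u \<mu>"
  and F: "F \<in> borel_measurable borel" "!!x. 0 <= F x" "integrable lborel F"
  and dom: "!!A. A \<in> sets borel ==> A \<subseteq> \<Omega> ==> emeasure \<mu> A <= (\<integral>\<^sup>+x. indicator A x * ennreal (F x) \<partial>lborel)"
  and \<Omega>d: "closure \<Omega> \<subseteq> ball c d" and d: "d > 0"
  and Oc: "open O'" "\<Omega> \<inter> contact_set \<Omega> u c d \<subseteq> O'" "O' \<subseteq> \<Omega>"
  and e0: "e0 > 0"
  and \<psi>k: "!!k. \<psi>k k \<in> cvx_sub (g k) c (3 * d)"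
  and \<psi>: "continuous_on (cball c (2 * d)) \<psi>" and \<psi>0: "!!x. x \<in> cball c (2 * d) ==> \<psi> x <= 0"
  and unif: "!!e. 0 < e ==> \<exists>N. \<forall>n x. n \<ge> N \<and> x \<in> cball c (2 * d) \<longrightarrow> \<bar>\<psi>k n x - \<psi> x\<bar> < e"
  and gi: "!!k. integrable lborel (%x. indicator (ball c (3 * d)) x * \<bar>g k x - (indicator O' x * F x + e0)\<bar>)"
  and g0: "(%k. (LBINT x. indicator (ball c (3 * d)) x * \<bar>g k x - (indicator O' x * F x + e0)\<bar>)) \<longlonglongrightarrow> 0"
  and x0: "x0 \<in> \<Omega>"
 shows "\<psi> x0 <= ut x0"
proof (rule ccontr)
 assume neg: "\<not> \<psi> x0 <= ut x0"
 define S where "S = cball c d"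
 have cS: "compact S" by (simp add: S_def)
 have SB: "S \<subseteq> cball c (2 * d)" using d by (auto simp: S_def)
 have OS: "\<Omega> \<subseteq> S" using \<Omega>d closure_subset[of \<Omega>] by (fastforce simp: S_def)
 define h where "h x = ut x - \<psi> x" for x
 have \<psi>S: "continuous_on S \<psi>" by (rule continuous_on_subset[OF \<psi> SB])
 have lsc: "\<exists>U. open U \<and> x \<in> U \<and> (\<forall>y\<in>U \<inter> S. k < h y)" if x: "x \<in> S" "k < h x" for x k
 proof -
  define \<delta> where "\<delta> = (h x - k) / 2"
  have \<delta>: "\<delta> > 0" "2 * \<delta> = h x - k" using x(2) by (auto simp: \<delta>_def)
  obtain U where U: "open U" "x \<in> U" "!!y. y \<in> U ==> ut x - \<delta> < ut y" using ut_lsc[of "ut x - \<delta>" x] \<delta> by auto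
  obtain \<rho> where \<rho>: "\<rho> > 0" "!!y. y \<in> S ==> dist y x < \<rho> ==> dist (\<psi> y) (\<psi> x) < \<delta>"
   using \<psi>S x(1) \<delta>(1) unfolding continuous_on_iff by blast
  have "k < h y" if y: "y \<in> U \<inter> ball x \<rho> \<inter> S" for y
  proof -
   have "\<bar>\<psi> y - \<psi> x\<bar> < \<delta>" using \<rho>(2)[of y] y by (auto simp: dist_commute dist_real_def)
   thus ?thesis using U(3)[of y] y \<delta>(2) unfolding h_def by (auto simp: abs_less_iff)
  qed
  thus ?thesis using U \<rho>(1) by (intro exI[of _ "U \<inter> ball x \<rho>"]) auto
 qed
 have "S \<noteq> {}" using d by (simp add: S_def)
 then obtain xm where xm: "xm \<in> S" "!!y. y \<in> S ==> h xm <= h y" using lsc_attains_min[OF cS _ lsc] by blast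
 define m where "m = h xm"
 have hm: "m <= h y" if "y \<in> S" for y using xm(2)[OF that] by (simp add: m_def)
 have m: "m < 0" using hm[of x0] neg x0 OS by (auto simp: h_def)
 have off0: "0 <= h x" if "x \<in> S" "x \<notin> \<Omega>" for x using that \<psi>0[of x] SB by (auto simp: h_def ut_eq)
 \<comment> \<open>\<psi> + m lies below \<open>ut\<close> on the whole 2d-ball, by minimality on S
   and by \<psi> \<le> 0 elsewhere; tangent planes of the smooth convex approximants then support
   \<open>ut\<close> at x up to e.\<close>
 have argmin: "x \<in> O'" if x: "x \<in> S" "h x = m" for x
 proof -
  have xO: "x \<in> \<Omega>" using off0[OF x(1)] x(2) m by force
  have x2: "x \<in> ball c (2 * d)" "x \<in> ball c (3 * d)" using x(1) d by (auto simp: S_def)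
  have "x \<in> contact_set \<Omega> u c d"
  proof (rule contact_setI[OF x2(1)])
   fix e :: real assume e: "e > 0"
   obtain N where N: "!!x. x \<in> cball c (2 * d) ==> \<bar>\<psi>k N x - \<psi> x\<bar> < e / 2" using unif[of "e / 2"] e by auto
   obtain p where p: "!!y. y \<in> ball c (3 * d) ==> \<psi>k N x + p \<bullet> (y - x) <= \<psi>k N y" using convex_tangent[OF \<psi>k x2(2)] by blast
   have "ut x - e + p \<bullet> (y - x) <= ut y" if y: "y \<in> ball c (2 * d)" for y
   proof -
    have yy: "y \<in> ball c (3 * d)" "y \<in> cball c (2 * d)" "x \<in> cball c (2 * d)" using y d x2 by auto
    have "\<psi> y + m <= ut y"
    proof (cases "y \<in> S")
     case True
     thus ?thesis using hm[of y] by (simp add: h_def)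
    next
     case False
     hence "y \<notin> \<Omega>" using OS by blast
     thus ?thesis using \<psi>0[OF yy(2)] m by (simp add: ut_eq)
    qed
    moreover have "\<bar>\<psi>k N y - \<psi> y\<bar> < e / 2" "\<bar>\<psi>k N x - \<psi> x\<bar> < e / 2" using N yy by auto
    ultimately show ?thesis using p[OF yy(1)] x(2) unfolding h_def by linarith
   qed
   thus "\<exists>p. \<forall>y\<in>ball c (2 * d). ut x - e + p \<bullet> (y - x) <= ut y" by blast
  qed
  thus ?thesis using Oc(2) xO by blast
 qed
 \<comment> \<open>On S outside the open set O' the minimum of h is attained and larger than m, so a
   whole sublevel set of h lies in O'.\<close>
 obtain t where t: "t > 0" "m + 4 * t < 0" "!!x. x \<in> S ==> h x <= m + 4 * t ==> x \<in> O'"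
 proof (cases "S - O' = {}")
  case True
  show thesis by (rule that[of "- m / 8"]) (use True m in auto)
 next
  case False
  have "compact (S - O')" using cS Oc(1) by (rule compact_diff)
  then obtain x2 where x2: "x2 \<in> S - O'" "!!y. y \<in> S - O' ==> h x2 <= h y"
  proof (rule lsc_attains_min[OF _ False, THEN bexE])
   fix x k assume "x \<in> S - O'" "k < h x"
   thus "\<exists>U. open U \<and> x \<in> U \<and> (\<forall>y\<in>U \<inter> (S - O'). k < h y)" using lsc[of x k] by blast
  qed blast
  have lt: "m < h x2" using hm[of x2] argmin[of x2] x2(1) by force
  define \<tau> where "\<tau> = min (- m) (h x2 - m)"
  have \<tau>: "\<tau> > 0" "\<tau> <= - m" "\<tau> <= h x2 - m" using m lt by (auto simp: \<tau>_def)
  show thesis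
  proof (rule that[of "\<tau> / 8"])
   show "\<tau> / 8 > 0" "m + 4 * (\<tau> / 8) < 0" using \<tau> m by auto
   fix x assume x: "x \<in> S" "h x <= m + 4 * (\<tau> / 8)"
   have "h x < h x2" using x(2) \<tau> by linarith
   thus "x \<in> O'" using x2(2)[of x] x(1) by force
  qed
 qed
 define K where "K = {x \<in> S. h x <= m + 4 * t}"
 have KO: "K \<subseteq> O'" using t(3) by (auto simp: K_def)
 have KS: "K \<subseteq> S" by (auto simp: K_def)
 have "open (- K)"
  unfolding open_subopen[of "- K"]
 proof
  fix x assume "x \<in> - K"
  then consider "x \<notin> S" | "x \<in> S" "m + 4 * t < h x" by (force simp: K_def)
  thus "\<exists>T. open T \<and> x \<in> T \<and> T \<subseteq> - K"
  proof cases
   case 1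
   thus ?thesis using compact_imp_closed[OF cS] KS by (intro exI[of _ "- S"]) auto
  next
   case 2
   from lsc[OF this] obtain U where U: "open U" "x \<in> U" "\<forall>y\<in>U \<inter> S. m + 4 * t < h y" by blast
   have "U \<subseteq> - K" using U(3) by (force simp: K_def)
   thus ?thesis using U by blast
  qed
 qed
 hence clK: "closed K" by (simp add: closed_def)
 have cK: "compact K" using compact_Int_closed[OF cS clK] KS by (simp add: Int_absorb1)
 have xmK: "xm \<in> K" using xm(1) t(1) by (simp add: K_def m_def)
 have KOm: "K \<subseteq> \<Omega>" using KO Oc(3) by blast
 obtain r where r: "r > 0" "K \<subseteq> inner_part \<Omega> (2 * r)"
 proof -
  have "continuous_on K (%x. infdist x (- \<Omega>))" by (intro continuous_intros)
  then obtain y where y: "y \<in> K" "!!x. x \<in> K ==> infdist y (- \<Omega>) <= infdist x (- \<Omega>)"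
   using continuous_attains_inf[OF cK] xmK by blast
  have ne: "- \<Omega> \<noteq> {}"
  proof
   assume "- \<Omega> = {}"
   hence "\<Omega> = UNIV" by blast
   thus False using \<Omega>(2) not_bounded_UNIV[where 'a="complex^'n"] by simp
  qed
  have "0 < infdist y (- \<Omega>)" using infdist_pos_not_in_closed[of "- \<Omega>" y] \<Omega>(1) ne y(1) KOm by auto
  thus thesis using y(2) by (intro that[of "infdist y (- \<Omega>) / 3"]) (force simp: inner_part_def)+
 qed
 define V where "V = inner_part \<Omega> r"
 have oV: "open V" by (simp add: V_def open_inner_part)
 have VO: "V \<subseteq> \<Omega>" using inner_part_subset[of r \<Omega>] r(1) by (simp add: V_def)
 have KV: "K \<subseteq> V" using r inner_part_mono[of r "2 * r" \<Omega>] by (auto simp: V_def)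
 obtain v where v: "!!j. Ck 3 (v j)" "!!j. psh_on V (v j)" and dec: "!!j x. x \<in> V ==> v (Suc j) x <= v j x"
  and lim: "!!x. x \<in> V ==> (%j. v j x) \<longlonglongrightarrow> u x" and ge: "!!j x. x \<in> V ==> u x <= v j x"
  and bd: "!!j x. \<bar>v j x\<bar> <= M"
  using psh_smooth_approximation[OF \<Omega>(1) psh uM M0 r(1)] unfolding V_def by blast
 have decle: "v j x <= v i x" if "x \<in> V" "i <= j" for i j x
  using lift_Suc_antimono_le[of "%j. v j x", OF dec[OF that(1)] that(2)] .
 have hu: "h x <= u x + s - \<psi> x" if "x \<in> \<Omega>" for x using ut_le[OF that] by (simp add: h_def)
 \<comment> \<open>The minimum concerns \<open>ul\<close>, a lower limit of u along other points;
   hence some nearby y has u itself within t of the minimal level.\<close>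
 obtain y where y: "y \<in> \<Omega>" "u y + s - \<psi> y < m + t"
 proof (rule ccontr)
  assume "\<not> thesis"
  hence nx: "m + t <= u y + s - \<psi> y" if "y \<in> \<Omega>" for y using that \<open>\<not> thesis\<close> \<open>!!y. [|y \<in> \<Omega>; u y + s - \<psi> y < m + t|] ==> thesis\<close> by force
  have xmO: "xm \<in> \<Omega>" using xmK KOm by blast
  have "ut xm < 0" using m \<psi>0[of xm] xm(1) SB unfolding m_def h_def by (auto simp: subset_iff)
  hence ul: "ul xm = \<psi> xm + m - s" using xmO unfolding m_def h_def by (simp add: ut_eq min_def split: if_splits)
  obtain \<rho> where \<rho>: "\<rho> > 0" "!!y. y \<in> S ==> dist y xm < \<rho> ==> dist (\<psi> y) (\<psi> xm) < t / 2"
   using \<psi>S xm(1) t(1) unfolding continuous_on_iff by (meson half_gt_zero)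
  have "\<forall>\<^sub>F z in at xm within \<Omega>. dist z xm < \<rho>" unfolding eventually_at using \<rho>(1) by auto
  with in_\<Omega>[of xm] have "\<forall>\<^sub>F z in at xm within \<Omega>. ul xm + t / 2 <= u z"
  proof eventually_elim
   case (elim z)
   have "\<bar>\<psi> z - \<psi> xm\<bar> < t / 2" using \<rho>(2)[of z] elim OS by (auto simp: dist_real_def)
   thus ?case using nx[OF elim(1)] ul by linarith
  qed
  hence "ul xm + t / 2 <= ul xm" using xmO closure_subset by (intro lsc_ge) auto
  thus False using t(1) by simp
 qed
 have yK: "y \<in> K" using hu[OF y(1)] y OS t(1) by (auto simp: K_def)
 have "(%j. v j y + s - \<psi> y) \<longlonglongrightarrow> u y + s - \<psi> y" using lim[of y] yK KV by (intro tendsto_intros) auto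
 from order_tendstoD(2)[OF this y(2)] obtain i0 where i0: "v i0 y + s - \<psi> y < m + t"
  unfolding eventually_sequentially by blast
 \<comment> \<open>The low value of v_i0 at y spreads to an open set by continuity and, by
   monotonicity, to all later v_i.\<close>
 define G where "G = (V \<inter> ball c (2 * d)) \<inter> (%x. v i0 x + s - \<psi> x) -` {..<m + t}"
 have oG: "open G" unfolding G_def
  by (intro continuous_open_preimage continuous_intros continuous_on_subset[OF Ck_continuous[OF v(1)]] continuous_on_subset[OF \<psi>] open_Int oV)
   auto
 have yG: "y \<in> G" using yK KV i0 KS d by (auto simp: G_def S_def)
 have GK: "G \<subseteq> K"
 proof
  fix x assume x: "x \<in> G"
  hence xV: "x \<in> V" and "v i0 x + s - \<psi> x < m + t" by (auto simp: G_def)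
  hence "h x < m + t" using hu[of x] ge[OF xV, of i0] VO by auto
  thus "x \<in> K" using xV VO OS t(1) by (auto simp: K_def)
 qed
 define \<gamma> where "\<gamma> = measure lborel G"
 have fG: "emeasure lborel G < \<infinity>" by (rule emeasure_bounded_finite[OF bounded_subset[OF compact_imp_bounded[OF cK] GK]])
 have \<gamma>: "\<gamma> > 0"
  using open_not_negligible[OF oG] yG oG fG
  by (auto simp: \<gamma>_def negligible_iff_null_sets null_sets_def zero_less_measure_iff emeasure_eq_ennreal_measure)
 define I1 where "I1 = (LBINT x. F x)"
 have I1: "I1 \<ge> 0" unfolding I1_def using F(2) by (intro integral_nonneg_AE) auto
 \<comment> \<open>The expected gain: excess density e0 times excess height 3/4 t times the volume
   of G.\<close>
 define A where "A = e0 * (3/4 * t) * \<gamma>"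
 have A: "A > 0" using e0 t(1) \<gamma> by (simp add: A_def)
 \<comment> \<open>The bound t/8 keeps the transition zone \<open>3 * e\<close> short against the
   levels; the other bound limits the loss from points with H \<le> 3 e to A/4.\<close>
 define e where "e = min (t / 8) (A / (12 * (I1 + 1)))"
 have e: "e > 0" "e <= t / 8" unfolding e_def using t(1) A I1 by simp (rule min.cobounded1)
 have eI: "3 * e * I1 <= A / 4"
 proof -
  have "e * I1 <= (A / (12 * (I1 + 1))) * (I1 + 1)" using I1 A by (intro mult_mono) (auto simp: e_def)
  also have "... = A / 12" using I1 by (simp add: field_simps)
  finally show ?thesis by simp
 qed
 define err where "err k = (LBINT x. indicator (ball c (3 * d)) x * \<bar>g k x - (indicator O' x * F x + e0)\<bar>)" for k
 obtain N where N: "!!x. x \<in> cball c (2 * d) ==> \<bar>\<psi>k N x - \<psi> x\<bar> < t / 4" "3 * t * err N <= A / 4"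
 proof -
  obtain N1 where N1: "!!n x. n \<ge> N1 ==> x \<in> cball c (2 * d) ==> \<bar>\<psi>k n x - \<psi> x\<bar> < t / 4" using unif[of "t / 4"] t(1) by auto
  have "\<forall>\<^sub>F k in sequentially. err k < A / (12 * t)" using order_tendstoD(2)[OF g0, of "A / (12 * t)"] A t(1) by (simp add: err_def)
  then obtain N2 where N2: "!!k. k \<ge> N2 ==> err k < A / (12 * t)" by (auto simp: eventually_sequentially)
  have "err (max N1 N2) * (12 * t) < A" using N2[of "max N1 N2"] t(1) by (simp add: pos_less_divide_eq)
  thus thesis using N1[of "max N1 N2"] by (intro that[of "max N1 N2"]) (auto simp: mult_ac)
 qed
 \<comment> \<open>With this lift q - u is below 9/4 t on \<Omega> and below -3 e on V off K, while
   q - v_i is above 3/4 t on G for i \<ge> i0.\<close>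
 define q where "q x = \<psi>k N x - (s - m - 2 * t)" for x
 have \<psi>C: "Ck 3 (\<psi>k N)" and \<psi>h: "!!x a. x \<in> ball c (3 * d) ==> 0 <= hess (\<psi>k N) x a a"
  and \<psi>g: "!!x. x \<in> ball c (3 * d) ==> g N x <= MA_density (\<psi>k N) x"
  using \<psi>k[of N] by (auto simp: cvx_sub_def)
 have \<psi>2: "Ck 2 (\<psi>k N)" using Ck_le[OF _ \<psi>C, of 2] by simp
 have qC: "Ck 3 q" unfolding q_def[abs_def] by (intro Ck_diff \<psi>C Ck_const)
 have qC2: "Ck 2 q" using Ck_le[OF _ qC, of 2] by simp
 have S3: "S \<subseteq> ball c (3 * d)" using d by (auto simp: S_def)
 have qpsd: "hpsd (cHess q x)" if "x \<in> K" for x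
  by (rule hess_nonneg_hpsd[OF qC2]) (use \<psi>h that KS S3 in \<open>auto simp: q_def[abs_def] hess_minus_const[OF \<psi>2]\<close>)
 have qg: "g N x <= MA_density q x" if "x \<in> K" for x
  unfolding q_def[abs_def] MA_minus_const[OF \<psi>2] using \<psi>g that KS S3 by blast
 have qu: "q x - u x < m + 9/4 * t - h x" if "x \<in> \<Omega>" for x
 proof -
  have "x \<in> cball c (2 * d)" using that OS SB by blast
  hence "\<bar>\<psi>k N x - \<psi> x\<bar> < t / 4" by (rule N(1))
  thus ?thesis using hu[OF that] unfolding q_def by linarith
 qed
 have off: "q x <= u x - 3 * e" if "x \<in> V - K" for x
 proof -
  have "x \<in> \<Omega>" "x \<in> S" "m + 4 * t < h x" using that VO OS by (auto simp: K_def)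
  thus ?thesis using qu[of x] e t(1) by linarith
 qed
 obtain i where i: "i \<ge> i0" and cmp: "(LBINT x. indicator {x \<in> K. 3 * e < q x - v i x} x * (e * kap ((q x - v i x) / e) * MA_density q x))
  <= (LBINT x. indicator K x * (e * kap ((q x - v i x) / e)) * F x) + A / 4"
  using local_comparison[OF \<Omega>(1,2) \<mu> F dom r(1) V_def v dec lim ge bd cK r(2) qC qpsd e(1) off, of "A / 4" i0] A by auto
 define H where "H x = e * kap ((q x - v i x) / e)" for x
 define Si where "Si = {x \<in> K. 3 * e < q x - v i x}"
 have Hnn: "0 <= H x" for x using e(1) kap_ge(1) by (simp add: H_def)
 have Hge: "q x - v i x <= H x" for x using kap_ge(2)[of "(q x - v i x) / e"] e(1) by (simp add: H_def field_simps)
 have Hle: "H x <= 3 * t" if "x \<in> K" for x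
 proof -
  have "q x - v i x <= 9/4 * t" using qu[of x] ge[of x i] hm[of x] that KOm KV KS by fastforce
  hence "(q x - v i x) / e <= 9/4 * t / e" using e(1) by (intro divide_right_mono) auto
  hence "max 0 ((q x - v i x) / e) <= 9/4 * t / e" using e(1) t(1) by simp
  hence "H x <= e * (9/4 * t / e + 1)"
   unfolding H_def using e(1) kap_le[of "(q x - v i x) / e"] by (intro mult_left_mono) auto
  also have "... = 9/4 * t + e" using e(1) by (simp add: field_simps)
  finally show ?thesis using e(2) t(1) by linarith
 qed
 have Hsm: "H x <= 3 * e" if "q x - v i x <= 3 * e" for x
 proof -
  have "kap ((q x - v i x) / e) <= kap 3" using that e(1) by (intro kap_mono) (simp add: pos_divide_le_eq)
  thus ?thesis using e(1) kap_high[of 3] by (simp add: H_def)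
 qed
 have HG: "3/4 * t < q x - v i x" if "x \<in> G" for x
 proof -
  have xV: "x \<in> V" and lt: "v i0 x + s - \<psi> x < m + t" and "x \<in> cball c (2 * d)" using that by (auto simp: G_def)
  hence "\<bar>\<psi>k N x - \<psi> x\<bar> < t / 4" by (intro N(1))
  thus ?thesis using lt decle[OF xV i] unfolding q_def by linarith
 qed
 have "Ck 3 (%x. rmax e (v i x) (q x) - v i x)" by (intro Ck_diff Ck_rmax v qC)
 hence Hc: "continuous_on UNIV H" unfolding H_def using Ck_continuous by (fastforce simp: rmax_def)
 have Sib: "Si \<in> sets borel"
 proof -
  have "Si = K \<inter> {x. 3 * e < q x - v i x}" by (auto simp: Si_def)
  moreover have "open {x. 3 * e < q x - v i x}"
   by (intro open_Collect_less continuous_intros Ck_continuous[OF qC] Ck_continuous[OF v(1)])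
  ultimately show ?thesis using clK by simp
 qed
 have i1: "integrable lborel (%x. indicator Si x * (H x * MA_density q x))"
 proof -
  have "integrable lborel (%x. indicator K x *\<^sub>R (H x * MA_density q x))"
   by (intro borel_integrable_compact[OF cK] continuous_intros continuous_on_subset[OF Hc] continuous_MA_density[OF qC2]) auto
  hence "integrable lborel (%x. indicator Si x *\<^sub>R (indicator K x *\<^sub>R (H x * MA_density q x)))"
   by (rule integrable_mult_indicator[rotated]) (simp add: Sib)
  moreover have "(%x. indicator Si x *\<^sub>R (indicator K x *\<^sub>R (H x * MA_density q x))) = (%x. indicator Si x * (H x * MA_density q x))"
   by (auto simp: indicator_def Si_def fun_eq_iff)
  ultimately show ?thesis by simp
 qed
 have i2: "integrable lborel (%x. indicator K x * H x * F x)"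
 proof (rule Bochner_Integration.integrable_bound[OF integrable_mult_right[OF F(3), of "3 * t"]])
  show "(%x. indicator K x * H x * F x) \<in> borel_measurable lborel"
   using F(1) borel_measurable_continuous_onI[OF Hc] clK by (intro borel_measurable_times borel_measurable_indicator) auto
  show "AE x in lborel. norm (indicator K x * H x * F x) <= norm (3 * t * F x)"
  proof (rule AE_I2)
   fix x show "norm (indicator K x * H x * F x) <= norm (3 * t * F x)"
    using mult_right_mono[OF Hle[of x] F(2)[of x]] Hnn[of x] F(2)[of x] t(1) by (auto simp: indicator_def abs_mult)
  qed
 qed
 let ?D = "%x. indicator (ball c (3 * d)) x * \<bar>g N x - (indicator O' x * F x + e0)\<bar> :: real"
 have iG: "integrable lborel (%x. (e0 * (3/4 * t)) * indicator G x :: real)"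
  using oG fG by (intro integrable_mult_right integrable_real_indicator) auto
 have i3: "integrable lborel (%x. (e0 * (3/4 * t)) * indicator G x - 3 * e * F x - 3 * t * ?D x)"
  by (intro Bochner_Integration.integrable_diff iG integrable_mult_right F(3) gi)
 have "A - 3 * e * I1 - 3 * t * err N = (LBINT x. (e0 * (3/4 * t)) * indicator G x - 3 * e * F x - 3 * t * ?D x)"
 proof -
  have "(LBINT x. (e0 * (3/4 * t)) * indicator G x - 3 * e * F x - 3 * t * ?D x)
   = (LBINT x. (e0 * (3/4 * t)) * indicator G x) - (LBINT x. 3 * e * F x) - (LBINT x. 3 * t * ?D x)"
   by (subst Bochner_Integration.integral_diff Bochner_Integration.integral_diff[OF iG],
     intro Bochner_Integration.integrable_diff iG integrable_mult_right F(3), intro integrable_mult_right gi,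
     subst Bochner_Integration.integral_diff[OF iG], intro integrable_mult_right F(3)) simp
  also have "(LBINT x. (e0 * (3/4 * t)) * indicator G x) = A"
   using oG fG by (simp add: A_def \<gamma>_def)
  also have "(LBINT x. 3 * e * F x) = 3 * e * I1" by (simp add: I1_def)
  also have "(LBINT x. 3 * t * ?D x) = 3 * t * err N" by (simp add: err_def)
  finally show ?thesis by simp
 qed
 also have "... <= (LBINT x. indicator Si x * (H x * MA_density q x) - indicator K x * H x * F x)"
 proof (rule integral_mono[OF i3 Bochner_Integration.integrable_diff[OF i1 i2]])
  fix x
  have D0: "0 <= ?D x" by simp
  have eF: "0 <= 3 * e * F x" using e(1) F(2)[of x] by simp
  have tD: "0 <= 3 * t * ?D x" using t(1) D0 by simp
  \<comment> \<open>On Si the density of q beats F by e0 up to the approximation error; on the rest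
    of K only the small values H \<le> 3 e count; off K both integrands on the right vanish.\<close>
  consider "x \<in> Si" | "x \<in> K" "x \<notin> Si" | "x \<notin> K" by blast
  thus "(e0 * (3/4 * t)) * indicator G x - 3 * e * F x - 3 * t * ?D x <= indicator Si x * (H x * MA_density q x) - indicator K x * H x * F x"
  proof cases
   case 1
   hence xK: "x \<in> K" by (simp add: Si_def)
   hence xO: "x \<in> O'" and xB: "x \<in> ball c (3 * d)" using KO KS S3 by auto
   have a: "(e0 * (3/4 * t)) * indicator G x <= H x * e0"
   proof (cases "x \<in> G")
    case True
    hence "3/4 * t <= H x" using HG[of x] Hge[of x] by linarith
    thus ?thesis using True e0 mult_right_mono[of "3/4 * t" "H x" e0] by (simp add: mult_ac)
   qed (use Hnn e0 in simp)
   have b: "H x * \<bar>g N x - (F x + e0)\<bar> <= 3 * t * ?D x"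
    using mult_right_mono[OF Hle[OF xK], of "\<bar>g N x - (F x + e0)\<bar>"] xO xB by simp
   have "H x * (g N x) <= H x * MA_density q x" using qg[OF xK] Hnn by (intro mult_left_mono) auto
   moreover have "H x * e0 + H x * F x - H x * \<bar>g N x - (F x + e0)\<bar> <= H x * g N x"
   proof -
    have "H x * (F x + e0 - \<bar>g N x - (F x + e0)\<bar>) <= H x * g N x" using Hnn by (intro mult_left_mono) auto
    thus ?thesis by (simp add: algebra_simps)
   qed
   ultimately show ?thesis using 1 xK a b eF by simp
  next
   case 2
   hence sm: "q x - v i x <= 3 * e" by (simp add: Si_def)
   hence "x \<notin> G" using HG[of x] e t(1) by force
   moreover have "H x * F x <= 3 * e * F x" using Hsm[OF sm] F(2) by (rule mult_right_mono)
   ultimately show ?thesis using 2 tD by simp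
  next
   case 3
   hence "x \<notin> G" "x \<notin> Si" using GK by (auto simp: Si_def)
   thus ?thesis using 3 tD eF by simp
  qed
 qed
 also have "... = (LBINT x. indicator Si x * (H x * MA_density q x)) - (LBINT x. indicator K x * H x * F x)"
  by (rule Bochner_Integration.integral_diff[OF i1 i2])
 also have "... <= A / 4" using cmp unfolding Si_def H_def by simp
 finally show False using eI N(2) A by linarith
qed

text \<open>By the envelope bound, each g_k admits a barrier with value above -(\<beta> + \<eta>) at
  x0. These barriers are equi-Lipschitz on the 2d-ball, and the uniform limit of a subsequence has
  to lie below \<open>ut\<close> at x0.\<close>

lemma (in bounded_usc) contact_estimate:
 fixes \<mu> :: "(complex^'n) measure"
 assumes psh: "psh_on \<Omega> u" and \<mu>: "MA_measure \<Omega> u \<mu>"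
  and F: "F \<in> borel_measurable borel" "!!x. 0 <= F x" "integrable lborel F" "integrable lborel (%x. (F x)\<^sup>2)"
  and dom: "!!A. A \<in> sets borel ==> A \<subseteq> \<Omega> ==> emeasure \<mu> A <= (\<integral>\<^sup>+x. indicator A x * ennreal (F x) \<partial>lborel)"
  and \<Omega>d: "closure \<Omega> \<subseteq> ball c d"
  and Oc: "open O'" "\<Omega> \<inter> contact_set \<Omega> u c d \<subseteq> O'" "O' \<subseteq> \<Omega>"
  and x0: "x0 \<in> \<Omega>"
  and Cb: "!!g. continuous_on UNIV g ==> (!!x. 0 < g x) ==>
   (max 0 (- perron g c (3 * d) x0)) ^ (2 * CARD('n)) <= Cr * (LBINT x. indicator (ball c (3 * d)) x * (g x)\<^sup>2)"
  and Cr: "Cr \<ge> 0" and \<eta>: "\<eta> > 0" and \<beta>: "\<beta> \<ge> 0" "Cr * ((LBINT x. indicator O' x * (F x)\<^sup>2) + \<eta>) <= \<beta> ^ (2 * CARD('n))"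
 shows "- (\<beta> + \<eta>) <= ut x0"
proof -
 have xd: "x0 \<in> ball c d" using x0 \<Omega>d closure_subset by blast
 hence d: "d > 0" by (metis ball_eq_empty empty_iff not_le)
 have x3: "x0 \<in> ball c (3 * d)" using xd d by auto
 define F2 where "F2 x = indicator O' x * F x" for x
 have F2: "F2 \<in> borel_measurable borel" "!!x. 0 <= F2 x" "integrable lborel F2" "integrable lborel (%x. (F2 x)\<^sup>2)"
 proof -
  show "F2 \<in> borel_measurable borel" unfolding F2_def using F(1) Oc(1) by (intro borel_measurable_times borel_measurable_indicator) auto
  show "0 <= F2 x" for x using F(2) by (simp add: F2_def)
  show "integrable lborel F2" unfolding F2_def using integrable_mult_indicator[OF _ F(3), of O'] Oc(1) by simp
  have "(%x. (F2 x)\<^sup>2) = (%x. indicator O' x *\<^sub>R (F x)\<^sup>2)" by (auto simp: F2_def indicator_def fun_eq_iff)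
  thus "integrable lborel (%x. (F2 x)\<^sup>2)" using integrable_mult_indicator[OF _ F(4), of O'] Oc(1) by simp
 qed
 have F2sq: "(LBINT x. (F2 x)\<^sup>2) = (LBINT x. indicator O' x * (F x)\<^sup>2)"
  by (intro Bochner_Integration.integral_cong) (auto simp: F2_def indicator_def)
 obtain e0 g where e0: "e0 > 0" and g: "!!k. continuous_on UNIV (g k)" "!!k x. e0 <= g k x"
  "!!k. (LBINT x. indicator (ball c (3 * d)) x * (g k x)\<^sup>2) <= (LBINT x. (F2 x)\<^sup>2) + \<eta>"
  "!!k. integrable lborel (%x. indicator (ball c (3 * d)) x * \<bar>g k x - (F2 x + e0)\<bar>)"
  "(%k. (LBINT x. indicator (ball c (3 * d)) x * \<bar>g k x - (F2 x + e0)\<bar>)) \<longlonglongrightarrow> 0"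
  by (rule continuous_L2_approximation[OF F2, of "ball c (3 * d)" \<eta>]) (use \<eta> in auto)
 have gpos: "0 < g k x" for k x using g(2)[of k x] e0 by linarith
 define \<beta>' where "\<beta>' = \<beta> + \<eta>"
 have b': "\<beta>' > 0" using \<beta> \<eta> by (simp add: \<beta>'_def)
 have "\<exists>\<psi>. \<psi> \<in> cvx_sub (g k) c (3 * d) \<and> - \<beta>' < \<psi> x0" for k
 proof -
  interpret P: perron_setup "g k" c "3 * d" by unfold_locales (use d g(1) gpos in auto)
  have "(max 0 (- perron (g k) c (3 * d) x0)) ^ (2 * CARD('n)) <= Cr * (LBINT x. indicator (ball c (3 * d)) x * (g k x)\<^sup>2)"
   by (rule Cb[OF g(1) gpos])
  also have "... <= Cr * ((LBINT x. indicator O' x * (F x)\<^sup>2) + \<eta>)"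
   using g(3)[of k] Cr unfolding F2sq by (intro mult_left_mono)
  also have "... <= \<beta> ^ (2 * CARD('n))" by (rule \<beta>(2))
  finally have "max 0 (- perron (g k) c (3 * d) x0) <= \<beta>" using \<beta>(1) by (subst (asm) power_mono_iff) auto
  hence "- \<beta>' < perron (g k) c (3 * d) x0" using \<eta> by (simp add: \<beta>'_def)
  from P.perron_approx[OF x3 this] show ?thesis by blast
 qed
 hence "\<forall>k. \<exists>\<psi>. \<psi> \<in> cvx_sub (g k) c (3 * d) \<and> - \<beta>' < \<psi> x0" by blast
 from choice[OF this] obtain \<psi>k where \<psi>k: "!!k. \<psi>k k \<in> cvx_sub (g k) c (3 * d)" "!!k. - \<beta>' < \<psi>k k x0" by blast
 define S where "S = cball c (2 * d)"
 note bnd = cvx_sub_bounds[OF \<psi>k(1) d xd less_imp_le[OF \<psi>k(2)]]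
 have S5: "y \<in> ball c (5/2 * d)" if "y \<in> S" for y using that d by (auto simp: S_def)
 obtain \<psi> kk where \<psi>: "continuous_on S \<psi>" and kk: "strict_mono (kk :: nat => nat)"
  and lim: "!!e. 0 < e ==> \<exists>N. \<forall>n x. n \<ge> N \<and> x \<in> S \<longrightarrow> norm (\<psi>k (kk n) x - \<psi> x) < e"
 proof (rule Arzela_Ascoli[of S \<psi>k "3 * \<beta>'"])
  show "compact S" by (simp add: S_def)
  show "norm (\<psi>k n x) <= 3 * \<beta>'" if "x \<in> S" for n x using bnd(1)[OF S5[OF that], of n] b' by auto
  show "\<exists>\<delta>. 0 < \<delta> \<and> (\<forall>n y. y \<in> S \<and> norm (x - y) < \<delta> \<longrightarrow> norm (\<psi>k n x - \<psi>k n y) < e)" if x: "x \<in> S" and e: "0 < e" for x e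
  proof (intro exI conjI allI impI)
   define L where "L = 12 * \<beta>' / d"
   have L: "L > 0" using b' d by (simp add: L_def)
   show "0 < e / L" using e L by simp
   fix n y assume y: "y \<in> S \<and> norm (x - y) < e / L"
   have "norm (\<psi>k n x - \<psi>k n y) <= L * norm (x - y)" using bnd(2)[of x y n] x y by (simp add: S_def L_def)
   also have "... < L * (e / L)" using y L by (intro mult_strict_left_mono) auto
   also have "... = e" using L by simp
   finally show "norm (\<psi>k n x - \<psi>k n y) < e" .
  qed
 qed blast
 have "\<psi> x0 <= ut x0"
 proof (rule no_touching[OF psh \<mu> F(1,2,3) dom \<Omega>d d Oc e0])
  show "\<psi>k (kk k) \<in> cvx_sub (g (kk k)) c (3 * d)" for k by (rule \<psi>k(1))
  show "continuous_on (cball c (2 * d)) \<psi>" using \<psi> by (simp add: S_def)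
  show "\<psi> x <= 0" if x: "x \<in> cball c (2 * d)" for x
  proof (rule field_le_epsilon)
   fix e :: real assume "e > 0"
   then obtain N where N: "norm (\<psi>k (kk N) x - \<psi> x) < e" using lim[of e] x by (auto simp: S_def)
   have "\<psi>k (kk N) x <= 0" using bnd(1)[of x "kk N"] S5[of x] x by (simp add: S_def)
   thus "\<psi> x <= 0 + e" using N by (simp add: abs_less_iff)
  qed
  show "\<exists>N. \<forall>n x. n \<ge> N \<and> x \<in> cball c (2 * d) \<longrightarrow> \<bar>\<psi>k (kk n) x - \<psi> x\<bar> < e" if "0 < e" for e
   using lim[OF that] by (simp add: S_def)
  show "integrable lborel (%x. indicator (ball c (3 * d)) x * \<bar>g (kk k) x - (indicator O' x * F x + e0)\<bar>)" for k
   using g(4)[of "kk k"] by (simp add: F2_def)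
  show "(%k. (LBINT x. indicator (ball c (3 * d)) x * \<bar>g (kk k) x - (indicator O' x * F x + e0)\<bar>)) \<longlonglongrightarrow> 0"
   using LIMSEQ_subseq_LIMSEQ[OF g(5) kk] by (simp add: F2_def o_def)
  show "x0 \<in> \<Omega>" by (rule x0)
 qed
 moreover have "- \<beta>' <= \<psi> x0"
 proof (rule field_le_epsilon)
  fix e :: real assume "e > 0"
  moreover have "x0 \<in> S" using xd d by (simp add: S_def)
  ultimately obtain N where N: "norm (\<psi>k (kk N) x0 - \<psi> x0) < e" using lim[of e] by blast
  thus "- \<beta>' <= \<psi> x0 + e" using \<psi>k(2)[of "kk N"] by (simp add: abs_less_iff)
 qed
 ultimately show ?thesis by (simp add: \<beta>'_def)
qed

text \<open>Rewrites the 2n-th root of the integral of a square as the n-th root of an L^2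
  norm.\<close>

lemma root_even_powr:
 assumes "0 <= x" "0 < n"
 shows "root (2 * n) x = sqrt x powr (1 / real n)"
proof (cases "x = 0")
 case False
 hence "sqrt x > 0" using assms by simp
 hence "sqrt x powr (1 / real n) = root n (sqrt x)" using assms by (simp add: root_powr_inverse)
 also have "... = root (n * 2) x" by (simp add: sqrt_def real_root_mult_exp)
 finally show ?thesis by (simp add: mult.commute)
qed (use assms in simp)

theorem theorem1:
  "\<exists>C::real. \<forall>(\<Omega>::(complex^'n) set) u f \<mu> c d.
     open \<Omega> \<and> connected \<Omega> \<and> \<Omega> \<noteq> {} \<and> bounded \<Omega> \<and>
     psh_on \<Omega> u \<and> bounded (u ` \<Omega>) \<and>
     MA_measure \<Omega> u \<mu> \<and>
     f \<in> borel_measurable lebesgue \<and> (\<forall>x\<in>\<Omega>. 0 \<le> f x) \<and>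
     set_integrable lebesgue \<Omega> (\<lambda>x. (f x)\<^sup>2) \<and>
     (\<forall>A\<in>sets borel. A \<subseteq> \<Omega> \<longrightarrow> emeasure \<mu> A \<le> set_nn_integral lebesgue A (\<lambda>x. ennreal (f x))) \<and>
     closure \<Omega> \<subseteq> ball c d \<and> d \<le> 2 * diameter \<Omega>
     \<longrightarrow> (SUP x\<in>\<Omega>. negpart (u x))
         \<le> (SUP y\<in>frontier \<Omega>. negpart (lsc_reg \<Omega> u y))
           + C * diameter \<Omega> *
             (sqrt (set_lebesgue_integral lebesgue (\<Omega> \<inter> contact_set \<Omega> u c d) (\<lambda>x. (f x)\<^sup>2)))
               powr (1 / real CARD('n))"
proof -
 define n2 where "n2 = 2 * CARD('n)"
 have n2: "n2 > 0" by (simp add: n2_def)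
 obtain C0 :: real where C0: "C0 > 0"
  "!!(g :: complex^'n => real) c R (x :: complex^'n). R > 0 ==> continuous_on UNIV g ==> (!!x. 0 < g x) ==> x \<in> ball c R ==>
   (max 0 (- perron g c R x)) ^ (2 * CARD('n)) <= C0 * R ^ (2 * CARD('n)) * (LBINT x. indicator (ball c R) x * (g x)\<^sup>2)"
  by (rule perron_lower_bound[where 'n='n]) blast
 show ?thesis
 \<comment> \<open>6 = 3 * 2: the envelope bound is applied on the ball of radius
   \<open>3 * d\<close>, and \<open>d \<le> 2 * diameter \<Omega>\<close>.\<close>
 proof (intro exI[of _ "6 * root n2 C0"] allI impI, elim conjE)
  fix \<Omega> :: "(complex^'n) set" and u f \<mu> c d
  assume Om: "open \<Omega>" "\<Omega> \<noteq> {}" "bounded \<Omega>" and psh: "psh_on \<Omega> u" and bdu: "bounded (u ` \<Omega>)"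
   and \<mu>: "MA_measure \<Omega> u \<mu>" and f: "f \<in> borel_measurable lebesgue" "\<forall>x\<in>\<Omega>. 0 <= f x"
   and f2: "set_integrable lebesgue \<Omega> (%x. (f x)\<^sup>2)"
   and dom: "\<forall>A\<in>sets borel. A \<subseteq> \<Omega> \<longrightarrow> emeasure \<mu> A <= set_nn_integral lebesgue A (%x. ennreal (f x))"
   and \<Omega>d: "closure \<Omega> \<subseteq> ball c d" and diam: "d <= 2 * diameter \<Omega>"
  obtain M where M: "!!x. x \<in> \<Omega> ==> \<bar>u x\<bar> <= M" using bdu by (auto simp: bounded_iff)
  interpret bounded_usc \<Omega> u M by unfold_locales (use Om psh M in \<open>auto simp: psh_on_def\<close>)
  define E where "E = \<Omega> \<inter> contact_set \<Omega> u c d"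
  have bE: "E \<in> sets borel" using Om(1) contact_set_borel by (auto simp: E_def)
  have bO: "\<Omega> \<in> sets borel" using Om(1) by simp
  \<comment> \<open>f is only Lebesgue measurable and constrained on \<Omega>; F is a Borel version,
    non-negative everywhere, zero outside \<Omega> and almost everywhere equal to f inside.\<close>
  obtain f' where f': "f' \<in> borel_measurable lborel" "AE x in lborel. f x = f' x"
   using completion_ex_borel_measurable_real[OF f(1)] by blast
  define F where "F x = indicator \<Omega> x * max 0 (f' x)" for x
  have F1: "F \<in> borel_measurable borel" unfolding F_def using f'(1) bO by (intro borel_measurable_times borel_measurable_indicator borel_measurable_max) auto
  have Fnn: "0 <= F x" for x by (simp add: F_def)
  have AEF: "AE x in lborel. x \<in> \<Omega> \<longrightarrow> f x = F x" using f'(2) by eventually_elim (use f(2) in \<open>auto simp: F_def\<close>)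
  have AEL: "AE x in lebesgue. x \<in> \<Omega> \<longrightarrow> f x = F x" using AEF by (simp add: AE_completion)
  have F0: "F x = 0" if "x \<notin> \<Omega>" for x using that by (simp add: F_def)
  have iF2: "integrable lborel (%x. (F x)\<^sup>2)"
  proof -
   have "integrable lebesgue (%x. indicator \<Omega> x *\<^sub>R (f x)\<^sup>2)" using f2 by (simp add: set_integrable_def)
   hence "integrable lebesgue (%x. (F x)\<^sup>2)"
   proof (rule integrable_cong_AE_imp)
    show "(%x. (F x)\<^sup>2) \<in> borel_measurable lebesgue" using F1 by (intro borel_measurable_power measurable_completion) simp
    show "AE x in lebesgue. indicator \<Omega> x *\<^sub>R (f x)\<^sup>2 = (F x)\<^sup>2" using AEL by eventually_elim (auto simp: indicator_def F0)
   qed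
   thus ?thesis using F1 by (subst (asm) integrable_completion) auto
  qed
  have iF: "integrable lborel F"
  proof (rule Bochner_Integration.integrable_bound)
   have "emeasure lborel \<Omega> < \<infinity>" by (rule emeasure_bounded_finite[OF Om(3)])
   thus "integrable lborel (%x. (F x)\<^sup>2 + indicator \<Omega> x)" using iF2 bO by (intro Bochner_Integration.integrable_add integrable_real_indicator) auto
   show "AE x in lborel. norm (F x) <= norm ((F x)\<^sup>2 + indicator \<Omega> x :: real)"
   proof (rule AE_I2)
    fix x
    have "F x <= (F x)\<^sup>2 + 1" using sum_squares_bound[of "F x" 1] Fnn[of x] by simp
    thus "norm (F x) <= norm ((F x)\<^sup>2 + indicator \<Omega> x :: real)" using Fnn[of x] F0[of x] by (cases "x \<in> \<Omega>") auto
   qed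
  qed (use F1 in simp)
  have domF: "emeasure \<mu> A <= (\<integral>\<^sup>+x. indicator A x * ennreal (F x) \<partial>lborel)" if A: "A \<in> sets borel" "A \<subseteq> \<Omega>" for A
  proof -
   have "emeasure \<mu> A <= (\<integral>\<^sup>+x. ennreal (f x) * indicator A x \<partial>lborel)" using dom A by (simp add: nn_integral_completion)
   also have "... = (\<integral>\<^sup>+x. indicator A x * ennreal (F x) \<partial>lborel)"
    by (rule nn_integral_cong_AE) (use AEF in eventually_elim, use A(2) in \<open>auto simp: indicator_def\<close>)
   finally show ?thesis .
  qed
  define IE where "IE = (LBINT x. indicator E x * (F x)\<^sup>2)"
  have IEeq: "set_lebesgue_integral lebesgue E (%x. (f x)\<^sup>2) = IE"
  proof -
   have mF: "(%x. indicator E x * (F x)\<^sup>2) \<in> borel_measurable lborel" using F1 bE by (intro borel_measurable_times borel_measurable_indicator borel_measurable_power) auto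
   have "set_lebesgue_integral lebesgue E (%x. (f x)\<^sup>2) = (\<integral>x. indicator E x * (F x)\<^sup>2 \<partial>lebesgue)"
    unfolding set_lebesgue_integral_def
   proof (rule integral_cong_AE)
    show "(%x. indicator E x *\<^sub>R (f x)\<^sup>2) \<in> borel_measurable lebesgue"
     using f(1) bE by (intro borel_measurable_scaleR borel_measurable_indicator borel_measurable_power) auto
    show "(%x. indicator E x * (F x)\<^sup>2) \<in> borel_measurable lebesgue" by (rule measurable_completion[OF mF])
    show "AE x in lebesgue. indicator E x *\<^sub>R (f x)\<^sup>2 = indicator E x * (F x)\<^sup>2"
     using AEL by eventually_elim (auto simp: indicator_def E_def)
   qed
   also have "... = IE" unfolding IE_def by (rule integral_completion[OF mF])
   finally show ?thesis .
  qed
  have IE0: "0 <= IE" unfolding IE_def by (intro integral_nonneg_AE) auto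
  obtain xx where xx: "xx \<in> \<Omega>" using Om(2) by blast
  have "xx \<in> ball c d" using xx \<Omega>d closure_subset by blast
  hence d: "d > 0" by (metis ball_eq_empty empty_iff not_le)
  define Cr where "Cr = C0 * (3 * d) ^ n2"
  have Cr: "Cr \<ge> 0" using C0(1) d by (simp add: Cr_def)
  \<comment> \<open>\<eta> is spent three times: on an open neighbourhood of the contact set, by
    outer regularity of the finite measure with density F^2; on the continuous approximation of F;
    and on picking barriers close to the envelope.\<close>
  have est: "- ut x0 <= root n2 (Cr * (IE + 2 * \<eta>)) + \<eta>" if x0: "x0 \<in> \<Omega>" and \<eta>: "\<eta> > 0" for x0 \<eta>
  proof -
   define \<nu> where "\<nu> = density lborel (%x. ennreal ((F x)\<^sup>2))"
   have \<nu>: "emeasure \<nu> A = ennreal (LBINT x. indicator A x * (F x)\<^sup>2)" if A: "A \<in> sets borel" for A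
   proof -
    have "emeasure \<nu> A = (\<integral>\<^sup>+x. ennreal (indicator A x * (F x)\<^sup>2) \<partial>lborel)"
     unfolding \<nu>_def using F1 A by (subst emeasure_density) (auto intro!: nn_integral_cong simp: indicator_def)
    also have "... = ennreal (LBINT x. indicator A x * (F x)\<^sup>2)"
     using integrable_mult_indicator[OF _ iF2, of A] A by (intro nn_integral_eq_integral) auto
    finally show ?thesis .
   qed
   have "emeasure \<nu> (space \<nu>) \<noteq> \<infinity>" using \<nu>[of UNIV] by (simp add: \<nu>_def)
   hence "emeasure \<nu> E = (INF U\<in>{U. E \<subseteq> U \<and> open U}. emeasure \<nu> U)" by (intro outer_regular) (auto simp: \<nu>_def bE)
   moreover have "emeasure \<nu> E < ennreal (IE + \<eta>)" using \<nu>[OF bE] IE0 \<eta> by (simp add: IE_def[symmetric] ennreal_less_iff)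
   ultimately obtain U where U: "E \<subseteq> U" "open U" "emeasure \<nu> U < ennreal (IE + \<eta>)" by (auto simp: INF_less_iff)
   define O' where "O' = U \<inter> \<Omega>"
   have O': "open O'" "\<Omega> \<inter> contact_set \<Omega> u c d \<subseteq> O'" "O' \<subseteq> \<Omega>" using U Om(1) by (auto simp: O'_def E_def)
   have "emeasure \<nu> O' <= emeasure \<nu> U" unfolding O'_def using U(2) by (intro emeasure_mono) (auto simp: \<nu>_def)
   hence "ennreal (LBINT x. indicator O' x * (F x)\<^sup>2) < ennreal (IE + \<eta>)" using \<nu>[of O'] O'(1) U(3) by auto
   hence IO: "(LBINT x. indicator O' x * (F x)\<^sup>2) < IE + \<eta>"
    by (subst (asm) ennreal_less_iff) (auto intro!: integral_nonneg_AE)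
   define \<beta> where "\<beta> = root n2 (Cr * (IE + 2 * \<eta>))"
   have \<beta>0: "0 <= \<beta>" unfolding \<beta>_def using Cr IE0 \<eta> n2 by (intro real_root_ge_zero) auto
   have \<beta>n: "\<beta> ^ n2 = Cr * (IE + 2 * \<eta>)" unfolding \<beta>_def using Cr IE0 \<eta> n2 by (intro real_root_pow_pos2) auto
   have "- (\<beta> + \<eta>) <= ut x0"
   proof (rule contact_estimate[OF psh \<mu> F1 Fnn iF iF2 domF \<Omega>d O' x0 _ Cr \<eta> \<beta>0])
    show "(max 0 (- perron g c (3 * d) x0)) ^ (2 * CARD('n)) <= Cr * (LBINT x. indicator (ball c (3 * d)) x * (g x)\<^sup>2)"
     if "continuous_on UNIV g" "!!x. 0 < g x" for g :: "complex^'n => real"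
    proof -
     have "x0 \<in> ball c d" using x0 \<Omega>d closure_subset by blast
     hence "x0 \<in> ball c (3 * d)" using d by auto
     thus ?thesis unfolding Cr_def n2_def using C0(2)[of "3 * d" g x0 c] d that by simp
    qed
    show "Cr * ((LBINT x. indicator O' x * (F x)\<^sup>2) + \<eta>) <= \<beta> ^ (2 * CARD('n))"
     using IO Cr unfolding n2_def[symmetric] \<beta>n by (intro mult_left_mono) auto
   qed
   thus ?thesis by (simp add: \<beta>_def)
  qed
  define Q where "Q = 6 * root n2 C0 * diameter \<Omega> * sqrt IE powr (1 / real CARD('n))"
  have main: "- ut x0 <= Q" if x0: "x0 \<in> \<Omega>" for x0
  proof -
   have "isCont (%\<eta>. root n2 (Cr * (IE + 2 * \<eta>)) + \<eta>) 0" by (intro continuous_intros)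
   hence lim: "((%\<eta>. root n2 (Cr * (IE + 2 * \<eta>)) + \<eta>) \<longlongrightarrow> root n2 (Cr * IE)) (at_right 0)"
    by (simp add: isCont_def filterlim_at_split)
   have "- ut x0 <= root n2 (Cr * IE)"
    by (rule tendsto_lowerbound[OF lim]) (auto intro: eventually_mono[OF eventually_at_right_less] est[OF x0])
   also have "... = root n2 C0 * (3 * d) * root n2 IE"
    using n2 d by (simp add: Cr_def real_root_mult real_root_power_cancel)
   also have "root n2 IE = sqrt IE powr (1 / real CARD('n))" unfolding n2_def using IE0 by (intro root_even_powr) auto
   also have "root n2 C0 * (3 * d) * sqrt IE powr (1 / real CARD('n)) <= Q"
    unfolding Q_def using C0(1) diam n2 by (intro mult_right_mono) auto
   finally show ?thesis .
  qed
  have Q0: "0 <= Q" using main[OF xx] ut_le_0[of xx] by linarith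
  have "negpart (u x) <= s + Q" if x: "x \<in> \<Omega>" for x
   using main[OF x] ut_le[OF x] s_nonneg Q0 by (simp add: negpart_def)
  hence "(SUP x\<in>\<Omega>. negpart (u x)) <= s + Q" by (intro cSUP_least[OF Om(2)])
  thus "(SUP x\<in>\<Omega>. negpart (u x))
     <= (SUP y\<in>frontier \<Omega>. negpart (lsc_reg \<Omega> u y))
      + 6 * root n2 C0 * diameter \<Omega> *
       (sqrt (set_lebesgue_integral lebesgue (\<Omega> \<inter> contact_set \<Omega> u c d) (%x. (f x)\<^sup>2)))
        powr (1 / real CARD('n))"
   using IEeq unfolding E_def s_def Q_def by simp
 qed
qed

end
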